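(* Let $F$ be a connected compact orientable convex $\mathbb{RP}^2$-surface with non-empty totally geodesic boundary whose double has genus at least $2$. Let $\mathcal{A}=\{\alpha_1,\ldots,\alpha_m\}$ be a positive peripheral marking. Then $$\ell_F(\partial F)=\sum_{x\in\mathcal{O}(F,\mathcal{A})}G_F(x),$$ where $\ell_F$ measures length in the Hilbert metric on $F$, $\ell_F(\partial F)=\sum_{i=1}^m\ell_F(\alpha_i)$, and $G_F([g]_{i,j})=\log B_{\mathbb{P}}(\alpha_i^+,\eta_i(g\cdot\alpha_j^+),\alpha_i^-,\eta_i(g\cdot\alpha_j^-))$. Furthermore, if $F$ is hyperbolic (i.e. $\Omega$ is the interior of a conic), then this is Basmajian's identity: the Hilbert metric is twice the hyperbolic metric, $G_F([g]_{i,j})=4\log\coth(\ell_h/2)$, where $\ell_h$ is the hyperbolic length of the orthogeodesic corresponding to $[g]_{i,j}$, and dividing by $2$ the identity reads $\ell_h(\partial F)=\sum_{\ell_h\in|\mathcal{O}(F)|}2\log\coth(\ell_h/2)$.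
   Context: **Convex projective surfaces.** A convex $\mathbb{RP}^2$-surface is a quotient $\Omega/\Gamma$, where $\Omega\subset\mathbb{RP}^2$ is a convex domain in the complement of some projective line and $\Gamma<\mathrm{PGL}(3,\mathbb{R})$ is a discrete group acting properly on $\Omega$. Here $F$ is compact with totally geodesic boundary; its holonomy is a $3$-Hitchin representation, in particular the holonomy of each boundary component has three distinct real eigenvalues, and each boundary component develops onto the segment joining the attracting and repelling fixed points of its holonomy. The double of $F$ is a closed convex $\mathbb{RP}^2$-surface $\widehat F=\Omega/\Gamma$ containing $F$, obtained by extending the holonomy of $F$ to the fundamental group of the topological double so that, if the holonomy $\widehat R$ (based at a point of a boundary component) sends that boundary component to a diagonal matrix with decreasing entries, then $\widehat R(\bar\gamma)=J\widehat R(\gamma)J$ with $J=\mathrm{diag}(1,-1,1)$, where $\gamma\mapsto\bar\gamma$ is induced by the involution of the double. $\Omega$ is strictly convex with $C^1$ boundary. The universal cover $\widetilde F\subset\Omega$ of $F$ is a convex subset cut out by geodesics, and $\pi_1(F)<\Gamma$. Fix an orientation of $F$. **Cross ratio and Hilbert metric.** For four points on a projective line, $B_{\mathbb{P}}(x,y,z,t)=\frac{|xy|\,|zt|}{|xt|\,|zy|}$, distances measured in any affine patch containing them. For $x,y\in\Omega$, let the projective line through $x,y$ meet $\partial\Omega$ in $p,q$ with $p,x,y,q$ cyclically ordered on the line; the Hilbert distance is $h(x,y)=\log B_{\mathbb{P}}(p,y,q,x)$. It is $\Gamma$-invariant and descends to $\widehat F\supset F$. $\ell_F(\alpha_i)$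 is the Hilbert length of the boundary geodesic of $F$ represented by $\alpha_i$. **Orthoset.** A positive peripheral marking is a collection $\mathcal{A}=\{\alpha_1,\dots,\alpha_m\}$ of primitive peripheral elements of $\pi_1(F)$, one for each of the $m$ boundary components, oriented so that the surface is to the left. With $H_i=\langle\alpha_i\rangle$, $\mathcal{O}(F,\mathcal{A})=\big(\bigsqcup_{1\le i,j\le m}H_i\backslash\pi_1(F)/H_j\big)\setminus\bigcup_i\{H_ieH_i\}$; the element $H_igH_j$ is denoted $[g]_{i,j}$. **Projection.** $\alpha_i^+,\alpha_i^-\in\partial\Omega$ are the attracting and repelling fixed points of $\alpha_i$, and $L_i$ is the geodesic of $\Omega$ joining them (stabilized by $\alpha_i$). For $x\in\partial\Omega$ let $\theta(x)$ be the tangent line to $\partial\Omega$ at $x$, and put $\alpha_i^0=\theta(\alpha_i^+)\cap\theta(\alpha_i^-)$. The orthogonal projection $\eta_i$ from $\overline\Omega$ to $L_i$ sends $y$ to the intersection of the line through $\alpha_i^0$ and $y$ with $L_i$. **Orthogeodesics (hyperbolic case).** An orthogeodesic is an oriented proper geodesic arc in $F$ perpendicular to $\partial F$ at both endpoints; $|\mathcal{O}(F)|$ is the multiset of their hyperbolic lengths. The one corresponding to $[g]_{i,j}$ is the projection to $F$ of the shortest arc from $L_i$ to $g\cdot L_j$. *)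

theory Defs
  imports "HOL-Analysis.Analysis" "HOL-Homology.Homology"
begin

section \<open>The real projective plane\<close>

typedef rp2 = "{V :: (real^3) set. subspace V \<and> dim V = 1}"
proof
  show "span {axis 1 1} \<in> {V :: (real^3) set. subspace V \<and> dim V = 1}"
    by (simp add: dim_span axis_eq_0_iff)
qed

lemma rp2_span:
  assumes "v \<in> Rep_rp2 p" "v \<noteq> 0"
  shows "Rep_rp2 p = span {v}"
proof -
  have p: "subspace (Rep_rp2 p)" "dim (Rep_rp2 p) = 1"
    using Rep_rp2[of p] by auto
  have "span {v} \<subseteq> Rep_rp2 p"
    using p assms by (simp add: span_minimal)
  moreover have "dim (Rep_rp2 p) \<le> dim (span {v})"
    using p assms by simp
  ultimately show ?thesis
    using subspace_dim_equal[OF subspace_span p(1)] by blast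
qed

text \<open>Quotient topology of the projection \<open>v \<mapsto> [v]\<close> from the nonzero vectors.\<close>

instantiation rp2 :: topological_space
begin

definition open_rp2 :: "rp2 set \<Rightarrow> bool" where
  "open_rp2 U \<longleftrightarrow> open (\<Union>p\<in>U. Rep_rp2 p - {0})"

instance
proof
  have "(\<Union>p. Rep_rp2 p - {0}) = - {0}"
  proof -
    have "\<exists>p. v \<in> Rep_rp2 p" if "v \<noteq> 0" for v
    proof
      have "span {v} \<in> {V :: (real^3) set. subspace V \<and> dim V = 1}"
        using that by simp
      then show "v \<in> Rep_rp2 (Abs_rp2 (span {v}))"
        by (simp add: Abs_rp2_inverse span_base)
    qed
    then show ?thesis by auto
  qed
  then show "open (UNIV :: rp2 set)"
    unfolding open_rp2_def by (simp add: open_Compl)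
next
  fix S T :: "rp2 set"
  assume ST: "open S" "open T"
  have "(\<Union>p\<in>S \<inter> T. Rep_rp2 p - {0}) = (\<Union>p\<in>S. Rep_rp2 p - {0}) \<inter> (\<Union>p\<in>T. Rep_rp2 p - {0})"
  proof -
    have "p = q" if "v \<in> Rep_rp2 p" "v \<in> Rep_rp2 q" "v \<noteq> 0" for v p q
      using rp2_span[OF that(1) that(3)] rp2_span[OF that(2) that(3)]
      by (simp add: Rep_rp2_inject[symmetric])
    then show ?thesis by blast
  qed
  with ST show "open (S \<inter> T)"
    unfolding open_rp2_def by (simp add: open_Int)
next
  fix K :: "rp2 set set"
  assume K: "\<forall>S\<in>K. open S"
  have "(\<Union>p\<in>\<Union>K. Rep_rp2 p - {0}) = (\<Union>S\<in>K. \<Union>p\<in>S. Rep_rp2 p - {0})"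
    by blast
  moreover have "open (\<Union>S\<in>K. \<Union>p\<in>S. Rep_rp2 p - {0})"
    using K unfolding open_rp2_def by (intro open_UN)
  ultimately show "open (\<Union>K)"
    unfolding open_rp2_def by (simp only:)
qed

end

definition pt :: "real^3 \<Rightarrow> rp2" where
  "pt v = Abs_rp2 (span {v})"

definition proj_line :: "rp2 set \<Rightarrow> bool" where
  "proj_line l \<longleftrightarrow> (\<exists>W. subspace W \<and> dim W = 2 \<and> l = {p. Rep_rp2 p \<subseteq> W})"

definition line_through :: "rp2 \<Rightarrow> rp2 \<Rightarrow> rp2 set" where
  "line_through p q = {r. Rep_rp2 r \<subseteq> span (Rep_rp2 p \<union> Rep_rp2 q)}"

text \<open>The line with normal direction \<open>n\<close>; this identifies the space of lines with \<open>rp2\<close>,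
  and convergence of lines means convergence of their normals.\<close>

definition polar :: "rp2 \<Rightarrow> rp2 set" where
  "polar n = {p. \<forall>v\<in>Rep_rp2 p. \<forall>w\<in>Rep_rp2 n. v \<bullet> w = 0}"

text \<open>The affine patch \<open>n \<bullet> v \<noteq> 0\<close>, realised as the Euclidean plane \<open>{v. n \<bullet> v = 1}\<close>.\<close>

definition patch :: "real^3 \<Rightarrow> rp2 set" where
  "patch n = {p. \<forall>v\<in>Rep_rp2 p. v \<noteq> 0 \<longrightarrow> n \<bullet> v \<noteq> 0}"

definition aff :: "real^3 \<Rightarrow> rp2 \<Rightarrow> real^3" where
  "aff n p = (THE v. v \<in> Rep_rp2 p \<and> n \<bullet> v = 1)"

definition cross_ratio :: "rp2 \<Rightarrow> rp2 \<Rightarrow> rp2 \<Rightarrow> rp2 \<Rightarrow> real" where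
  "cross_ratio x y z t =
     (let n = (SOME n. {x, y, z, t} \<subseteq> patch n);
          d = (\<lambda>p q. dist (aff n p) (aff n q))
      in (d x y * d z t) / (d x t * d z y))"

text \<open>Four distinct points of a line are cyclically ordered iff they are linearly ordered in some
  affine patch.\<close>

definition cyclically_ordered :: "rp2 \<Rightarrow> rp2 \<Rightarrow> rp2 \<Rightarrow> rp2 \<Rightarrow> bool" where
  "cyclically_ordered a b c d \<longleftrightarrow>
     (\<exists>n. {a, b, c, d} \<subseteq> patch n \<and>
          aff n b \<in> open_segment (aff n a) (aff n c) \<and>
          aff n c \<in> open_segment (aff n b) (aff n d))"

text \<open>\<open>PGL(3,\<real>)\<close>, as the group of transformations of \<open>rp2\<close> induced by invertible matrices.\<close>

definition proj_map :: "real^3^3 \<Rightarrow> rp2 \<Rightarrow> rp2" where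
  "proj_map A p = Abs_rp2 ((*v) A ` Rep_rp2 p)"

definition PGL3 :: "(rp2 \<Rightarrow> rp2) monoid" where
  "PGL3 = \<lparr>carrier = {proj_map A |A. invertible A}, mult = (\<circ>), one = id\<rparr>"

text \<open>Discreteness in \<open>PGL(3,\<real>)\<close>, which is homeomorphic to \<open>SL(3,\<real>)\<close>.\<close>

definition discrete_in_PGL3 :: "(rp2 \<Rightarrow> rp2) set \<Rightarrow> bool" where
  "discrete_in_PGL3 \<Gamma> \<longleftrightarrow> discrete {A :: real^3^3. det A = 1 \<and> proj_map A \<in> \<Gamma>}"

definition diag3 :: "real \<Rightarrow> real \<Rightarrow> real \<Rightarrow> real^3^3" where
  "diag3 a b c = (\<chi> i j. if i = j then (vector [a, b, c] :: real^3) $ i else 0)"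

text \<open>In the basis formed by the columns of \<open>B\<close>, \<open>g\<close> is a diagonal matrix with positive decreasing
  entries.  The objects defined below from a chosen \<open>B\<close> do not depend on the choice, since \<open>B\<close> is
  determined by \<open>g\<close> up to scaling its columns.\<close>

definition diagonalizes :: "real^3^3 \<Rightarrow> (rp2 \<Rightarrow> rp2) \<Rightarrow> bool" where
  "diagonalizes B g \<longleftrightarrow> invertible B \<and>
     (\<exists>a b c. a > b \<and> b > c \<and> c > 0 \<and> g = proj_map (B ** diag3 a b c ** matrix_inv B))"

definition eigenbasis :: "(rp2 \<Rightarrow> rp2) \<Rightarrow> real^3^3" where
  "eigenbasis g = (SOME B. diagonalizes B g)"

definition attracting :: "(rp2 \<Rightarrow> rp2) \<Rightarrow> rp2" where
  "attracting g = pt (eigenbasis g *v axis 1 1)"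

definition repelling :: "(rp2 \<Rightarrow> rp2) \<Rightarrow> rp2" where
  "repelling g = pt (eigenbasis g *v axis 3 1)"

definition reflection_of :: "(rp2 \<Rightarrow> rp2) \<Rightarrow> (rp2 \<Rightarrow> rp2)" where
  "reflection_of g = proj_map (eigenbasis g ** diag3 1 (-1) 1 ** matrix_inv (eigenbasis g))"


section \<open>Convex domains and the Hilbert metric\<close>

definition convex_domain :: "rp2 set \<Rightarrow> bool" where
  "convex_domain \<Omega> \<longleftrightarrow> open \<Omega> \<and> \<Omega> \<noteq> {} \<and> (\<exists>n. \<Omega> \<subseteq> patch n \<and> convex (aff n ` \<Omega>))"

definition strictly_convex :: "rp2 set \<Rightarrow> bool" where
  "strictly_convex \<Omega> \<longleftrightarrow>
     (\<exists>n. closure \<Omega> \<subseteq> patch n \<and>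
        (\<forall>x\<in>closure \<Omega>. \<forall>y\<in>closure \<Omega>. x \<noteq> y \<longrightarrow> open_segment (aff n x) (aff n y) \<subseteq> aff n ` \<Omega>))"

text \<open>The tangent line to a curve \<open>S\<close> at \<open>x\<close> is the limit of the secants through \<open>x\<close>.\<close>

definition secant_normal :: "rp2 \<Rightarrow> rp2 \<Rightarrow> rp2" where
  "secant_normal x y = (THE n. polar n = line_through x y)"

definition tangent_normal :: "rp2 set \<Rightarrow> rp2 \<Rightarrow> rp2" where
  "tangent_normal S x = (THE n. (secant_normal x \<longlongrightarrow> n) (at x within S))"

definition tangent_line :: "rp2 set \<Rightarrow> rp2 \<Rightarrow> rp2 set" where
  "tangent_line S x = polar (tangent_normal S x)"

definition C1_boundary :: "rp2 set \<Rightarrow> bool" where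
  "C1_boundary \<Omega> \<longleftrightarrow>
     (\<forall>x\<in>frontier \<Omega>.
        (secant_normal x \<longlongrightarrow> tangent_normal (frontier \<Omega>) x) (at x within frontier \<Omega>)) \<and>
     continuous_on (frontier \<Omega>) (tangent_normal (frontier \<Omega>))"

definition hilbert_dist :: "rp2 set \<Rightarrow> rp2 \<Rightarrow> rp2 \<Rightarrow> real" where
  "hilbert_dist \<Omega> x y =
     (if x = y then 0
      else (THE r. \<exists>p\<in>frontier \<Omega>. \<exists>q\<in>frontier \<Omega>.
              cyclically_ordered p x y q \<and> r = ln (cross_ratio p y q x)))"

definition geodesics :: "rp2 set \<Rightarrow> rp2 set set" where
  "geodesics \<Omega> = {l \<inter> \<Omega> |l. proj_line l \<and> l \<inter> \<Omega> \<noteq> {}}"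

definition geodesic_arc :: "rp2 set \<Rightarrow> (real \<Rightarrow> rp2) \<Rightarrow> rp2 \<Rightarrow> rp2 \<Rightarrow> bool" where
  "geodesic_arc \<Omega> c x y \<longleftrightarrow>
     continuous_on {0..1} c \<and> inj_on c {0..1} \<and> c 0 = x \<and> c 1 = y \<and>
     (\<exists>L\<in>geodesics \<Omega>. c ` {0..1} \<subseteq> L)"

definition curve_length :: "('a \<Rightarrow> 'a \<Rightarrow> real) \<Rightarrow> (real \<Rightarrow> 'a) \<Rightarrow> real" where
  "curve_length d c =
     Sup {\<Sum>k<n. d (c (t k)) (c (t (Suc k))) |n t.
            t 0 = 0 \<and> t n = 1 \<and> (\<forall>k<n. t k \<le> t (Suc k))}"

text \<open>Length, for the distance \<open>d\<close>, of the geodesic arc from \<open>x\<close> to \<open>y\<close> (\<open>x \<noteq> y\<close>).\<close>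

definition geodesic_length ::
    "rp2 set \<Rightarrow> (rp2 \<Rightarrow> rp2 \<Rightarrow> real) \<Rightarrow> rp2 \<Rightarrow> rp2 \<Rightarrow> real" where
  "geodesic_length \<Omega> d x y = (THE r. \<exists>c. geodesic_arc \<Omega> c x y \<and> r = curve_length d c)"

definition axis_of :: "rp2 set \<Rightarrow> (rp2 \<Rightarrow> rp2) \<Rightarrow> rp2 set" where
  "axis_of \<Omega> g = line_through (attracting g) (repelling g) \<inter> \<Omega>"

text \<open>Length of the closed geodesic covered by \<open>axis_of \<Omega> g\<close>, developed onto an arc from \<open>x\<close> to \<open>g x\<close>.\<close>

definition closed_geodesic_length ::
    "rp2 set \<Rightarrow> (rp2 \<Rightarrow> rp2 \<Rightarrow> real) \<Rightarrow> (rp2 \<Rightarrow> rp2) \<Rightarrow> real" where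
  "closed_geodesic_length \<Omega> d g =
     (let x = (SOME x. x \<in> axis_of \<Omega> g) in geodesic_length \<Omega> d x (g x))"


section \<open>Convex projective surfaces\<close>

definition acts_freely_and_properly :: "(rp2 \<Rightarrow> rp2) set \<Rightarrow> rp2 set \<Rightarrow> bool" where
  "acts_freely_and_properly \<Gamma> \<Omega> \<longleftrightarrow>
     (\<forall>g\<in>\<Gamma>. g ` \<Omega> = \<Omega>) \<and>
     (\<forall>g\<in>\<Gamma>. \<forall>x\<in>\<Omega>. g x = x \<longrightarrow> g = id) \<and>
     (\<forall>K. compact K \<and> K \<subseteq> \<Omega> \<longrightarrow> finite {g\<in>\<Gamma>. g ` K \<inter> K \<noteq> {}})"

text \<open>\<open>\<Omega>/\<Gamma>\<close> is a convex projective surface.  As \<open>\<Omega>\<close> is contractible, \<open>\<Gamma>\<close> is its fundamental group.\<close>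

definition convex_surface :: "rp2 set \<Rightarrow> (rp2 \<Rightarrow> rp2) set \<Rightarrow> bool" where
  "convex_surface \<Omega> \<Gamma> \<longleftrightarrow>
     convex_domain \<Omega> \<and> subgroup \<Gamma> PGL3 \<and> discrete_in_PGL3 \<Gamma> \<and> acts_freely_and_properly \<Gamma> \<Omega>"

definition orbit_of :: "(rp2 \<Rightarrow> rp2) set \<Rightarrow> rp2 \<Rightarrow> rp2 set" where
  "orbit_of \<Gamma> x = {g x |g. g \<in> \<Gamma>}"

definition quotient_space :: "rp2 set \<Rightarrow> (rp2 \<Rightarrow> rp2) set \<Rightarrow> rp2 set topology" where
  "quotient_space X \<Gamma> =
     topology (\<lambda>U. U \<subseteq> orbit_of \<Gamma> ` X \<and> openin (top_of_set X) {x \<in> X. orbit_of \<Gamma> x \<in> U})"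

lemma openin_quotient_space:
  "openin (quotient_space X \<Gamma>) U \<longleftrightarrow>
     U \<subseteq> orbit_of \<Gamma> ` X \<and> openin (top_of_set X) {x \<in> X. orbit_of \<Gamma> x \<in> U}"
proof -
  let ?P = "\<lambda>U. U \<subseteq> orbit_of \<Gamma> ` X \<and> openin (top_of_set X) {x \<in> X. orbit_of \<Gamma> x \<in> U}"
  have "istopology ?P"
    unfolding istopology_def
  proof (intro conjI allI impI)
    fix S T assume "?P S" "?P T"
    moreover have "{x \<in> X. orbit_of \<Gamma> x \<in> S \<inter> T} =
        {x \<in> X. orbit_of \<Gamma> x \<in> S} \<inter> {x \<in> X. orbit_of \<Gamma> x \<in> T}"
      by auto
    ultimately show "S \<inter> T \<subseteq> orbit_of \<Gamma> ` X"
      and "openin (top_of_set X) {x \<in> X. orbit_of \<Gamma> x \<in> S \<inter> T}"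
      by (auto simp only: openin_Int)
  next
    fix \<K> assume K: "\<forall>K\<in>\<K>. ?P K"
    then show "\<Union>\<K> \<subseteq> orbit_of \<Gamma> ` X" by blast
    have "{x \<in> X. orbit_of \<Gamma> x \<in> \<Union>\<K>} = \<Union> ((\<lambda>K. {x \<in> X. orbit_of \<Gamma> x \<in> K}) ` \<K>)"
      by auto
    with K show "openin (top_of_set X) {x \<in> X. orbit_of \<Gamma> x \<in> \<Union>\<K>}"
      by (force intro: openin_Union)
  qed
  then show ?thesis
    unfolding quotient_space_def by (simp add: topology_inverse')
qed

text \<open>Genus of a closed orientable surface \<open>X\<close>: half the rank of its first homology.\<close>

definition has_genus :: "'a topology \<Rightarrow> nat \<Rightarrow> bool" where
  "has_genus X k \<longleftrightarrow> homology_group 1 X \<cong> free_Abelian_group {..<2 * k}"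

text \<open>An orientation of \<open>\<Omega>\<close> is encoded by one of the two components \<open>C\<close> of the cone over \<open>\<Omega>\<close>
  (a tangent frame at \<open>[v]\<close>, \<open>v \<in> C\<close>, given by \<open>a, b\<close> is positive iff \<open>det (v, a, b) > 0\<close>).\<close>

definition orientation_cone :: "rp2 set \<Rightarrow> (real^3) set \<Rightarrow> bool" where
  "orientation_cone \<Omega> C \<longleftrightarrow> C \<in> components (\<Union>p\<in>\<Omega>. Rep_rp2 p - {0})"

definition preserves_orientation :: "(real^3) set \<Rightarrow> (rp2 \<Rightarrow> rp2) \<Rightarrow> bool" where
  "preserves_orientation C g \<longleftrightarrow> (\<exists>A. det A > 0 \<and> g = proj_map A \<and> (*v) A ` C = C)"

text \<open>\<open>x \<in> \<Omega>\<close> lies to the left of the geodesic directed from \<open>p\<close> to \<open>q\<close>, both in \<open>closure \<Omega>\<close>.\<close>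

definition left_of :: "(real^3) set \<Rightarrow> rp2 \<Rightarrow> rp2 \<Rightarrow> rp2 \<Rightarrow> bool" where
  "left_of C p q x \<longleftrightarrow>
     (\<exists>u\<in>Rep_rp2 p \<inter> closure C. \<exists>v\<in>Rep_rp2 q \<inter> closure C. \<exists>w\<in>Rep_rp2 x \<inter> C.
        det (vector [u, v, w] :: real^3^3) > 0)"

text \<open>The subsurface \<open>F\<close> of \<open>\<Omega>/\<Gamma>\<close> is given by its universal cover \<open>Ft \<subseteq> \<Omega>\<close> and the stabilizer
  \<open>\<Delta>\<close> of \<open>Ft\<close> in \<open>\<Gamma>\<close>, which is the fundamental group of \<open>F\<close>; thus \<open>F = Ft/\<Delta>\<close>.\<close>

definition boundary_geodesics :: "rp2 set \<Rightarrow> rp2 set \<Rightarrow> rp2 set set" where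
  "boundary_geodesics \<Omega> Ft = {L \<in> geodesics \<Omega>. L \<subseteq> frontier Ft}"

definition peripheral ::
    "rp2 set \<Rightarrow> rp2 set \<Rightarrow> (rp2 \<Rightarrow> rp2) set \<Rightarrow> (rp2 \<Rightarrow> rp2) \<Rightarrow> bool" where
  "peripheral \<Omega> Ft \<Delta> a \<longleftrightarrow>
     a \<in> \<Delta> \<and> a \<noteq> id \<and> (\<exists>L\<in>boundary_geodesics \<Omega> Ft. a ` L = L)"

definition primitive :: "(rp2 \<Rightarrow> rp2) set \<Rightarrow> (rp2 \<Rightarrow> rp2) \<Rightarrow> bool" where
  "primitive \<Delta> a \<longleftrightarrow> a \<noteq> id \<and> (\<forall>b\<in>\<Delta>. \<forall>n::nat. a = b ^^ n \<longrightarrow> n = 1)"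

definition geodesic_subsurface ::
    "rp2 set \<Rightarrow> (rp2 \<Rightarrow> rp2) set \<Rightarrow> rp2 set \<Rightarrow> (rp2 \<Rightarrow> rp2) set \<Rightarrow> bool" where
  "geodesic_subsurface \<Omega> \<Gamma> Ft \<Delta> \<longleftrightarrow>
     Ft \<subseteq> \<Omega> \<and> closedin (top_of_set \<Omega>) Ft \<and> interior Ft \<noteq> {} \<and>
     (\<exists>n. \<Omega> \<subseteq> patch n \<and> convex (aff n ` Ft)) \<and>
     \<Omega> \<inter> frontier Ft = \<Union> (boundary_geodesics \<Omega> Ft) \<and>
     \<Delta> = {g \<in> \<Gamma>. g ` Ft = Ft} \<and>
     (\<forall>g\<in>\<Gamma>. g ` interior Ft \<inter> interior Ft \<noteq> {} \<longrightarrow> g \<in> \<Delta>) \<and>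
     (\<forall>L\<in>boundary_geodesics \<Omega> Ft. \<forall>a\<in>\<Delta>. a \<noteq> id \<and> a ` L = L \<longrightarrow>
        (\<exists>B. diagonalizes B a) \<and> L = axis_of \<Omega> a)"

text \<open>\<open>\<Omega>/\<Gamma>\<close> is the double of \<open>F\<close>.  For peripheral \<open>a\<close>, the map \<open>J = reflection_of a\<close> (which is
  \<open>diag(1,-1,1)\<close> where \<open>a\<close> is diagonal with decreasing entries) induces the involution of the
  double: \<open>\<gamma> \<mapsto> J \<gamma> J\<close> is the automorphism of \<open>\<Gamma>\<close> induced by the involution.  The lifts of this
  one involution obtained from two peripheral elements differ by an element of \<open>\<Gamma>\<close>; as each
  \<open>reflection_of a\<close> fixes \<open>axis_of \<Omega> a\<close> pointwise, the involution is the identity on the boundary of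
  \<open>F\<close>.  The last two clauses say that \<open>\<Omega>/\<Gamma>\<close> is the union of \<open>F\<close> and its mirror image, with disjoint
  interiors.\<close>

definition is_double ::
    "rp2 set \<Rightarrow> (rp2 \<Rightarrow> rp2) set \<Rightarrow> rp2 set \<Rightarrow> (rp2 \<Rightarrow> rp2) set \<Rightarrow> bool" where
  "is_double \<Omega> \<Gamma> Ft \<Delta> \<longleftrightarrow>
     (\<forall>a. peripheral \<Omega> Ft \<Delta> a \<longrightarrow>
        (let J = reflection_of a in
           (\<forall>g\<in>\<Gamma>. J \<circ> g \<circ> J \<in> \<Gamma>) \<and>
           (\<forall>b. peripheral \<Omega> Ft \<Delta> b \<longrightarrow> J \<circ> reflection_of b \<in> \<Gamma>) \<and>
           \<Omega> = (\<Union>g\<in>\<Gamma>. g ` (Ft \<union> J ` Ft)) \<and>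
           (\<forall>g\<in>\<Gamma>. g ` interior Ft \<inter> J ` interior Ft = {})))"

text \<open>One primitive peripheral element for each boundary component, the latter being the
  \<open>\<Delta>\<close>-orbits of boundary geodesics.\<close>

definition positive_peripheral_marking ::
    "rp2 set \<Rightarrow> rp2 set \<Rightarrow> (rp2 \<Rightarrow> rp2) set \<Rightarrow> (real^3) set \<Rightarrow> nat \<Rightarrow> (nat \<Rightarrow> rp2 \<Rightarrow> rp2) \<Rightarrow> bool"
  where
  "positive_peripheral_marking \<Omega> Ft \<Delta> C m \<alpha> \<longleftrightarrow>
     (\<forall>i<m. peripheral \<Omega> Ft \<Delta> (\<alpha> i) \<and> primitive \<Delta> (\<alpha> i) \<and>
        (\<forall>x\<in>interior Ft. left_of C (repelling (\<alpha> i)) (attracting (\<alpha> i)) x)) \<and>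
     (\<forall>L\<in>boundary_geodesics \<Omega> Ft. \<exists>!i. i < m \<and> (\<exists>g\<in>\<Delta>. L = g ` axis_of \<Omega> (\<alpha> i)))"


section \<open>The orthoset and the gap function\<close>

definition double_coset ::
    "(rp2 \<Rightarrow> rp2) set \<Rightarrow> (rp2 \<Rightarrow> rp2) \<Rightarrow> (rp2 \<Rightarrow> rp2) set \<Rightarrow> (rp2 \<Rightarrow> rp2) set" where
  "double_coset H g K = {h \<circ> g \<circ> k |h k. h \<in> H \<and> k \<in> K}"

text \<open>The disjoint union over \<open>i, j\<close> is formed by tagging a double coset with its indices.\<close>

definition orthoset ::
    "(rp2 \<Rightarrow> rp2) set \<Rightarrow> nat \<Rightarrow> (nat \<Rightarrow> rp2 \<Rightarrow> rp2) \<Rightarrow> (nat \<times> nat \<times> (rp2 \<Rightarrow> rp2) set) set" where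
  "orthoset \<Delta> m \<alpha> =
     (let H = (\<lambda>i. generate PGL3 {\<alpha> i}) in
      {(i, j, double_coset (H i) g (H j)) |i j g. i < m \<and> j < m \<and> g \<in> \<Delta>}
      - {(i, i, double_coset (H i) id (H i)) |i. i < m})"

definition pole_of :: "rp2 set \<Rightarrow> (rp2 \<Rightarrow> rp2) \<Rightarrow> rp2" where
  "pole_of \<Omega> a = (THE p. p \<in> tangent_line (frontier \<Omega>) (attracting a) \<inter>
                          tangent_line (frontier \<Omega>) (repelling a))"

text \<open>The closure adds the endpoints of the axis, which are fixed by the projection.\<close>

definition orth_proj :: "rp2 set \<Rightarrow> (rp2 \<Rightarrow> rp2) \<Rightarrow> rp2 \<Rightarrow> rp2" where
  "orth_proj \<Omega> a y = (THE z. z \<in> closure (axis_of \<Omega> a) \<inter> line_through (pole_of \<Omega> a) y)"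

definition gap ::
    "rp2 set \<Rightarrow> (nat \<Rightarrow> rp2 \<Rightarrow> rp2) \<Rightarrow> nat \<times> nat \<times> (rp2 \<Rightarrow> rp2) set \<Rightarrow> real" where
  "gap \<Omega> \<alpha> = (\<lambda>(i, j, D).
     let g = (SOME g. g \<in> D) in
     ln (cross_ratio (attracting (\<alpha> i)) (orth_proj \<Omega> (\<alpha> i) (g (attracting (\<alpha> j))))
                     (repelling (\<alpha> i)) (orth_proj \<Omega> (\<alpha> i) (g (repelling (\<alpha> j))))))"


section \<open>The hyperbolic case\<close>

definition conic_form :: "real^3^3 \<Rightarrow> bool" where
  "conic_form Q \<longleftrightarrow> (\<exists>T. invertible T \<and> Q = transpose T ** diag3 1 1 (-1) ** T)"

definition conic_interior :: "real^3^3 \<Rightarrow> rp2 set" where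
  "conic_interior Q = {p. \<forall>v\<in>Rep_rp2 p. v \<noteq> 0 \<longrightarrow> v \<bullet> (Q *v v) < 0}"

definition rep :: "rp2 \<Rightarrow> real^3" where
  "rep p = (SOME v. v \<in> Rep_rp2 p \<and> v \<noteq> 0)"

text \<open>Hyperbolic metric of curvature \<open>-1\<close>, from the hyperboloid \<open>v \<bullet> Q v = -1\<close>.\<close>

definition hyp_dist :: "real^3^3 \<Rightarrow> rp2 \<Rightarrow> rp2 \<Rightarrow> real" where
  "hyp_dist Q x y =
     (let v = rep x; w = rep y in
      arcosh (\<bar>v \<bullet> (Q *v w)\<bar> / sqrt ((v \<bullet> (Q *v v)) * (w \<bullet> (Q *v w)))))"

text \<open>The tangent space of the hyperboloid at \<open>v\<close> is the \<open>Q\<close>-orthogonal complement of \<open>v\<close>, and the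
  geodesic from \<open>[v]\<close> to \<open>[w]\<close> has there the direction of the component of \<open>w\<close> orthogonal to \<open>v\<close>.\<close>

definition hyp_perpendicular_at :: "real^3^3 \<Rightarrow> rp2 \<Rightarrow> rp2 \<Rightarrow> rp2 \<Rightarrow> bool" where
  "hyp_perpendicular_at Q x y z \<longleftrightarrow>
     (let v = rep x;
          dir = (\<lambda>p. rep p - ((v \<bullet> (Q *v rep p)) / (v \<bullet> (Q *v v))) *\<^sub>R v)
      in dir y \<bullet> (Q *v dir z) = 0)"

text \<open>Lifts to \<open>Ft\<close> of oriented proper geodesic arcs of \<open>F\<close> perpendicular to the boundary at both
  ends; an arc is recorded by its initial and final points.\<close>

definition orthogeodesic_lift :: "rp2 set \<Rightarrow> rp2 set \<Rightarrow> real^3^3 \<Rightarrow> rp2 \<times> rp2 \<Rightarrow> bool" where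
  "orthogeodesic_lift \<Omega> Ft Q = (\<lambda>(x, y).
     \<exists>L\<in>boundary_geodesics \<Omega> Ft. \<exists>L'\<in>boundary_geodesics \<Omega> Ft. x \<in> L \<and> y \<in> L' \<and>
       (\<exists>c. geodesic_arc \<Omega> c x y \<and> c ` {0<..<1} \<subseteq> interior Ft) \<and>
       (\<forall>z\<in>L. hyp_perpendicular_at Q x y z) \<and> (\<forall>z\<in>L'. hyp_perpendicular_at Q y x z))"

definition arc_orbit :: "(rp2 \<Rightarrow> rp2) set \<Rightarrow> rp2 \<times> rp2 \<Rightarrow> (rp2 \<times> rp2) set" where
  "arc_orbit \<Delta> = (\<lambda>(x, y). {(g x, g y) |g. g \<in> \<Delta>})"

definition orthogeodesics ::
    "rp2 set \<Rightarrow> rp2 set \<Rightarrow> (rp2 \<Rightarrow> rp2) set \<Rightarrow> real^3^3 \<Rightarrow> (rp2 \<times> rp2) set set" where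
  "orthogeodesics \<Omega> Ft \<Delta> Q = arc_orbit \<Delta> ` {e. orthogeodesic_lift \<Omega> Ft Q e}"

definition orthogeodesic_length :: "rp2 set \<Rightarrow> real^3^3 \<Rightarrow> (rp2 \<times> rp2) set \<Rightarrow> real" where
  "orthogeodesic_length \<Omega> Q E =
     (let (x, y) = (SOME e. e \<in> E) in geodesic_length \<Omega> (hyp_dist Q) x y)"

definition shortest_arc :: "real^3^3 \<Rightarrow> rp2 set \<Rightarrow> rp2 set \<Rightarrow> rp2 \<times> rp2" where
  "shortest_arc Q L L' =
     (THE e. e \<in> L \<times> L' \<and>
        (\<forall>x\<in>L. \<forall>y\<in>L'. hyp_dist Q (fst e) (snd e) \<le> hyp_dist Q x y))"

definition corresponding_orthogeodesic ::
    "rp2 set \<Rightarrow> (rp2 \<Rightarrow> rp2) set \<Rightarrow> real^3^3 \<Rightarrow> (nat \<Rightarrow> rp2 \<Rightarrow> rp2) \<Rightarrow>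
     nat \<times> nat \<times> (rp2 \<Rightarrow> rp2) set \<Rightarrow> (rp2 \<times> rp2) set" where
  "corresponding_orthogeodesic \<Omega> \<Delta> Q \<alpha> = (\<lambda>(i, j, D).
     let g = (SOME g. g \<in> D) in
     arc_orbit \<Delta> (shortest_arc Q (axis_of \<Omega> (\<alpha> i)) (g ` axis_of \<Omega> (\<alpha> j))))"

definition coth :: "real \<Rightarrow> real" where
  "coth x = cosh x / sinh x"

end

theory Submission
  imports Defs "HOL-Real_Asymp.Real_Asymp"
begin

text \<open>Let \<open>C\<close> be the convex cone over \<open>\<Omega>\<close>. The axis of \<open>\<alpha>\<^sub>i\<close> joins the rays of two eigenvectors \<open>b1\<close>, \<open>b3\<close>
  in the boundary of \<open>C\<close>; the third eigenvector \<open>b2\<close> spans the pole, so the orthogonal projection to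
  the axis reads off the ratio of the coordinates along \<open>b1\<close> and \<open>b3\<close>. In the logarithm \<open>t\<close> of this
  ratio, which is Hilbert arc length, \<open>\<alpha>\<^sub>i\<close> acts by the translation by its length. Every other boundary geodesic
  cuts an open interval out of the \<open>t\<close>-line, whose length is the gap of its double coset. Different
  boundary geodesics give disjoint intervals, so modulo \<open>\<alpha>\<^sub>i\<close> the lengths add up to \<open>\<ell>(\<alpha>\<^sub>i)\<close> as soon as
  the complement of the intervals is a null set. It is, because it is porous: by cocompactness one
  can zoom in on any of its points with elements of \<open>\<Delta>\<close>, and, supporting lines being unique, a gap of
  fixed size survives in the limit, so the set has no density point.

  If \<open>\<Omega>\<close> is the interior of a conic, a boundary geodesic whose ends have ratios \<open>p\<^sup>2 < q\<^sup>2\<close> has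
  exactly one common perpendicular with the axis. It starts at the point with ratio \<open>pq\<close> and has
  length \<open>\<ell>\<close> with \<open>cosh \<ell> = (p + q) / (q - p)\<close>, whence its gap is \<open>2 ln (q / p) = 4 ln coth (\<ell> / 2)\<close>.\<close>

section \<open>The projective plane in homogeneous coordinates\<close>

text \<open>Projective points carry no sign. The work is therefore done with vectors in one half
  \<open>C\<close> of the cone over the domain, with covectors \<open>wf M\<close> that are positive
  inside the surface, and with lifts of group elements that preserve \<open>C\<close>. The obstacle
  in the measure estimate is that the projection to an axis is not equivariant: a group element
  replaces the pole \<open>b2\<close> by its image, so the zoom has to follow the pole too. It runs
  into a boundary point \<open>w\<close>, and the coordinate functionals \<open>f1\<close> and
  \<open>f3\<close>, transported and normalised, tend to functionals supporting the cone at
  \<open>w\<close>. Uniqueness of such functionals, which is where the C^1 boundary enters, gives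
  both the same limit \<open>H\<close>. Differences of coordinates are, up to common factors, triple
  products with the pole, so the quotient of distance and gap size has a finite limit although both
  tend to 0. The porosity constant may depend on the point. The set is cut into countably many
  bounded, uniformly porous pieces; each is null because a Vitali covering lets every open superset
  of finite measure lose a fixed fraction of its measure.\<close>

lemma Rep_pt: "v \<noteq> 0 \<Longrightarrow> Rep_rp2 (pt v) = span {v}"
  by (simp add: pt_def Abs_rp2_inverse)

lemma pt_cases:
  obtains v where "v \<noteq> 0" "p = pt v"
proof -
  have p: "subspace (Rep_rp2 p)" "dim (Rep_rp2 p) = 1"
    using Rep_rp2[of p] by auto
  then have "\<not> Rep_rp2 p \<subseteq> {0}"
    by (metis dim_eq_0 zero_neq_one)
  then obtain v where v: "v \<in> Rep_rp2 p" "v \<noteq> 0" by auto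
  then have "p = pt v"
    by (metis Rep_pt Rep_rp2_inject rp2_span)
  with v that show thesis by blast
qed

lemma mem_Rep_pt: "v \<noteq> 0 \<Longrightarrow> w \<in> Rep_rp2 (pt v) \<longleftrightarrow> (\<exists>c. w = c *\<^sub>R v)"
  by (auto simp: Rep_pt span_singleton)

lemma pt_scale [simp]: "c \<noteq> 0 \<Longrightarrow> pt (c *\<^sub>R v) = pt v"
proof -
  assume c: "c \<noteq> 0"
  have "range (\<lambda>k. k *\<^sub>R c *\<^sub>R v) = range (\<lambda>k. k *\<^sub>R v)"
  proof (intro subset_antisym subsetI; elim rangeE)
    fix x k assume "x = k *\<^sub>R c *\<^sub>R v"
    then show "x \<in> range (\<lambda>k. k *\<^sub>R v)" by (intro range_eqI[of _ _ "k * c"]) simp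
  next
    fix x k assume "x = k *\<^sub>R v"
    then show "x \<in> range (\<lambda>k. k *\<^sub>R c *\<^sub>R v)" using c by (intro range_eqI[of _ _ "k / c"]) simp
  qed
  then show ?thesis by (simp add: pt_def span_singleton)
qed

lemma pt_minus [simp]: "pt (- v) = pt v"
  using pt_scale[of "-1" v] by simp

lemma pt_eq_iff:
  assumes "u \<noteq> 0" "v \<noteq> 0"
  shows "pt u = pt v \<longleftrightarrow> (\<exists>c. u = c *\<^sub>R v)"
proof
  assume "pt u = pt v"
  then show "\<exists>c. u = c *\<^sub>R v" using assms mem_Rep_pt span_base Rep_pt
    by (metis singletonI)
next
  assume "\<exists>c. u = c *\<^sub>R v"
  then obtain c where c: "u = c *\<^sub>R v" by blast
  then have "c \<noteq> 0" using assms by auto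
  then show "pt u = pt v" using c by simp
qed

lemma open_rp2_iff: "open U \<longleftrightarrow> open {v. v \<noteq> 0 \<and> pt v \<in> U}"
proof -
  have "(\<Union>p\<in>U. Rep_rp2 p - {0}) = {v. v \<noteq> 0 \<and> pt v \<in> U}"
  proof safe
    fix p v assume "p \<in> U" "v \<in> Rep_rp2 p" "v \<noteq> 0"
    then show "pt v \<in> U" by (metis Rep_pt Rep_rp2_inject rp2_span)
  next
    fix v :: "real^3" assume v: "v \<noteq> 0" "pt v \<in> U"
    moreover have "v \<in> Rep_rp2 (pt v)" using v by (simp add: Rep_pt span_base)
    ultimately show "v \<in> (\<Union>p\<in>U. Rep_rp2 p - {0})" by blast
  qed
  then show ?thesis by (simp add: open_rp2_def)
qed

lemma tendsto_pt:
  assumes "(f \<longlongrightarrow> w) F" "w \<noteq> 0"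
  shows "((\<lambda>x. pt (f x)) \<longlongrightarrow> pt w) F"
proof (rule topological_tendstoI)
  fix S assume "open S" "pt w \<in> S"
  then have "eventually (\<lambda>x. f x \<in> {v. v \<noteq> 0 \<and> pt v \<in> S}) F"
    using assms by (intro topological_tendstoD) (auto simp: open_rp2_iff)
  then show "eventually (\<lambda>x. pt (f x) \<in> S) F"
    by (rule eventually_mono) auto
qed

lemma continuous_on_pt: "0 \<notin> S \<Longrightarrow> continuous_on S pt"
  unfolding continuous_on_def by (auto intro!: tendsto_pt)

lemma open_pt_image:
  assumes "open V" "0 \<notin> V"
  shows "open (pt ` V)"
proof -
  have "{v. v \<noteq> 0 \<and> pt v \<in> pt ` V} = (\<Union>c\<in>- {0}. (*\<^sub>R) c ` V)"
  proof safe
    fix v u assume "v \<noteq> 0" "pt v = pt u" "u \<in> V"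
    then obtain c where "v = c *\<^sub>R u" using assms pt_eq_iff by metis
    moreover have "c \<noteq> 0" using calculation \<open>v \<noteq> 0\<close> by auto
    ultimately show "v \<in> (\<Union>c\<in>- {0}. (*\<^sub>R) c ` V)" using \<open>u \<in> V\<close> by auto
  qed (use assms in auto)
  moreover have "open (\<Union>c\<in>- {0}. (*\<^sub>R) c ` V)"
    using assms by (intro open_UN) (auto intro: open_scaling)
  ultimately show ?thesis by (simp add: open_rp2_iff)
qed

text \<open>\<open>pt\<close> is continuous and open away from 0: neighbourhoods of \<open>v\<close>
  project to neighbourhoods of \<open>pt v\<close>, and neighbourhoods of \<open>pt v\<close> pull
  back to neighbourhoods of \<open>v\<close>.\<close>

lemma pt_closure_iff:
  assumes "v \<noteq> 0"
  shows "pt v \<in> closure S \<longleftrightarrow> v \<in> closure {w. w \<noteq> 0 \<and> pt w \<in> S}"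
proof
  assume *: "pt v \<in> closure S"
  show "v \<in> closure {w. w \<noteq> 0 \<and> pt w \<in> S}"
    unfolding closure_iff_nhds_not_empty
  proof (intro allI impI)
    fix A V assume A: "V \<subseteq> A" "open V" "v \<in> V"
    have "open (pt ` (V - {0}))" "pt v \<in> pt ` (V - {0})"
      using A assms by (auto intro!: open_pt_image)
    then obtain q where "q \<in> pt ` (V - {0})" "q \<in> S"
      using * unfolding closure_iff_nhds_not_empty by blast
    then show "{w. w \<noteq> 0 \<and> pt w \<in> S} \<inter> A \<noteq> {}" using A by auto
  qed
next
  assume *: "v \<in> closure {w. w \<noteq> 0 \<and> pt w \<in> S}"
  show "pt v \<in> closure S"
    unfolding closure_iff_nhds_not_empty
  proof (intro allI impI)
    fix A V assume A: "V \<subseteq> A" "open V" "pt v \<in> V"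
    have "open {w. w \<noteq> 0 \<and> pt w \<in> V}" "v \<in> {w. w \<noteq> 0 \<and> pt w \<in> V}"
      using A assms by (auto simp: open_rp2_iff)
    then obtain w where "w \<in> {w. w \<noteq> 0 \<and> pt w \<in> V}" "w \<in> {w. w \<noteq> 0 \<and> pt w \<in> S}"
      using * unfolding closure_iff_nhds_not_empty by blast
    then show "S \<inter> A \<noteq> {}" using A by auto
  qed
qed

text \<open>Unit representatives \<open>a\<close>, \<open>b\<close> of distinct points satisfy |a.b|
  < 1, so comparing |w.a| with |w.b| gives disjoint open sets stable under scaling. Separation makes
  limits of secant lines unique.\<close>

instance rp2 :: t2_space
proof
  fix p q :: rp2 assume "p \<noteq> q"
  obtain u v where uv: "u \<noteq> 0" "v \<noteq> 0" "p = pt u" "q = pt v" by (metis pt_cases)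
  define a b where "a = u /\<^sub>R norm u" and "b = v /\<^sub>R norm v"
  have ab: "norm a = 1" "norm b = 1" "p = pt a" "q = pt b"
    using uv by (auto simp: a_def b_def)
  have lt: "\<bar>a \<bullet> b\<bar> < 1"
  proof (rule ccontr)
    assume "\<not> ?thesis"
    then have "\<bar>a \<bullet> b\<bar> = norm a * norm b"
      using Cauchy_Schwarz_ineq2[of a b] ab by auto
    then have "a = b \<or> a = - b"
      unfolding norm_cauchy_schwarz_abs_eq using ab by auto
    then show False using \<open>p \<noteq> q\<close> ab by auto
  qed
  define U where "U = {w. \<bar>w \<bullet> a\<bar> > \<bar>w \<bullet> b\<bar>}"
  define V where "V = {w. \<bar>w \<bullet> b\<bar> > \<bar>w \<bullet> a\<bar>}"
  have o: "open U" "open V" unfolding U_def V_def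
    by (auto intro!: open_Collect_less continuous_intros)
  have nz: "0 \<notin> U" "0 \<notin> V" unfolding U_def V_def by auto
  have "a \<bullet> a = 1" "b \<bullet> b = 1" using ab by (auto simp: norm_eq_1)
  then have m: "a \<in> U" "b \<in> V" unfolding U_def V_def using lt by (auto simp: inner_commute)
  have "pt ` U \<inter> pt ` V = {}"
  proof safe
    fix x y assume xy: "x \<in> U" "y \<in> V" "pt x = pt y"
    then have "x \<noteq> 0" "y \<noteq> 0" using nz by auto
    then obtain c where "x = c *\<^sub>R y" using xy pt_eq_iff by metis
    then have "\<bar>c\<bar> * \<bar>y \<bullet> b\<bar> < \<bar>c\<bar> * \<bar>y \<bullet> a\<bar>" "\<bar>y \<bullet> a\<bar> < \<bar>y \<bullet> b\<bar>"
      using xy by (auto simp: U_def V_def abs_mult)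
    then show "pt x \<in> {}" by (auto simp: mult_less_cancel_left)
  qed
  then show "\<exists>U V. open U \<and> open V \<and> p \<in> U \<and> q \<in> V \<and> U \<inter> V = {}"
    using o nz m ab open_pt_image by (metis imageI)
qed

lemma invertible_mult_eq_0:
  fixes A :: "real^3^3"
  assumes "invertible A"
  shows "A *v v = 0 \<longleftrightarrow> v = 0"
  using assms
  by (metis matrix_left_invertible_ker invertible_left_inverse matrix_vector_mult_0_right)

lemma proj_map_pt:
  assumes "invertible A" "v \<noteq> 0"
  shows "proj_map A (pt v) = pt (A *v v)"
proof -
  have "(*v) A ` span {v} = span {A *v v}"
    using linear_span_image[of "(*v) A" "{v}"] by simp
  then show ?thesis using assms by (simp add: proj_map_def Rep_pt) (simp add: pt_def)
qed

lemma mem_patch: "v \<noteq> 0 \<Longrightarrow> pt v \<in> patch n \<longleftrightarrow> n \<bullet> v \<noteq> 0"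
  unfolding patch_def mem_Collect_eq
proof safe
  assume "v \<noteq> 0" "\<forall>w\<in>Rep_rp2 (pt v). w \<noteq> 0 \<longrightarrow> n \<bullet> w \<noteq> 0" "n \<bullet> v = 0"
  moreover have "v \<in> Rep_rp2 (pt v)" using \<open>v \<noteq> 0\<close> by (simp add: Rep_pt span_base)
  ultimately show False by blast
qed (auto simp: mem_Rep_pt)

lemma aff_pt:
  assumes "n \<bullet> v \<noteq> 0"
  shows "aff n (pt v) = (1 / (n \<bullet> v)) *\<^sub>R v"
proof -
  have "v \<noteq> 0" using assms by auto
  show ?thesis unfolding aff_def
  proof (rule the_equality)
    show "(1 / (n \<bullet> v)) *\<^sub>R v \<in> Rep_rp2 (pt v) \<and> n \<bullet> ((1 / (n \<bullet> v)) *\<^sub>R v) = 1"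
      using assms by (auto simp: mem_Rep_pt[OF \<open>v \<noteq> 0\<close>])
    fix w assume "w \<in> Rep_rp2 (pt v) \<and> n \<bullet> w = 1"
    then obtain c where "w = c *\<^sub>R v" "n \<bullet> w = 1"
      using mem_Rep_pt[OF \<open>v \<noteq> 0\<close>] by blast
    then show "w = (1 / (n \<bullet> v)) *\<^sub>R v" using assms by (simp add: field_simps)
  qed
qed

lemma pt_aff:
  assumes "p \<in> patch n"
  shows "n \<bullet> aff n p = 1" "pt (aff n p) = p" "aff n p \<noteq> 0"
proof -
  obtain v where v: "v \<noteq> 0" "p = pt v" using pt_cases by blast
  then have "n \<bullet> v \<noteq> 0" using assms by (simp add: mem_patch)
  then show "n \<bullet> aff n p = 1" "pt (aff n p) = p" "aff n p \<noteq> 0"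
    using v by (auto simp: aff_pt)
qed

lemma span_pair: "w \<in> span {u, v} \<longleftrightarrow> (\<exists>a b. w = a *\<^sub>R u + b *\<^sub>R (v :: 'a::real_vector))"
proof -
  have "w \<in> span {u, v} \<longleftrightarrow> (\<exists>a b. w - a *\<^sub>R u = b *\<^sub>R v)"
    by (simp add: span_breakdown_eq)
  then show ?thesis by (auto simp: algebra_simps)
qed

lemma mem_line_through:
  assumes "u \<noteq> 0" "v \<noteq> 0" "w \<noteq> 0"
  shows "pt w \<in> line_through (pt u) (pt v) \<longleftrightarrow> (\<exists>a b. w = a *\<^sub>R u + b *\<^sub>R v)"
proof -
  have "span (span {u} \<union> span {v}) = span {u, v}"
  proof (rule subset_antisym; rule span_minimal)
    show "span {u} \<union> span {v} \<subseteq> span {u, v}" using span_mono[of "{u}" "{u, v}"] span_mono[of "{v}" "{u, v}"] by auto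
    show "{u, v} \<subseteq> span (span {u} \<union> span {v})" by (auto intro!: span_base)
  qed auto
  moreover have "span {w} \<subseteq> span {u, v} \<longleftrightarrow> w \<in> span {u, v}"
    using span_minimal[of "{w}" "span {u, v}"] span_base[of w "{w}"] by auto
  ultimately show ?thesis using assms by (simp add: line_through_def Rep_pt flip: span_pair)
qed

lemma mem_polar: "w \<noteq> 0 \<Longrightarrow> n \<noteq> 0 \<Longrightarrow> pt w \<in> polar (pt n) \<longleftrightarrow> w \<bullet> n = 0"
  unfolding polar_def mem_Collect_eq
proof safe
  assume "w \<noteq> 0" "n \<noteq> 0" "\<forall>v\<in>Rep_rp2 (pt w). \<forall>w\<in>Rep_rp2 (pt n). v \<bullet> w = 0"
  then show "w \<bullet> n = 0" by (auto simp: Rep_pt span_base)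
qed (auto simp: mem_Rep_pt)

text \<open>Subtracting from \<open>\<psi>\<close> its component along \<open>\<phi>\<close> leaves
  a vector that both functionals annihilate, hence one orthogonal to itself. It is the standard way
  below to recognise two covectors with the same kernel.\<close>

lemma functional_multiple:
  fixes \<phi> \<psi> :: "'a::real_inner"
  assumes "\<And>w. \<phi> \<bullet> w = 0 \<Longrightarrow> \<psi> \<bullet> w = 0"
  shows "\<exists>c. \<psi> = c *\<^sub>R \<phi>"
proof (cases "\<phi> = 0")
  case False
  define c where "c = (\<psi> \<bullet> \<phi>) / (\<phi> \<bullet> \<phi>)"
  have "\<phi> \<bullet> (\<psi> - c *\<^sub>R \<phi>) = 0"
    using False by (simp add: c_def inner_diff_right inner_commute)
  moreover from this have "\<psi> \<bullet> (\<psi> - c *\<^sub>R \<phi>) = 0" by (rule assms)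
  ultimately have "(\<psi> - c *\<^sub>R \<phi>) \<bullet> (\<psi> - c *\<^sub>R \<phi>) = 0"
    by (simp add: inner_diff_left)
  then show ?thesis by auto
qed (use assms[of \<psi>] in auto)

lemma proj_line_iff:
  "proj_line l \<longleftrightarrow> (\<exists>\<phi>. \<phi> \<noteq> 0 \<and> l = {pt w |w. w \<noteq> 0 \<and> \<phi> \<bullet> w = 0})"
proof -
  have eq: "{p. Rep_rp2 p \<subseteq> W} = {pt w |w. w \<noteq> 0 \<and> w \<in> W}" if "subspace W" for W
  proof safe
    fix p assume "Rep_rp2 p \<subseteq> W"
    then show "\<exists>w. p = pt w \<and> w \<noteq> 0 \<and> w \<in> W"
      by (metis Rep_pt pt_cases singletonI span_base subset_iff)
  next
    fix w x assume "w \<noteq> 0" "w \<in> W" "x \<in> Rep_rp2 (pt w)"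
    then show "x \<in> W" using that by (auto simp: mem_Rep_pt subspace_scale)
  qed
  show ?thesis
  proof
    assume "proj_line l"
    then obtain W where W: "subspace W" "dim W = 2" "l = {p. Rep_rp2 p \<subseteq> W}"
      by (auto simp: proj_line_def)
    have "dim W < DIM(real^3)" using W by simp
    then obtain \<phi> where \<phi>: "\<phi> \<noteq> 0" "\<And>y. y \<in> span W \<Longrightarrow> orthogonal \<phi> y"
      using orthogonal_to_subspace_exists by blast
    have "W \<subseteq> {x. \<phi> \<bullet> x = 0}" using \<phi> span_base by (auto simp: orthogonal_def)
    moreover have "dim {x. \<phi> \<bullet> x = 0} \<le> dim W" using W \<phi> by (simp add: dim_hyperplane)
    ultimately have "W = {x. \<phi> \<bullet> x = 0}"
      using subspace_dim_equal[OF W(1) subspace_hyperplane] by blast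
    then show "\<exists>\<phi>. \<phi> \<noteq> 0 \<and> l = {pt w |w. w \<noteq> 0 \<and> \<phi> \<bullet> w = 0}"
      using W eq[OF W(1)] \<phi> by auto
  next
    assume "\<exists>\<phi>. \<phi> \<noteq> 0 \<and> l = {pt w |w. w \<noteq> 0 \<and> \<phi> \<bullet> w = 0}"
    then obtain \<phi> where \<phi>: "\<phi> \<noteq> 0" "l = {pt w |w. w \<noteq> 0 \<and> \<phi> \<bullet> w = 0}" by blast
    have "l = {p. Rep_rp2 p \<subseteq> {x. \<phi> \<bullet> x = 0}}"
      unfolding \<phi> by (subst eq[OF subspace_hyperplane]) auto
    then show "proj_line l" unfolding proj_line_def
      using \<phi> by (intro exI[of _ "{x. \<phi> \<bullet> x = 0}"]) (auto simp: subspace_hyperplane dim_hyperplane)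
  qed
qed

lemma cross3_eq_0_iff:
  assumes "u \<noteq> 0" "v \<noteq> 0"
  shows "cross3 u v = 0 \<longleftrightarrow> pt u = pt v"
proof
  assume "cross3 u v = 0"
  then have "\<exists>c. v = c *\<^sub>R u" using assms by (auto simp: cross_eq_0 collinear_lemma)
  then show "pt u = pt v" using assms pt_eq_iff by metis
next
  assume "pt u = pt v"
  then obtain c where "u = c *\<^sub>R v" using assms pt_eq_iff by metis
  then show "cross3 u v = 0" by (simp add: cross_mult_left)
qed

text \<open>One inclusion of planes is clear and the dimensions agree. The cross product thus serves
  as the covector of the line through two points.\<close>

lemma cross3_kernel:
  assumes "u \<noteq> 0" "v \<noteq> 0" "pt u \<noteq> pt v"
  shows "cross3 u v \<bullet> w = 0 \<longleftrightarrow> (\<exists>a b. w = a *\<^sub>R u + b *\<^sub>R v)"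
proof -
  have nz: "cross3 u v \<noteq> 0" using assms by (simp add: cross3_eq_0_iff)
  have "u \<notin> span {v}" using assms by (auto simp: span_singleton pt_eq_iff)
  then have "independent {u, v}" "u \<noteq> v"
    using assms by (auto simp: independent_insert)
  then have "dim (span {u, v}) = 2" by (simp add: dim_eq_card_independent)
  moreover have "span {u, v} \<subseteq> {w. cross3 u v \<bullet> w = 0}"
    by (auto simp: span_pair inner_add_right dot_cross_self)
  moreover have "dim {w. cross3 u v \<bullet> w = 0} = 2" using nz by (simp add: dim_hyperplane)
  ultimately have "span {u, v} = {w. cross3 u v \<bullet> w = 0}"
    using subspace_dim_equal[OF subspace_span subspace_hyperplane] by (metis order_refl)
  then show ?thesis by (metis (mono_tags, lifting) mem_Collect_eq span_pair)
qed

lemma polar_eq_iff: "polar p = polar q \<longleftrightarrow> p = q"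
proof
  assume eq: "polar p = polar q"
  obtain m n where mn: "m \<noteq> 0" "n \<noteq> 0" "p = pt m" "q = pt n" by (metis pt_cases)
  have "n \<bullet> w = 0" if "m \<bullet> w = 0" for w
  proof (cases "w = 0")
    case False
    then show ?thesis using eq that mn mem_polar by (metis inner_commute)
  qed auto
  then obtain c where "n = c *\<^sub>R m" using functional_multiple by blast
  then show "p = q" using mn pt_eq_iff by metis
qed auto

lemma secant_normal_pt:
  assumes "u \<noteq> 0" "v \<noteq> 0" "pt u \<noteq> pt v"
  shows "secant_normal (pt u) (pt v) = pt (cross3 u v)"
proof -
  have nz: "cross3 u v \<noteq> 0" using assms by (simp add: cross3_eq_0_iff)
  have "polar (pt (cross3 u v)) = line_through (pt u) (pt v)"
  proof (rule Set.set_eqI)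
    fix p obtain w where w: "w \<noteq> 0" "p = pt w" using pt_cases by blast
    then show "p \<in> polar (pt (cross3 u v)) \<longleftrightarrow> p \<in> line_through (pt u) (pt v)"
      using assms nz by (simp add: mem_polar mem_line_through cross3_kernel inner_commute[of w])
  qed
  then show ?thesis unfolding secant_normal_def
    by (intro the_equality) (simp_all flip: polar_eq_iff)
qed

text \<open>On one line an affine distance is a 2 by 2 determinant times factors that depend only on
  the patch and on each point separately; these factors cancel in a cross ratio.\<close>

lemma dist_aff_coplanar:
  assumes "v = x *\<^sub>R e + y *\<^sub>R f" "v' = x' *\<^sub>R e + y' *\<^sub>R f" "n \<bullet> v \<noteq> 0" "n \<bullet> v' \<noteq> 0"
  shows "dist (aff n (pt v)) (aff n (pt v')) =
    \<bar>x * y' - x' * y\<bar> * norm ((n \<bullet> f) *\<^sub>R e - (n \<bullet> e) *\<^sub>R f) / (\<bar>n \<bullet> v\<bar> * \<bar>n \<bullet> v'\<bar>)"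
proof -
  have "(1 / (n \<bullet> v)) *\<^sub>R v - (1 / (n \<bullet> v')) *\<^sub>R v' =
      (1 / ((n \<bullet> v) * (n \<bullet> v'))) *\<^sub>R ((n \<bullet> v') *\<^sub>R v - (n \<bullet> v) *\<^sub>R v')"
    using assms(3,4) by (simp add: scaleR_diff_right)
  moreover have "(n \<bullet> v') *\<^sub>R v - (n \<bullet> v) *\<^sub>R v' =
      (x * y' - x' * y) *\<^sub>R ((n \<bullet> f) *\<^sub>R e - (n \<bullet> e) *\<^sub>R f)"
    unfolding assms(1,2) by (simp add: inner_add_right algebra_simps)
  ultimately show ?thesis using assms(3,4)
    by (simp add: dist_norm aff_pt abs_mult)
qed

text \<open>Homogeneous coordinates on the line also give a formula when two of the points coincide,
  both sides being subject to the convention \<open>x / 0 = 0\<close>.\<close>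

lemma cross_ratio_coplanar:
  assumes ef: "e \<noteq> 0" "f \<noteq> 0" "pt e \<noteq> pt f"
    and n: "n \<bullet> v1 \<noteq> 0" "n \<bullet> v2 \<noteq> 0" "n \<bullet> v3 \<noteq> 0" "n \<bullet> v4 \<noteq> 0"
    and v: "v1 = x1 *\<^sub>R e + y1 *\<^sub>R f" "v2 = x2 *\<^sub>R e + y2 *\<^sub>R f"
      "v3 = x3 *\<^sub>R e + y3 *\<^sub>R f" "v4 = x4 *\<^sub>R e + y4 *\<^sub>R f"
  shows "cross_ratio (pt v1) (pt v2) (pt v3) (pt v4) =
      \<bar>((x1 * y2 - x2 * y1) * (x3 * y4 - x4 * y3)) / ((x1 * y4 - x4 * y1) * (x3 * y2 - x2 * y3))\<bar>"
    and "(dist (aff n (pt v1)) (aff n (pt v2)) * dist (aff n (pt v3)) (aff n (pt v4))) /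
      (dist (aff n (pt v1)) (aff n (pt v4)) * dist (aff n (pt v3)) (aff n (pt v2))) =
      \<bar>((x1 * y2 - x2 * y1) * (x3 * y4 - x4 * y3)) / ((x1 * y4 - x4 * y1) * (x3 * y2 - x2 * y3))\<bar>"
proof -
  have nz: "v1 \<noteq> 0" "v2 \<noteq> 0" "v3 \<noteq> 0" "v4 \<noteq> 0" using n by auto
  have *: "(dist (aff n (pt v1)) (aff n (pt v2)) * dist (aff n (pt v3)) (aff n (pt v4))) /
      (dist (aff n (pt v1)) (aff n (pt v4)) * dist (aff n (pt v3)) (aff n (pt v2))) =
      \<bar>((x1 * y2 - x2 * y1) * (x3 * y4 - x4 * y3)) / ((x1 * y4 - x4 * y1) * (x3 * y2 - x2 * y3))\<bar>"
    if n: "n \<bullet> v1 \<noteq> 0" "n \<bullet> v2 \<noteq> 0" "n \<bullet> v3 \<noteq> 0" "n \<bullet> v4 \<noteq> 0" for n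
  proof -
    define N where "N = norm ((n \<bullet> f) *\<^sub>R e - (n \<bullet> e) *\<^sub>R f)"
    \<comment> \<open>Otherwise, \<open>e\<close> and \<open>f\<close> being independent,
      \<open>n\<close> would vanish on their whole span and so at \<open>v1\<close>.\<close>
    have "N \<noteq> 0"
    proof
      assume "N = 0"
      then have eq: "(n \<bullet> f) *\<^sub>R e = (n \<bullet> e) *\<^sub>R f" by (simp add: N_def)
      show False
      proof (cases "n \<bullet> f = 0")
        case True
        then have "n \<bullet> e = 0" using eq ef by auto
        with True n(1) v(1) show False by (simp add: inner_add_right)
      next
        case False
        then have "n \<bullet> e \<noteq> 0" using eq ef by auto
        then show False using eq ef False pt_scale by metis
      qed
    qed
    then show ?thesis
      using n dist_aff_coplanar[OF v(1) v(2) n(1,2)] dist_aff_coplanar[OF v(3) v(4) n(3,4)]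
        dist_aff_coplanar[OF v(1) v(4) n(1,4)] dist_aff_coplanar[OF v(3) v(2) n(3,2)]
      by (simp add: abs_mult flip: N_def)
  qed
  show "(dist (aff n (pt v1)) (aff n (pt v2)) * dist (aff n (pt v3)) (aff n (pt v4))) /
      (dist (aff n (pt v1)) (aff n (pt v4)) * dist (aff n (pt v3)) (aff n (pt v2))) =
      \<bar>((x1 * y2 - x2 * y1) * (x3 * y4 - x4 * y3)) / ((x1 * y4 - x4 * y1) * (x3 * y2 - x2 * y3))\<bar>"
    by (rule *[OF n])
  let ?m = "SOME n. {pt v1, pt v2, pt v3, pt v4} \<subseteq> patch n"
  have "{pt v1, pt v2, pt v3, pt v4} \<subseteq> patch n" using n nz by (simp add: mem_patch)
  then have "{pt v1, pt v2, pt v3, pt v4} \<subseteq> patch ?m" by (rule someI)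
  then have "?m \<bullet> v1 \<noteq> 0" "?m \<bullet> v2 \<noteq> 0" "?m \<bullet> v3 \<noteq> 0" "?m \<bullet> v4 \<noteq> 0"
    using nz by (auto simp: mem_patch)
  from *[OF this] show "cross_ratio (pt v1) (pt v2) (pt v3) (pt v4) =
      \<bar>((x1 * y2 - x2 * y1) * (x3 * y4 - x4 * y3)) / ((x1 * y4 - x4 * y1) * (x3 * y2 - x2 * y3))\<bar>"
    by (simp add: cross_ratio_def Let_def)
qed

section \<open>Strictly convex cones\<close>

text \<open>One of the two halves of the cone over a properly convex domain. Strict convexity is
  stated without segments: non-proportional vectors of the closed cone have their sum in the open
  cone.\<close>

locale strict_cone =
  fixes C :: "(real^3) set"
  assumes open_C: "open C" and nonempty: "C \<noteq> {}"
    and scale_C: "\<And>v c. v \<in> C \<Longrightarrow> c > 0 \<Longrightarrow> c *\<^sub>R v \<in> C"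
    and pointed: "\<exists>n. \<forall>v\<in>closure C. v \<noteq> 0 \<longrightarrow> n \<bullet> v > 0"
    and strict: "\<And>u v. u \<in> closure C \<Longrightarrow> v \<in> closure C \<Longrightarrow> u \<noteq> 0 \<Longrightarrow> v \<noteq> 0 \<Longrightarrow>
      pt u \<noteq> pt v \<Longrightarrow> u + v \<in> C"
begin

definition bd :: "(real^3) set" where
  "bd = closure C - C - {0}"

text \<open>A fixed positive functional serves both as the affine patch in which distances inside
  the cone are computed and, through \<open>height_bound\<close>, as a substitute for the norm that
  is additive on the cone.\<close>

definition height :: "real^3" where
  "height = (SOME n. \<forall>v\<in>closure C. v \<noteq> 0 \<longrightarrow> n \<bullet> v > 0)"

lemma height_pos: "v \<in> closure C \<Longrightarrow> v \<noteq> 0 \<Longrightarrow> height \<bullet> v > 0"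
  using someI_ex[OF pointed] unfolding height_def by blast

lemma zero_notin_C: "0 \<notin> C"
proof
  assume "0 \<in> C"
  then obtain e where e: "e > 0" "ball 0 e \<subseteq> C" using open_C open_contains_ball by blast
  define v :: "real^3" where "v = (e/2) *\<^sub>R axis 1 1"
  have "norm v < e" "v \<noteq> 0" using e by (auto simp: v_def axis_eq_0_iff)
  then have "v \<in> C" "- v \<in> C" using e by auto
  then have "v \<in> closure C" "- v \<in> closure C" using closure_subset by auto
  then have "height \<bullet> v > 0" "height \<bullet> (- v) > 0"
    using height_pos[of v] height_pos[of "- v"] \<open>v \<noteq> 0\<close> by auto
  then show False by simp
qed

lemma C_sub_closure: "v \<in> C \<Longrightarrow> v \<in> closure C"
  using closure_subset by blast

lemma C_nonzero: "v \<in> C \<Longrightarrow> v \<noteq> 0"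
  using zero_notin_C by auto

lemma bdD: "v \<in> bd \<Longrightarrow> v \<in> closure C" "v \<in> bd \<Longrightarrow> v \<notin> C" "v \<in> bd \<Longrightarrow> v \<noteq> 0"
  by (auto simp: bd_def)

lemma closure_scale: 
  assumes "v \<in> closure C" "c \<ge> 0"
  shows "c *\<^sub>R v \<in> closure C"
proof (cases "c = 0")
  case True
  obtain x where x: "x \<in> C" using nonempty by blast
  have "(\<lambda>n. (1 / real (Suc n)) *\<^sub>R x) \<longlonglongrightarrow> 0 *\<^sub>R x"
    by (intro tendsto_scaleR tendsto_const) real_asymp
  moreover have "\<And>n. (1 / real (Suc n)) *\<^sub>R x \<in> C" using x by (intro scale_C) auto
  ultimately have "0 *\<^sub>R x \<in> closure C"
    unfolding closure_sequential by (intro exI[of _ "\<lambda>n. (1 / real (Suc n)) *\<^sub>R x"]) blast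
  then show ?thesis using True by simp
next
  case False
  obtain x where x: "\<And>n. x n \<in> C" "x \<longlonglongrightarrow> v" using assms unfolding closure_sequential by blast
  have "(\<lambda>n. c *\<^sub>R x n) \<longlonglongrightarrow> c *\<^sub>R v" using x by (intro tendsto_intros)
  moreover have "\<And>n. c *\<^sub>R x n \<in> C" using x False assms by (intro scale_C) auto
  ultimately show ?thesis
    unfolding closure_sequential by (intro exI[of _ "\<lambda>n. c *\<^sub>R x n"]) blast
qed

lemma bd_scale: "v \<in> bd \<Longrightarrow> c > 0 \<Longrightarrow> c *\<^sub>R v \<in> bd"
  using scale_C[of "c *\<^sub>R v" "1/c"] by (auto simp: bd_def intro: closure_scale)

lemma minus_notin_closure: "v \<in> closure C \<Longrightarrow> v \<noteq> 0 \<Longrightarrow> - v \<notin> closure C"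
  using height_pos[of v] height_pos[of "- v"] by auto

lemma parallel_pos:
  assumes "u \<in> closure C" "v \<in> closure C" "u \<noteq> 0" "v \<noteq> 0" "pt u = pt v"
  obtains c where "c > 0" "u = c *\<^sub>R v"
proof -
  obtain c where c: "u = c *\<^sub>R v" using assms pt_eq_iff by blast
  have "height \<bullet> u > 0" "height \<bullet> v > 0" using assms height_pos by auto
  then have "c > 0" using c by (simp add: zero_less_mult_iff)
  with c that show thesis by blast
qed

lemma C_add_closure:
  assumes "u \<in> C" "v \<in> closure C"
  shows "u + v \<in> C"
proof (cases "v = 0 \<or> pt v \<noteq> pt u")
  case True
  then show ?thesis using assms strict C_sub_closure C_nonzero by force
next
  case False
  then obtain c where "c > 0" "v = c *\<^sub>R u" using assms parallel_pos C_sub_closure C_nonzero by metis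
  then show ?thesis using assms scale_C[of u "c + 1"] by (simp add: algebra_simps)
qed

lemma C_add: "u \<in> C \<Longrightarrow> v \<in> C \<Longrightarrow> u + v \<in> C"
  using C_add_closure C_sub_closure by blast

lemma C_closure_add: "u \<in> closure C \<Longrightarrow> v \<in> C \<Longrightarrow> u + v \<in> C"
  using C_add_closure by (metis add.commute)

lemma C_pos_comb:
  assumes "u \<in> closure C" "v \<in> closure C" "u \<noteq> 0" "v \<noteq> 0" "pt u \<noteq> pt v" "a > 0" "b > 0"
  shows "a *\<^sub>R u + b *\<^sub>R v \<in> C"
  using assms by (intro strict closure_scale) auto

lemma convex_C: "convex C"
  unfolding convex_def
proof (intro ballI allI impI)
  fix x y and u v :: real
  assume "x \<in> C" "y \<in> C" "0 \<le> u" "0 \<le> v" "u + v = 1"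
  then consider "u = 0" "v = 1" | "v = 0" "u = 1" | "u > 0" "v > 0" by fastforce
  then show "u *\<^sub>R x + v *\<^sub>R y \<in> C"
    using \<open>x \<in> C\<close> \<open>y \<in> C\<close> by cases (auto intro: C_add scale_C)
qed

lemma pt_in_image: "v \<in> closure C \<Longrightarrow> v \<noteq> 0 \<Longrightarrow> pt v \<in> pt ` C \<longleftrightarrow> v \<in> C"
proof
  assume "v \<in> closure C" "v \<noteq> 0" "pt v \<in> pt ` C"
  then obtain u c where "u \<in> C" "c > 0" "v = c *\<^sub>R u"
    using parallel_pos C_sub_closure C_nonzero by (metis image_iff)
  then show "v \<in> C" by (simp add: scale_C)
qed auto

text \<open>If the ray stayed in the closed cone, its points divided by \<open>t\<close> would
  converge to \<open>e\<close>, which would then lie in the closed cone. The hypothesis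
  \<open>nz\<close> excludes rays through the origin, which is in the closure but not in
  \<open>bd\<close>.\<close>

lemma exit:
  assumes v: "v \<in> C" and e: "e \<notin> closure C" and nz: "\<And>t. t > 0 \<Longrightarrow> v + t *\<^sub>R e \<noteq> 0"
  obtains t where "t > 0" "v + t *\<^sub>R e \<in> bd" "\<And>r. 0 \<le> r \<Longrightarrow> r < t \<Longrightarrow> v + r *\<^sub>R e \<in> C"
proof -
  define S where "S = {t. t \<ge> 0 \<and> v + t *\<^sub>R e \<in> closure C}"
  have "S = {0..} \<inter> (\<lambda>t. v + t *\<^sub>R e) -` closure C" by (auto simp: S_def)
  moreover have "closed ((\<lambda>t. v + t *\<^sub>R e) -` closure C)"
    by (intro closed_vimage closed_closure continuous_intros)
  ultimately have cl: "closed S" by auto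
  have "0 \<in> S" using v C_sub_closure by (auto simp: S_def)
  have "bounded S"
  proof (rule ccontr)
    assume "\<not> bounded S"
    then have "\<forall>n. \<exists>t\<in>S. \<bar>t\<bar> > real (Suc n)"
      unfolding bounded_iff by (metis linorder_not_le real_norm_def)
    then obtain t where t: "\<And>n. t n \<in> S" "\<And>n. \<bar>t n\<bar> > real (Suc n)" by metis
    have tp: "t n > real (Suc n)" for n using t[of n] by (auto simp: S_def)
    have "(\<lambda>n. 1 / t n) \<longlonglongrightarrow> 0"
    proof (rule tendsto_sandwich[OF _ _ tendsto_const])
      have tp': "0 < t n" for n
      proof -
        have "0 < real (Suc n)" by simp
        then show ?thesis using tp[of n] by linarith
      qed
      show "\<forall>\<^sub>F n in sequentially. 0 \<le> 1 / t n" using tp' by (auto intro!: always_eventually less_imp_le)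
      show "\<forall>\<^sub>F n in sequentially. 1 / t n \<le> 1 / real (Suc n)"
        using tp tp' by (intro always_eventually allI frac_le) (auto simp: less_imp_le simp del: of_nat_Suc)
      show "(\<lambda>n. 1 / real (Suc n)) \<longlonglongrightarrow> 0" by real_asymp
    qed
    then have "(\<lambda>n. (1 / t n) *\<^sub>R v + e) \<longlonglongrightarrow> 0 *\<^sub>R v + e" by (intro tendsto_intros)
    moreover have "(1 / t n) *\<^sub>R v + e \<in> closure C" for n
    proof -
      have "t n > 0" using tp[of n] by (smt (verit) of_nat_0_less_iff zero_less_Suc)
      then have "(1 / t n) *\<^sub>R (v + t n *\<^sub>R e) \<in> closure C"
        using t(1)[of n] by (intro closure_scale) (auto simp: S_def)
      then show ?thesis using \<open>t n > 0\<close> by (simp add: scaleR_add_right)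
    qed
    ultimately have "e \<in> closure C"
      using closed_sequentially[OF closed_closure, of "\<lambda>n. (1 / t n) *\<^sub>R v + e" C e] by simp
    with e show False by simp
  qed
  define t where "t = Sup S"
  have bdd: "bdd_above S" using \<open>bounded S\<close> by (rule bounded_imp_bdd_above)
  have tS: "t \<in> S" unfolding t_def using \<open>0 \<in> S\<close> cl bdd by (intro closed_contains_Sup) auto
  have up: "s \<le> t" if "s \<in> S" for s unfolding t_def using that bdd by (rule cSup_upper)
  have notC: "v + t *\<^sub>R e \<notin> C"
  proof
    assume "v + t *\<^sub>R e \<in> C"
    moreover have "((\<lambda>s. v + s *\<^sub>R e) \<longlongrightarrow> v + t *\<^sub>R e) (at_right t)" by (intro tendsto_intros)
    ultimately have "\<forall>\<^sub>F s in at_right t. v + s *\<^sub>R e \<in> C"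
      using topological_tendstoD[OF _ open_C] by blast
    moreover have "\<forall>\<^sub>F s in at_right t. s > t" by (simp add: eventually_at_filter)
    ultimately have "\<forall>\<^sub>F s in at_right t. s > t \<and> v + s *\<^sub>R e \<in> C" by eventually_elim auto
    then obtain s where "s > t" "v + s *\<^sub>R e \<in> C"
      using eventually_happens trivial_limit_at_right_real by blast
    then show False using up[of s] tS C_sub_closure by (auto simp: S_def)
  qed
  have "t \<noteq> 0" using notC v by auto
  then have "t > 0" using tS by (auto simp: S_def)
  show thesis
  proof
    show "t > 0" by fact
    show "v + t *\<^sub>R e \<in> bd" using tS notC nz[OF \<open>t > 0\<close>] by (auto simp: bd_def S_def)
    fix r assume r: "0 \<le> r" "r < t"
    have "v + r *\<^sub>R e = (1 - r / t) *\<^sub>R v + (r / t) *\<^sub>R (v + t *\<^sub>R e)"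
      using \<open>t > 0\<close> by (simp add: algebra_simps)
    also have "\<dots> \<in> C" using tS r v \<open>t > 0\<close>
      by (intro C_add_closure scale_C closure_scale) (auto simp: S_def)
    finally show "v + r *\<^sub>R e \<in> C" .
  qed
qed

text \<open>At an interior zero, a small step against the gradient of \<open>h\<close> would stay in
  the cone and make \<open>h\<close> negative.\<close>

lemma functional_pos:
  assumes h: "\<And>v. v \<in> C \<Longrightarrow> h \<bullet> v \<ge> 0" "h \<noteq> 0" and v: "v \<in> C"
  shows "h \<bullet> v > 0"
proof (rule ccontr)
  assume "\<not> h \<bullet> v > 0"
  then have 0: "h \<bullet> v = 0" using h v by force
  obtain e where e: "e > 0" "ball v e \<subseteq> C" using open_C v open_contains_ball by blast
  define d where "d = e / (2 * norm h)"
  have "d > 0" "d * norm h < e" using e h by (auto simp: d_def)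
  then have "v - d *\<^sub>R h \<in> C" using e by (auto simp: subset_iff dist_norm)
  then have "h \<bullet> (v - d *\<^sub>R h) \<ge> 0" by (rule h)
  moreover have "h \<bullet> (d *\<^sub>R h) > 0" using \<open>d > 0\<close> h by simp
  ultimately show False using 0 by (simp add: inner_diff_right)
qed

lemma functional_nonneg_closure:
  assumes h: "\<And>v. v \<in> C \<Longrightarrow> h \<bullet> v \<ge> 0" and v: "v \<in> closure C"
  shows "h \<bullet> v \<ge> 0"
proof -
  have "closure C \<subseteq> {v. h \<bullet> v \<ge> 0}"
    using h by (intro closure_minimal) (auto simp: closed_halfspace_ge)
  with v show ?thesis by blast
qed

text \<open>By strictness \<open>v + w\<close> is interior, where \<open>h\<close> is positive, and
  \<open>w\<close> contributes nothing. A supporting plane thus touches the closed cone along one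
  ray only.\<close>

lemma functional_zero_unique:
  assumes h: "\<And>v. v \<in> C \<Longrightarrow> h \<bullet> v \<ge> 0" "h \<noteq> 0"
    and w: "w \<in> closure C" "w \<noteq> 0" "h \<bullet> w = 0"
    and v: "v \<in> closure C" "v \<noteq> 0" "pt v \<noteq> pt w"
  shows "h \<bullet> v > 0"
proof -
  have "v + w \<in> C" using w v by (intro strict) auto
  then have "h \<bullet> (v + w) > 0" using functional_pos h by blast
  then show ?thesis using w by (simp add: inner_add_right)
qed

text \<open>A line meets the frontier in at most two points: in a linear relation between three
  boundary vectors one of them becomes a positive combination of the other two, hence interior. Two
  negative coefficients are excluded by \<open>height\<close>.\<close>

lemma not_coplanar:
  assumes "u \<in> bd" "v \<in> bd" "w \<in> bd" "pt u \<noteq> pt v" "pt v \<noteq> pt w" "pt u \<noteq> pt w"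
  shows "cross3 u v \<bullet> w \<noteq> 0"
proof
  assume "cross3 u v \<bullet> w = 0"
  then obtain a b where w: "w = a *\<^sub>R u + b *\<^sub>R v" using assms cross3_kernel bdD by metis
  have a: "a \<noteq> 0" using w assms bdD(3) pt_eq_iff by (metis add_0 scaleR_zero_left)
  have b: "b \<noteq> 0" using w assms bdD(3) pt_eq_iff by (metis add.right_neutral scaleR_zero_left)
  have *: False if "x \<in> bd" "y \<in> bd" "z \<in> bd" "pt x \<noteq> pt y" "c > 0" "d > 0" "z = c *\<^sub>R x + d *\<^sub>R y"
    for x y z c d using that C_pos_comb[of x y c d] bdD by metis
  have hp: "height \<bullet> u > 0" "height \<bullet> v > 0" "height \<bullet> w > 0"
    using assms bdD height_pos by auto
  consider "a > 0" "b > 0" | "a > 0" "b < 0" | "a < 0" "b > 0" | "a < 0" "b < 0"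
    using a b by linarith
  then show False
  proof cases
    case 1 then show False using * assms w by blast
  next
    case 2
    then have "u = (1/a) *\<^sub>R w + (- b / a) *\<^sub>R v" "- b / a > 0" "1 / a > 0"
      using w by (auto simp: algebra_simps divide_neg_pos)
    from *[OF assms(3,2,1) _ this(3,2,1)] show False using assms by simp
  next
    case 3
    then have "v = (1/b) *\<^sub>R w + (- a / b) *\<^sub>R u" "- a / b > 0" "1 / b > 0"
      using w by (auto simp: algebra_simps divide_neg_pos)
    from *[OF assms(3,1,2) _ this(3,2,1)] show False using assms by simp
  next
    case 4
    then have "height \<bullet> w < 0" using hp unfolding w
      by (simp add: inner_add_right add_neg_neg mult_neg_pos)
    then show False using hp by simp
  qed
qed

text \<open>\<open>height\<close> attains a positive minimum on the compact set of unit vectors of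
  the closed cone.\<close>

lemma height_bound:
  obtains \<kappa> where "\<kappa> > 0" "\<And>v. v \<in> closure C \<Longrightarrow> norm v \<le> \<kappa> * (height \<bullet> v)"
proof -
  define S where "S = closure C \<inter> sphere 0 1"
  have S: "compact S" unfolding S_def by (intro closed_Int_compact) auto
  obtain x where x: "x \<in> C" using nonempty by blast
  then have "x /\<^sub>R norm x \<in> S" using C_nonzero C_sub_closure closure_scale
    by (auto simp: S_def)
  then have ne: "S \<noteq> {}" by blast
  have "continuous_on S (\<lambda>v. height \<bullet> v)" by (intro continuous_intros)
  then obtain m where m: "m \<in> S" "\<And>v. v \<in> S \<Longrightarrow> height \<bullet> m \<le> height \<bullet> v"
    using continuous_attains_inf[OF S ne] by blast
  then have "m \<noteq> 0" by (auto simp: S_def)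
  then have pos: "height \<bullet> m > 0" using m by (intro height_pos) (auto simp: S_def)
  show thesis
  proof (rule that[of "1 / (height \<bullet> m)"])
    show "1 / (height \<bullet> m) > 0" using pos by simp
    fix v assume v: "v \<in> closure C"
    show "norm v \<le> 1 / (height \<bullet> m) * (height \<bullet> v)"
    proof (cases "v = 0")
      case False
      then have "v /\<^sub>R norm v \<in> S" using v by (auto simp: S_def intro: closure_scale)
      then have "height \<bullet> m \<le> height \<bullet> (v /\<^sub>R norm v)" by (rule m)
      then show ?thesis using False pos by (simp add: field_simps)
    qed auto
  qed
qed

lemma pt_preimage: "{w. w \<noteq> 0 \<and> pt w \<in> pt ` C} = C \<union> uminus ` C"
proof safe
  fix w c assume "w \<noteq> 0" "pt w = pt c" "c \<in> C" "w \<notin> uminus ` C"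
  then obtain t where t: "w = t *\<^sub>R c" "t \<noteq> 0" using pt_eq_iff C_nonzero by (metis scaleR_zero_left)
  show "w \<in> C"
  proof (cases "t > 0")
    case False
    then have "w = - ((- t) *\<^sub>R c)" "(- t) *\<^sub>R c \<in> C" using t scale_C[OF \<open>c \<in> C\<close>, of "- t"] by auto
    then show ?thesis using \<open>w \<notin> uminus ` C\<close> by blast
  qed (use t \<open>c \<in> C\<close> in \<open>auto intro: scale_C\<close>)
qed (auto simp: C_nonzero zero_notin_C)

lemma closure_uminus_image: "closure (uminus ` C) = uminus ` closure C"
  using closure_injective_linear_image[of "uminus :: real^3 \<Rightarrow> real^3" C]
  by (auto intro: linear_uminus)

lemma closure_pt_image: "closure (pt ` C) = pt ` (closure C - {0})"
proof (rule Set.set_eqI)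
  fix p obtain v where v: "v \<noteq> 0" "p = pt v" using pt_cases by blast
  have "p \<in> closure (pt ` C) \<longleftrightarrow> v \<in> closure C \<or> v \<in> uminus ` closure C"
    using v by (simp add: pt_closure_iff pt_preimage closure_Un closure_uminus_image)
  also have "\<dots> \<longleftrightarrow> p \<in> pt ` (closure C - {0})"
  proof
    assume "v \<in> closure C \<or> v \<in> uminus ` closure C"
    then show "p \<in> pt ` (closure C - {0})"
    proof
      assume "v \<in> uminus ` closure C"
      then obtain x where "x \<in> closure C" "v = - x" by blast
      then show ?thesis using v by (intro image_eqI[of _ _ x]) auto
    qed (use v in blast)
  next
    assume "p \<in> pt ` (closure C - {0})"
    then obtain u where u: "u \<in> closure C" "u \<noteq> 0" "pt v = pt u" using v by auto
    then obtain c where c: "v = c *\<^sub>R u" using v pt_eq_iff by blast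
    show "v \<in> closure C \<or> v \<in> uminus ` closure C"
    proof (cases "c \<ge> 0")
      case False
      then have "(- c) *\<^sub>R u \<in> closure C" using u by (intro closure_scale) auto
      then show ?thesis using c by (metis image_eqI minus_minus scaleR_minus_left)
    qed (use c u in \<open>auto intro: closure_scale\<close>)
  qed
  finally show "p \<in> closure (pt ` C) \<longleftrightarrow> p \<in> pt ` (closure C - {0})" .
qed

lemma frontier_pt_image: "frontier (pt ` C) = pt ` bd"
proof -
  have o: "open (pt ` C)" using open_C zero_notin_C by (rule open_pt_image)
  have "pt ` (closure C - {0}) - pt ` C = pt ` bd"
  proof (intro subset_antisym subsetI)
    fix p assume "p \<in> pt ` (closure C - {0}) - pt ` C"
    then obtain v where "v \<in> closure C" "v \<noteq> 0" "p = pt v" "p \<notin> pt ` C" by blast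
    then show "p \<in> pt ` bd" using pt_in_image[of v] by (auto simp: bd_def)
  next
    fix p assume "p \<in> pt ` bd"
    then obtain v where "v \<in> bd" "p = pt v" by blast
    then show "p \<in> pt ` (closure C - {0}) - pt ` C" using bdD[of v] pt_in_image[of v] by auto
  qed
  then show ?thesis using o by (simp add: frontier_def interior_open closure_pt_image)
qed

lemma frontier_cases:
  assumes "p \<in> frontier (pt ` C)"
  obtains v where "v \<in> bd" "p = pt v"
  using assms by (auto simp: frontier_pt_image)

end

lemma scaleR_eqD:
  fixes x y :: "'a::real_vector"
  assumes "a *\<^sub>R x = b *\<^sub>R y" "a \<noteq> 0"
  shows "x = (b / a) *\<^sub>R y"
proof -
  have "x = (1/a) *\<^sub>R (a *\<^sub>R x)" using assms(2) by simp
  also have "\<dots> = (b / a) *\<^sub>R y" unfolding assms(1) by simp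
  finally show ?thesis .
qed

lemma strict_cone_uminus:
  assumes "strict_cone C"
  shows "strict_cone (uminus ` C)"
proof -
  interpret strict_cone C by fact
  show ?thesis
  proof
    show "open (uminus ` C)" using open_C by (rule open_negations)
    show "uminus ` C \<noteq> {}" using nonempty by simp
    show "c *\<^sub>R v \<in> uminus ` C" if "v \<in> uminus ` C" "c > 0" for v c
    proof -
      from that(1) obtain x where "x \<in> C" "v = - x" by blast
      then show ?thesis using scale_C[of x c] that by (intro image_eqI[of _ _ "c *\<^sub>R x"]) auto
    qed
    show "\<exists>n. \<forall>v\<in>closure (uminus ` C). v \<noteq> 0 \<longrightarrow> n \<bullet> v > 0"
      unfolding closure_uminus_image using height_pos by (intro exI[of _ "- height"]) auto
    show "u + v \<in> uminus ` C" if "u \<in> closure (uminus ` C)" "v \<in> closure (uminus ` C)"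
      "u \<noteq> 0" "v \<noteq> 0" "pt u \<noteq> pt v" for u v
    proof -
      have "- u \<in> closure C" "- v \<in> closure C" using that by (auto simp: closure_uminus_image)
      then have "- u + - v \<in> C" using that by (intro strict) auto
      then show ?thesis by (intro image_eqI[of _ _ "- u + - v"]) auto
    qed
  qed
qed

text \<open>The patch \<open>n\<close> of strict convexity contains the closure of the domain, so
  \<open>n\<close> has no zero on the cone over it. The sign of \<open>n\<close> splits this cone
  into a convex half \<open>K\<close> and its negative, and these are the two components among which
  \<open>C\<close> is chosen.\<close>

lemma orientation_cone_strict:
  assumes conv: "convex_domain \<Omega>" and strict: "strictly_convex \<Omega>" and or: "orientation_cone \<Omega> C"
  shows "strict_cone C" and "pt ` C = \<Omega>"
proof -
  obtain n where n': "closure \<Omega> \<subseteq> patch n \<and>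
    (\<forall>x\<in>closure \<Omega>. \<forall>y\<in>closure \<Omega>. x \<noteq> y \<longrightarrow> open_segment (aff n x) (aff n y) \<subseteq> aff n ` \<Omega>)"
    using strict unfolding strictly_convex_def by (elim exE)
  then have n: "closure \<Omega> \<subseteq> patch n"
    "\<And>x y. x \<in> closure \<Omega> \<Longrightarrow> y \<in> closure \<Omega> \<Longrightarrow> x \<noteq> y \<Longrightarrow> open_segment (aff n x) (aff n y) \<subseteq> aff n ` \<Omega>"
    by simp_all
  have op: "open \<Omega>" "\<Omega> \<noteq> {}" using conv by (auto simp: convex_domain_def)
  define U where "U = {v. v \<noteq> 0 \<and> pt v \<in> \<Omega>}"
  define K where "K = {v. v \<noteq> 0 \<and> pt v \<in> \<Omega> \<and> n \<bullet> v > 0}"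
  have "(\<Union>p\<in>\<Omega>. Rep_rp2 p - {0}) = U"
  proof (intro subset_antisym subsetI)
    fix v assume "v \<in> (\<Union>p\<in>\<Omega>. Rep_rp2 p - {0})"
    then obtain p where p: "p \<in> \<Omega>" "v \<in> Rep_rp2 p" "v \<noteq> 0" by blast
    obtain u where u: "u \<noteq> 0" "p = pt u" using pt_cases by blast
    then have "\<exists>c. v = c *\<^sub>R u" using p by (simp add: mem_Rep_pt)
    then have "pt v = p" using u p pt_eq_iff by metis
    then show "v \<in> U" using p by (simp add: U_def)
  next
    fix v assume "v \<in> U"
    then have "v \<in> Rep_rp2 (pt v) - {0}" "pt v \<in> \<Omega>" by (auto simp: U_def Rep_pt span_base)
    then show "v \<in> (\<Union>p\<in>\<Omega>. Rep_rp2 p - {0})" by blast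
  qed
  then have comp: "C \<in> components U" using or by (simp add: orientation_cone_def)
  have openU: "open U" using op by (simp add: U_def open_rp2_iff)
  have nz: "n \<bullet> v \<noteq> 0" if "pt v \<in> closure \<Omega>" "v \<noteq> 0" for v
    using n(1) that by (auto simp: mem_patch)
  have nzU: "n \<bullet> v \<noteq> 0" if "v \<in> U" for v
    using nz that closure_subset unfolding U_def by blast
  have Kopen: "open K"
  proof -
    have "K = U \<inter> {v. 0 < n \<bullet> v}" by (auto simp: K_def U_def)
    then show ?thesis using openU by (simp add: open_Int open_halfspace_gt)
  qed
  have clK: "pt v \<in> closure \<Omega> \<and> n \<bullet> v > 0" if "v \<in> closure K" "v \<noteq> 0" for v
  proof -
    have "K \<subseteq> {w. w \<noteq> 0 \<and> pt w \<in> \<Omega>}" by (auto simp: K_def)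
    then have 1: "pt v \<in> closure \<Omega>" using that closure_mono by (auto simp: pt_closure_iff)
    have "closure K \<subseteq> {v. n \<bullet> v \<ge> 0}"
      by (intro closure_minimal) (auto simp: K_def closed_halfspace_ge)
    then have "n \<bullet> v \<ge> 0" using that by blast
    then show ?thesis using 1 nz[of v] that by auto
  qed
  have Kscale: "c *\<^sub>R v \<in> K" if "v \<in> K" "c > 0" for v c
    using that by (auto simp: K_def)
  have Kstrict: "u + v \<in> K" if uv: "u \<in> closure K" "v \<in> closure K" "u \<noteq> 0" "v \<noteq> 0" "pt u \<noteq> pt v" for u v
  proof -
    have p: "n \<bullet> u > 0" "n \<bullet> v > 0" "pt u \<in> closure \<Omega>" "pt v \<in> closure \<Omega>" using clK uv by auto
    define c where "c = n \<bullet> u + n \<bullet> v"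
    have c: "c > 0" using p by (simp add: c_def)
    have "(1/c) *\<^sub>R (u + v) \<in> open_segment (aff n (pt u)) (aff n (pt v))"
    proof -
      have "aff n (pt u) \<noteq> aff n (pt v)"
        using uv p pt_aff(2)[of "pt u" n] pt_aff(2)[of "pt v" n] by (metis mem_patch nz)
      moreover have "(1/c) *\<^sub>R (u + v) = (1 - (n \<bullet> v) / c) *\<^sub>R aff n (pt u) + ((n \<bullet> v) / c) *\<^sub>R aff n (pt v)"
      proof -
        have "1 - (n \<bullet> v) / c = (n \<bullet> u) / c" using c by (simp add: c_def field_simps)
        then show ?thesis using p by (simp add: aff_pt scaleR_add_right)
      qed
      moreover have "(n \<bullet> v) / c > 0" "(n \<bullet> v) / c < 1" using c p by (auto simp: c_def)
      ultimately show ?thesis unfolding in_segment by blast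
    qed
    then have "(1/c) *\<^sub>R (u + v) \<in> aff n ` \<Omega>" using n(2) p uv by blast
    then obtain q where q: "q \<in> \<Omega>" "(1/c) *\<^sub>R (u + v) = aff n q" by blast
    have "q \<in> patch n" using q n(1) closure_subset by blast
    then have "pt ((1/c) *\<^sub>R (u + v)) = q" using q pt_aff(2) by metis
    moreover have "pt ((1/c) *\<^sub>R (u + v)) = pt (u + v)" using c by (intro pt_scale) auto
    ultimately have "pt (u + v) \<in> \<Omega>" using q by simp
    moreover have "n \<bullet> (u + v) > 0" using p by (simp add: inner_add_right)
    ultimately show ?thesis by (auto simp: K_def)
  qed
  have KU: "U = K \<union> uminus ` K"
  proof (intro subset_antisym subsetI)
    fix v assume v: "v \<in> U"
    then consider "n \<bullet> v > 0" | "n \<bullet> v < 0" using nzU by fastforce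
    then show "v \<in> K \<union> uminus ` K"
    proof cases
      case 2
      then have "- v \<in> K" using v by (auto simp: K_def U_def)
      then show ?thesis by (metis UnI2 image_eqI minus_minus)
    qed (use v in \<open>auto simp: K_def U_def\<close>)
  qed (auto simp: K_def U_def)
  have Kne: "K \<noteq> {}"
  proof -
    obtain p where "p \<in> \<Omega>" using op by blast
    moreover obtain v where "v \<noteq> 0" "p = pt v" using pt_cases by blast
    ultimately have "v \<in> U" by (simp add: U_def)
    then show ?thesis using KU by blast
  qed
  have scK: "strict_cone K"
  proof
    show "\<exists>n. \<forall>v\<in>closure K. v \<noteq> 0 \<longrightarrow> n \<bullet> v > 0" using clK by blast
  qed (use Kopen Kne Kscale Kstrict in auto)
  then interpret K: strict_cone K .
  have conK: "connected K" using K.convex_C by (rule convex_connected)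
  have con_minus: "connected (uminus ` K)"
    using conK by (intro connected_continuous_image continuous_intros)
  have Csub: "C \<subseteq> U" "C \<noteq> {}" "connected C" using comp by (auto simp: in_components_subset in_components_nonempty in_components_connected)
  have CK: "C = K \<or> C = uminus ` K"
  proof (cases "C \<inter> K = {}")
    case False
    then have "K \<subseteq> C" using comp conK KU by (intro components_maximal[of C U]) auto
    moreover have "C \<subseteq> K"
    proof (rule ccontr)
      assume "\<not> C \<subseteq> K"
      then obtain v where v: "v \<in> C" "v \<in> uminus ` K" using Csub KU by blast
      obtain u where u: "u \<in> C" "u \<in> K" using False by blast
      have "\<exists>z\<in>C. n \<bullet> z = 0"
        using connected_ivt_hyperplane[OF Csub(3) v(1) u(1), of n 0] u v by (auto simp: K_def)
      then show False using Csub nzU by blast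
    qed
    ultimately show ?thesis by blast
  next
    case True
    then have C': "C \<subseteq> uminus ` K" using Csub KU by blast
    moreover have "uminus ` K \<subseteq> C" using comp con_minus KU C' Csub by (intro components_maximal[of C U]) auto
    ultimately show ?thesis by blast
  qed
  then show "strict_cone C" using scK strict_cone_uminus by auto
  have "pt ` K = \<Omega>"
  proof (intro subset_antisym subsetI)
    fix p assume "p \<in> \<Omega>"
    obtain v where v: "v \<noteq> 0" "p = pt v" using pt_cases by blast
    then have "v \<in> U" using \<open>p \<in> \<Omega>\<close> by (simp add: U_def)
    then show "p \<in> pt ` K" using KU v by auto
  qed (auto simp: K_def)
  moreover have "pt ` uminus ` K = pt ` K" by (auto simp: image_image)
  ultimately show "pt ` C = \<Omega>" using CK by auto
qed

section \<open>Tangent lines and supporting functionals along a C^1 boundary\<close>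

context strict_cone
begin

text \<open>The limit of secants is assumed to exist along the whole frontier, so any one sequence
  of boundary points computes it.\<close>

lemma secant_limit:
  assumes C1: "C1_boundary (pt ` C)" and w: "w \<in> bd"
    and q: "\<And>k. q k \<in> bd" "\<And>k. pt (q k) \<noteq> pt w" "(\<lambda>k. pt (q k)) \<longlonglongrightarrow> pt w"
    and n: "(\<lambda>k. pt (cross3 w (q k))) \<longlonglongrightarrow> n"
  shows "tangent_normal (frontier (pt ` C)) (pt w) = n"
proof -
  let ?F = "frontier (pt ` C)"
  have "pt w \<in> ?F" using w by (simp add: frontier_pt_image)
  then have "(secant_normal (pt w) \<longlongrightarrow> tangent_normal ?F (pt w)) (at (pt w) within ?F)"
    using C1 by (simp add: C1_boundary_def)
  moreover have "filterlim (\<lambda>k. pt (q k)) (at (pt w) within ?F) sequentially"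
    using q by (auto simp: filterlim_at frontier_pt_image)
  ultimately have "(\<lambda>k. secant_normal (pt w) (pt (q k))) \<longlonglongrightarrow> tangent_normal ?F (pt w)"
    by (rule filterlim_compose)
  moreover have "secant_normal (pt w) (pt (q k)) = pt (cross3 w (q k))" for k
    using bdD(3)[OF w] bdD(3)[OF q(1)[of k]] q(2)[of k, symmetric] by (rule secant_normal_pt)
  ultimately show ?thesis using n LIMSEQ_unique by auto
qed

text \<open>From the interior vector \<open>w + u/(k+1)\<close> move in direction \<open>-p\<close>
  until leaving the cone. The value of \<open>g\<close> does not change on the way because
  \<open>g\<close> kills \<open>p\<close>, and \<open>h\<close>, which is nonnegative at the exit,
  bounds the distance travelled by a multiple of \<open>1/(k+1)\<close>.\<close>

lemma boundary_sequence:
  assumes w: "w \<in> bd" and h: "\<And>v. v \<in> C \<Longrightarrow> h \<bullet> v \<ge> 0" "h \<noteq> 0" "h \<bullet> w = 0"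
    and g: "g \<bullet> w = 0" "g \<bullet> p = 0" "p \<in> C" "g \<bullet> u \<noteq> 0" "u \<in> C"
  obtains q where "\<And>k. q k \<in> bd" "q \<longlonglongrightarrow> w" "\<And>k. sgn (g \<bullet> q k) = sgn (g \<bullet> u)"
proof -
  define x where "x k = w + (1 / real (Suc k)) *\<^sub>R u" for k
  have xC: "x k \<in> C" for k unfolding x_def using w g
    by (intro C_closure_add scale_C) (auto simp: bdD)
  have gx: "g \<bullet> x k = (1 / real (Suc k)) * (g \<bullet> u)" for k
    using g by (simp add: x_def inner_add_right)
  have hp: "h \<bullet> p > 0" using functional_pos[OF h(1,2)] g by blast
  have "\<exists>t>0. x k - t *\<^sub>R p \<in> bd" for k
  proof (rule exit[of "x k" "- p"])
    show "x k \<in> C" by (rule xC)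
    show "- p \<notin> closure C" using g(3) C_sub_closure C_nonzero by (intro minus_notin_closure) auto
    fix t :: real assume "t > 0"
    show "x k + t *\<^sub>R - p \<noteq> 0"
    proof
      assume "x k + t *\<^sub>R - p = 0"
      then have "g \<bullet> x k = t * (g \<bullet> p)" by (simp add: algebra_simps)
      then show False using g gx[of k] by simp
    qed
  qed auto
  then obtain t where t: "\<And>k. t k > 0" "\<And>k. x k - t k *\<^sub>R p \<in> bd" by metis
  define q where "q k = x k - t k *\<^sub>R p" for k
  have tb: "t k \<le> (1 / real (Suc k)) * ((h \<bullet> u) / (h \<bullet> p))" for k
  proof -
    have "h \<bullet> q k \<ge> 0" unfolding q_def by (rule functional_nonneg_closure[OF h(1) bdD(1)[OF t(2)]])
    then have "t k * (h \<bullet> p) \<le> (1 / real (Suc k)) * (h \<bullet> u)"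
      using h by (simp add: q_def x_def inner_add_right inner_diff_right)
    then have "t k \<le> ((1 / real (Suc k)) * (h \<bullet> u)) / (h \<bullet> p)"
      using hp by (simp add: pos_le_divide_eq mult.assoc mult.commute mult.left_commute del: of_nat_Suc)
    then show ?thesis by simp
  qed
  have "t \<longlonglongrightarrow> 0"
  proof (rule tendsto_sandwich[OF _ _ tendsto_const])
    show "\<forall>\<^sub>F k in sequentially. 0 \<le> t k" using t by (auto intro!: always_eventually less_imp_le)
    show "\<forall>\<^sub>F k in sequentially. t k \<le> (1 / real (Suc k)) * ((h \<bullet> u) / (h \<bullet> p))"
      using tb by (intro always_eventually) auto
    have "(\<lambda>k. 1 / real (Suc k)) \<longlonglongrightarrow> 0" by real_asymp
    then show "(\<lambda>k. (1 / real (Suc k)) * ((h \<bullet> u) / (h \<bullet> p))) \<longlonglongrightarrow> 0"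
      by (rule tendsto_mult_left_zero)
  qed
  moreover have "(\<lambda>k. 1 / real (Suc k)) \<longlonglongrightarrow> 0" by real_asymp
  ultimately have "(\<lambda>k. w + (1 / real (Suc k)) *\<^sub>R u - t k *\<^sub>R p) \<longlonglongrightarrow> w + 0 *\<^sub>R u - 0 *\<^sub>R p"
    by (intro tendsto_intros)
  then have "q \<longlonglongrightarrow> w" by (simp add: q_def[abs_def] x_def[abs_def])
  moreover have "q k \<in> bd" for k using t(2) by (simp add: q_def)
  moreover have "sgn (g \<bullet> q k) = sgn (g \<bullet> u)" for k
    using gx[of k] g by (simp add: q_def inner_diff_right sgn_mult)
  ultimately show thesis by (intro that)
qed

text \<open>If two functionals \<open>h\<close>, \<open>h'\<close> supported the cone along the same boundary ray \<open>w\<close>, then,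
  for every interior vector \<open>p\<close>, the secants through \<open>w\<close> on the two sides of the plane spanned
  by \<open>w\<close> and \<open>p\<close> could only have that plane as common limit.\<close>

lemma support_unique:
  assumes C1: "C1_boundary (pt ` C)" and w: "w \<in> bd"
    and h: "\<And>v. v \<in> C \<Longrightarrow> h \<bullet> v \<ge> 0" "h \<noteq> 0" "h \<bullet> w = 0"
    and h': "\<And>v. v \<in> C \<Longrightarrow> h' \<bullet> v \<ge> 0" "h' \<noteq> 0" "h' \<bullet> w = 0"
  shows "\<exists>c>0. h' = c *\<^sub>R h"
proof (rule ccontr)
  assume no: "\<not> ?thesis"
  have pos: "h \<bullet> v > 0" "h' \<bullet> v > 0" if "v \<in> C" for v
    using that functional_pos h h' by auto
  obtain x0 where x0: "x0 \<in> C" using nonempty by blast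
  have indep: "h' \<noteq> c *\<^sub>R h" for c
  proof
    assume c: "h' = c *\<^sub>R h"
    then have "c * (h \<bullet> x0) > 0" using pos[OF x0] by simp
    then have "c > 0" using pos[OF x0] by (simp add: zero_less_mult_iff)
    then show False using no c by blast
  qed
  define N where "N = tangent_normal (frontier (pt ` C)) (pt w)"
  \<comment> \<open>\<open>y a\<close> kills \<open>w\<close> and all vectors on which
    \<open>h : h'\<close> equals \<open>a : (1 - a)\<close>. Hence \<open>y (r q)\<close> is the
    normal of the plane through \<open>w\<close> and \<open>q\<close>, and \<open>r\<close> takes
    values in the compact unit interval.\<close>
  define y where "y a = a *\<^sub>R h' - (1 - a) *\<^sub>R h" for a :: real
  have ynz: "y a \<noteq> 0" for a
  proof
    assume "y a = 0"
    then have eq: "a *\<^sub>R h' = (1 - a) *\<^sub>R h" by (simp add: y_def)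
    show False
    proof (cases "a = 0")
      case True then show False using eq h by simp
    next
      case False
      then have "h' = ((1 - a) / a) *\<^sub>R h" using eq by (metis divideR_right scaleR_scaleR divide_inverse mult.commute)
      then show False using indep by blast
    qed
  qed
  have yinj: "a = b" if "pt (y a) = pt (y b)" for a b
  proof -
    from that obtain c where c: "y a = c *\<^sub>R y b" using ynz pt_eq_iff by blast
    then have eq: "(a - c * b) *\<^sub>R h' = ((1 - a) - c * (1 - b)) *\<^sub>R h"
      by (simp add: y_def algebra_simps)
    have ab: "a = c * b"
    proof (rule ccontr)
      assume "a \<noteq> c * b"
      then have "h' = (((1 - a) - c * (1 - b)) / (a - c * b)) *\<^sub>R h"
        using scaleR_eqD[OF eq] by simp
      then show False using indep by blast
    qed
    then have "(1 - a) = c * (1 - b)" using eq h by simp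
    with ab have "c = 1" by (simp add: algebra_simps)
    then show "a = b" using ab by simp
  qed
  define r where "r v = (h \<bullet> v) / (h \<bullet> v + h' \<bullet> v)" for v
  \<comment> \<open>The sign of \<open>g\<close> at a vector tells whether its value of
    \<open>r\<close> is above or below \<open>r p\<close>. A sequence approaching \<open>w\<close>
    on one side of the plane through \<open>w\<close> and \<open>p\<close> therefore has its limit
    parameter on that side of \<open>r p\<close>.\<close>
  have side: "\<exists>a. (r p \<le> a \<and> g \<bullet> u > 0 \<or> a \<le> r p \<and> g \<bullet> u < 0) \<and> N = pt (y a)"
    if p: "p \<in> C" and g: "g = (h' \<bullet> p) *\<^sub>R h - (h \<bullet> p) *\<^sub>R h'" and u: "u \<in> C" "g \<bullet> u \<noteq> 0" for p g u
  proof -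
    have gp: "g \<bullet> w = 0" "g \<bullet> p = 0" using h h' by (auto simp: g inner_diff_left)
    obtain q where q: "\<And>k. q k \<in> bd" "q \<longlonglongrightarrow> w" "\<And>k. sgn (g \<bullet> q k) = sgn (g \<bullet> u)"
      using boundary_sequence[OF w h gp p u(2,1)] by blast
    have qw: "pt (q k) \<noteq> pt w" for k
    proof
      assume "pt (q k) = pt w"
      then have "\<exists>c. q k = c *\<^sub>R w" using pt_eq_iff[OF bdD(3)[OF q(1)[of k]] bdD(3)[OF w]] by simp
      then have "g \<bullet> q k = 0" using gp by auto
      then show False using q(3)[of k] u by (simp add: sgn_0_0)
    qed
    have qpos: "h \<bullet> q k > 0" "h' \<bullet> q k > 0" for k
      using functional_zero_unique[OF h(1,2) _ _ h(3)] functional_zero_unique[OF h'(1,2) _ _ h'(3)]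
        q(1)[of k] w qw[of k] bdD by auto
    have r01: "r (q k) \<in> {0..1}" for k using qpos[of k] by (simp add: r_def)
    have "\<forall>k. r (q k) \<in> {0..1}" using r01 by blast
    from seq_compactE[OF compact_imp_seq_compact[OF compact_Icc] this]
    obtain a s where "strict_mono s" "((\<lambda>k. r (q k)) \<circ> s) \<longlonglongrightarrow> a" by metis
    then have s: "strict_mono s" "(\<lambda>k. r (q (s k))) \<longlonglongrightarrow> a" by (simp_all add: o_def)
    have perp: "pt (cross3 w (q k)) = pt (y (r (q k)))" for k
    proof -
      have nzc: "cross3 w (q k) \<noteq> 0" using w q(1) qw[of k] bdD cross3_eq_0_iff by metis
      define z where "z = (h \<bullet> q k) *\<^sub>R h' - (h' \<bullet> q k) *\<^sub>R h"
      have zy: "z = (h \<bullet> q k + h' \<bullet> q k) *\<^sub>R y (r (q k))"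
      proof -
        define S where "S = h \<bullet> q k + h' \<bullet> q k"
        have "S \<noteq> 0" "S * r (q k) = h \<bullet> q k" "S * (1 - r (q k)) = h' \<bullet> q k"
          using qpos[of k] by (auto simp: r_def S_def field_simps)
        then show ?thesis by (simp add: z_def y_def scaleR_diff_right flip: S_def)
      qed
      have "z \<bullet> x = 0" if "cross3 w (q k) \<bullet> x = 0" for x
      proof -
        from that obtain a b where "x = a *\<^sub>R w + b *\<^sub>R q k"
          using cross3_kernel[of w "q k"] w q(1) qw[of k] bdD by metis
        then show ?thesis using h h' by (simp add: z_def inner_add_right inner_diff_left algebra_simps)
      qed
      then obtain c where c: "z = c *\<^sub>R cross3 w (q k)" using functional_multiple by blast
      have "h \<bullet> q k + h' \<bullet> q k \<noteq> 0" using qpos[of k] by simp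
      then have "z \<noteq> 0" "pt z = pt (y (r (q k)))" using zy ynz by auto
      then show ?thesis using c nzc pt_eq_iff by metis
    qed
    have "(\<lambda>k. y (r (q (s k)))) \<longlonglongrightarrow> y a"
      unfolding y_def using s by (intro tendsto_intros)
    then have lim: "(\<lambda>k. pt (cross3 w (q (s k)))) \<longlonglongrightarrow> pt (y a)"
      unfolding perp by (rule tendsto_pt) (rule ynz)
    have "(\<lambda>k. q (s k)) \<longlonglongrightarrow> w" using LIMSEQ_subseq_LIMSEQ[OF q(2) s(1)] by (simp add: o_def)
    then have "(\<lambda>k. pt (q (s k))) \<longlonglongrightarrow> pt w" using w bdD by (intro tendsto_pt) auto
    then have N: "N = pt (y a)" unfolding N_def using q(1) qw
      by (intro secant_limit[OF C1 w _ _ _ lim]) auto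
    have cmp: "r p < r v \<longleftrightarrow> g \<bullet> v > 0" "r v < r p \<longleftrightarrow> g \<bullet> v < 0" if "h \<bullet> v > 0" "h' \<bullet> v > 0" for v
      using that pos[OF p] by (auto simp: g r_def inner_diff_left divide_simps algebra_simps)
    have "r p \<le> a \<and> g \<bullet> u > 0 \<or> a \<le> r p \<and> g \<bullet> u < 0"
    proof (cases "g \<bullet> u > 0")
      case True
      then have "g \<bullet> q k > 0" for k using q(3)[of k] by (simp add: sgn_if split: if_splits)
      then have "r p \<le> r (q (s k))" for k using cmp(1) qpos by (simp add: less_imp_le)
      then show ?thesis using True LIMSEQ_le_const[OF s(2)] by blast
    next
      case False
      then have "g \<bullet> q k < 0" for k using u q(3)[of k] by (simp add: sgn_if split: if_splits)
      then have "r (q (s k)) \<le> r p" for k using cmp(2) qpos by (simp add: less_imp_le)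
      then show ?thesis using False u LIMSEQ_le_const2[OF s(2)] by (auto simp: not_less)
    qed
    with N show ?thesis by blast
  qed
  \<comment> \<open>Approaching from both sides gives one limit parameter at least
    \<open>r p\<close> and one at most \<open>r p\<close>. The tangent is unique and
    \<open>y\<close> is injective, so both equal \<open>r p\<close>.\<close>
  have Nr: "N = pt (y (r p))" if p: "p \<in> C" for p
  proof -
    define g where "g = (h' \<bullet> p) *\<^sub>R h - (h \<bullet> p) *\<^sub>R h'"
    have gnz: "g \<noteq> 0"
    proof
      assume "g = 0"
      then have "(h' \<bullet> p) *\<^sub>R h = (h \<bullet> p) *\<^sub>R h'" by (simp add: g_def)
      then have "h' = ((h' \<bullet> p) / (h \<bullet> p)) *\<^sub>R h"
        using scaleR_eqD[of "h \<bullet> p" h' "h' \<bullet> p" h] pos[OF p] by simp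
      then show False using indep by blast
    qed
    obtain e where e: "e > 0" "ball p e \<subseteq> C" using open_C p open_contains_ball by blast
    define d where "d = e / (2 * norm g)"
    have "d > 0" "d * norm g < e" using e gnz by (auto simp: d_def)
    then have C': "p + d *\<^sub>R g \<in> C" "p - d *\<^sub>R g \<in> C" using e by (auto simp: subset_iff dist_norm)
    have gp: "g \<bullet> p = 0" by (simp add: g_def inner_diff_left)
    have s: "g \<bullet> (p + d *\<^sub>R g) > 0" "g \<bullet> (p - d *\<^sub>R g) < 0"
      using \<open>d > 0\<close> gnz gp by (auto simp: inner_add_right inner_diff_right)
    obtain a where a: "r p \<le> a" "N = pt (y a)" using side[OF p g_def C'(1)] s by auto
    obtain b where b: "b \<le> r p" "N = pt (y b)" using side[OF p g_def C'(2)] s by auto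
    have "a = b" using a b yinj by auto
    then show ?thesis using a b by auto
  qed
  \<comment> \<open>The tangent does not depend on \<open>p\<close>, so \<open>r\<close> is constant
    on the open cone. A nonzero functional \<open>g\<close> would then vanish on all of it.\<close>
  then have rc: "r p = r x0" if "p \<in> C" for p using that x0 yinj by metis
  define g where "g = (h' \<bullet> x0) *\<^sub>R h - (h \<bullet> x0) *\<^sub>R h'"
  have "g \<bullet> p = 0" if "p \<in> C" for p
    using rc[OF that] pos[OF that] pos[OF x0]
    by (auto simp: g_def r_def inner_diff_left divide_simps algebra_simps)
  moreover have "g \<noteq> 0"
  proof
    assume "g = 0"
    then have "(h' \<bullet> x0) *\<^sub>R h = (h \<bullet> x0) *\<^sub>R h'" by (simp add: g_def)
    then have "h' = ((h' \<bullet> x0) / (h \<bullet> x0)) *\<^sub>R h"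
      using scaleR_eqD[of "h \<bullet> x0" h' "h' \<bullet> x0" h] pos[OF x0] by simp
    then show False using indep by blast
  qed
  ultimately show False using functional_pos[of g x0] x0 by auto
qed

end

section \<open>The Hilbert metric on a chord\<close>

lemma continuous_on_aff: "continuous_on (patch n) (aff n)"
proof -
  have eq: "{w. w \<noteq> 0 \<and> pt w \<in> aff n -` B \<inter> patch n} =
      {w. n \<bullet> w \<noteq> 0} \<inter> (\<lambda>w. (1 / (n \<bullet> w)) *\<^sub>R w) -` B" for B
  proof (rule Set.set_eqI)
    fix w show "w \<in> {w. w \<noteq> 0 \<and> pt w \<in> aff n -` B \<inter> patch n} \<longleftrightarrow>
      w \<in> {w. n \<bullet> w \<noteq> 0} \<inter> (\<lambda>w. (1 / (n \<bullet> w)) *\<^sub>R w) -` B"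
      by (cases "w = 0"; cases "n \<bullet> w = 0") (auto simp: mem_patch aff_pt)
  qed
  have 1: "open {w :: real^3. n \<bullet> w \<noteq> 0}"
    by (intro open_Collect_neq continuous_intros)
  have op: "open (aff n -` B \<inter> patch n)" if "open B" for B
  proof -
    have "continuous_on {w. n \<bullet> w \<noteq> 0} (\<lambda>w. (1 / (n \<bullet> w)) *\<^sub>R w)"
      by (intro continuous_intros) auto
    then show ?thesis unfolding open_rp2_iff eq
      using continuous_open_preimage[OF _ 1 \<open>open B\<close>] by blast
  qed
  have "patch n = aff n -` UNIV \<inter> patch n" by simp
  then have "open (patch n)" using op[OF open_UNIV] by simp
  then show ?thesis using op by (simp add: continuous_on_open_vimage)
qed

lemma open_segment_param:
  fixes E :: "'a::euclidean_space"
  assumes "E \<noteq> F" "a < b" "b < c"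
  shows "E + b *\<^sub>R (F - E) \<in> open_segment (E + a *\<^sub>R (F - E)) (E + c *\<^sub>R (F - E))"
proof -
  have "E + b *\<^sub>R (F - E) = (1 - (b - a) / (c - a)) *\<^sub>R (E + a *\<^sub>R (F - E)) + ((b - a) / (c - a)) *\<^sub>R (E + c *\<^sub>R (F - E))"
  proof -
    define r where "r = (b - a) / (c - a)"
    have "r * (c - a) = b - a" using assms by (simp add: r_def)
    then have b: "b = (1 - r) * a + r * c" by (simp add: algebra_simps)
    have "E + ((1 - r) * a + r * c) *\<^sub>R (F - E) = (1 - r) *\<^sub>R (E + a *\<^sub>R (F - E)) + r *\<^sub>R (E + c *\<^sub>R (F - E))"
      by (simp add: algebra_simps)
    then show ?thesis unfolding r_def[symmetric] by (simp flip: b)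
  qed
  moreover have "0 < (b - a) / (c - a)" "(b - a) / (c - a) < 1" using assms by auto
  moreover have "E + a *\<^sub>R (F - E) \<noteq> E + c *\<^sub>R (F - E)"
    using assms by auto
  ultimately show ?thesis unfolding in_segment by blast
qed

lemma aff_pencil:
  assumes "n \<bullet> e > 0" "n \<bullet> f > 0" "s > 0"
  shows "aff n (pt (s *\<^sub>R e + f)) =
    aff n (pt e) + ((n \<bullet> f) / (s * (n \<bullet> e) + n \<bullet> f)) *\<^sub>R (aff n (pt f) - aff n (pt e))"
proof -
  define E F where "E = n \<bullet> e" and "F = n \<bullet> f"
  have pos: "E > 0" "F > 0" "s * E + F > 0" using assms by (auto simp: E_def F_def add_pos_pos)
  have nn: "n \<bullet> (s *\<^sub>R e + f) = s * E + F" by (simp add: inner_add_right E_def F_def)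
  define D where "D = s * E + F"
  have "1 / E - F / D / E = (D - F) / E / D" using pos by (simp add: D_def[symmetric] diff_divide_distrib)
  then have "1 / E - F / (s * E + F) / E = s / (s * E + F)" using pos by (simp add: D_def)
  then have "(s / (s * E + F)) *\<^sub>R e = (1 / E) *\<^sub>R e - (F / (s * E + F)) *\<^sub>R (1 / E) *\<^sub>R e"
    by (simp flip: scaleR_left_diff_distrib)
  moreover have "(1 / (s * E + F)) *\<^sub>R f = (F / (s * E + F)) *\<^sub>R (1 / F) *\<^sub>R f" using pos by simp
  ultimately show ?thesis
    using pos nn by (simp add: aff_pt scaleR_add_right scaleR_diff_right flip: E_def F_def)
qed

context strict_cone
begin

text \<open>If one coefficient were not positive, adding the missing multiple of that boundary
  vector would keep the point in the cone and leave a multiple of the other boundary vector in the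
  interior.\<close>

lemma chord_coords_pos:
  assumes uv: "u \<in> bd" "v \<in> bd" and w: "w \<in> C" "w = a *\<^sub>R u + b *\<^sub>R v"
  shows "a > 0" "b > 0"
proof -
  have *: "\<not> b \<le> 0" if "u \<in> bd" "v \<in> bd" "w = a *\<^sub>R u + b *\<^sub>R v" for a b u v
  proof
    assume "b \<le> 0"
    then have "w + (- b) *\<^sub>R v \<in> C" using that w by (intro C_add_closure closure_scale) (auto simp: bdD)
    then have au: "a *\<^sub>R u \<in> C" using that by simp
    then have "height \<bullet> (a *\<^sub>R u) > 0" using height_pos C_sub_closure C_nonzero by blast
    then have "a > 0" using height_pos[of u] that bdD by (auto simp: zero_less_mult_iff)
    then show False using bd_scale[of u a] that au bdD by auto
  qed
  show "a > 0" using *[OF uv(2,1), of b a] w by (auto simp: add.commute)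
  show "b > 0" using *[OF uv, of a b] w by auto
qed

text \<open>Leave the cone from \<open>x\<close> away from \<open>y\<close>, which gives
  \<open>u\<close>, and then from \<open>y\<close> away from \<open>u\<close>, which gives
  \<open>v\<close>. Undoing the two steps yields positive coordinates.\<close>

lemma chord:
  assumes xy: "x \<in> C" "y \<in> C" "pt x \<noteq> pt y"
  obtains u v a b c d where "u \<in> bd" "v \<in> bd" "pt u \<noteq> pt v"
    "a > 0" "b > 0" "c > 0" "d > 0" "x = a *\<^sub>R u + b *\<^sub>R v" "y = c *\<^sub>R u + d *\<^sub>R v"
proof -
  have nz: "x + t *\<^sub>R - y \<noteq> 0" if "t > 0" for t
  proof
    assume "x + t *\<^sub>R - y = 0"
    then have "x = t *\<^sub>R y" by simp
    then show False using xy that by simp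
  qed
  have "- y \<notin> closure C" using minus_notin_closure[of y] C_sub_closure C_nonzero xy by blast
  from exit[OF xy(1) this nz] obtain l where l: "l > 0" "x + l *\<^sub>R - y \<in> bd" by metis
  define u where "u = x + l *\<^sub>R - y"
  have u: "u \<in> bd" using l by (simp add: u_def)
  have nz': "y + t *\<^sub>R - u \<noteq> 0" if "t > 0" for t
  proof
    assume "y + t *\<^sub>R - u = 0"
    then have "y = t *\<^sub>R u" by simp
    then show False using bd_scale[OF u that] xy bdD by auto
  qed
  have "- u \<notin> closure C" using minus_notin_closure[of u] u bdD by blast
  from exit[OF xy(2) this nz'] obtain m where m: "m > 0" "y + m *\<^sub>R - u \<in> bd" by metis
  define v where "v = y + m *\<^sub>R - u"
  have v: "v \<in> bd" using m by (simp add: v_def)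
  have y: "y = m *\<^sub>R u + 1 *\<^sub>R v" by (simp add: v_def)
  have x: "x = (1 + l * m) *\<^sub>R u + l *\<^sub>R v" by (simp add: v_def u_def algebra_simps)
  have "pt u \<noteq> pt v"
  proof
    assume "pt u = pt v"
    then obtain c where "c > 0" "v = c *\<^sub>R u" using parallel_pos u v bdD by metis
    then have "y = (m + c) *\<^sub>R u" using y by (simp add: algebra_simps)
    then show False using bd_scale[OF u, of "m + c"] m \<open>c > 0\<close> xy bdD by auto
  qed
  then show thesis using that[OF u v _ _ _ _ _ x y] l m by (auto simp: add_pos_pos)
qed

lemma chord_ends:
  assumes "u \<in> bd" "v \<in> bd" "pt u \<noteq> pt v" "p \<in> bd" "p = a *\<^sub>R u + b *\<^sub>R v"
  shows "pt p = pt u \<or> pt p = pt v"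
proof (rule ccontr)
  assume "\<not> ?thesis"
  then have "cross3 u v \<bullet> p \<noteq> 0" using not_coplanar[of u v p] assms by metis
  then show False using assms cross3_kernel[of u v p] bdD by metis
qed

lemma pt_pencil_eq_iff:
  assumes "u \<in> bd" "v \<in> bd" "pt u \<noteq> pt v" "s > 0" "t > 0"
  shows "pt (s *\<^sub>R u + v) = pt (t *\<^sub>R u + v) \<longleftrightarrow> s = t"
proof
  assume eq: "pt (s *\<^sub>R u + v) = pt (t *\<^sub>R u + v)"
  have C: "s *\<^sub>R u + v \<in> C" "t *\<^sub>R u + v \<in> C"
    using C_pos_comb[of u v s 1] C_pos_comb[of u v t 1] assms bdD by auto
  then obtain c where c: "s *\<^sub>R u + v = c *\<^sub>R (t *\<^sub>R u + v)"
    using eq pt_eq_iff C_nonzero by blast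
  then have e: "(s - c * t) *\<^sub>R u = (c - 1) *\<^sub>R v" by (simp add: algebra_simps)
  have "s = c * t"
  proof (rule ccontr)
    assume "s \<noteq> c * t"
    then have "u = ((c - 1) / (s - c * t)) *\<^sub>R v" using scaleR_eqD[OF e] by simp
    then show False using assms pt_eq_iff bdD by blast
  qed
  then show "s = t" using e bdD(3)[OF assms(2)] by auto
qed auto

lemma cyclically_ordered_pencil:
  assumes e: "e \<in> bd" and f: "f \<in> bd" and ef: "pt e \<noteq> pt f" and st: "0 < t" "t < s"
  shows "cyclically_ordered (pt e) (pt (s *\<^sub>R e + f)) (pt (t *\<^sub>R e + f)) (pt f)"
proof -
  let ?n = height
  have pos: "?n \<bullet> e > 0" "?n \<bullet> f > 0" using e f bdD height_pos by auto
  define E F where "E = aff ?n (pt e)" and "F = aff ?n (pt f)"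
  define \<theta> where "\<theta> r = (?n \<bullet> f) / (r * (?n \<bullet> e) + ?n \<bullet> f)" for r
  have "E \<noteq> F" unfolding E_def F_def using ef pos pt_aff(2) mem_patch e f bdD
    by (metis less_irrefl)
  have aff: "aff ?n (pt (r *\<^sub>R e + f)) = E + \<theta> r *\<^sub>R (F - E)" if "r > 0" for r
    using aff_pencil[OF pos that] by (simp add: E_def F_def \<theta>_def)
  have th: "0 < \<theta> s" "\<theta> s < \<theta> t" "\<theta> t < 1"
    using pos st by (auto simp: \<theta>_def add_pos_pos intro!: divide_strict_left_mono)
  have "(\<forall>p\<in>{pt e, pt (s *\<^sub>R e + f), pt (t *\<^sub>R e + f), pt f}. p \<in> patch ?n)"
  proof -
    have "?n \<bullet> (r *\<^sub>R e + f) > 0" if "r > 0" for r using pos that by (simp add: inner_add_right add_pos_pos)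
    then have "?n \<bullet> (r *\<^sub>R e + f) \<noteq> 0 \<and> r *\<^sub>R e + f \<noteq> 0" if "r > 0" for r using that by force
    then show ?thesis using pos st e f bdD by (auto simp: mem_patch)
  qed
  moreover have "aff ?n (pt (s *\<^sub>R e + f)) \<in> open_segment (aff ?n (pt e)) (aff ?n (pt (t *\<^sub>R e + f)))"
    using open_segment_param[OF \<open>E \<noteq> F\<close> th(1,2)] aff st by (simp add: E_def)
  moreover have "aff ?n (pt (t *\<^sub>R e + f)) \<in> open_segment (aff ?n (pt (s *\<^sub>R e + f))) (aff ?n (pt f))"
    using open_segment_param[OF \<open>E \<noteq> F\<close> th(2,3)] aff st by (simp add: F_def)
  ultimately show ?thesis unfolding cyclically_ordered_def by (intro exI[of _ ?n]) auto
qed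

lemma cross_ratio_pencil:
  assumes e: "e \<in> bd" and f: "f \<in> bd" and ef: "pt e \<noteq> pt f" and st: "s > 0" "t > 0"
  shows "cross_ratio (pt e) (pt (t *\<^sub>R e + f)) (pt f) (pt (s *\<^sub>R e + f)) = s / t"
proof -
  let ?n = height
  have pos: "?n \<bullet> e > 0" "?n \<bullet> f > 0" using e f bdD height_pos by auto
  have "?n \<bullet> (r *\<^sub>R e + f) > 0" if "r > 0" for r using pos that by (simp add: inner_add_right add_pos_pos)
  then have nz: "?n \<bullet> e \<noteq> 0" "?n \<bullet> (t *\<^sub>R e + f) \<noteq> 0" "?n \<bullet> f \<noteq> 0" "?n \<bullet> (s *\<^sub>R e + f) \<noteq> 0"
    using pos st by (auto simp: less_imp_neq[symmetric])
  from cross_ratio_coplanar(1)[OF bdD(3)[OF e] bdD(3)[OF f] ef nz, of 1 0 t 1 0 1 s 1]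
  show ?thesis using st by simp
qed

text \<open>The patch hidden in \<open>cyclically_ordered\<close> is arbitrary, so it is not known
  in advance which end comes first. The betweenness relations put \<open>p\<close> and
  \<open>q\<close> on the chord, so they are its two ends in some order; comparing distances in that
  same patch shows that the cross ratio exceeds 1, which gives the absolute value in either
  order.\<close>

lemma cyclically_ordered_pencilD:
  assumes e: "e \<in> bd" and f: "f \<in> bd" and ef: "pt e \<noteq> pt f" and st: "0 < s" "0 < t"
    and pq: "p \<in> frontier (pt ` C)" "q \<in> frontier (pt ` C)"
    and cyc: "cyclically_ordered p (pt (s *\<^sub>R e + f)) (pt (t *\<^sub>R e + f)) q"
  shows "ln (cross_ratio p (pt (t *\<^sub>R e + f)) q (pt (s *\<^sub>R e + f))) = \<bar>ln s - ln t\<bar>"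
proof -
  define x y where "x = s *\<^sub>R e + f" and "y = t *\<^sub>R e + f"
  obtain p' q' where p': "p' \<in> bd" "p = pt p'" and q': "q' \<in> bd" "q = pt q'"
    using pq frontier_cases by metis
  obtain n where n: "{p, pt x, pt y, q} \<subseteq> patch n"
    "aff n (pt x) \<in> open_segment (aff n p) (aff n (pt y))"
    "aff n (pt y) \<in> open_segment (aff n (pt x)) (aff n q)"
    using cyc unfolding cyclically_ordered_def x_def y_def by metis
  have xyC: "x \<in> C" "y \<in> C" unfolding x_def y_def
    using C_pos_comb[of e f s 1] C_pos_comb[of e f t 1] e f ef st bdD by auto
  have nn: "n \<bullet> p' \<noteq> 0" "n \<bullet> x \<noteq> 0" "n \<bullet> y \<noteq> 0" "n \<bullet> q' \<noteq> 0"
    using n(1) p' q' xyC bdD C_nonzero by (auto simp: mem_patch)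
  let ?P = "aff n p" and ?X = "aff n (pt x)" and ?Y = "aff n (pt y)" and ?Q = "aff n q"
  have d1: "dist ?P ?X < dist ?P ?Y" "dist ?Y ?X < dist ?Y ?P" "?P \<noteq> ?Y" "?X \<noteq> ?P"
    using open_segment_bound[OF n(2)] n(2) by (auto simp: dist_norm norm_minus_commute open_segment_def)
  have d2: "dist ?Q ?Y < dist ?Q ?X" "dist ?X ?Y < dist ?X ?Q" "?Q \<noteq> ?Y"
    using open_segment_bound[OF n(3)] n(3) by (auto simp: dist_norm norm_minus_commute open_segment_def)
  have "p \<noteq> q" using d1 d2 by (auto simp: dist_commute)
  have gt1: "(dist ?P ?Y * dist ?Q ?X) / (dist ?P ?X * dist ?Q ?Y) > 1"
  proof -
    have "dist ?P ?X > 0" "dist ?Q ?Y > 0" using d1 d2 by auto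
    moreover from this have "dist ?P ?X * dist ?Q ?Y < dist ?P ?Y * dist ?Q ?X"
      using d1(1) d2(1) by (intro mult_strict_mono) auto
    ultimately show ?thesis by simp
  qed
  have span: "\<exists>a b. z = a *\<^sub>R e + b *\<^sub>R f"
    if z: "n \<bullet> z \<noteq> 0" and v: "\<alpha> \<noteq> 0" "\<alpha> *\<^sub>R aff n (pt z) = \<beta> *\<^sub>R ?X + \<gamma> *\<^sub>R ?Y" for z \<alpha> \<beta> \<gamma>
  proof -
    have "(\<alpha> / (n \<bullet> z)) *\<^sub>R z = (\<beta> / (n \<bullet> x)) *\<^sub>R x + (\<gamma> / (n \<bullet> y)) *\<^sub>R y"
      using v z nn by (simp add: aff_pt)
    also have "\<dots> = 1 *\<^sub>R ((\<beta> / (n \<bullet> x) * s + \<gamma> / (n \<bullet> y) * t) *\<^sub>R e + (\<beta> / (n \<bullet> x) + \<gamma> / (n \<bullet> y)) *\<^sub>R f)"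
      by (simp add: x_def y_def algebra_simps)
    finally have "z = (1 / (\<alpha> / (n \<bullet> z))) *\<^sub>R ((\<beta> / (n \<bullet> x) * s + \<gamma> / (n \<bullet> y) * t) *\<^sub>R e + (\<beta> / (n \<bullet> x) + \<gamma> / (n \<bullet> y)) *\<^sub>R f)"
      by (rule scaleR_eqD) (use v z in auto)
    then show ?thesis unfolding scaleR_add_right scaleR_scaleR by blast
  qed
  obtain r where r: "0 < r" "r < 1" "?X = (1 - r) *\<^sub>R ?P + r *\<^sub>R ?Y"
    using n(2) unfolding in_segment by blast
  then have "(1 - r) *\<^sub>R aff n (pt p') = 1 *\<^sub>R ?X + (- r) *\<^sub>R ?Y" using p' by simp
  then have "\<exists>a b. p' = a *\<^sub>R e + b *\<^sub>R f" by (rule span[rotated 2]) (use r nn in auto)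
  then have pe: "p = pt e \<or> p = pt f" using chord_ends[OF e f ef p'(1)] p' by blast
  obtain r where r: "0 < r" "r < 1" "?Y = (1 - r) *\<^sub>R ?X + r *\<^sub>R ?Q"
    using n(3) unfolding in_segment by blast
  then have "r *\<^sub>R aff n (pt q') = (r - 1) *\<^sub>R ?X + 1 *\<^sub>R ?Y" using q' by (simp add: algebra_simps)
  then have "\<exists>a b. q' = a *\<^sub>R e + b *\<^sub>R f" by (rule span[rotated 2]) (use r nn in auto)
  then have qe: "q = pt e \<or> q = pt f" using chord_ends[OF e f ef q'(1)] q' by blast
  have ne: "n \<bullet> e \<noteq> 0" "n \<bullet> f \<noteq> 0"
    using pe qe \<open>p \<noteq> q\<close> n(1) e f bdD by (auto simp: mem_patch)
  note cr = cross_ratio_coplanar[OF bdD(3)[OF e] bdD(3)[OF f] ef]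
  from pe qe \<open>p \<noteq> q\<close> consider "p = pt e" "q = pt f" | "p = pt f" "q = pt e" by blast
  then show ?thesis
  proof cases
    case 1
    have "cross_ratio p (pt y) q (pt x) = s / t" "s / t > 1"
      using cr[OF ne(1) nn(3) ne(2) nn(2), of 1 0 t 1 0 1 s 1] gt1 st
      unfolding 1 by (auto simp: x_def y_def dist_commute)
    then show ?thesis using st by (simp add: ln_div flip: x_def y_def)
  next
    case 2
    have "cross_ratio p (pt y) q (pt x) = t / s" "t / s > 1"
      using cr[OF ne(2) nn(3) ne(1) nn(2), of 0 1 t 1 1 0 s 1] gt1 st
      unfolding 2 by (auto simp: x_def y_def dist_commute)
    then show ?thesis using st by (simp add: ln_div flip: x_def y_def)
  qed
qed

lemma hilbert_dist_pencil:
  assumes e: "e \<in> bd" and f: "f \<in> bd" and ef: "pt e \<noteq> pt f" and st: "0 < s" "0 < t"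
  shows "hilbert_dist (pt ` C) (pt (s *\<^sub>R e + f)) (pt (t *\<^sub>R e + f)) = \<bar>ln s - ln t\<bar>"
proof (cases "s = t")
  case False
  let ?x = "pt (s *\<^sub>R e + f)" and ?y = "pt (t *\<^sub>R e + f)"
  have "?x \<noteq> ?y" using False pt_pencil_eq_iff[OF e f ef st] by blast
  have fr: "pt e \<in> frontier (pt ` C)" "pt f \<in> frontier (pt ` C)" using e f by (auto simp: frontier_pt_image)
  have "\<exists>p\<in>frontier (pt ` C). \<exists>q\<in>frontier (pt ` C). cyclically_ordered p ?x ?y q"
  proof (cases "t < s")
    case True
    then show ?thesis using cyclically_ordered_pencil[OF e f ef st(2)] fr by blast
  next
    \<comment> \<open>Exchanging the ends of the chord replaces \<open>s\<close>, \<open>t\<close>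
      by their inverses and reverses their order.\<close>
    case F: False
    have sw: "pt ((1/r) *\<^sub>R f + e) = pt (r *\<^sub>R e + f)" if "r > 0" for r
    proof -
      have "pt (r *\<^sub>R ((1/r) *\<^sub>R f + e)) = pt ((1/r) *\<^sub>R f + e)" using that by (intro pt_scale) auto
      moreover have "r *\<^sub>R ((1/r) *\<^sub>R f + e) = r *\<^sub>R e + f" using that by (simp add: scaleR_add_right add.commute)
      ultimately show ?thesis by simp
    qed
    have "cyclically_ordered (pt f) (pt ((1/s) *\<^sub>R f + e)) (pt ((1/t) *\<^sub>R f + e)) (pt e)"
      using F \<open>s \<noteq> t\<close> st ef by (intro cyclically_ordered_pencil[OF f e]) (auto simp: frac_less2)
    then show ?thesis using fr sw st by auto
  qed
  then obtain p q where pq: "p \<in> frontier (pt ` C)" "q \<in> frontier (pt ` C)" "cyclically_ordered p ?x ?y q" by blast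
  have "(THE r. \<exists>p\<in>frontier (pt ` C). \<exists>q\<in>frontier (pt ` C).
      cyclically_ordered p ?x ?y q \<and> r = ln (cross_ratio p ?y q ?x)) = \<bar>ln s - ln t\<bar>"
  proof (rule the_equality)
    show "\<exists>p\<in>frontier (pt ` C). \<exists>q\<in>frontier (pt ` C).
        cyclically_ordered p ?x ?y q \<and> \<bar>ln s - ln t\<bar> = ln (cross_ratio p ?y q ?x)"
      using pq cyclically_ordered_pencilD[OF e f ef st pq] by fastforce
    fix r assume "\<exists>p\<in>frontier (pt ` C). \<exists>q\<in>frontier (pt ` C).
        cyclically_ordered p ?x ?y q \<and> r = ln (cross_ratio p ?y q ?x)"
    then show "r = \<bar>ln s - ln t\<bar>" using cyclically_ordered_pencilD[OF e f ef st] by blast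
  qed
  then show ?thesis using \<open>?x \<noteq> ?y\<close> by (simp add: hilbert_dist_def)
qed (simp add: hilbert_dist_def)

lemma pencil_scale:
  assumes "a > 0" "b > 0"
  shows "pt (a *\<^sub>R u + b *\<^sub>R v) = pt ((a / b) *\<^sub>R u + v)"
proof -
  have "a *\<^sub>R u + b *\<^sub>R v = b *\<^sub>R ((a / b) *\<^sub>R u + v)" using assms by (simp add: scaleR_add_right)
  then show ?thesis using assms by simp
qed

end

lemma cross3_triple: "cross3 v m \<bullet> u = m \<bullet> cross3 u v" "cross3 m u \<bullet> v = m \<bullet> cross3 u v"
  by (simp_all add: cross3_simps)

lemma sum_abs_monotone:
  fixes F :: "real \<Rightarrow> real"
  assumes F: "strict_mono_on {0..1} F \<or> strict_antimono_on {0..1} F"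
    and t: "t 0 = 0" "t n = 1" "\<And>k. k < n \<Longrightarrow> t k \<le> t (Suc k)"
  shows "(\<Sum>k<n. \<bar>F (t k) - F (t (Suc k))\<bar>) = \<bar>F 0 - F 1\<bar>"
proof -
  have mono: "t i \<le> t j" if "i \<le> j" "j \<le> n" for i j
    using that by (induction j) (auto simp: le_Suc_eq intro: order_trans[OF _ t(3)])
  have t01: "t k \<in> {0..1}" if "k \<le> n" for k
    using mono[of 0 k] mono[of k n] that t by auto
  have tel: "(\<Sum>k<n. F (t (Suc k)) - F (t k)) = F 1 - F 0"
    using sum_lessThan_telescope[of "\<lambda>k. F (t k)" n] t by simp
  from F show ?thesis
  proof
    assume F: "strict_mono_on {0..1} F"
    have le: "F a \<le> F b" if "a \<in> {0..1}" "b \<in> {0..1}" "a \<le> b" for a b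
      using F that by (metis less_eq_real_def strict_mono_onD)
    have "(\<Sum>k<n. \<bar>F (t k) - F (t (Suc k))\<bar>) = (\<Sum>k<n. F (t (Suc k)) - F (t k))"
    proof (intro sum.cong refl)
      fix k assume "k \<in> {..<n}"
      then have "F (t k) \<le> F (t (Suc k))" using t01[of k] t01[of "Suc k"] t(3)[of k] by (intro le) auto
      then show "\<bar>F (t k) - F (t (Suc k))\<bar> = F (t (Suc k)) - F (t k)" by simp
    qed
    then show ?thesis using tel le[of 0 1] by simp
  next
    assume F: "strict_antimono_on {0..1} F"
    have le: "F a \<ge> F b" if "a \<in> {0..1}" "b \<in> {0..1}" "a \<le> b" for a b
      using F that by (metis less_eq_real_def monotone_onD)
    have "(\<Sum>k<n. \<bar>F (t k) - F (t (Suc k))\<bar>) = (\<Sum>k<n. - (F (t (Suc k)) - F (t k)))"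
    proof (intro sum.cong refl)
      fix k assume "k \<in> {..<n}"
      then have "F (t k) \<ge> F (t (Suc k))" using t01[of k] t01[of "Suc k"] t(3)[of k] by (intro le) auto
      then show "\<bar>F (t k) - F (t (Suc k))\<bar> = - (F (t (Suc k)) - F (t k))" by simp
    qed
    also have "\<dots> = - (F 1 - F 0)" unfolding tel[symmetric] by (rule sum_negf)
    finally show ?thesis using le[of 0 1] by simp
  qed
qed

context strict_cone
begin

lemma geodesic_pencil:
  assumes uv: "u \<in> bd" "v \<in> bd" "pt u \<noteq> pt v" and st: "s > 0" "t > 0" "s \<noteq> t"
    and L: "L \<in> geodesics (pt ` C)" "pt (s *\<^sub>R u + v) \<in> L" "pt (t *\<^sub>R u + v) \<in> L" "p \<in> L"
  obtains r where "r > 0" "p = pt (r *\<^sub>R u + v)"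
proof -
  obtain \<phi> where \<phi>: "\<phi> \<noteq> 0" "L = {pt w |w. w \<noteq> 0 \<and> \<phi> \<bullet> w = 0} \<inter> pt ` C"
    using L(1) by (auto simp: geodesics_def proj_line_iff)
  have zero: "\<phi> \<bullet> w = 0" if "pt w \<in> L" "w \<in> C" for w
  proof -
    from that(1) \<phi> obtain w' where "w' \<noteq> 0" "\<phi> \<bullet> w' = 0" "pt w = pt w'" by auto
    then obtain c where "w = c *\<^sub>R w'" using pt_eq_iff C_nonzero \<open>w \<in> C\<close> by blast
    then show ?thesis using \<open>\<phi> \<bullet> w' = 0\<close> by simp
  qed
  have C: "s *\<^sub>R u + v \<in> C" "t *\<^sub>R u + v \<in> C"
    using C_pos_comb[of u v s 1] C_pos_comb[of u v t 1] uv st bdD by auto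
  then have "s * (\<phi> \<bullet> u) + \<phi> \<bullet> v = 0" "t * (\<phi> \<bullet> u) + \<phi> \<bullet> v = 0"
    using zero L by (auto simp: inner_add_right dest!: zero)
  then have "s * (\<phi> \<bullet> u) - t * (\<phi> \<bullet> u) = 0" by linarith
  then have "(s - t) * (\<phi> \<bullet> u) = 0" by (simp only: left_diff_distrib)
  then have "\<phi> \<bullet> u = 0" using st by simp
  moreover from this have "\<phi> \<bullet> v = 0" using \<open>s * (\<phi> \<bullet> u) + \<phi> \<bullet> v = 0\<close> by simp
  ultimately have "\<phi> \<bullet> w = 0" if "cross3 u v \<bullet> w = 0" for w
    using that cross3_kernel[of u v w] uv bdD by (auto simp: inner_add_right)
  then obtain c where c: "\<phi> = c *\<^sub>R cross3 u v" using functional_multiple by blast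
  obtain w where w: "w \<in> C" "p = pt w" using L(4) \<phi> by auto
  then have "\<phi> \<bullet> w = 0" using zero L by blast
  then have "cross3 u v \<bullet> w = 0" using c \<phi> by auto
  then obtain a b where ab: "w = a *\<^sub>R u + b *\<^sub>R v" using cross3_kernel[of u v w] uv bdD by blast
  then have "a > 0" "b > 0" using chord_coords_pos[OF uv(1,2) w(1)] by auto
  then show thesis using that[of "a / b"] w ab by (simp add: pencil_scale)
qed

text \<open>In the coordinate \<open>F\<close> the metric on the chord is a multiple of the distance
  on the real line. A continuous injective arc is monotone there, so all partition sums telescope to
  the same value. The factor \<open>\<kappa>\<close> lets the lemma serve the Hilbert metric (1) and
  the hyperbolic metric (1/2).\<close>

lemma geodesic_length_eq:
  assumes d: "\<And>x y. x \<in> pt ` C \<Longrightarrow> y \<in> pt ` C \<Longrightarrow> d x y = \<kappa> * hilbert_dist (pt ` C) x y"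
    and x: "x \<in> pt ` C" and y: "y \<in> pt ` C" and xy: "x \<noteq> y"
  shows "geodesic_length (pt ` C) d x y = d x y"
proof -
  obtain x' y' where x': "x' \<in> C" "x = pt x'" and y': "y' \<in> C" "y = pt y'" using x y by blast
  then have "pt x' \<noteq> pt y'" using xy by simp
  with x' y' obtain u v a b a' b' where uv: "u \<in> bd" "v \<in> bd" "pt u \<noteq> pt v" and
    ab: "a > 0" "b > 0" "a' > 0" "b' > 0" "x' = a *\<^sub>R u + b *\<^sub>R v" "y' = a' *\<^sub>R u + b' *\<^sub>R v"
    using chord by metis
  define s t where "s = a / b" and "t = a' / b'"
  have st: "s > 0" "t > 0" "x = pt (s *\<^sub>R u + v)" "y = pt (t *\<^sub>R u + v)"
    using ab x' y' by (auto simp: s_def t_def pencil_scale)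
  then have "s \<noteq> t" using xy by auto
  have PC: "r *\<^sub>R u + v \<in> C" if "r > 0" for r
    using C_pos_comb[of u v r 1] uv that bdD by auto
  define m where "m = cross3 u v"
  have m: "m \<noteq> 0" using uv bdD by (auto simp: m_def cross3_eq_0_iff)
  \<comment> \<open>Up to the common factor \<open>m . m\<close>, these are the coordinate
    functionals of the basis \<open>u\<close>, \<open>v\<close> of the plane of the chord; the
    factor cancels in \<open>F\<close>.\<close>
  define h1 h2 where "h1 = cross3 v m" and "h2 = cross3 m u"
  have h: "h1 \<bullet> u = m \<bullet> m" "h1 \<bullet> v = 0" "h2 \<bullet> u = 0" "h2 \<bullet> v = m \<bullet> m"
    using cross3_triple(1)[of v m u] cross3_triple(2)[of m u v]
    by (simp_all add: h1_def h2_def dot_cross_self flip: m_def)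
  define F where "F p = ln ((h1 \<bullet> aff height p) / (h2 \<bullet> aff height p))" for p
  have hr: "height \<bullet> (r *\<^sub>R u + v) > 0" if "r > 0" for r
    using height_pos PC[OF that] C_sub_closure C_nonzero by blast
  have quo: "h2 \<bullet> aff height (pt (r *\<^sub>R u + v)) > 0" "h1 \<bullet> aff height (pt (r *\<^sub>R u + v)) > 0"
    "F (pt (r *\<^sub>R u + v)) = ln r" if "r > 0" for r
  proof -
    have "m \<bullet> m > 0" using m by simp
    then show "h2 \<bullet> aff height (pt (r *\<^sub>R u + v)) > 0" "h1 \<bullet> aff height (pt (r *\<^sub>R u + v)) > 0"
      using hr[OF that] that by (auto simp: aff_pt inner_add_right h)
    show "F (pt (r *\<^sub>R u + v)) = ln r" unfolding F_def using hr[OF that] m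
      by (simp add: aff_pt inner_add_right h)
  qed
  have dF: "d (pt (r *\<^sub>R u + v)) (pt (r' *\<^sub>R u + v)) = \<kappa> * \<bar>F (pt (r *\<^sub>R u + v)) - F (pt (r' *\<^sub>R u + v))\<bar>"
    if "r > 0" "r' > 0" for r r'
    using d hilbert_dist_pencil[OF uv that] PC that quo(3) by simp
  have len: "curve_length d c = d x y" if c: "geodesic_arc (pt ` C) c x y" for c
  proof -
    obtain L where L: "L \<in> geodesics (pt ` C)" "c ` {0..1} \<subseteq> L"
      using c by (auto simp: geodesic_arc_def)
    have cc: "continuous_on {0..1} c" "inj_on c {0..1}" "c 0 = x" "c 1 = y"
      using c by (auto simp: geodesic_arc_def)
    have "x \<in> L" "y \<in> L" using L cc by force+
    then have "\<exists>r>0. p = pt (r *\<^sub>R u + v)" if "p \<in> L" for p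
      using geodesic_pencil[OF uv st(1,2) \<open>s \<noteq> t\<close> L(1) _ _ that] st by metis
    then have ex: "\<exists>r>0. c \<tau> = pt (r *\<^sub>R u + v)" if "\<tau> \<in> {0..1}" for \<tau> using L that by blast
    have cont: "continuous_on {0..1} (\<lambda>\<tau>. F (c \<tau>))"
    proof -
      have "c ` {0..1} \<subseteq> patch height"
      proof
        fix p assume "p \<in> c ` {0..1}"
        then obtain r where "r > 0" "p = pt (r *\<^sub>R u + v)" using ex by blast
        then show "p \<in> patch height" using hr[of r] PC[of r] C_nonzero by (auto simp: mem_patch)
      qed
      then have "continuous_on {0..1} (\<lambda>\<tau>. aff height (c \<tau>))"
        using continuous_on_compose2[OF continuous_on_aff cc(1)] by blast
      moreover have "h2 \<bullet> aff height (c \<tau>) \<noteq> 0 \<and> (h1 \<bullet> aff height (c \<tau>)) / (h2 \<bullet> aff height (c \<tau>)) \<noteq> 0"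
        if "\<tau> \<in> {0..1}" for \<tau>
        using ex[OF that] quo by fastforce
      ultimately show ?thesis unfolding F_def by (intro continuous_intros) auto
    qed
    moreover have "inj_on (\<lambda>\<tau>. F (c \<tau>)) {0..1}"
    proof (rule inj_onI)
      fix \<tau> \<tau>' assume T: "\<tau> \<in> {0..1}" "\<tau>' \<in> {0..1}" "F (c \<tau>) = F (c \<tau>')"
      obtain r r' where r: "r > 0" "c \<tau> = pt (r *\<^sub>R u + v)" "r' > 0" "c \<tau>' = pt (r' *\<^sub>R u + v)"
        using ex T by metis
      then have "ln r = ln r'" using T quo by simp
      then have "r = r'" using r by simp
      then have "c \<tau> = c \<tau>'" using r by simp
      then show "\<tau> = \<tau>'" by (rule inj_onD[OF cc(2) _ T(1,2)])
    qed
    ultimately have mono: "strict_mono_on {0..1} (\<lambda>\<tau>. F (c \<tau>)) \<or> strict_antimono_on {0..1} (\<lambda>\<tau>. F (c \<tau>))"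
      using injective_eq_monotone_map[of "{0..1::real}"] by (simp add: is_interval_cc)
    have dc: "d (c \<tau>) (c \<tau>') = \<kappa> * \<bar>F (c \<tau>) - F (c \<tau>')\<bar>" if "\<tau> \<in> {0..1}" "\<tau>' \<in> {0..1}" for \<tau> \<tau>'
      using ex[OF that(1)] ex[OF that(2)] dF by auto
    have *: "(\<Sum>k<n. d (c (\<tau> k)) (c (\<tau> (Suc k)))) = d x y"
      if \<tau>: "\<tau> 0 = 0" "\<tau> n = 1" "\<forall>k<n. \<tau> k \<le> \<tau> (Suc k)" for n and \<tau> :: "nat \<Rightarrow> real"
    proof -
      have mn: "\<tau> i \<le> \<tau> j" if "i \<le> j" "j \<le> n" for i j
        using that \<tau>(3) by (induction j) (auto simp: le_Suc_eq intro: order_trans)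
      have t01: "\<tau> k \<in> {0..1}" if "k \<le> n" for k
        using mn[of 0 k] mn[of k n] that \<tau> by auto
      have "(\<Sum>k<n. d (c (\<tau> k)) (c (\<tau> (Suc k)))) = \<kappa> * (\<Sum>k<n. \<bar>F (c (\<tau> k)) - F (c (\<tau> (Suc k)))\<bar>)"
        unfolding sum_distrib_left using t01 by (intro sum.cong dc) auto
      also have "\<dots> = \<kappa> * \<bar>F (c 0) - F (c 1)\<bar>"
        using sum_abs_monotone[OF mono, of \<tau> n] \<tau> by simp
      also have "\<dots> = d x y" using dc[of 0 1] cc by simp
      finally show ?thesis .
    qed
    have "{\<Sum>k<n. d (c (t k)) (c (t (Suc k))) |n t. t 0 = (0::real) \<and> t n = 1 \<and> (\<forall>k<n. t k \<le> t (Suc k))} = {d x y}"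
      (is "?S = _")
    proof (intro subset_antisym subsetI)
      fix z assume "z \<in> {d x y}"
      moreover have "d x y \<in> ?S"
        using *[of real 1] by (intro CollectI exI[of _ 1] exI[of _ real]) auto
      ultimately show "z \<in> ?S" by simp
    qed (use * in auto)
    then show ?thesis by (simp add: curve_length_def)
  qed
  have "\<exists>c. geodesic_arc (pt ` C) c x y"
  proof -
    define c where "c \<tau> = pt ((s + \<tau> * (t - s)) *\<^sub>R u + v)" for \<tau>
    have pos: "s + \<tau> * (t - s) > 0" if "\<tau> \<in> {0..1}" for \<tau>
    proof -
      have "s + \<tau> * (t - s) = (1 - \<tau>) * s + \<tau> * t" by (simp add: algebra_simps)
      also have "\<dots> > 0"
      proof (cases "\<tau> = 0")
        case False
        then show ?thesis using that st by (intro add_nonneg_pos) auto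
      qed (use st in simp)
      finally show ?thesis .
    qed
    have "continuous_on {0..1} c" unfolding c_def
    proof (rule continuous_on_compose2[OF continuous_on_pt[OF zero_notin_C]])
      show "continuous_on {0..1} (\<lambda>\<tau>. (s + \<tau> * (t - s)) *\<^sub>R u + v)" by (intro continuous_intros)
      show "(\<lambda>\<tau>. (s + \<tau> * (t - s)) *\<^sub>R u + v) ` {0..1} \<subseteq> C" using PC pos by blast
    qed
    moreover have "inj_on c {0..1}"
    proof (rule inj_onI)
      fix \<tau> \<tau>' assume T: "\<tau> \<in> {0..1}" "\<tau>' \<in> {0..1}" "c \<tau> = c \<tau>'"
      then have "s + \<tau> * (t - s) = s + \<tau>' * (t - s)"
        unfolding c_def using pt_pencil_eq_iff[OF uv pos pos] by blast
      then show "\<tau> = \<tau>'" using \<open>s \<noteq> t\<close> by simp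
    qed
    moreover have "c 0 = x" "c 1 = y" using st by (auto simp: c_def)
    moreover have "{pt w |w. w \<noteq> 0 \<and> m \<bullet> w = 0} \<inter> pt ` C \<in> geodesics (pt ` C)"
      "c ` {0..1} \<subseteq> {pt w |w. w \<noteq> 0 \<and> m \<bullet> w = 0} \<inter> pt ` C"
    proof -
      have mw: "m \<bullet> (r *\<^sub>R u + v) = 0" for r by (simp add: m_def inner_add_right dot_cross_self)
      show sub: "c ` {0..1} \<subseteq> {pt w |w. w \<noteq> 0 \<and> m \<bullet> w = 0} \<inter> pt ` C"
      proof
        fix p assume "p \<in> c ` {0..1}"
        then obtain \<tau> where "\<tau> \<in> {0..1}" "p = c \<tau>" by blast
        then show "p \<in> {pt w |w. w \<noteq> 0 \<and> m \<bullet> w = 0} \<inter> pt ` C"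
          using PC[OF pos] mw C_nonzero unfolding c_def by blast
      qed
      then have "{pt w |w. w \<noteq> 0 \<and> m \<bullet> w = 0} \<inter> pt ` C \<noteq> {}"
        by (metis atLeastAtMost_iff empty_iff imageI le_numeral_extra(3) subset_empty zero_le_one)
      then show "{pt w |w. w \<noteq> 0 \<and> m \<bullet> w = 0} \<inter> pt ` C \<in> geodesics (pt ` C)"
        unfolding geodesics_def proj_line_iff using m by blast
    qed
    ultimately show ?thesis unfolding geodesic_arc_def by blast
  qed
  then show ?thesis unfolding geodesic_length_def using len by (intro the_equality) auto
qed

end

section \<open>The universal cover of a surface with geodesic boundary\<close>

lemma matrix_inv_mult_vec:
  fixes A :: "real^3^3"
  assumes "invertible A"
  shows "A *v (matrix_inv A *v x) = x" "matrix_inv A *v (A *v x) = x"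
proof -
  have "A ** matrix_inv A = mat 1" "matrix_inv A ** A = mat 1"
    using assms someI_ex[of "\<lambda>A'. A ** A' = mat 1 \<and> A' ** A = mat 1"]
    by (auto simp: matrix_inv_def invertible_def)
  then show "A *v (matrix_inv A *v x) = x" "matrix_inv A *v (A *v x) = x"
    by (simp_all add: matrix_vector_mul_assoc)
qed

lemma transpose_inner: "(transpose M *v x) \<bullet> y = x \<bullet> (M *v (y :: real^3))" for M :: "real^3^3"
  by (simp add: dot_lmul_matrix)

context strict_cone
begin

definition cut :: "real^3 \<Rightarrow> rp2 set" where
  "cut \<phi> = {pt v |v. v \<in> C \<and> \<phi> \<bullet> v = 0}"

lemma pt_in_cut: "v \<in> C \<Longrightarrow> pt v \<in> cut \<phi> \<longleftrightarrow> \<phi> \<bullet> v = 0"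
proof
  assume v: "v \<in> C" "pt v \<in> cut \<phi>"
  then obtain w where w: "w \<in> C" "\<phi> \<bullet> w = 0" "pt v = pt w" by (auto simp: cut_def)
  then obtain c where "v = c *\<^sub>R w" using v C_nonzero pt_eq_iff by blast
  then show "\<phi> \<bullet> v = 0" using w by simp
qed (auto simp: cut_def)

lemma geodesics_cut: "geodesics (pt ` C) = {cut \<phi> |\<phi>. \<phi> \<noteq> 0 \<and> cut \<phi> \<noteq> {}}"
proof -
  have eq: "{pt w |w. w \<noteq> 0 \<and> \<phi> \<bullet> w = 0} \<inter> pt ` C = cut \<phi>" for \<phi>
  proof (intro subset_antisym subsetI)
    fix p assume "p \<in> {pt w |w. w \<noteq> 0 \<and> \<phi> \<bullet> w = 0} \<inter> pt ` C"
    then obtain v w where vw: "v \<in> C" "w \<noteq> 0" "\<phi> \<bullet> w = 0" "p = pt v" "pt v = pt w" by auto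
    then obtain c where "v = c *\<^sub>R w" using C_nonzero pt_eq_iff by blast
    then have "\<phi> \<bullet> v = 0" using vw by simp
    then show "p \<in> cut \<phi>" using vw(1,4) by (auto simp: cut_def)
  next
    fix p assume "p \<in> cut \<phi>"
    then obtain v where "v \<in> C" "\<phi> \<bullet> v = 0" "p = pt v" by (auto simp: cut_def)
    then show "p \<in> {pt w |w. w \<noteq> 0 \<and> \<phi> \<bullet> w = 0} \<inter> pt ` C" using C_nonzero by blast
  qed
  show ?thesis unfolding geodesics_def proj_line_iff
  proof (intro subset_antisym subsetI)
    fix L assume "L \<in> {l \<inter> pt ` C |l. (\<exists>\<phi>. \<phi> \<noteq> 0 \<and> l = {pt w |w. w \<noteq> 0 \<and> \<phi> \<bullet> w = 0}) \<and> l \<inter> pt ` C \<noteq> {}}"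
    then obtain \<phi> where "\<phi> \<noteq> 0" "L = {pt w |w. w \<noteq> 0 \<and> \<phi> \<bullet> w = 0} \<inter> pt ` C"
      "{pt w |w. w \<noteq> 0 \<and> \<phi> \<bullet> w = 0} \<inter> pt ` C \<noteq> {}" by blast
    then show "L \<in> {cut \<phi> |\<phi>. \<phi> \<noteq> 0 \<and> cut \<phi> \<noteq> {}}" unfolding eq by blast
  next
    fix L assume "L \<in> {cut \<phi> |\<phi>. \<phi> \<noteq> 0 \<and> cut \<phi> \<noteq> {}}"
    then obtain \<phi> where "\<phi> \<noteq> 0" "L = {pt w |w. w \<noteq> 0 \<and> \<phi> \<bullet> w = 0} \<inter> pt ` C"
      "{pt w |w. w \<noteq> 0 \<and> \<phi> \<bullet> w = 0} \<inter> pt ` C \<noteq> {}" unfolding eq by blast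
    then show "L \<in> {l \<inter> pt ` C |l. (\<exists>\<phi>. \<phi> \<noteq> 0 \<and> l = {pt w |w. w \<noteq> 0 \<and> \<phi> \<bullet> w = 0}) \<and> l \<inter> pt ` C \<noteq> {}}"
      by blast
  qed
qed

text \<open>Only a one-sided sign is required: \<open>\<psi>\<close> is nonnegative on a plane
  section of the open cone and vanishes at an inner point \<open>p\<close> of it, so moving from
  \<open>p\<close> both ways along any direction of the plane shows that it vanishes there.\<close>

lemma cut_cong_iff:
  assumes "\<phi> \<noteq> 0" "p \<in> C" "\<phi> \<bullet> p = 0" and sub: "\<And>v. v \<in> C \<Longrightarrow> \<phi> \<bullet> v = 0 \<Longrightarrow> \<psi> \<bullet> v \<ge> 0" "\<psi> \<bullet> p = 0"
  shows "\<exists>c. \<psi> = c *\<^sub>R \<phi>"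
proof (rule functional_multiple)
  fix w assume w: "\<phi> \<bullet> w = 0"
  obtain e where e: "e > 0" "ball p e \<subseteq> C" using open_C assms(2) open_contains_ball by blast
  define d where "d = e / (2 * (norm w + 1))"
  have "d > 0" "d * norm w < e"
  proof -
    have "norm w + 1 > 0" using norm_ge_zero[of w] by linarith
    then show "d > 0" using e by (simp add: d_def)
    have "norm w < 2 * (norm w + 1)" by (smt (verit) norm_ge_zero)
    then have "d * norm w < d * (2 * (norm w + 1))" using \<open>d > 0\<close> by (rule mult_strict_left_mono)
    also have "\<dots> = e" using \<open>norm w + 1 > 0\<close> by (simp add: d_def)
    finally show "d * norm w < e" .
  qed
  then have "p + d *\<^sub>R w \<in> C" "p - d *\<^sub>R w \<in> C" using e by (auto simp: subset_iff dist_norm)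
  moreover have "\<phi> \<bullet> (p + d *\<^sub>R w) = 0" "\<phi> \<bullet> (p - d *\<^sub>R w) = 0"
    using assms(3) w by (simp_all add: inner_add_right inner_diff_right)
  ultimately have "\<psi> \<bullet> (p + d *\<^sub>R w) \<ge> 0" "\<psi> \<bullet> (p - d *\<^sub>R w) \<ge> 0"
    using sub(1) by blast+
  then have "d * (\<psi> \<bullet> w) \<ge> 0" "d * (\<psi> \<bullet> w) \<le> 0" using sub(2) by (auto simp: inner_add_right inner_diff_right)
  then show "\<psi> \<bullet> w = 0" using \<open>d > 0\<close> by (auto simp: zero_le_mult_iff mult_le_0_iff)
qed

lemma functional_same_sign:
  assumes "\<And>v. v \<in> C \<Longrightarrow> n \<bullet> v \<noteq> 0" "u \<in> C" "v \<in> C" "n \<bullet> u > 0"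
  shows "n \<bullet> v > 0"
proof (rule ccontr)
  assume "\<not> n \<bullet> v > 0"
  then have "n \<bullet> v < 0" using assms(1)[OF assms(3)] by simp
  then have "(- (n \<bullet> v)) *\<^sub>R u + (n \<bullet> u) *\<^sub>R v \<in> C" using assms by (intro C_add scale_C) auto
  moreover have "n \<bullet> ((- (n \<bullet> v)) *\<^sub>R u + (n \<bullet> u) *\<^sub>R v) = 0" by (simp add: inner_add_right inner_diff_right)
  ultimately show False using assms(1) by blast
qed

end

text \<open>A matrix inducing \<open>a\<close> is determined up to a factor. Requiring that it
  preserve \<open>C\<close>, and not only \<open>C\<close> up to sign, leaves positive factors only,
  so that signs of covectors can be transported.\<close>

definition lifts :: "(real^3) set \<Rightarrow> (rp2 \<Rightarrow> rp2) \<Rightarrow> real^3^3 \<Rightarrow> bool" where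
  "lifts C a A \<longleftrightarrow> det A > 0 \<and> a = proj_map A \<and> (*v) A ` C = C"

context strict_cone
begin

context
  fixes a A assumes A: "lifts C a A"
begin

lemma lift_invertible: "invertible A"
  using A by (auto simp: lifts_def invertible_det_nz)

lemma lift_nonzero: "A *v v = 0 \<longleftrightarrow> v = 0"
  by (rule invertible_mult_eq_0[OF lift_invertible])

lemma lift_pt: "v \<noteq> 0 \<Longrightarrow> a (pt v) = pt (A *v v)"
  using A proj_map_pt[OF lift_invertible] by (simp add: lifts_def)

lemma lift_inj: "A *v u = A *v v \<longleftrightarrow> u = v"
  using matrix_inv_mult_vec[OF lift_invertible] by metis

lemma lift_C: "A *v v \<in> C \<longleftrightarrow> v \<in> C"
proof
  assume "A *v v \<in> C"
  then have "A *v v \<in> (*v) A ` C" using A by (simp add: lifts_def)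
  then show "v \<in> C" using lift_inj by auto
qed (use A in \<open>auto simp: lifts_def\<close>)

lemma lift_closure: "A *v v \<in> closure C \<longleftrightarrow> v \<in> closure C"
proof -
  have "inj ((*v) A)" using lift_inj by (simp add: inj_def)
  then have "(*v) A ` closure C = closure C"
    using closure_injective_linear_image[of "(*v) A" C] A by (simp add: lifts_def)
  then have "A *v v \<in> closure C \<longleftrightarrow> A *v v \<in> (*v) A ` closure C" by simp
  also have "\<dots> \<longleftrightarrow> v \<in> closure C" using lift_inj by auto
  finally show ?thesis .
qed

lemma lift_bd: "A *v v \<in> bd \<longleftrightarrow> v \<in> bd"
  by (simp add: bd_def lift_C lift_closure lift_nonzero)

lemma lift_inv_C: "matrix_inv A *v v \<in> C \<longleftrightarrow> v \<in> C"
  using lift_C[of "matrix_inv A *v v"] matrix_inv_mult_vec[OF lift_invertible] by simp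

lemma lift_inv_bd: "matrix_inv A *v v \<in> bd \<longleftrightarrow> v \<in> bd"
  using lift_bd[of "matrix_inv A *v v"] matrix_inv_mult_vec[OF lift_invertible] by simp

lemma lift_pt_eq: "u \<noteq> 0 \<Longrightarrow> v \<noteq> 0 \<Longrightarrow> pt (A *v u) = pt (A *v v) \<longleftrightarrow> pt u = pt v"
proof -
  assume nz: "u \<noteq> 0" "v \<noteq> 0"
  have "(\<exists>c. A *v u = c *\<^sub>R (A *v v)) \<longleftrightarrow> (\<exists>c. u = c *\<^sub>R v)"
    using lift_inj by (simp flip: matrix_vector_mult_scaleR)
  then show ?thesis using nz by (simp add: pt_eq_iff lift_nonzero)
qed

lemma lift_cut: "a ` cut \<phi> = cut (transpose (matrix_inv A) *v \<phi>)"
proof (intro subset_antisym subsetI)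
  fix p assume "p \<in> a ` cut \<phi>"
  then obtain v where v: "v \<in> C" "\<phi> \<bullet> v = 0" "p = pt (A *v v)"
    using lift_pt C_nonzero by (auto simp: cut_def)
  then show "p \<in> cut (transpose (matrix_inv A) *v \<phi>)"
    using lift_C by (simp add: pt_in_cut transpose_inner matrix_inv_mult_vec[OF lift_invertible] del: transpose_matrix_vector)
next
  fix p assume "p \<in> cut (transpose (matrix_inv A) *v \<phi>)"
  then obtain v where v: "v \<in> C" "(transpose (matrix_inv A) *v \<phi>) \<bullet> v = 0" "p = pt v" by (auto simp: cut_def simp del: transpose_matrix_vector)
  then have "p = a (pt (matrix_inv A *v v))" "pt (matrix_inv A *v v) \<in> cut \<phi>"
    using lift_pt[of "matrix_inv A *v v"] lift_inv_C[of v] C_nonzero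
    by (auto simp: pt_in_cut transpose_inner matrix_inv_mult_vec[OF lift_invertible] simp del: transpose_matrix_vector)
  then show "p \<in> a ` cut \<phi>" by blast
qed

lemma lift_covector_nonzero: "transpose (matrix_inv A) *v \<phi> = 0 \<longleftrightarrow> \<phi> = 0"
proof
  assume "transpose (matrix_inv A) *v \<phi> = 0"
  then have "\<phi> \<bullet> (matrix_inv A *v (A *v \<phi>)) = 0"
    using transpose_inner[of "matrix_inv A" \<phi> "A *v \<phi>"] by simp
  then show "\<phi> = 0" by (simp add: matrix_inv_mult_vec[OF lift_invertible])
qed simp

lemma lift_inj_map: "p \<in> pt ` C \<Longrightarrow> q \<in> pt ` C \<Longrightarrow> a p = a q \<Longrightarrow> p = q"
  using lift_pt lift_pt_eq C_nonzero by auto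

end

lemma lifts_scale:
  assumes "lifts C a A" "c > 0"
  shows "lifts C a (c *\<^sub>R A)"
proof -
  have dc: "det (c *\<^sub>R A) = c ^ 3 * det A" by (simp add: det_3 algebra_simps power3_eq_cube)
  have i: "invertible (c *\<^sub>R A)" "invertible A"
    using assms by (auto simp: lifts_def invertible_det_nz dc)
  have mv: "(c *\<^sub>R A) *v v = c *\<^sub>R (A *v v)" for v by (simp add: scaleR_matrix_vector_assoc)
  have "proj_map (c *\<^sub>R A) p = proj_map A p" for p
  proof -
    obtain v where v: "v \<noteq> 0" "p = pt v" using pt_cases by blast
    then show ?thesis using proj_map_pt[OF i(1) v(1)] proj_map_pt[OF i(2) v(1)] assms by (simp add: mv)
  qed
  moreover have "(*v) (c *\<^sub>R A) ` C = C"
  proof (intro subset_antisym subsetI)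
    fix x assume "x \<in> (*v) (c *\<^sub>R A) ` C"
    then show "x \<in> C" using assms lift_C by (auto simp: mv scale_C)
  next
    fix x assume "x \<in> C"
    then have "(1/c) *\<^sub>R x \<in> (*v) A ` C" using assms scale_C[of x "1/c"] by (simp add: lifts_def)
    then obtain v where "v \<in> C" "(1/c) *\<^sub>R x = A *v v" by blast
    then have "x = c *\<^sub>R (A *v v)" using assms by (metis divide_self_if less_irrefl scaleR_one scaleR_scaleR times_divide_eq_right mult.right_neutral)
    then show "x \<in> (*v) (c *\<^sub>R A) ` C" using \<open>v \<in> C\<close> by (auto simp: mv)
  qed
  ultimately show ?thesis using assms by (auto simp: lifts_def dc)
qed

end

section \<open>The universal cover as an intersection of half-spaces\<close>

locale surface = strict_cone C for C +
  fixes Ft :: "rp2 set" and \<Delta> :: "(rp2 \<Rightarrow> rp2) set"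
  assumes C1: "C1_boundary (pt ` C)"
    and Ft_sub: "Ft \<subseteq> pt ` C"
    and Ft_closed: "closedin (top_of_set (pt ` C)) Ft"
    and Ft_interior: "interior Ft \<noteq> {}"
    and Ft_convex: "\<exists>n. pt ` C \<subseteq> patch n \<and> convex (aff n ` Ft)"
    and Ft_frontier: "pt ` C \<inter> frontier Ft = \<Union> (boundary_geodesics (pt ` C) Ft)"
    and stabilizer: "\<And>L a. L \<in> boundary_geodesics (pt ` C) Ft \<Longrightarrow> a \<in> \<Delta> \<Longrightarrow> a \<noteq> id \<Longrightarrow> a ` L = L \<Longrightarrow>
      (\<exists>B. diagonalizes B a) \<and> L = axis_of (pt ` C) a"
    and id_in: "id \<in> \<Delta>"
    and comp_in: "\<And>a b. a \<in> \<Delta> \<Longrightarrow> b \<in> \<Delta> \<Longrightarrow> a \<circ> b \<in> \<Delta>"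
    and inv_in: "\<And>a. a \<in> \<Delta> \<Longrightarrow> \<exists>b\<in>\<Delta>. a \<circ> b = id \<and> b \<circ> a = id"
    and ex_lift: "\<And>a. a \<in> \<Delta> \<Longrightarrow> \<exists>A. lifts C a A"
    and free: "\<And>a p. a \<in> \<Delta> \<Longrightarrow> p \<in> pt ` C \<Longrightarrow> a p = p \<Longrightarrow> a = id"
    and proper: "\<And>K. compact K \<Longrightarrow> K \<subseteq> pt ` C \<Longrightarrow> finite {a \<in> \<Delta>. a ` K \<inter> K \<noteq> {}}"
    and Ft_inv: "\<And>a. a \<in> \<Delta> \<Longrightarrow> a ` Ft = Ft"
    and cocompact: "compact_space (quotient_space Ft \<Delta>)"
begin

abbreviation \<Omega> :: "rp2 set" where "\<Omega> \<equiv> pt ` C"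
abbreviation BG :: "rp2 set set" where "BG \<equiv> boundary_geodesics (pt ` C) Ft"

definition D :: "(real^3) set" where "D = {v \<in> C. pt v \<in> Ft}"
definition Di :: "(real^3) set" where "Di = {v \<in> C. pt v \<in> interior Ft}"

lemma D_sub: "v \<in> D \<Longrightarrow> v \<in> C" by (simp add: D_def)

lemma Di_sub: "v \<in> Di \<Longrightarrow> v \<in> D"
  using interior_subset by (auto simp: D_def Di_def)

lemma D_scale: "v \<in> D \<Longrightarrow> c > 0 \<Longrightarrow> c *\<^sub>R v \<in> D"
  by (auto simp: D_def scale_C)

lemma D_add:
  assumes uv: "u \<in> D" "v \<in> D"
  shows "u + v \<in> D"
proof -
  obtain n where n: "pt ` C \<subseteq> patch n" "convex (aff n ` Ft)" using Ft_convex by blast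
  have nz: "n \<bullet> v \<noteq> 0" if "v \<in> C" for v using n(1) that C_nonzero by (auto simp: image_subset_iff mem_patch)
  have C: "u \<in> C" "v \<in> C" using uv D_sub by auto
  then have s: "(n \<bullet> u > 0 \<and> n \<bullet> v > 0) \<or> (n \<bullet> u < 0 \<and> n \<bullet> v < 0)"
    using functional_same_sign[of n, OF nz] nz by (metis linorder_neqE_linordered_idom)
  \<comment> \<open>The patch in which \<open>Ft\<close> is convex may be negative on
    \<open>C\<close>, but its sign is constant there, so the quotients by \<open>c\<close> are
    convex weights in either case.\<close>
  define c where "c = n \<bullet> u + n \<bullet> v"
  have c: "c \<noteq> 0" "(n \<bullet> u) / c \<ge> 0" "(n \<bullet> v) / c \<ge> 0" "(n \<bullet> u) / c + (n \<bullet> v) / c = 1"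
    using s by (auto simp: c_def divide_nonneg_pos divide_nonpos_neg add_neg_neg simp flip: add_divide_distrib)
  have "aff n (pt u) \<in> aff n ` Ft" "aff n (pt v) \<in> aff n ` Ft" using uv by (auto simp: D_def)
  then have "((n \<bullet> u) / c) *\<^sub>R aff n (pt u) + ((n \<bullet> v) / c) *\<^sub>R aff n (pt v) \<in> aff n ` Ft"
    using n(2) c unfolding convex_def by blast
  moreover have "((n \<bullet> u) / c) *\<^sub>R aff n (pt u) + ((n \<bullet> v) / c) *\<^sub>R aff n (pt v) = (1/c) *\<^sub>R (u + v)"
    using nz C by (simp add: aff_pt scaleR_add_right)
  ultimately obtain q where q: "q \<in> Ft" "(1/c) *\<^sub>R (u + v) = aff n q" by auto
  then have "pt ((1/c) *\<^sub>R (u + v)) = q" using pt_aff(2)[of q n] n(1) Ft_sub q by (metis subsetD)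
  moreover have "pt ((1/c) *\<^sub>R (u + v)) = pt (u + v)" using c by (intro pt_scale) auto
  ultimately show ?thesis using q C C_add by (auto simp: D_def)
qed

lemma open_Di: "open Di"
proof -
  have "Di = C \<inter> {v. v \<noteq> 0 \<and> pt v \<in> interior Ft}" using C_nonzero by (auto simp: Di_def)
  moreover have "open {v. v \<noteq> 0 \<and> pt v \<in> interior Ft}" using open_interior[of Ft] unfolding open_rp2_iff .
  ultimately show ?thesis using open_C by auto
qed

lemma DiI:
  assumes "open S" "v \<in> S" "S \<subseteq> D"
  shows "v \<in> Di"
proof -
  have "open (pt ` S)" using assms D_sub C_nonzero by (intro open_pt_image) auto
  moreover have "pt ` S \<subseteq> Ft" using assms by (auto simp: D_def)
  ultimately have "pt v \<in> interior Ft" using assms by (intro interiorI) auto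
  then show ?thesis using assms D_sub by (auto simp: Di_def)
qed

lemma Di_add: 
  assumes "u \<in> Di" "v \<in> D"
  shows "u + v \<in> Di"
proof (rule DiI)
  show "open ((+) v ` Di)" using open_Di by (rule open_translation)
  show "u + v \<in> (+) v ` Di" using assms by (auto simp: add.commute)
  show "(+) v ` Di \<subseteq> D"
  proof clarify
    fix x assume "x \<in> Di"
    then show "v + x \<in> D" using assms D_add[OF _ Di_sub] by blast
  qed
qed

lemma Di_scale: "v \<in> Di \<Longrightarrow> c > 0 \<Longrightarrow> c *\<^sub>R v \<in> Di"
  by (auto simp: Di_def scale_C)

lemma Di_nonempty: "Di \<noteq> {}"
proof -
  obtain p where p: "p \<in> interior Ft" using Ft_interior by blast
  then have "p \<in> pt ` C" using interior_subset Ft_sub by blast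
  then show ?thesis using p by (auto simp: Di_def)
qed

lemma D_closed:
  assumes "v \<in> C" "x \<longlonglongrightarrow> v" "\<And>k. x k \<in> D"
  shows "v \<in> D"
proof -
  obtain U where U: "closed U" "Ft = \<Omega> \<inter> U" using Ft_closed by (auto simp: closedin_closed)
  have "(\<lambda>k. pt (x k)) \<longlonglongrightarrow> pt v" using assms C_nonzero by (intro tendsto_pt) auto
  moreover have "pt (x k) \<in> U" for k using assms(3)[of k] U(2) unfolding D_def by blast
  ultimately have "pt v \<in> U" using Lim_in_closed_set[of U "\<lambda>k. pt (x k)" sequentially] U(1) by auto
  then have "pt v \<in> Ft" using U(2) assms(1) by blast
  then show ?thesis using assms(1) by (simp add: D_def)
qed

lemma frontier_Ft_iff:
  assumes "v \<in> C"
  shows "pt v \<in> frontier Ft \<longleftrightarrow> v \<in> D \<and> v \<notin> Di"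
proof
  assume f: "pt v \<in> frontier Ft"
  obtain U where U: "closed U" "Ft = \<Omega> \<inter> U" using Ft_closed by (auto simp: closedin_closed)
  then have "closure Ft \<subseteq> U" by (intro closure_minimal) auto
  then have "pt v \<in> Ft" using f U assms by (auto simp: frontier_def)
  then show "v \<in> D \<and> v \<notin> Di" using f assms by (auto simp: D_def Di_def frontier_def)
next
  assume "v \<in> D \<and> v \<notin> Di"
  then show "pt v \<in> frontier Ft" using closure_subset by (auto simp: D_def Di_def frontier_def)
qed

lemma BG_iff:
  "L \<in> BG \<longleftrightarrow> (\<exists>\<phi>. \<phi> \<noteq> 0 \<and> L = cut \<phi> \<and> (\<exists>v\<in>C. \<phi> \<bullet> v = 0) \<and> (\<forall>v\<in>C. \<phi> \<bullet> v = 0 \<longrightarrow> v \<in> D \<and> v \<notin> Di))"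
proof -
  have "(cut \<phi> \<noteq> {}) = (\<exists>v\<in>C. \<phi> \<bullet> v = 0)" for \<phi> by (auto simp: cut_def)
  moreover have "cut \<phi> \<subseteq> frontier Ft \<longleftrightarrow> (\<forall>v\<in>C. \<phi> \<bullet> v = 0 \<longrightarrow> v \<in> D \<and> v \<notin> Di)" for \<phi>
    using frontier_Ft_iff by (auto simp: cut_def)
  ultimately have 1: "(\<phi> \<noteq> 0 \<and> L = cut \<phi> \<and> cut \<phi> \<noteq> {} \<and> cut \<phi> \<subseteq> frontier Ft) \<longleftrightarrow>
      (\<phi> \<noteq> 0 \<and> L = cut \<phi> \<and> (\<exists>v\<in>C. \<phi> \<bullet> v = 0) \<and> (\<forall>v\<in>C. \<phi> \<bullet> v = 0 \<longrightarrow> v \<in> D \<and> v \<notin> Di))" for \<phi>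
    by metis
  have "L \<in> BG \<longleftrightarrow> (\<exists>\<phi>. \<phi> \<noteq> 0 \<and> L = cut \<phi> \<and> cut \<phi> \<noteq> {} \<and> cut \<phi> \<subseteq> frontier Ft)"
    unfolding boundary_geodesics_def geodesics_cut by blast
  then show ?thesis by (simp only: 1)
qed

lemma BG_E:
  assumes "L \<in> BG"
  obtains \<phi> where "\<phi> \<noteq> 0" "L = cut \<phi>" "\<exists>v\<in>C. \<phi> \<bullet> v = 0" "\<And>v. v \<in> C \<Longrightarrow> \<phi> \<bullet> v = 0 \<Longrightarrow> v \<in> D \<and> v \<notin> Di"
proof -
  obtain \<phi> where "\<phi> \<noteq> 0 \<and> L = cut \<phi> \<and> (\<exists>v\<in>C. \<phi> \<bullet> v = 0) \<and> (\<forall>v\<in>C. \<phi> \<bullet> v = 0 \<longrightarrow> v \<in> D \<and> v \<notin> Di)"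
    using assms unfolding BG_iff by (elim exE)
  then show thesis using that by blast
qed

lemma boundary_point: "v \<in> D \<Longrightarrow> v \<notin> Di \<Longrightarrow> \<exists>L\<in>BG. pt v \<in> L"
proof -
  assume "v \<in> D" "v \<notin> Di"
  then have "pt v \<in> \<Omega> \<inter> frontier Ft" using frontier_Ft_iff[of v] D_sub by blast
  then show ?thesis unfolding Ft_frontier by blast
qed

text \<open>The covector of a geodesic is determined only up to a nonzero factor. Positivity on the
  interior of the surface fixes its sign, so a negative value means lying beyond the
  geodesic.\<close>

definition wall :: "rp2 set \<Rightarrow> real^3 \<Rightarrow> bool" where
  "wall L \<phi> \<longleftrightarrow> \<phi> \<noteq> 0 \<and> L = cut \<phi> \<and> (\<exists>v\<in>C. \<phi> \<bullet> v = 0) \<and> (\<forall>v\<in>C. \<phi> \<bullet> v = 0 \<longrightarrow> v \<in> D) \<and>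
     (\<forall>v\<in>D. \<phi> \<bullet> v \<ge> 0) \<and> (\<forall>v\<in>Di. \<phi> \<bullet> v > 0)"

lemma ex_wall:
  assumes "L \<in> BG"
  shows "\<exists>\<phi>. wall L \<phi>"
proof -
  obtain \<phi> where \<phi>: "\<phi> \<noteq> 0" "L = cut \<phi>" "\<exists>v\<in>C. \<phi> \<bullet> v = 0" "\<And>v. v \<in> C \<Longrightarrow> \<phi> \<bullet> v = 0 \<Longrightarrow> v \<in> D \<and> v \<notin> Di"
    using BG_E[OF assms] by metis
  have nz: "\<phi> \<bullet> v \<noteq> 0" if "v \<in> Di" for v using \<phi>(4) that Di_sub D_sub by blast
  obtain p where p: "p \<in> Di" using Di_nonempty by blast
  have *: "\<exists>\<phi>. wall L \<phi>" if \<phi>: "\<phi> \<noteq> 0" "L = cut \<phi>" "\<exists>v\<in>C. \<phi> \<bullet> v = 0"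
    "\<And>v. v \<in> C \<Longrightarrow> \<phi> \<bullet> v = 0 \<Longrightarrow> v \<in> D \<and> v \<notin> Di" and pp: "\<phi> \<bullet> p > 0"
    and nz: "\<And>v. v \<in> Di \<Longrightarrow> \<phi> \<bullet> v \<noteq> 0" for \<phi>
  proof -
    have pos: "\<phi> \<bullet> v > 0" if "v \<in> Di" for v
    proof (rule ccontr)
      assume "\<not> \<phi> \<bullet> v > 0"
      then have "\<phi> \<bullet> v < 0" using nz[OF that] by simp
      then have "(- (\<phi> \<bullet> v)) *\<^sub>R p + (\<phi> \<bullet> p) *\<^sub>R v \<in> Di"
        using p that pp by (intro Di_add Di_scale D_scale Di_sub) auto
      moreover have "\<phi> \<bullet> ((- (\<phi> \<bullet> v)) *\<^sub>R p + (\<phi> \<bullet> p) *\<^sub>R v) = 0" by (simp add: inner_add_right inner_diff_right)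
      ultimately show False using nz by blast
    qed
    have "\<phi> \<bullet> v \<ge> 0" if "v \<in> D" for v
    proof (rule ccontr)
      assume neg: "\<not> \<phi> \<bullet> v \<ge> 0"
      define c where "c = - (\<phi> \<bullet> v) / (\<phi> \<bullet> p)"
      have "c > 0" using neg pp by (simp add: c_def divide_neg_pos)
      then have "\<phi> \<bullet> (c *\<^sub>R p + v) > 0" using p that by (intro pos Di_add Di_scale) auto
      then show False using pp by (simp add: inner_add_right inner_diff_right c_def)
    qed
    then show ?thesis using \<phi> pos unfolding wall_def by blast
  qed
  show ?thesis
  proof (cases "\<phi> \<bullet> p > 0")
    case True
    then show ?thesis using *[of \<phi>] \<phi> nz by blast
  next
    case False
    have "cut (- \<phi>) = cut \<phi>" by (simp add: cut_def)
    then have "L = cut (- \<phi>)" using \<phi>(2) by simp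
    moreover have "\<phi> \<bullet> p < 0" using False nz[OF p] by linarith
    ultimately show ?thesis by (intro *[of "- \<phi>"]) (use \<phi> nz in auto)
  qed
qed

definition wf :: "rp2 set \<Rightarrow> real^3" where
  "wf L = (SOME \<phi>. wall L \<phi>)"

lemma wall_wf: "L \<in> BG \<Longrightarrow> wall L (wf L)"
  unfolding wf_def using ex_wall by (rule someI_ex)

lemma D_wall: "v \<in> D \<Longrightarrow> L \<in> BG \<Longrightarrow> wf L \<bullet> v \<ge> 0"
  using wall_wf by (auto simp: wall_def)

lemma Di_wall: "v \<in> Di \<Longrightarrow> L \<in> BG \<Longrightarrow> wf L \<bullet> v > 0"
  using wall_wf by (auto simp: wall_def)

lemma mem_L: "v \<in> C \<Longrightarrow> L \<in> BG \<Longrightarrow> pt v \<in> L \<longleftrightarrow> wf L \<bullet> v = 0"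
  using wall_wf[of L] pt_in_cut[of v "wf L"] by (auto simp: wall_def)

lemma L_sub_D: "v \<in> C \<Longrightarrow> L \<in> BG \<Longrightarrow> wf L \<bullet> v = 0 \<Longrightarrow> v \<in> D"
  using wall_wf[of L] by (auto simp: wall_def)

text \<open>On the segment from an interior vector \<open>p\<close> to \<open>v\<close>, the last
  point in \<open>D\<close> lies on some boundary geodesic. Its wall is positive at \<open>p\<close>
  and zero there, hence negative at \<open>v\<close>.\<close>

lemma not_D_wall:
  assumes v: "v \<in> C" "v \<notin> D"
  shows "\<exists>L\<in>BG. wf L \<bullet> v < 0"
proof -
  obtain p where p: "p \<in> Di" using Di_nonempty by blast
  define S where "S = {t\<in>{0..1}. (1 - t) *\<^sub>R p + t *\<^sub>R v \<in> D}"
  have inC: "(1 - t) *\<^sub>R p + t *\<^sub>R v \<in> C" if "t \<in> {0..1}" for t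
    using that p v convex_C Di_sub D_sub unfolding convex_def by auto
  have "0 \<in> S" using p Di_sub by (auto simp: S_def)
  have bdd: "bdd_above S" by (auto simp: S_def intro!: bdd_aboveI[of _ 1])
  have "closed S" unfolding closed_sequential_limits
  proof (intro allI impI, elim conjE)
    fix x l assume x: "\<forall>n. x n \<in> S" "x \<longlonglongrightarrow> l"
    then have "\<forall>n. x n \<in> {0..1}" by (simp add: S_def)
    then have l: "l \<in> {0..1}" using x closed_atLeastAtMost closed_sequentially by blast
    have "(\<lambda>k. (1 - x k) *\<^sub>R p + x k *\<^sub>R v) \<longlonglongrightarrow> (1 - l) *\<^sub>R p + l *\<^sub>R v"
      using x by (intro tendsto_intros)
    then have "(1 - l) *\<^sub>R p + l *\<^sub>R v \<in> D" by (rule D_closed[OF inC[OF l]]) (use x(1) in \<open>simp add: S_def\<close>)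
    then show "l \<in> S" using l by (simp add: S_def)
  qed
  define t where "t = Sup S"
  have tS: "t \<in> S" unfolding t_def using \<open>0 \<in> S\<close> \<open>closed S\<close> bdd by (intro closed_contains_Sup) auto
  then have t01: "0 \<le> t" "t \<le> 1" by (auto simp: S_def)
  have "t \<noteq> 1" using tS v by (auto simp: S_def)
  define q where "q = (1 - t) *\<^sub>R p + t *\<^sub>R v"
  have qD: "q \<in> D" using tS by (simp add: S_def q_def)
  have "q \<notin> Di"
  proof
    assume "q \<in> Di"
    moreover have "((\<lambda>s. (1 - s) *\<^sub>R p + s *\<^sub>R v) \<longlongrightarrow> q) (at_right t)" unfolding q_def by (intro tendsto_intros)
    ultimately have "\<forall>\<^sub>F s in at_right t. (1 - s) *\<^sub>R p + s *\<^sub>R v \<in> Di"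
      using topological_tendstoD[OF _ open_Di] by blast
    moreover have "\<forall>\<^sub>F s in at_right t. s \<in> {t<..<1}"
      using \<open>t \<noteq> 1\<close> t01 by (intro eventually_at_right_real) auto
    ultimately have "\<forall>\<^sub>F s in at_right t. s \<in> {t<..<1} \<and> (1 - s) *\<^sub>R p + s *\<^sub>R v \<in> Di" by eventually_elim auto
    then obtain s where "s \<in> {t<..<1}" "(1 - s) *\<^sub>R p + s *\<^sub>R v \<in> Di"
      using eventually_happens trivial_limit_at_right_real by blast
    then have "s \<in> S" "s > t" using t01 Di_sub by (auto simp: S_def)
    then show False using cSup_upper[OF _ bdd] by (force simp: t_def)
  qed
  then obtain L where L: "L \<in> BG" "pt q \<in> L" using boundary_point qD by blast
  then have 0: "wf L \<bullet> q = 0" using mem_L qD D_sub by blast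
  have pos: "wf L \<bullet> p > 0" using Di_wall p L by blast
  have "(1 - t) * (wf L \<bullet> p) + t * (wf L \<bullet> v) = 0" using 0 by (simp add: q_def inner_add_right)
  moreover have "(1 - t) * (wf L \<bullet> p) > 0" using pos t01 \<open>t \<noteq> 1\<close> by simp
  ultimately have "t * (wf L \<bullet> v) < 0" by linarith
  then have "wf L \<bullet> v < 0" using t01 by (auto simp: mult_less_0_iff)
  then show ?thesis using L by blast
qed

lemma D_iff: "v \<in> D \<longleftrightarrow> v \<in> C \<and> (\<forall>L\<in>BG. wf L \<bullet> v \<ge> 0)"
proof
  assume "v \<in> C \<and> (\<forall>L\<in>BG. wf L \<bullet> v \<ge> 0)"
  then show "v \<in> D" using not_D_wall by force
qed (use D_sub D_wall in blast)

text \<open>The geodesic \<open>L\<close> lies in \<open>D\<close>, so the wall of \<open>M\<close>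
  is nonnegative along \<open>L\<close>. Touching zero at an inner point, it vanishes on the plane
  of \<open>L\<close>.\<close>

lemma BG_disjoint:
  assumes LM: "L \<in> BG" "M \<in> BG" and p: "p \<in> C" "wf L \<bullet> p = 0" "wf M \<bullet> p = 0"
  shows "L = M"
proof -
  have nz: "wf L \<noteq> 0" "wf M \<noteq> 0" "L = cut (wf L)" "M = cut (wf M)"
    using wall_wf LM by (auto simp: wall_def)
  have "wf M \<bullet> v \<ge> 0" if "v \<in> C" "wf L \<bullet> v = 0" for v
    using that L_sub_D LM D_wall by blast
  then obtain c where c: "wf M = c *\<^sub>R wf L" using cut_cong_iff[OF nz(1) p(1,2)] p(3) by blast
  then have "c \<noteq> 0" using nz by auto
  then have "cut (wf M) = cut (wf L)" by (simp add: c cut_def)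
  then show ?thesis using nz by simp
qed

lemma lift_D:
  assumes a: "a \<in> \<Delta>" and A: "lifts C a A"
  shows "A *v v \<in> D \<longleftrightarrow> v \<in> D"
proof
  assume v: "v \<in> D"
  then have "v \<in> C" "pt v \<in> Ft" by (simp_all add: D_def)
  then have "v \<in> C" "v \<noteq> 0" "a (pt v) \<in> Ft" using Ft_inv[OF a] C_nonzero by blast+
  then show "A *v v \<in> D" by (simp add: D_def lift_C[OF A] flip: lift_pt[OF A])
next
  assume "A *v v \<in> D"
  then have "v \<in> C" "pt (A *v v) \<in> Ft" by (simp_all add: D_def lift_C[OF A])
  then have v: "v \<in> C" "a (pt v) \<in> Ft" using lift_pt[OF A, of v] C_nonzero by auto
  then have "a (pt v) \<in> a ` Ft" using Ft_inv[OF a] by simp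
  then obtain q where "q \<in> Ft" "a (pt v) = a q" by blast
  then have "q = pt v" using lift_inj_map[OF A, of q "pt v"] v Ft_sub by auto
  then show "v \<in> D" using \<open>q \<in> Ft\<close> v by (simp add: D_def)
qed

lemma lift_Di:
  assumes a: "a \<in> \<Delta>" and A: "lifts C a A"
  shows "A *v v \<in> Di \<longleftrightarrow> v \<in> Di"
proof
  assume v: "v \<in> Di"
  have "(*v) A ` Di = (*v) (matrix_inv A) -` Di"
    using matrix_inv_mult_vec[OF lift_invertible[OF A]] by (auto simp: image_iff) metis
  moreover have "open ((*v) (matrix_inv A) -` Di)"
    using open_Di by (intro open_vimage) (auto intro: matrix_vector_mult_linear_continuous_on)
  ultimately have "open ((*v) A ` Di)" by simp
  moreover have "(*v) A ` Di \<subseteq> D" using Di_sub lift_D[OF a A] by blast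
  ultimately show "A *v v \<in> Di" using v by (intro DiI[of "(*v) A ` Di"]) auto
next
  assume v: "A *v v \<in> Di"
  have "open ((*v) A -` Di)"
    using open_Di by (intro open_vimage) (auto intro: matrix_vector_mult_linear_continuous_on)
  then show "v \<in> Di" using v Di_sub lift_D[OF a A] by (intro DiI[of "(*v) A -` Di"]) auto
qed

lemma BG_image:
  assumes a: "a \<in> \<Delta>" and L: "L \<in> BG"
  shows "a ` L \<in> BG"
proof -
  obtain A where A: "lifts C a A" using ex_lift a by blast
  obtain \<phi> where \<phi>: "\<phi> \<noteq> 0" "L = cut \<phi>" "\<exists>v\<in>C. \<phi> \<bullet> v = 0" "\<And>v. v \<in> C \<Longrightarrow> \<phi> \<bullet> v = 0 \<Longrightarrow> v \<in> D \<and> v \<notin> Di"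
    using BG_E[OF L] by metis
  define \<psi> where "\<psi> = transpose (matrix_inv A) *v \<phi>"
  have psi: "\<psi> \<bullet> (A *v v) = \<phi> \<bullet> v" for v
    unfolding \<psi>_def transpose_inner by (simp add: matrix_inv_mult_vec[OF lift_invertible[OF A]])
  have "\<psi> \<noteq> 0" using \<phi> lift_covector_nonzero[OF A] by (simp add: \<psi>_def)
  moreover have "a ` L = cut \<psi>" using \<phi> lift_cut[OF A] by (simp add: \<psi>_def)
  moreover obtain v where "v \<in> C" "\<phi> \<bullet> v = 0" using \<phi> by blast
  then have "\<exists>v\<in>C. \<psi> \<bullet> v = 0" using psi lift_C[OF A] by metis
  moreover have "w \<in> D \<and> w \<notin> Di" if "w \<in> C" "\<psi> \<bullet> w = 0" for w
  proof -
    define v where "v = matrix_inv A *v w"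
    have w: "w = A *v v" by (simp add: v_def matrix_inv_mult_vec[OF lift_invertible[OF A]])
    then have "v \<in> C" "\<phi> \<bullet> v = 0" using that psi lift_C[OF A] by auto
    then show ?thesis using \<phi>(4) w lift_D[OF a A] lift_Di[OF a A] by blast
  qed
  ultimately show ?thesis using BG_iff by blast
qed

end

section \<open>Boundary geodesics and their eigenbases\<close>

lemma vec3_expansion: "(y :: real^3) = (y $ 1) *\<^sub>R axis 1 1 + (y $ 2) *\<^sub>R axis 2 1 + (y $ 3) *\<^sub>R axis 3 1"
  by (simp add: vec_eq_iff forall_3 axis_def)

text \<open>The matrix \<open>M\<close> maps every vector to a multiple of itself. Comparing the
  factors at two basis vectors and at their sum shows that they are all equal.\<close>

lemma proj_map_eqD:
  assumes A: "invertible A" and B: "invertible B" and eq: "proj_map A = proj_map B"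
  shows "\<exists>c. A = c *\<^sub>R B"
proof -
  define M where "M = matrix_inv B ** A"
  have BM: "B *v (M *v v) = A *v v" for v
    by (simp add: M_def matrix_inv_mult_vec[OF B] flip: matrix_vector_mul_assoc)
  have ex: "\<exists>c. M *v v = c *\<^sub>R v" if v: "v \<noteq> 0" for v
  proof -
    have "pt (A *v v) = pt (B *v v)" using eq proj_map_pt[OF A v] proj_map_pt[OF B v] by simp
    then obtain c where "A *v v = c *\<^sub>R (B *v v)"
      using pt_eq_iff invertible_mult_eq_0 A B v by blast
    then have "M *v v = c *\<^sub>R (matrix_inv B *v (B *v v))"
      by (simp add: M_def flip: matrix_vector_mul_assoc matrix_vector_mult_scaleR)
    then show ?thesis by (auto simp: matrix_inv_mult_vec[OF B])
  qed
  define e where "e i = (axis i 1 :: real^3)" for i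
  have enz: "e i \<noteq> 0" "e i + e j \<noteq> 0" for i j
    by (auto simp: e_def vec_eq_iff axis_def)
  obtain c where c: "\<And>i. M *v e i = c i *\<^sub>R e i" using ex[OF enz(1)] by metis
  have "c i = c j" for i j
  proof (cases "i = j")
    case False
    obtain d where "M *v (e i + e j) = d *\<^sub>R (e i + e j)" using ex[OF enz(2)] by blast
    then have "c i *\<^sub>R e i + c j *\<^sub>R e j = d *\<^sub>R e i + d *\<^sub>R e j"
      by (simp add: matrix_vector_right_distrib c scaleR_add_right)
    then have "(c i *\<^sub>R e i + c j *\<^sub>R e j) $ k = (d *\<^sub>R e i + d *\<^sub>R e j) $ k" for k by simp
    from this[of i] this[of j] show ?thesis using False by (simp add: e_def axis_def)
  qed simp
  then have M: "M *v e i = c 1 *\<^sub>R e i" for i using c by metis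
  have "A *v v = (c 1 *\<^sub>R B) *v v" for v
  proof -
    have "M *v v = M *v ((v $ 1) *\<^sub>R e 1 + (v $ 2) *\<^sub>R e 2 + (v $ 3) *\<^sub>R e 3)"
      using vec3_expansion[of v] by (simp add: e_def)
    also have "\<dots> = c 1 *\<^sub>R ((v $ 1) *\<^sub>R e 1 + (v $ 2) *\<^sub>R e 2 + (v $ 3) *\<^sub>R e 3)"
      by (simp add: matrix_vector_right_distrib matrix_vector_mult_scaleR M scaleR_add_right mult.commute)
    also have "\<dots> = c 1 *\<^sub>R v" using vec3_expansion[of v] by (simp add: e_def)
    finally have "A *v v = B *v (c 1 *\<^sub>R v)" using BM[of v] by simp
    then show ?thesis by (simp add: matrix_vector_mult_scaleR scaleR_matrix_vector_assoc)
  qed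
  then have "A = c 1 *\<^sub>R B" by (simp add: matrix_eq)
  then show ?thesis by blast
qed

lemma diag3_axis: "diag3 x y z *v axis 1 1 = x *\<^sub>R axis 1 1" "diag3 x y z *v axis 2 1 = y *\<^sub>R axis 2 1"
  "diag3 x y z *v axis 3 1 = z *\<^sub>R axis 3 1"
  by (simp_all add: vec_eq_iff forall_3 matrix_vector_mult_def sum_3 diag3_def axis_def)

lemma det_diag3: "det (diag3 x y z) = x * y * z"
  by (simp add: det_3 diag3_def)

lemma ratio_power_tendsto_0:
  fixes x y :: real
  assumes "0 < x" "x < y"
  shows "(\<lambda>n. (x / y) ^ n) \<longlonglongrightarrow> 0"
  by (rule LIMSEQ_power_zero) (use assms in simp)

text \<open>Eigencoordinates adapted to a boundary geodesic. Two normalisations fix the signs that a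
  projective eigenbasis leaves open: \<open>b1\<close> and \<open>b3\<close> lie in the closure of
  the chosen half-cone, and \<open>f2\<close> is the wall of \<open>L\<close>, so that
  \<open>b2\<close> points to the side of the surface.\<close>

locale framed = surface C Ft \<Delta> for C Ft \<Delta> +
  fixes L :: "rp2 set" and a :: "rp2 \<Rightarrow> rp2" and A :: "real^3^3"
    and b1 b2 b3 f1 f2 f3 :: "real^3" and l1 l2 l3 :: real
  assumes L: "L \<in> BG" and a: "a \<in> \<Delta>" "a \<noteq> id" "a ` L = L" and A: "lifts C a A"
    and eig: "A *v b1 = l1 *\<^sub>R b1" "A *v b2 = l2 *\<^sub>R b2" "A *v b3 = l3 *\<^sub>R b3"
    and l: "l1 > l2" "l2 > l3" "l3 > 0"
    and b: "b1 \<in> bd" "b3 \<in> bd"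
    and dual: "f1 \<bullet> b1 = 1" "f1 \<bullet> b2 = 0" "f1 \<bullet> b3 = 0" "f2 \<bullet> b1 = 0" "f2 \<bullet> b2 = 1" "f2 \<bullet> b3 = 0"
      "f3 \<bullet> b1 = 0" "f3 \<bullet> b2 = 0" "f3 \<bullet> b3 = 1"
    and expand: "\<And>v. v = (f1 \<bullet> v) *\<^sub>R b1 + (f2 \<bullet> v) *\<^sub>R b2 + (f3 \<bullet> v) *\<^sub>R b3"
    and f2: "f2 = wf L"
    and ar: "attracting a = pt b1" "repelling a = pt b3"

context surface
begin

text \<open>A vector \<open>v\<close> of \<open>C\<close> over \<open>L\<close> has nonzero
  coordinates along both extreme eigenvectors, since otherwise \<open>a\<close> would fix an
  interior point. These coordinates are absorbed into \<open>b1\<close> and \<open>b3\<close>, which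
  are then limits of rescaled forward and backward images of \<open>v\<close>, and which are not
  interior because \<open>a\<close> fixes their classes.\<close>

lemma ex_frame:
  assumes L: "L \<in> BG" and a: "a \<in> \<Delta>" "a \<noteq> id" "a ` L = L"
  shows "\<exists>A b1 b2 b3 f1 f2 f3 l1 l2 l3. framed C Ft \<Delta> L a A b1 b2 b3 f1 f2 f3 l1 l2 l3"
proof -
  have st: "\<exists>B. diagonalizes B a" "L = axis_of \<Omega> a" using stabilizer[OF L a] by auto
  define E where "E = eigenbasis a"
  have "diagonalizes E a" unfolding E_def eigenbasis_def using st(1) by (rule someI_ex)
  then obtain x y z where E: "invertible E" and xyz: "x > y" "y > z" "z > 0"
    and aM: "a = proj_map (E ** diag3 x y z ** matrix_inv E)" unfolding diagonalizes_def by blast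
  define M where "M = E ** diag3 x y z ** matrix_inv E"
  define e where "e i = E *v axis i 1" for i
  have inv_e: "matrix_inv E *v e i = axis i 1" for i
    by (simp add: e_def matrix_inv_mult_vec[OF E])
  have Me: "M *v e 1 = x *\<^sub>R e 1" "M *v e 2 = y *\<^sub>R e 2" "M *v e 3 = z *\<^sub>R e 3"
    by (simp_all add: M_def inv_e diag3_axis flip: matrix_vector_mul_assoc)
       (simp_all add: e_def matrix_vector_mult_scaleR)
  define h where "h i = matrix_inv E $ i" for i
  have hv: "h i \<bullet> v = (matrix_inv E *v v) $ i" for i v
    by (simp add: h_def matrix_vector_mul_component)
  have he: "h i \<bullet> e j = (if i = j then 1 else 0)" for i j
    by (simp add: hv inv_e axis_def)
  have hexp: "v = (h 1 \<bullet> v) *\<^sub>R e 1 + (h 2 \<bullet> v) *\<^sub>R e 2 + (h 3 \<bullet> v) *\<^sub>R e 3" for v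
  proof -
    have "v = E *v (matrix_inv E *v v)" by (simp add: matrix_inv_mult_vec[OF E])
    also have "\<dots> = E *v ((h 1 \<bullet> v) *\<^sub>R axis 1 1 + (h 2 \<bullet> v) *\<^sub>R axis 2 1 + (h 3 \<bullet> v) *\<^sub>R axis 3 1)"
      unfolding hv by (subst vec3_expansion[symmetric]) simp
    finally show ?thesis by (simp add: e_def matrix_vector_right_distrib matrix_vector_mult_scaleR)
  qed
  have enz: "e i \<noteq> 0" for i using he[of i i] by auto
  have ene: "pt (e 1) \<noteq> pt (e 3)"
  proof
    assume "pt (e 1) = pt (e 3)"
    then obtain c where "e 1 = c *\<^sub>R e 3" using enz pt_eq_iff by blast
    then have "h 1 \<bullet> e 1 = c * (h 1 \<bullet> e 3)" by simp
    then show False by (simp add: he)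
  qed
  obtain A where A: "lifts C a A" using ex_lift a by blast
  have invA: "invertible A" by (rule lift_invertible[OF A])
  have "A *v v \<noteq> 0 \<longleftrightarrow> v \<noteq> 0" for v using invertible_mult_eq_0[OF invA] by blast
  have invM: "invertible M"
  proof -
    have "det M = det E * (x * y * z) * det (matrix_inv E)"
      by (simp add: M_def det_mul det_diag3)
    moreover have "det E * det (matrix_inv E) = 1"
    proof -
      have "E ** matrix_inv E = mat 1"
        by (simp add: matrix_eq matrix_inv_mult_vec[OF E] flip: matrix_vector_mul_assoc)
      then have "det (E ** matrix_inv E) = 1" by simp
      then show ?thesis by (simp add: det_mul)
    qed
    then have "det E \<noteq> 0" "det (matrix_inv E) \<noteq> 0" by auto
    ultimately show ?thesis using xyz by (simp add: invertible_det_nz)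
  qed
  obtain c where c: "A = c *\<^sub>R M" using proj_map_eqD[OF invA invM] A aM by (auto simp: lifts_def M_def)
  have Av: "A *v v = c *\<^sub>R (M *v v)" for v by (simp add: c scaleR_matrix_vector_assoc)
  have cnz: "c \<noteq> 0" using invA c by (auto simp: invertible_det_nz det_3)
  have fixed: "v \<notin> C" if "M *v v = r *\<^sub>R v" "r \<noteq> 0" for v r
  proof
    assume v: "v \<in> C"
    then have "a (pt v) = pt v" using lift_pt[OF A C_nonzero[OF v]] that cnz by (simp add: Av)
    then show False using free[OF a(1)] v a(2) by blast
  qed
  have mem: "w \<in> C \<Longrightarrow> pt w \<in> L \<longleftrightarrow> (\<exists>p q. w = p *\<^sub>R e 1 + q *\<^sub>R e 3)" for w
    using mem_line_through[OF enz enz C_nonzero, of w 1 3]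
    by (auto simp: st(2) axis_of_def attracting_def repelling_def e_def E_def)
  obtain \<phi> where "L = cut \<phi>" "\<exists>v\<in>C. \<phi> \<bullet> v = 0" using BG_E[OF L] by metis
  then obtain v where v: "v \<in> C" "pt v \<in> L" using pt_in_cut by blast
  then obtain p q where pq: "v = p *\<^sub>R e 1 + q *\<^sub>R e 3" using mem by blast
  have Mlin: "M *v (p *\<^sub>R e 1 + q *\<^sub>R e 3) = (x * p) *\<^sub>R e 1 + (z * q) *\<^sub>R e 3" for p q
    by (simp add: matrix_vector_right_distrib matrix_vector_mult_scaleR Me mult.commute)
  have p: "p \<noteq> 0"
  proof
    assume "p = 0"
    then have "M *v v = z *\<^sub>R v" using pq Mlin[of p q] by simp
    then show False using fixed[of v z] v xyz by simp
  qed
  have q: "q \<noteq> 0"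
  proof
    assume "q = 0"
    then have "M *v v = x *\<^sub>R v" using pq Mlin[of p q] by simp
    then show False using fixed[of v x] v xyz by simp
  qed
  \<comment> \<open>If \<open>c\<close> were negative, \<open>v\<close> and its image, both in
    \<open>C\<close>, would have opposite coordinates along \<open>e 1\<close>. The positive
    combination cancelling them (hence the choice of \<open>t\<close>) is a multiple of
    \<open>e 3\<close> in \<open>C\<close>, a fixed point of \<open>a\<close>.\<close>
  have cpos: "c > 0"
  proof (rule ccontr)
    assume "\<not> c > 0"
    then have c0: "c < 0" using cnz by simp
    define t where "t = - 1 / (c * x)"
    have "c * x < 0" using c0 xyz by (simp add: mult_neg_pos)
    then have t: "t > 0" by (simp add: t_def divide_neg_neg)
    have "v + t *\<^sub>R (A *v v) \<in> C" using v t lift_C[OF A] by (intro C_add scale_C) auto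
    moreover have "v + t *\<^sub>R (A *v v) = (p + t * (c * x) * p) *\<^sub>R e 1 + (q + t * c * z * q) *\<^sub>R e 3"
      unfolding Av pq Mlin by (simp add: algebra_simps)
    moreover have "p + t * (c * x) * p = 0" using \<open>c * x < 0\<close> cnz xyz by (simp add: t_def)
    ultimately have "(q + t * c * z * q) *\<^sub>R e 3 \<in> C" by simp
    then show False using fixed[of "(q + t * c * z * q) *\<^sub>R e 3" z] xyz
      by (simp add: matrix_vector_mult_scaleR Me mult.commute)
  qed
  have Ml: "lifts C a M"
  proof -
    have "M = (1/c) *\<^sub>R A" using c cnz by simp
    then show ?thesis using lifts_scale[OF A, of "1/c"] cpos by simp
  qed
  define b1 b3 where "b1 = p *\<^sub>R e 1" and "b3 = q *\<^sub>R e 3"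
  define \<rho> where "\<rho> = z / x"
  have \<rho>: "0 < \<rho>" "\<rho> < 1" using xyz by (auto simp: \<rho>_def)
  have Mb: "M *v (r *\<^sub>R b1 + s *\<^sub>R b3) = (x * r) *\<^sub>R b1 + (z * s) *\<^sub>R b3" for r s
    using Mlin[of "r * p" "s * q"] by (simp add: b1_def b3_def mult.assoc)
  \<comment> \<open>These are the forward images of \<open>v\<close> divided by powers of
    \<open>x\<close>; the backward images multiplied by powers of \<open>z\<close> are treated
    next.\<close>
  have u: "1 *\<^sub>R b1 + \<rho> ^ n *\<^sub>R b3 \<in> C" for n
  proof (induction n)
    case 0 show ?case using v pq by (simp add: b1_def b3_def)
  next
    case (Suc n)
    then have "M *v (1 *\<^sub>R b1 + \<rho> ^ n *\<^sub>R b3) \<in> C" using lift_C[OF Ml] by blast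
    then have "(1/x) *\<^sub>R (M *v (1 *\<^sub>R b1 + \<rho> ^ n *\<^sub>R b3)) \<in> C" using xyz by (intro scale_C) auto
    then show ?case unfolding Mb using xyz by (simp add: scaleR_add_right \<rho>_def)
  qed
  have w: "\<rho> ^ n *\<^sub>R b1 + 1 *\<^sub>R b3 \<in> C" for n
  proof (induction n)
    case 0 show ?case using v pq by (simp add: b1_def b3_def)
  next
    case (Suc n)
    then have "z *\<^sub>R (\<rho> ^ n *\<^sub>R b1 + 1 *\<^sub>R b3) \<in> C" using xyz by (intro scale_C) auto
    moreover have "M *v (\<rho> ^ Suc n *\<^sub>R b1 + 1 *\<^sub>R b3) = z *\<^sub>R (\<rho> ^ n *\<^sub>R b1 + 1 *\<^sub>R b3)"
      unfolding Mb using xyz by (simp add: scaleR_add_right \<rho>_def)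
    ultimately show ?case using lift_C[OF Ml] by metis
  qed
  have lim: "(\<lambda>n. \<rho> ^ n) \<longlonglongrightarrow> 0" using \<rho> by (intro LIMSEQ_power_zero) auto
  have "(\<lambda>n. 1 *\<^sub>R b1 + \<rho> ^ n *\<^sub>R b3) \<longlonglongrightarrow> 1 *\<^sub>R b1 + 0 *\<^sub>R b3" using lim by (intro tendsto_add tendsto_scaleR tendsto_mult tendsto_const)
  then have "1 *\<^sub>R b1 + 0 *\<^sub>R b3 \<in> closure C" unfolding closure_sequential using u
    by (intro exI[of _ "\<lambda>n. 1 *\<^sub>R b1 + \<rho> ^ n *\<^sub>R b3"]) blast
  moreover have "(\<lambda>n. \<rho> ^ n *\<^sub>R b1 + 1 *\<^sub>R b3) \<longlonglongrightarrow> 0 *\<^sub>R b1 + 1 *\<^sub>R b3" using lim by (intro tendsto_add tendsto_scaleR tendsto_mult tendsto_const)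
  then have "0 *\<^sub>R b1 + 1 *\<^sub>R b3 \<in> closure C" unfolding closure_sequential using w
    by (intro exI[of _ "\<lambda>n. \<rho> ^ n *\<^sub>R b1 + 1 *\<^sub>R b3"]) blast
  moreover have "b1 \<notin> C" "b3 \<notin> C"
    using fixed[of b1 x] fixed[of b3 z] Mb[of 1 0] Mb[of 0 1] xyz by auto
  moreover have "b1 \<noteq> 0" "b3 \<noteq> 0" using p q enz by (auto simp: b1_def b3_def)
  ultimately have bbd: "b1 \<in> bd" "b3 \<in> bd" by (auto simp: bd_def)
  have ptb: "pt b1 = pt (e 1)" "pt b3 = pt (e 3)" using p q by (auto simp: b1_def b3_def)
  define \<phi> where "\<phi> = wf L"
  have phi0: "\<phi> \<bullet> (r *\<^sub>R b1 + 1 *\<^sub>R b3) = 0" if "r > 0" for r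
  proof -
    have "r *\<^sub>R b1 + 1 *\<^sub>R b3 \<in> C" using bbd bdD ene ptb that by (intro C_pos_comb) auto
    moreover have "\<exists>p' q'. r *\<^sub>R b1 + 1 *\<^sub>R b3 = p' *\<^sub>R e 1 + q' *\<^sub>R e 3"
      by (rule exI[of _ "r * p"], rule exI[of _ q]) (simp add: b1_def b3_def)
    ultimately have "r *\<^sub>R b1 + 1 *\<^sub>R b3 \<in> C" "pt (r *\<^sub>R b1 + 1 *\<^sub>R b3) \<in> L" using mem by auto
    then show ?thesis using mem_L[OF _ L] by (simp add: \<phi>_def)
  qed
  have phi: "\<phi> \<bullet> b1 = 0" "\<phi> \<bullet> b3 = 0" using phi0[of 1] phi0[of 2] by (auto simp: inner_add_right)
  have phiv: "\<phi> \<bullet> v = (h 2 \<bullet> v) * (\<phi> \<bullet> e 2)" for v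
  proof -
    have "\<phi> \<bullet> e 1 = 0" "\<phi> \<bullet> e 3 = 0" using phi p q by (auto simp: b1_def b3_def)
    then have "\<phi> \<bullet> ((h 1 \<bullet> v) *\<^sub>R e 1 + (h 2 \<bullet> v) *\<^sub>R e 2 + (h 3 \<bullet> v) *\<^sub>R e 3) = (h 2 \<bullet> v) * (\<phi> \<bullet> e 2)"
      by (simp add: inner_add_right)
    then show ?thesis by (simp flip: hexp)
  qed
  have phi2: "\<phi> \<bullet> e 2 \<noteq> 0"
  proof
    assume "\<phi> \<bullet> e 2 = 0"
    then have "\<phi> \<bullet> \<phi> = 0" using phiv[of \<phi>] by simp
    then show False using wall_wf[OF L] by (simp add: \<phi>_def wall_def)
  qed
  define b2 where "b2 = (1 / (\<phi> \<bullet> e 2)) *\<^sub>R e 2"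
  have "framed C Ft \<Delta> L a M b1 b2 b3 ((1/p) *\<^sub>R h 1) \<phi> ((1/q) *\<^sub>R h 3) x y z"
  proof (unfold_locales; (fact L a Ml xyz bbd)?)
    show "M *v b1 = x *\<^sub>R b1" "M *v b2 = y *\<^sub>R b2" "M *v b3 = z *\<^sub>R b3"
      by (simp_all add: b1_def b2_def b3_def matrix_vector_mult_scaleR Me mult.commute)
    show "(1 / p) *\<^sub>R h 1 \<bullet> b1 = 1" "(1 / p) *\<^sub>R h 1 \<bullet> b2 = 0" "(1 / p) *\<^sub>R h 1 \<bullet> b3 = 0"
      "\<phi> \<bullet> b1 = 0" "\<phi> \<bullet> b2 = 1" "\<phi> \<bullet> b3 = 0" 
      "(1 / q) *\<^sub>R h 3 \<bullet> b1 = 0" "(1 / q) *\<^sub>R h 3 \<bullet> b2 = 0" "(1 / q) *\<^sub>R h 3 \<bullet> b3 = 1"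
      using p q phi2 phi by (auto simp: b1_def b2_def b3_def he)
    show "v = ((1 / p) *\<^sub>R h 1 \<bullet> v) *\<^sub>R b1 + (\<phi> \<bullet> v) *\<^sub>R b2 + ((1 / q) *\<^sub>R h 3 \<bullet> v) *\<^sub>R b3" for v
    proof -
      have "((1 / p) *\<^sub>R h 1 \<bullet> v) *\<^sub>R b1 + (\<phi> \<bullet> v) *\<^sub>R b2 + ((1 / q) *\<^sub>R h 3 \<bullet> v) *\<^sub>R b3 =
          (h 1 \<bullet> v) *\<^sub>R e 1 + (h 2 \<bullet> v) *\<^sub>R e 2 + (h 3 \<bullet> v) *\<^sub>R e 3"
        using p q phi2 by (simp add: b1_def b2_def b3_def phiv[of v])
      also have "\<dots> = v" by (rule hexp[symmetric])
      finally show ?thesis by (rule sym)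
    qed
    show "\<phi> = wf L" by (simp add: \<phi>_def)
    show "attracting a = pt b1" "repelling a = pt b3"
      by (simp_all add: ptb attracting_def repelling_def e_def E_def)
  qed
  then show ?thesis by blast
qed

end

context framed
begin

lemma b_nonzero: "b1 \<noteq> 0" "b2 \<noteq> 0" "b3 \<noteq> 0" using dual by auto

lemma f_nonzero: "f1 \<noteq> 0" "f2 \<noteq> 0" "f3 \<noteq> 0" using dual by auto

lemma f_ext: "f1 \<bullet> u = f1 \<bullet> v \<Longrightarrow> f2 \<bullet> u = f2 \<bullet> v \<Longrightarrow> f3 \<bullet> u = f3 \<bullet> v \<Longrightarrow> u = v"
  using expand[of u] expand[of v] by simp

lemma fA: "f1 \<bullet> (A *v v) = l1 * (f1 \<bullet> v)" "f2 \<bullet> (A *v v) = l2 * (f2 \<bullet> v)" "f3 \<bullet> (A *v v) = l3 * (f3 \<bullet> v)"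
proof -
  have "A *v v = A *v ((f1 \<bullet> v) *\<^sub>R b1 + (f2 \<bullet> v) *\<^sub>R b2 + (f3 \<bullet> v) *\<^sub>R b3)" using expand[of v] by simp
  then have *: "A *v v = (f1 \<bullet> v * l1) *\<^sub>R b1 + (f2 \<bullet> v * l2) *\<^sub>R b2 + (f3 \<bullet> v * l3) *\<^sub>R b3"
    by (simp add: matrix_vector_right_distrib matrix_vector_mult_scaleR eig)
  show "f1 \<bullet> (A *v v) = l1 * (f1 \<bullet> v)" "f2 \<bullet> (A *v v) = l2 * (f2 \<bullet> v)" "f3 \<bullet> (A *v v) = l3 * (f3 \<bullet> v)"
    unfolding * by (simp_all add: inner_add_right dual)
qed

lemma lpos: "l1 > 0" "l2 > 0" "l3 > 0" using l by linarith+

text \<open>The iterates of \<open>A\<close> on \<open>v\<close>, divided by \<open>l1^n\<close>,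
  converge to \<open>(f1 . v) b1\<close>, which therefore lies in the closed cone, whereas
  \<open>- b1\<close> does not. For \<open>f3\<close> the same is done with inverse
  iterates.\<close>

lemma f1_nonneg: assumes v: "v \<in> closure C" shows "f1 \<bullet> v \<ge> 0"
proof -
  define x where "x n = (f1 \<bullet> v) *\<^sub>R b1 + ((l2 / l1) ^ n * (f2 \<bullet> v)) *\<^sub>R b2 + ((l3 / l1) ^ n * (f3 \<bullet> v)) *\<^sub>R b3" for n
  have xC: "x n \<in> closure C" for n
  proof (induction n)
    case 0 show ?case using v expand[of v] by (simp add: x_def)
  next
    case (Suc n)
    then have "(1/l1) *\<^sub>R (A *v x n) \<in> closure C" using lpos lift_closure[OF A] by (intro closure_scale) auto
    moreover have "(1/l1) *\<^sub>R (A *v x n) = x (Suc n)" using lpos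
      by (simp add: x_def matrix_vector_right_distrib matrix_vector_mult_scaleR eig scaleR_add_right field_simps)
    ultimately show ?case by simp
  qed
  have "(\<lambda>n. (l2 / l1) ^ n) \<longlonglongrightarrow> 0" "(\<lambda>n. (l3 / l1) ^ n) \<longlonglongrightarrow> 0"
    using l lpos by (auto intro!: ratio_power_tendsto_0)
  then have "x \<longlonglongrightarrow> (f1 \<bullet> v) *\<^sub>R b1 + (0 * (f2 \<bullet> v)) *\<^sub>R b2 + (0 * (f3 \<bullet> v)) *\<^sub>R b3"
    unfolding x_def[abs_def] by (intro tendsto_add tendsto_scaleR tendsto_mult tendsto_const)
  then have *: "(f1 \<bullet> v) *\<^sub>R b1 \<in> closure C" using closed_sequentially[OF closed_closure, of x C] xC by simp
  show ?thesis
  proof (rule ccontr)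
    assume neg: "\<not> ?thesis"
    then have "(- (1 / (f1 \<bullet> v))) *\<^sub>R ((f1 \<bullet> v) *\<^sub>R b1) \<in> closure C" using closure_scale[OF *, of "- (1 / (f1 \<bullet> v))"] by auto
    then have "- b1 \<in> closure C" using neg by simp
    then show False using minus_notin_closure b bdD by blast
  qed
qed

lemma f3_nonneg: assumes v: "v \<in> closure C" shows "f3 \<bullet> v \<ge> 0"
proof -
  define x where "x n = ((l3 / l1) ^ n * (f1 \<bullet> v)) *\<^sub>R b1 + ((l3 / l2) ^ n * (f2 \<bullet> v)) *\<^sub>R b2 + (f3 \<bullet> v) *\<^sub>R b3" for n
  have xC: "x n \<in> closure C" for n
  proof (induction n)
    case 0 show ?case using v expand[of v] by (simp add: x_def)
  next
    case (Suc n)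
    then have "l3 *\<^sub>R x n \<in> closure C" using lpos by (intro closure_scale) auto
    moreover have "l3 *\<^sub>R x n = A *v x (Suc n)" using lpos
      by (simp add: x_def matrix_vector_right_distrib matrix_vector_mult_scaleR eig scaleR_add_right field_simps)
    ultimately show ?case using lift_closure[OF A] by simp
  qed
  have "(\<lambda>n. (l3 / l1) ^ n) \<longlonglongrightarrow> 0" "(\<lambda>n. (l3 / l2) ^ n) \<longlonglongrightarrow> 0"
    using l lpos by (auto intro!: ratio_power_tendsto_0)
  then have "x \<longlonglongrightarrow> (0 * (f1 \<bullet> v)) *\<^sub>R b1 + (0 * (f2 \<bullet> v)) *\<^sub>R b2 + (f3 \<bullet> v) *\<^sub>R b3"
    unfolding x_def[abs_def] by (intro tendsto_add tendsto_scaleR tendsto_mult tendsto_const)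
  then have *: "(f3 \<bullet> v) *\<^sub>R b3 \<in> closure C" using closed_sequentially[OF closed_closure, of x C] xC by simp
  show ?thesis
  proof (rule ccontr)
    assume neg: "\<not> ?thesis"
    then have "(- (1 / (f3 \<bullet> v))) *\<^sub>R ((f3 \<bullet> v) *\<^sub>R b3) \<in> closure C" using closure_scale[OF *, of "- (1 / (f3 \<bullet> v))"] by auto
    then have "- b3 \<in> closure C" using neg by simp
    then show False using minus_notin_closure b bdD by blast
  qed
qed

lemma f1_pos: "v \<in> closure C \<Longrightarrow> v \<noteq> 0 \<Longrightarrow> pt v \<noteq> pt b3 \<Longrightarrow> f1 \<bullet> v > 0"
  using functional_zero_unique[of f1 b3 v] f1_nonneg C_sub_closure f_nonzero b bdD dual by blast

lemma f3_pos: "v \<in> closure C \<Longrightarrow> v \<noteq> 0 \<Longrightarrow> pt v \<noteq> pt b1 \<Longrightarrow> f3 \<bullet> v > 0"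
  using functional_zero_unique[of f3 b1 v] f3_nonneg C_sub_closure f_nonzero b bdD dual by blast

lemma f_pos_C: "v \<in> C \<Longrightarrow> f1 \<bullet> v > 0" "v \<in> C \<Longrightarrow> f3 \<bullet> v > 0"
  using functional_pos[of f1 v] functional_pos[of f3 v] f1_nonneg f3_nonneg C_sub_closure f_nonzero by auto

lemma pt_b_distinct: "pt b1 \<noteq> pt b2" "pt b1 \<noteq> pt b3" "pt b2 \<noteq> pt b3"
proof -
  have *: "pt u \<noteq> pt v" if "v \<noteq> 0" "f \<bullet> u = 1" "f \<bullet> v = 0" for u v f :: "real^3"
  proof
    assume "pt u = pt v"
    moreover have "u \<noteq> 0" using that by auto
    ultimately obtain c where "u = c *\<^sub>R v" using \<open>v \<noteq> 0\<close> pt_eq_iff by blast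
    then show False using that by simp
  qed
  show "pt b1 \<noteq> pt b2" "pt b1 \<noteq> pt b3" "pt b2 \<noteq> pt b3"
    using *[of b2 f1 b1] *[of b3 f1 b1] *[of b3 f2 b2] dual b_nonzero by auto
qed

lemma b2_notin: "b2 \<notin> closure C" "- b2 \<notin> closure C"
  using f1_pos[of b2] f1_pos[of "- b2"] b_nonzero dual pt_b_distinct by auto

lemma axis_C: "r > 0 \<Longrightarrow> s > 0 \<Longrightarrow> r *\<^sub>R b1 + s *\<^sub>R b3 \<in> C"
  using C_pos_comb[of b1 b3 r s] b bdD pt_b_distinct by auto

lemma f2_nonneg: "v \<in> D \<Longrightarrow> f2 \<bullet> v \<ge> 0" and f2_pos: "v \<in> Di \<Longrightarrow> f2 \<bullet> v > 0"
  using D_wall Di_wall L f2 by auto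

lemma axis_D: "r > 0 \<Longrightarrow> s > 0 \<Longrightarrow> r *\<^sub>R b1 + s *\<^sub>R b3 \<in> D"
  using L_sub_D[OF axis_C L] dual by (simp add: inner_add_right flip: f2)

lemma mem_L_iff: "v \<in> C \<Longrightarrow> pt v \<in> L \<longleftrightarrow> f2 \<bullet> v = 0"
  using mem_L[OF _ L] f2 by simp

lemma wall_nonneg_ends:
  assumes M: "M \<in> BG"
  shows "wf M \<bullet> b1 \<ge> 0" "wf M \<bullet> b3 \<ge> 0"
proof -
  have *: "wf M \<bullet> b1 + r * (wf M \<bullet> b3) \<ge> 0" "r * (wf M \<bullet> b1) + wf M \<bullet> b3 \<ge> 0" if "r > 0" for r
    using D_wall[OF axis_D[of 1 r] M] D_wall[OF axis_D[of r 1] M] that by (auto simp: inner_add_right)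
  have pos: "x \<ge> 0" if "\<And>r. r > 0 \<Longrightarrow> x + r * y \<ge> 0" for x y :: real
  proof (rule ccontr)
    assume "\<not> x \<ge> 0"
    \<comment> \<open>With this \<open>r\<close>, the product \<open>r * (|y| + 1)\<close> is half
      of \<open>- x\<close>, so \<open>x + r * y\<close> is still negative.\<close>
    define r where "r = - x / (2 * (\<bar>y\<bar> + 1))"
    have "r > 0" using \<open>\<not> x \<ge> 0\<close> by (simp add: r_def divide_neg_pos)
    then have "x + r * y \<le> x + r * (\<bar>y\<bar> + 1)" by (intro add_left_mono mult_left_mono) auto
    also have "\<dots> = x / 2" by (simp add: r_def field_simps)
    finally show False using that[OF \<open>r > 0\<close>] \<open>\<not> x \<ge> 0\<close> by simp
  qed
  show "wf M \<bullet> b1 \<ge> 0" using pos[of "wf M \<bullet> b1" "wf M \<bullet> b3"] * by blast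
  show "wf M \<bullet> b3 \<ge> 0" using pos[of "wf M \<bullet> b3" "wf M \<bullet> b1"] * by (simp add: add.commute)
qed

lemma wall_expand: "wf M \<bullet> v = (f1 \<bullet> v) * (wf M \<bullet> b1) + (f2 \<bullet> v) * (wf M \<bullet> b2) + (f3 \<bullet> v) * (wf M \<bullet> b3)"
proof -
  have "wf M \<bullet> v = wf M \<bullet> ((f1 \<bullet> v) *\<^sub>R b1 + (f2 \<bullet> v) *\<^sub>R b2 + (f3 \<bullet> v) *\<^sub>R b3)" using expand[of v] by simp
  then show ?thesis by (simp add: inner_add_right)
qed

lemma wall_axis_pos:
  assumes M: "M \<in> BG" "M \<noteq> L" and rs: "r > 0" "s > 0"
  shows "wf M \<bullet> (r *\<^sub>R b1 + s *\<^sub>R b3) > 0"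
proof -
  have "wf M \<bullet> (r *\<^sub>R b1 + s *\<^sub>R b3) \<ge> 0" using D_wall axis_D rs M by blast
  moreover have "wf M \<bullet> (r *\<^sub>R b1 + s *\<^sub>R b3) \<noteq> 0"
    using BG_disjoint[OF M(1) L axis_C[OF rs]] M dual by (auto simp: inner_add_right simp flip: f2)
  ultimately show ?thesis by simp
qed

text \<open>Two boundary geodesics have no common endpoint: if \<open>M\<close> ended at \<open>b1\<close>, the orbit \<open>A\<^sup>n v\<close>
  of an interior vector \<open>v\<close> of \<open>D\<close> would approach \<open>b1\<close> in the tangential direction \<open>b2\<close> and
  so leave \<open>D\<close> across \<open>M\<close>.\<close>

lemma wall_middle_neg:
  assumes M: "M \<in> BG" "M \<noteq> L" and "wf M \<bullet> b1 = 0 \<or> wf M \<bullet> b3 = 0"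
  shows "wf M \<bullet> b2 < 0"
proof -
  obtain v where v: "v \<in> C" "wf M \<bullet> v = 0" using wall_wf[OF M(1)] by (auto simp: wall_def)
  have vD: "f2 \<bullet> v \<ge> 0" using L_sub_D[OF v(1) M(1) v(2)] f2_nonneg by blast
  have "(f1 \<bullet> v) * (wf M \<bullet> b1) + (f3 \<bullet> v) * (wf M \<bullet> b3) > 0"
    using wall_axis_pos[OF M, of "f1 \<bullet> v" "f3 \<bullet> v"] f_pos_C[OF v(1)] by (simp add: inner_add_right)
  then have "(f2 \<bullet> v) * (wf M \<bullet> b2) < 0" using v(2) wall_expand[of M v] by linarith
  then show ?thesis using vD by (auto simp: mult_less_0_iff)
qed

lemma wall_ends_pos:
  assumes M: "M \<in> BG" "M \<noteq> L"
  shows "wf M \<bullet> b1 > 0" "wf M \<bullet> b3 > 0"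
proof -
  obtain v where v: "v \<in> Di" using Di_nonempty by blast
  have vC: "v \<in> C" using v Di_sub D_sub by blast
  have iter: "((*v) A ^^ n) v \<in> Di" for n
    by (induction n) (use v lift_Di[OF a(1) A] in auto)
  have fit: "f1 \<bullet> ((*v) A ^^ n) w = l1 ^ n * (f1 \<bullet> w)" "f2 \<bullet> ((*v) A ^^ n) w = l2 ^ n * (f2 \<bullet> w)"
    "f3 \<bullet> ((*v) A ^^ n) w = l3 ^ n * (f3 \<bullet> w)" for n w
    by (induction n) (auto simp: fA)
  show "wf M \<bullet> b1 > 0"
  proof (rule ccontr)
    assume "\<not> ?thesis"
    then have 0: "wf M \<bullet> b1 = 0" using wall_nonneg_ends[OF M(1)] by simp
    then have neg: "wf M \<bullet> b2 < 0" using wall_middle_neg M by blast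
    \<comment> \<open>The dominant \<open>b1\<close> coordinate of the iterates is invisible to
      \<open>M\<close>. After division by \<open>l2^n\<close> only the negative \<open>b2\<close>
      term survives in the limit.\<close>
    have pos: "(f2 \<bullet> v) * (wf M \<bullet> b2) + (l3 / l2) ^ n * ((f3 \<bullet> v) * (wf M \<bullet> b3)) \<ge> 0" for n
    proof -
      have "0 < wf M \<bullet> ((*v) A ^^ n) v" using Di_wall iter M by blast
      also have "\<dots> = l2 ^ n * (f2 \<bullet> v) * (wf M \<bullet> b2) + l3 ^ n * (f3 \<bullet> v) * (wf M \<bullet> b3)"
        unfolding wall_expand[of M "((*v) A ^^ n) v"] fit 0 by simp
      also have "\<dots> = l2 ^ n * ((f2 \<bullet> v) * (wf M \<bullet> b2) + (l3 / l2) ^ n * ((f3 \<bullet> v) * (wf M \<bullet> b3)))"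
        using lpos by (simp add: power_divide algebra_simps)
      finally show ?thesis using lpos by (simp add: zero_less_mult_iff)
    qed
    have "(\<lambda>n. (l3 / l2) ^ n) \<longlonglongrightarrow> 0" using l lpos by (auto intro!: ratio_power_tendsto_0)
    then have "(\<lambda>n. (f2 \<bullet> v) * (wf M \<bullet> b2) + (l3 / l2) ^ n * ((f3 \<bullet> v) * (wf M \<bullet> b3))) \<longlonglongrightarrow>
        (f2 \<bullet> v) * (wf M \<bullet> b2) + 0 * ((f3 \<bullet> v) * (wf M \<bullet> b3))" by (intro tendsto_add tendsto_scaleR tendsto_mult tendsto_const)
    then have "(f2 \<bullet> v) * (wf M \<bullet> b2) \<ge> 0" using pos by (intro LIMSEQ_le_const) auto
    then show False using neg f2_pos[OF v] by (simp add: zero_le_mult_iff)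
  qed
  show "wf M \<bullet> b3 > 0"
  proof (rule ccontr)
    assume "\<not> ?thesis"
    then have 0: "wf M \<bullet> b3 = 0" using wall_nonneg_ends[OF M(1)] by simp
    then have neg: "wf M \<bullet> b2 < 0" using wall_middle_neg M by blast
    have pos: "(l2 / l1) ^ n * ((f1 \<bullet> v) * (wf M \<bullet> b1)) + (f2 \<bullet> v) * (wf M \<bullet> b2) \<ge> 0" for n
    proof -
      \<comment> \<open>This is the image of \<open>v\<close> under the inverse of
        \<open>A^n\<close>, written in eigencoordinates: under inverse iteration \<open>b3\<close>
        dominates instead.\<close>
      define w where "w = (1 / l1 ^ n * (f1 \<bullet> v)) *\<^sub>R b1 + (1 / l2 ^ n * (f2 \<bullet> v)) *\<^sub>R b2 + (1 / l3 ^ n * (f3 \<bullet> v)) *\<^sub>R b3"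
      have fw: "f1 \<bullet> w = f1 \<bullet> v / l1 ^ n" "f2 \<bullet> w = f2 \<bullet> v / l2 ^ n" "f3 \<bullet> w = f3 \<bullet> v / l3 ^ n"
        by (simp_all add: w_def inner_add_right dual)
      have "((*v) A ^^ n) w = v" by (rule f_ext) (use lpos in \<open>simp_all add: fit fw\<close>)
      moreover have "w \<in> Di" if "((*v) A ^^ n) w \<in> Di" for n w
        using that lift_Di[OF a(1) A] by (induction n) auto
      ultimately have "w \<in> Di" using v by metis
      then have "0 < wf M \<bullet> w" using Di_wall M by blast
      also have "\<dots> = (f1 \<bullet> v) / l1 ^ n * (wf M \<bullet> b1) + (f2 \<bullet> v) / l2 ^ n * (wf M \<bullet> b2)"
        unfolding wall_expand[of M w] fw 0 by simp
      finally have "0 < l2 ^ n * ((f1 \<bullet> v) / l1 ^ n * (wf M \<bullet> b1) + (f2 \<bullet> v) / l2 ^ n * (wf M \<bullet> b2))"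
        using lpos by simp
      then show ?thesis using lpos by (simp add: power_divide algebra_simps)
    qed
    have "(\<lambda>n. (l2 / l1) ^ n) \<longlonglongrightarrow> 0" using l lpos by (auto intro!: ratio_power_tendsto_0)
    then have "(\<lambda>n. (l2 / l1) ^ n * ((f1 \<bullet> v) * (wf M \<bullet> b1)) + (f2 \<bullet> v) * (wf M \<bullet> b2)) \<longlonglongrightarrow>
        0 * ((f1 \<bullet> v) * (wf M \<bullet> b1)) + (f2 \<bullet> v) * (wf M \<bullet> b2)" by (intro tendsto_add tendsto_scaleR tendsto_mult tendsto_const)
    then have "0 * ((f1 \<bullet> v) * (wf M \<bullet> b1)) + (f2 \<bullet> v) * (wf M \<bullet> b2) \<ge> 0" using pos by (intro LIMSEQ_le_const) auto
    then show False using neg f2_pos[OF v] by (simp add: zero_le_mult_iff)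
  qed
qed

end

section \<open>Gaps seen from a boundary geodesic\<close>

context surface
begin

text \<open>Join \<open>x\<close> to an interior vector \<open>p\<close>. The crossing with
  \<open>M\<close> lies in \<open>D\<close>, so the wall of \<open>M'\<close> is nonnegative there,
  and vice versa. These two inequalities are opposite, hence equalities, and \<open>M\<close> and
  \<open>M'\<close> meet. Applied to boundary vectors this makes the gaps disjoint.\<close>

lemma walls_disjoint_closure:
  assumes LM: "M \<in> BG" "M' \<in> BG" and x: "x \<in> closure C" "wf M \<bullet> x < 0" "wf M' \<bullet> x < 0"
  shows "M = M'"
proof -
  obtain p where p: "p \<in> Di" using Di_nonempty by blast
  have pC: "p \<in> C" using p Di_sub D_sub by blast
  define q where "q N = (- (wf N \<bullet> x)) *\<^sub>R p + (wf N \<bullet> p) *\<^sub>R x" for N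
  have qD: "q N \<in> D" "q N \<in> C" "wf N \<bullet> q N = 0" if "N \<in> BG" "wf N \<bullet> x < 0" for N
  proof -
    have "wf N \<bullet> p > 0" using Di_wall p that by blast
    then show "q N \<in> C" unfolding q_def using that pC x by (intro C_add_closure scale_C closure_scale) auto
    moreover show "wf N \<bullet> q N = 0" by (simp add: q_def inner_add_right inner_diff_right)
    ultimately show "q N \<in> D" using L_sub_D that by blast
  qed
  have pp: "wf M \<bullet> p > 0" "wf M' \<bullet> p > 0" using Di_wall p LM by auto
  have "wf M' \<bullet> q M \<ge> 0" "wf M \<bullet> q M' \<ge> 0" using D_wall qD LM x by auto
  then have "(- (wf M \<bullet> x)) * (wf M' \<bullet> p) + (wf M \<bullet> p) * (wf M' \<bullet> x) = 0"
    by (simp add: q_def inner_add_right inner_diff_right mult.commute)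
  then have "wf M' \<bullet> q M = 0" by (simp add: q_def inner_add_right inner_diff_right)
  then show ?thesis using BG_disjoint[OF LM qD(2,3)[OF LM(1) x(2)]] by blast
qed

lemma closure_C_scale_into: "u \<in> C \<Longrightarrow> w \<in> C \<Longrightarrow> pt u = pt w \<Longrightarrow> \<exists>c>0. w = c *\<^sub>R u"
  using parallel_pos[of w u] C_sub_closure C_nonzero by metis

lemma orbit_of_eq: 
  assumes "b \<in> \<Delta>"
  shows "orbit_of \<Delta> (b x) = orbit_of \<Delta> x"
proof (intro subset_antisym subsetI)
  fix y assume "y \<in> orbit_of \<Delta> (b x)"
  then obtain g where "g \<in> \<Delta>" "y = (g \<circ> b) x" by (auto simp: orbit_of_def)
  then show "y \<in> orbit_of \<Delta> x" using comp_in assms unfolding orbit_of_def by blast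
next
  fix y assume "y \<in> orbit_of \<Delta> x"
  then obtain g where g: "g \<in> \<Delta>" "y = g x" by (auto simp: orbit_of_def)
  obtain b' where b': "b' \<in> \<Delta>" "b' \<circ> b = id" using inv_in assms by blast
  have "b' (b x) = x" using b'(2) by (simp add: fun_eq_iff)
  then have "y = (g \<circ> b') (b x)" using g by simp
  then show "y \<in> orbit_of \<Delta> (b x)" using comp_in g b' unfolding orbit_of_def by blast
qed

text \<open>Compactness of the quotient is pulled up to vectors: small balls around vectors of
  \<open>D\<close> have open images in the quotient, finitely many of these cover it, and
  \<open>K\<close> is the union of the corresponding closed balls. Because lifts may be rescaled,
  the image vector itself lies in \<open>K\<close>, not merely its class.\<close>

lemma cocompact_cone:
  obtains K where "compact K" "K \<subseteq> C" "\<And>v. v \<in> D \<Longrightarrow> \<exists>a\<in>\<Delta>. \<exists>A. lifts C a A \<and> A *v v \<in> K"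
proof -
  have "\<forall>v\<in>D. \<exists>e>0. cball v e \<subseteq> C" using open_C D_sub open_contains_cball by blast
  then obtain r where r: "\<And>v. v \<in> D \<Longrightarrow> r v > 0" "\<And>v. v \<in> D \<Longrightarrow> cball v (r v) \<subseteq> C" by metis
  obtain l where l: "\<And>b. b \<in> \<Delta> \<Longrightarrow> lifts C b (l b)" using ex_lift by metis
  define V where "V v = orbit_of \<Delta> ` {pt w |w. w \<in> ball v (r v) \<and> pt w \<in> Ft}" for v
  have orb: "\<exists>b\<in>\<Delta>. \<exists>w c. w \<in> ball v (r v) \<and> c > 0 \<and> w = c *\<^sub>R (l b *v u)"
    if v: "v \<in> D" and u: "u \<in> C" "orbit_of \<Delta> (pt u) \<in> V v" for u v
  proof -
    from u(2) obtain w where w: "w \<in> ball v (r v)" "orbit_of \<Delta> (pt u) = orbit_of \<Delta> (pt w)"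
      by (auto simp: V_def)
    have "pt w \<in> orbit_of \<Delta> (pt w)" using id_in unfolding orbit_of_def mem_Collect_eq by (intro exI[of _ id]) simp
    then have "pt w \<in> orbit_of \<Delta> (pt u)" using w by simp
    then obtain b where b: "b \<in> \<Delta>" "pt w = b (pt u)" by (auto simp: orbit_of_def)
    then have "pt (l b *v u) = pt w" using lift_pt[OF l[OF b(1)] C_nonzero[OF u(1)]] by simp
    moreover have "w \<in> C" using w(1) r(2)[OF v] by auto
    moreover have "l b *v u \<in> C" using lift_C[OF l[OF b(1)]] u by blast
    ultimately obtain c where "c > 0" "w = c *\<^sub>R (l b *v u)" using closure_C_scale_into by blast
    then show ?thesis using b w by blast
  qed
  have openV: "openin (quotient_space Ft \<Delta>) (V v)" if v: "v \<in> D" for v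
  proof -
    \<comment> \<open>The union of all translates of the ball, so that membership in
      \<open>V v\<close> becomes an open condition on points of \<open>Ft\<close>.\<close>
    define W where "W = (\<Union>b\<in>\<Delta>. pt ` ((*v) (l b) -` ball v (r v) \<inter> C))"
    have "open ((*v) (l b) -` ball v (r v) \<inter> C)" for b
      by (intro open_Int open_vimage open_C open_ball matrix_vector_mult_linear_continuous_on)
    then have "open W" unfolding W_def using zero_notin_C by (intro open_UN ballI open_pt_image) auto
    moreover have "{x \<in> Ft. orbit_of \<Delta> x \<in> V v} = Ft \<inter> W"
    proof (intro subset_antisym subsetI)
      fix x assume x: "x \<in> {x \<in> Ft. orbit_of \<Delta> x \<in> V v}"
      then obtain u where u: "u \<in> C" "x = pt u" using Ft_sub by blast
      then obtain b w c where b: "b \<in> \<Delta>" "w \<in> ball v (r v)" "c > 0" "w = c *\<^sub>R (l b *v u)"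
        using orb[OF v u(1)] x by auto
      then have "c *\<^sub>R u \<in> (*v) (l b) -` ball v (r v) \<inter> C" "pt (c *\<^sub>R u) = x"
        using u by (auto simp: matrix_vector_mult_scaleR scale_C)
      then have "x \<in> W" using b(1) unfolding W_def by blast
      then show "x \<in> Ft \<inter> W" using x by simp
    next
      fix x assume x: "x \<in> Ft \<inter> W"
      then obtain b u where b: "b \<in> \<Delta>" "l b *v u \<in> ball v (r v)" "u \<in> C" "x = pt u" by (auto simp: W_def)
      have "b x = pt (l b *v u)" using lift_pt[OF l[OF b(1)] C_nonzero[OF b(3)]] b(4) by simp
      moreover have "b x \<in> Ft" using x Ft_inv[OF b(1)] by blast
      ultimately have "orbit_of \<Delta> (b x) \<in> V v" using b(2) unfolding V_def by auto
      then show "x \<in> {x \<in> Ft. orbit_of \<Delta> x \<in> V v}" using x orbit_of_eq[OF b(1)] by simp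
    qed
    moreover have "V v \<subseteq> orbit_of \<Delta> ` Ft" by (auto simp: V_def)
    ultimately show ?thesis by (simp add: openin_quotient_space openin_open_Int)
  qed
  have cover: "orbit_of \<Delta> ` Ft \<subseteq> \<Union> (V ` D)"
  proof clarify
    fix x assume "x \<in> Ft"
    then obtain v where v: "v \<in> D" "x = pt v" using Ft_sub by (auto simp: D_def)
    then have "v \<in> ball v (r v)" using r(1) by simp
    then have "orbit_of \<Delta> x \<in> V v" using v(2) \<open>x \<in> Ft\<close> unfolding V_def by blast
    then show "orbit_of \<Delta> x \<in> \<Union> (V ` D)" using v by blast
  qed
  have "{x \<in> Ft. orbit_of \<Delta> x \<in> orbit_of \<Delta> ` Ft} = Ft" by auto
  then have "openin (quotient_space Ft \<Delta>) (orbit_of \<Delta> ` Ft)" by (simp add: openin_quotient_space)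
  moreover have "topspace (quotient_space Ft \<Delta>) \<subseteq> orbit_of \<Delta> ` Ft"
    using openin_topspace[of "quotient_space Ft \<Delta>"] unfolding openin_quotient_space by blast
  ultimately have top: "topspace (quotient_space Ft \<Delta>) = orbit_of \<Delta> ` Ft"
    using openin_subset by blast
  have cmp: "(\<forall>U\<in>V ` D. openin (quotient_space Ft \<Delta>) U) \<and> orbit_of \<Delta> ` Ft \<subseteq> \<Union> (V ` D) \<longrightarrow>
      (\<exists>\<F>. finite \<F> \<and> \<F> \<subseteq> V ` D \<and> orbit_of \<Delta> ` Ft \<subseteq> \<Union> \<F>)"
    using cocompact unfolding compact_space_alt top by (rule spec)
  have "\<forall>U\<in>V ` D. openin (quotient_space Ft \<Delta>) U" using openV by simp
  then have "\<exists>\<F>. finite \<F> \<and> \<F> \<subseteq> V ` D \<and> orbit_of \<Delta> ` Ft \<subseteq> \<Union> \<F>" using cmp cover by simp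
  then obtain \<F> where "finite \<F>" "\<F> \<subseteq> V ` D" "orbit_of \<Delta> ` Ft \<subseteq> \<Union> \<F>" by blast
  then obtain F where F: "finite F" "F \<subseteq> D" "\<F> = V ` F" by (meson finite_subset_image)
  define K where "K = (\<Union>v\<in>F. cball v (r v))"
  show thesis
  proof
    show "compact K" unfolding K_def using F by (intro compact_UN) auto
    show "K \<subseteq> C" unfolding K_def using F r by blast
    fix x assume x: "x \<in> D"
    then have "orbit_of \<Delta> (pt x) \<in> orbit_of \<Delta> ` Ft" by (auto simp: D_def)
    then obtain v where v: "v \<in> F" "orbit_of \<Delta> (pt x) \<in> V v" using \<open>orbit_of \<Delta> ` Ft \<subseteq> \<Union> \<F>\<close> F by blast
    then obtain b w c where b: "b \<in> \<Delta>" "w \<in> ball v (r v)" "c > 0" "w = c *\<^sub>R (l b *v x)"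
      using orb[of v x] F D_sub[OF x] by blast
    have "lifts C b (c *\<^sub>R l b)" using lifts_scale l b by blast
    moreover have "(c *\<^sub>R l b) *v x = w" using b(4) by (simp add: scaleR_matrix_vector_assoc)
    moreover have "w \<in> cball v (r v)" using b(2) by simp
    then have "w \<in> K" using v(1) unfolding K_def by blast
    ultimately show "\<exists>a\<in>\<Delta>. \<exists>A. lifts C a A \<and> A *v x \<in> K" using b(1) by metis
  qed
qed

end

context framed
begin

lemma ex_top:
  assumes "s > 0"
  shows "\<exists>r>0. s *\<^sub>R b1 + r *\<^sub>R b2 + b3 \<in> bd"
proof -
  have y: "s *\<^sub>R b1 + b3 \<in> C" using axis_C[of s 1] assms by simp
  have "s *\<^sub>R b1 + b3 + t *\<^sub>R b2 \<noteq> 0" for t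
  proof
    assume "s *\<^sub>R b1 + b3 + t *\<^sub>R b2 = 0"
    then have "f3 \<bullet> (s *\<^sub>R b1 + b3 + t *\<^sub>R b2) = 0" by simp
    then show False by (simp add: inner_add_right dual)
  qed
  from exit[OF y b2_notin(1) this] obtain t where "t > 0" "s *\<^sub>R b1 + b3 + t *\<^sub>R b2 \<in> bd" by metis
  then show ?thesis by (intro exI[of _ t]) (simp add: algebra_simps)
qed

text \<open>The boundary point over the point of \<open>L\<close> with coordinate \<open>s\<close>, on the side of \<open>D\<close>.\<close>

definition lam :: "real \<Rightarrow> real" where
  "lam s = (SOME r. r > 0 \<and> s *\<^sub>R b1 + r *\<^sub>R b2 + b3 \<in> bd)"

definition top :: "real \<Rightarrow> real^3" where
  "top s = s *\<^sub>R b1 + lam s *\<^sub>R b2 + b3"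

lemma lam_pos: "s > 0 \<Longrightarrow> lam s > 0" and top_bd: "s > 0 \<Longrightarrow> top s \<in> bd"
  using someI_ex[OF ex_top[of s]] by (auto simp: lam_def top_def)

lemma f_top: "f1 \<bullet> top s = s" "f2 \<bullet> top s = lam s" "f3 \<bullet> top s = 1"
  by (simp_all add: top_def inner_add_right dual)

lemma below_C:
  assumes s: "s > 0" and q: "s *\<^sub>R b1 + q *\<^sub>R b2 + b3 \<in> closure C" and r: "0 \<le> r" "r < q"
  shows "s *\<^sub>R b1 + r *\<^sub>R b2 + b3 \<in> C"
proof -
  have "(1 - r / q) *\<^sub>R (s *\<^sub>R b1 + b3) + (r / q) *\<^sub>R (s *\<^sub>R b1 + q *\<^sub>R b2 + b3) \<in> C"
    using r axis_C[of s 1] s by (intro C_add_closure[OF scale_C closure_scale[OF q]]) auto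
  moreover have "(1 - r / q) *\<^sub>R (s *\<^sub>R b1 + b3) + (r / q) *\<^sub>R (s *\<^sub>R b1 + q *\<^sub>R b2 + b3) = s *\<^sub>R b1 + r *\<^sub>R b2 + b3"
    using r by (simp add: algebra_simps)
  ultimately show ?thesis by simp
qed

text \<open>Since the wall of \<open>M\<close> is positive at \<open>b1\<close> and
  \<open>b3\<close>, the end \<open>u\<close> is neither of them, which makes \<open>f1\<close> and
  \<open>f3\<close> positive. It is a limit of points of \<open>M\<close>, which lie in
  \<open>D\<close>, so \<open>f2\<close> is nonnegative; if \<open>f2\<close> vanished,
  \<open>u\<close> would be an inner point of the chord of \<open>L\<close>.\<close>

lemma end_pos:
  assumes M: "M \<in> BG" "M \<noteq> L" and u: "u \<in> bd" "wf M \<bullet> u = 0"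
  shows "f1 \<bullet> u > 0" "f2 \<bullet> u > 0" "f3 \<bullet> u > 0"
proof -
  have "pt u \<noteq> pt b1"
  proof
    assume "pt u = pt b1"
    then obtain c where "c > 0" "u = c *\<^sub>R b1" using parallel_pos[of u b1] u b bdD by metis
    then show False using u(2) wall_ends_pos(1)[OF M] by simp
  qed
  then show 3: "f3 \<bullet> u > 0" using f3_pos u bdD by blast
  have "pt u \<noteq> pt b3"
  proof
    assume "pt u = pt b3"
    then obtain c where "c > 0" "u = c *\<^sub>R b3" using parallel_pos[of u b3] u b bdD by metis
    then show False using u(2) wall_ends_pos(2)[OF M] by simp
  qed
  then show 1: "f1 \<bullet> u > 0" using f1_pos u bdD by blast
  obtain v where v: "v \<in> C" "wf M \<bullet> v = 0" using wall_wf[OF M(1)] by (auto simp: wall_def)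
  have "f2 \<bullet> u + (1 / real (Suc n)) * (f2 \<bullet> v) \<ge> 0" for n
  proof -
    have "u + (1 / real (Suc n)) *\<^sub>R v \<in> C" using u v by (intro C_closure_add scale_C) (auto simp: bdD)
    then have "u + (1 / real (Suc n)) *\<^sub>R v \<in> D" using u v M by (intro L_sub_D[OF _ M(1)]) (auto simp: inner_add_right)
    then show ?thesis using f2_nonneg[of "u + (1 / real (Suc n)) *\<^sub>R v"] by (simp add: inner_add_right)
  qed
  moreover have "(\<lambda>n. 1 / real (Suc n)) \<longlonglongrightarrow> 0" by real_asymp
  then have "(\<lambda>n. f2 \<bullet> u + (1 / real (Suc n)) * (f2 \<bullet> v)) \<longlonglongrightarrow> f2 \<bullet> u + 0 * (f2 \<bullet> v)"
    by (intro tendsto_add tendsto_mult tendsto_const)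
  ultimately have "f2 \<bullet> u \<ge> 0" using LIMSEQ_le_const[of "\<lambda>n. f2 \<bullet> u + (1 / real (Suc n)) * (f2 \<bullet> v)"] by auto
  moreover have "f2 \<bullet> u \<noteq> 0"
  proof
    assume "f2 \<bullet> u = 0"
    then have "u = (f1 \<bullet> u) *\<^sub>R b1 + (f3 \<bullet> u) *\<^sub>R b3" using expand[of u] by simp
    then show False using axis_C[OF 1 3] u bdD by auto
  qed
  ultimately show "f2 \<bullet> u > 0" by simp
qed

definition coord :: "real^3 \<Rightarrow> real" where
  "coord v = (f1 \<bullet> v) / (f3 \<bullet> v)"

lemma normal_form:
  assumes "f3 \<bullet> u > 0"
  shows "(1 / (f3 \<bullet> u)) *\<^sub>R u = coord u *\<^sub>R b1 + ((f2 \<bullet> u) / (f3 \<bullet> u)) *\<^sub>R b2 + b3"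
  by (rule f_ext) (use assms in \<open>simp_all add: coord_def inner_add_right dual\<close>)

text \<open>Of two boundary vectors over the same point of \<open>L\<close> on the side of the
  surface, the lower one would be interior by \<open>below_C\<close>.\<close>

lemma coord_ends_distinct:
  assumes M: "M \<in> BG" "M \<noteq> L" and uv: "u \<in> bd" "wf M \<bullet> u = 0" "v \<in> bd" "wf M \<bullet> v = 0" "pt u \<noteq> pt v"
  shows "coord u \<noteq> coord v"
proof
  assume eq: "coord u = coord v"
  have *: "\<not> (f2 \<bullet> u) / (f3 \<bullet> u) < (f2 \<bullet> v) / (f3 \<bullet> v)"
    if uv: "u \<in> bd" "wf M \<bullet> u = 0" "v \<in> bd" "wf M \<bullet> v = 0" "coord u = coord v" for u v
  proof
    assume lt: "(f2 \<bullet> u) / (f3 \<bullet> u) < (f2 \<bullet> v) / (f3 \<bullet> v)"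
    note pu = end_pos[OF M uv(1,2)] and pv = end_pos[OF M uv(3,4)]
    have "(1 / (f3 \<bullet> v)) *\<^sub>R v \<in> closure C" using uv pv bdD by (intro closure_scale) auto
    then have "coord u *\<^sub>R b1 + ((f2 \<bullet> v) / (f3 \<bullet> v)) *\<^sub>R b2 + b3 \<in> closure C" using normal_form[OF pv(3)] uv by simp
    moreover have "coord u > 0" using pu by (simp add: coord_def)
    ultimately have "(1 / (f3 \<bullet> u)) *\<^sub>R u \<in> C" unfolding normal_form[OF pu(3)]
      using lt pu by (intro below_C) auto
    then show False using bd_scale[OF uv(1), of "1 / (f3 \<bullet> u)"] pu bdD by auto
  qed
  note pu = end_pos[OF M uv(1,2)] and pv = end_pos[OF M uv(3,4)]
  have "(f2 \<bullet> u) / (f3 \<bullet> u) = (f2 \<bullet> v) / (f3 \<bullet> v)" using *[OF uv(1-4) eq] *[OF uv(3,4,1,2) eq[symmetric]] by linarith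
  then have "(1 / (f3 \<bullet> u)) *\<^sub>R u = (1 / (f3 \<bullet> v)) *\<^sub>R v"
    unfolding normal_form[OF pu(3)] normal_form[OF pv(3)] using eq by simp
  then have "pt ((1 / (f3 \<bullet> u)) *\<^sub>R u) = pt ((1 / (f3 \<bullet> v)) *\<^sub>R v)" by simp
  then show False using uv pu pv by simp
qed

text \<open>Follow the line through the pole over \<open>s\<close> from \<open>L\<close>, where the
  wall of \<open>M\<close> is positive, up to \<open>top s\<close>. The wall is negative at the top
  exactly if this segment crosses \<open>M\<close>, and the points of \<open>M\<close> project onto
  the open interval between the coordinates of its ends.\<close>

lemma gap_iff:
  assumes M: "M \<in> BG" "M \<noteq> L" and uv: "u \<in> bd" "wf M \<bullet> u = 0" "v \<in> bd" "wf M \<bullet> v = 0"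
    and lt: "coord u < coord v" and s: "s > 0"
  shows "wf M \<bullet> top s < 0 \<longleftrightarrow> coord u < s \<and> s < coord v"
proof -
  define \<phi> where "\<phi> = wf M"
  note pu = end_pos[OF M uv(1,2)] and pv = end_pos[OF M uv(3,4)]
  have puv: "pt u \<noteq> pt v"
  proof
    assume "pt u = pt v"
    then obtain c where "c > 0" "u = c *\<^sub>R v" using parallel_pos uv bdD by metis
    then show False using lt by (simp add: coord_def)
  qed
  have y: "\<phi> \<bullet> (s *\<^sub>R b1 + b3) > 0" using wall_axis_pos[OF M s, of 1] by (simp add: \<phi>_def)
  have line: "\<phi> \<bullet> (s *\<^sub>R b1 + r *\<^sub>R b2 + b3) = \<phi> \<bullet> (s *\<^sub>R b1 + b3) + r * (\<phi> \<bullet> b2)" for r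
    by (simp add: inner_add_right)
  have topl: "\<phi> \<bullet> top s = \<phi> \<bullet> (s *\<^sub>R b1 + b3) + lam s * (\<phi> \<bullet> b2)" unfolding top_def by (rule line)
  show ?thesis
  proof
    assume neg: "wf M \<bullet> top s < 0"
    then have "lam s * (\<phi> \<bullet> b2) < 0" using topl y by (simp add: \<phi>_def)
    then have p2: "\<phi> \<bullet> b2 < 0" using lam_pos[OF s] by (simp add: mult_less_0_iff)
    \<comment> \<open>The height over \<open>s\<close> at which the wall of \<open>M\<close>
      vanishes.\<close>
    define r where "r = - (\<phi> \<bullet> (s *\<^sub>R b1 + b3)) / (\<phi> \<bullet> b2)"
    have "r * (\<phi> \<bullet> b2) = - (\<phi> \<bullet> (s *\<^sub>R b1 + b3))" using p2 by (simp add: r_def)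
    then have "lam s * (\<phi> \<bullet> b2) < r * (\<phi> \<bullet> b2)" using topl neg by (simp add: \<phi>_def)
    then have "r < lam s" using p2 by (simp add: mult_less_cancel_right)
    moreover have "r > 0" using y p2 by (simp add: r_def divide_pos_neg)
    ultimately have r: "r > 0" "r < lam s" by simp_all
    define w where "w = s *\<^sub>R b1 + r *\<^sub>R b2 + b3"
    have wC: "w \<in> C" unfolding w_def using r top_bd[OF s] bdD by (intro below_C[OF s, of "lam s"]) (auto simp: top_def)
    have w0: "\<phi> \<bullet> w = 0" unfolding w_def line using p2 by (simp add: r_def)
    have "\<phi> \<bullet> x = 0" if "cross3 u v \<bullet> x = 0" for x
      using that cross3_kernel[of u v x] puv uv bdD by (auto simp: inner_add_right \<phi>_def)
    then obtain c where c: "\<phi> = c *\<^sub>R cross3 u v" using functional_multiple by blast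
    then have "c \<noteq> 0" using p2 by auto
    then have "cross3 u v \<bullet> w = 0" using w0 c by simp
    then obtain \<alpha> \<beta> where w: "w = \<alpha> *\<^sub>R u + \<beta> *\<^sub>R v" using cross3_kernel[of u v w] puv uv bdD by blast
    then have ab: "\<alpha> > 0" "\<beta> > 0" using chord_coords_pos[OF uv(1,3) wC] by auto
    have "f3 \<bullet> w = 1" "f1 \<bullet> w = s" by (simp_all add: w_def inner_add_right dual)
    then have e: "\<alpha> * (f3 \<bullet> u) + \<beta> * (f3 \<bullet> v) = 1" "\<alpha> * (f1 \<bullet> u) + \<beta> * (f1 \<bullet> v) = s"
      by (simp_all add: w inner_add_right)
    \<comment> \<open>Rescaling the ends to \<open>f3 = 1\<close> turns the coefficients into convex
      weights and \<open>f1\<close> into \<open>coord\<close>.\<close>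
    define \<alpha>' \<beta>' where "\<alpha>' = \<alpha> * (f3 \<bullet> u)" and "\<beta>' = \<beta> * (f3 \<bullet> v)"
    have pos: "\<alpha>' > 0" "\<beta>' > 0" "\<alpha>' = 1 - \<beta>'" using ab pu pv e by (auto simp: \<alpha>'_def \<beta>'_def)
    have "s = \<alpha>' * coord u + \<beta>' * coord v" using e pu pv by (simp add: \<alpha>'_def \<beta>'_def coord_def)
    then have "s = (1 - \<beta>') * coord u + \<beta>' * coord v" using pos(3) by simp
    then have "s - coord u = \<beta>' * (coord v - coord u)" "coord v - s = (1 - \<beta>') * (coord v - coord u)"
      by (simp_all add: algebra_simps)
    then have "s - coord u = \<beta>' * (coord v - coord u)" "coord v - s = \<alpha>' * (coord v - coord u)"
      using pos(3) by simp_all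
    moreover have "\<beta>' * (coord v - coord u) > 0" "\<alpha>' * (coord v - coord u) > 0" using pos lt by simp_all
    ultimately show "coord u < s \<and> s < coord v" by linarith
  next
    assume btw: "coord u < s \<and> s < coord v"
    define t where "t = (s - coord u) / (coord v - coord u)"
    have t: "0 < t" "t < 1" using btw lt by (auto simp: t_def)
    have st: "s = (1 - t) * coord u + t * coord v"
    proof -
      have "t * (coord v - coord u) = s - coord u" using lt by (simp add: t_def)
      then show ?thesis by (simp add: algebra_simps)
    qed
    define w where "w = (1 - t) *\<^sub>R (1 / (f3 \<bullet> u)) *\<^sub>R u + t *\<^sub>R (1 / (f3 \<bullet> v)) *\<^sub>R v"
    define r where "r = (1 - t) * ((f2 \<bullet> u) / (f3 \<bullet> u)) + t * ((f2 \<bullet> v) / (f3 \<bullet> v))"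
    have r: "r > 0" unfolding r_def using t pu pv by (intro add_pos_pos) auto
    have wC: "w \<in> C" unfolding w_def scaleR_scaleR using t pu pv uv bdD puv by (intro C_pos_comb) auto
    have w: "w = s *\<^sub>R b1 + r *\<^sub>R b2 + b3"
      by (rule f_ext) (use pu pv in \<open>simp_all add: w_def inner_add_right dual st r_def coord_def\<close>)
    have "r < lam s"
    proof (rule ccontr)
      assume "\<not> r < lam s"
      then consider "r = lam s" | "lam s < r" by linarith
      then have "top s \<in> C"
      proof cases
        case 1 then show ?thesis using wC w by (simp add: top_def)
      next
        case 2
        then show ?thesis unfolding top_def using wC w lam_pos[OF s] C_sub_closure
          by (intro below_C[OF s, of r]) auto
      qed
      then show False using top_bd[OF s] bdD by blast
    qed
    have "\<phi> \<bullet> w = 0" using uv by (simp add: w_def \<phi>_def inner_add_right)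
    then have 0: "\<phi> \<bullet> (s *\<^sub>R b1 + b3) + r * (\<phi> \<bullet> b2) = 0" unfolding w line .
    then have "r * (\<phi> \<bullet> b2) < 0" using y by linarith
    then have p2: "\<phi> \<bullet> b2 < 0" using r by (simp add: mult_less_0_iff)
    then have "lam s * (\<phi> \<bullet> b2) < r * (\<phi> \<bullet> b2)" using \<open>r < lam s\<close> by simp
    then show "wf M \<bullet> top s < 0" using topl 0 by (simp add: \<phi>_def)
  qed
qed

end

context surface
begin

lemma wall_image_ends:
  assumes fr: "framed C Ft \<Delta> L a A b1 b2 b3 f1 f2 f3 l1 l2 l3"
    and g: "g \<in> \<Delta>" "lifts C g G"
  shows "wf (g ` L) \<bullet> (G *v b1) = 0" "wf (g ` L) \<bullet> (G *v b3) = 0"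
    "G *v b1 \<in> bd" "G *v b3 \<in> bd" "pt (G *v b1) \<noteq> pt (G *v b3)" "g ` L \<in> BG"
proof -
  interpret f: framed C Ft \<Delta> L a A b1 b2 b3 f1 f2 f3 l1 l2 l3 by fact
  show BGg: "g ` L \<in> BG" using BG_image g f.L by blast
  have 0: "wf (g ` L) \<bullet> (G *v (r *\<^sub>R b1 + 1 *\<^sub>R b3)) = 0" if "r > 0" for r
  proof -
    have C: "r *\<^sub>R b1 + 1 *\<^sub>R b3 \<in> C" by (intro f.axis_C that) simp
    then have "pt (r *\<^sub>R b1 + 1 *\<^sub>R b3) \<in> L" using f.mem_L_iff f.dual by (simp add: inner_add_right)
    then have "pt (G *v (r *\<^sub>R b1 + 1 *\<^sub>R b3)) \<in> g ` L"
      using lift_pt[OF g(2) C_nonzero[OF C]] by (metis imageI)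
    then show ?thesis using mem_L[OF _ BGg] lift_C[OF g(2)] C by blast
  qed
  have "wf (g ` L) \<bullet> (G *v b1) + wf (g ` L) \<bullet> (G *v b3) = 0"
    "2 * (wf (g ` L) \<bullet> (G *v b1)) + wf (g ` L) \<bullet> (G *v b3) = 0"
    using 0[of 1] 0[of 2] by (simp_all add: matrix_vector_right_distrib matrix_vector_mult_scaleR inner_add_right)
  then show "wf (g ` L) \<bullet> (G *v b1) = 0" "wf (g ` L) \<bullet> (G *v b3) = 0" by linarith+
  show "G *v b1 \<in> bd" "G *v b3 \<in> bd" using f.b lift_bd[OF g(2)] by auto
  show "pt (G *v b1) \<noteq> pt (G *v b3)" using f.pt_b_distinct lift_pt_eq[OF g(2)] f.b_nonzero by auto
qed

end

section \<open>The limit set is negligible\<close>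

text \<open>The Binet-Cauchy identity. It turns the difference of two projected coordinates into a
  triple product with the pole of the projection.\<close>

lemma cross3_dot_cross3: "cross3 a b \<bullet> cross3 c d = (a \<bullet> c) * (b \<bullet> d) - (a \<bullet> d) * (b \<bullet> c)"
  by (simp add: cross3_simps)

lemma cross3_parallel:
  assumes "a \<bullet> p = 0" "b \<bullet> p = 0" "p \<noteq> 0"
  shows "\<exists>\<mu>. cross3 a b = \<mu> *\<^sub>R p"
proof -
  have "cross3 (cross3 a b) p = 0"
  proof -
    have "cross3 (cross3 a b) p = (a \<bullet> p) *\<^sub>R b - (b \<bullet> p) *\<^sub>R a"
      by (simp add: cross3_simps forall_3)
    then show ?thesis using assms by simp
  qed
  then show ?thesis using cross3_eq_0_iff[of "cross3 a b" p] assms pt_eq_iff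
    by (metis scaleR_zero_left)
qed

lemma (in strict_cone) scale_C_iff: "c > 0 \<Longrightarrow> c *\<^sub>R v \<in> C \<longleftrightarrow> v \<in> C"
  using scale_C[of "c *\<^sub>R v" "1 / c"] scale_C[of v c] by auto

context surface
begin

lemma wall_image:
  assumes M: "M \<in> BG" and g: "g \<in> \<Delta>" "lifts C g G"
  shows "\<exists>c>0. \<forall>v. wf (g ` M) \<bullet> (G *v v) = c * (wf M \<bullet> v)"
proof -
  define \<psi> where "\<psi> = transpose (matrix_inv G) *v wf M"
  have psi: "\<psi> \<bullet> (G *v v) = wf M \<bullet> v" for v
    unfolding \<psi>_def transpose_inner by (simp add: matrix_inv_mult_vec[OF lift_invertible[OF g(2)]])
  have M': "wf M \<noteq> 0" "M = cut (wf M)" "\<exists>v\<in>C. wf M \<bullet> v = 0" using wall_wf[OF M] by (auto simp: wall_def)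
  have gM: "g ` M \<in> BG" using BG_image M g by blast
  have cut: "g ` M = cut \<psi>" using M'(2) lift_cut[OF g(2), of "wf M"] by (simp add: \<psi>_def)
  obtain p where p: "p \<in> C" "wf M \<bullet> p = 0" using M' by blast
  have zero: "wf (g ` M) \<bullet> x = 0" if "x \<in> C" "\<psi> \<bullet> x = 0" for x
    using mem_L[OF that(1) gM] pt_in_cut[OF that(1), of \<psi>] that cut by simp
  have "\<exists>c. wf (g ` M) = c *\<^sub>R \<psi>"
  proof (rule cut_cong_iff)
    show "\<psi> \<noteq> 0" using M' lift_covector_nonzero[OF g(2)] by (simp add: \<psi>_def)
    show "G *v p \<in> C" "\<psi> \<bullet> (G *v p) = 0" using p psi lift_C[OF g(2)] by auto
    then show "wf (g ` M) \<bullet> (G *v p) = 0" by (rule zero)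
    show "wf (g ` M) \<bullet> v \<ge> 0" if "v \<in> C" "\<psi> \<bullet> v = 0" for v using zero[OF that] by simp
  qed
  then obtain c where c: "wf (g ` M) = c *\<^sub>R \<psi>" by blast
  obtain q where q: "q \<in> Di" using Di_nonempty by blast
  have "wf (g ` M) \<bullet> (G *v q) > 0" "wf M \<bullet> q > 0" using q lift_Di[OF g] Di_wall gM M by auto
  then have "c > 0" using c psi[of q] by (simp add: zero_less_mult_iff)
  moreover have "wf (g ` M) \<bullet> (G *v v) = c * (wf M \<bullet> v)" for v using c psi by simp
  ultimately show ?thesis by blast
qed

end

lemma bounded_norm_sequences:
  fixes x y u v :: "nat \<Rightarrow> 'a::euclidean_space"
  assumes "\<And>n. norm (x n) \<le> B" "\<And>n. norm (y n) \<le> B" "\<And>n. norm (u n) \<le> B" "\<And>n. norm (v n) \<le> B"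
  obtains r x' y' u' v' where "strict_mono (r :: nat \<Rightarrow> nat)" "(\<lambda>n. x (r n)) \<longlonglongrightarrow> x'"
    "(\<lambda>n. y (r n)) \<longlonglongrightarrow> y'" "(\<lambda>n. u (r n)) \<longlonglongrightarrow> u'" "(\<lambda>n. v (r n)) \<longlonglongrightarrow> v'"
proof -
  let ?K = "cball (0::'a) B \<times> cball (0::'a) B \<times> cball (0::'a) B \<times> cball (0::'a) B"
  let ?s = "\<lambda>n. (x n, y n, u n, v n)"
  have K: "compact ?K" by (intro compact_Times compact_cball)
  have "\<forall>n. ?s n \<in> ?K" using assms by auto
  from K[unfolded compact_def, THEN spec, THEN mp, OF this]
  obtain l r where r: "strict_mono (r :: nat \<Rightarrow> nat)" "(?s \<circ> r) \<longlonglongrightarrow> l" by (elim bexE exE conjE)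
  have "(\<lambda>n. fst ((?s \<circ> r) n)) \<longlonglongrightarrow> fst l" "(\<lambda>n. fst (snd ((?s \<circ> r) n))) \<longlonglongrightarrow> fst (snd l)"
    "(\<lambda>n. fst (snd (snd ((?s \<circ> r) n)))) \<longlonglongrightarrow> fst (snd (snd l))"
    "(\<lambda>n. snd (snd (snd ((?s \<circ> r) n)))) \<longlonglongrightarrow> snd (snd (snd l))"
    by (intro tendsto_fst tendsto_snd r(2))+
  then show thesis using that[OF r(1)] by (simp add: o_def)
qed

context framed
begin

text \<open>The complement of the gaps is porous: zooming in on one of its points \<open>s0\<close> by elements of the
  cocompact group \<open>\<Delta>\<close>, the projection to \<open>L\<close> tends to a projection from a boundary point \<open>w\<close>, which
  transports a fixed gap to gaps near \<open>s0\<close> without degenerating.\<close>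

lemma zoom:
  assumes s0: "s0 > 0" and nonneg: "\<And>M. M \<in> BG \<Longrightarrow> M \<noteq> L \<Longrightarrow> wf M \<bullet> top s0 \<ge> 0"
  obtains g G w x c P h1 h3 n1 n3 H where "\<And>n::nat. g n \<in> \<Delta>" "\<And>n. lifts C (g n) (G n)"
    "(\<lambda>n. G n *v top s0) \<longlonglongrightarrow> x" "x \<in> bd" "w \<in> bd" "pt x \<noteq> pt w"
    "P \<longlonglongrightarrow> w" "\<And>n. P n = c n *\<^sub>R (G n *v b2)" "\<And>n. c n \<noteq> (0::real)"
    "h1 \<longlonglongrightarrow> H" "h3 \<longlonglongrightarrow> H" "\<And>n. n1 n > (0::real)" "\<And>n. n3 n > (0::real)"
    "\<And>n v. f1 \<bullet> v = n1 n * (h1 n \<bullet> (G n *v v))" "\<And>n v. f3 \<bullet> v = n3 n * (h3 n \<bullet> (G n *v v))"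
    "\<And>v. v \<in> C \<Longrightarrow> H \<bullet> v \<ge> 0" "H \<noteq> 0" "H \<bullet> w = 0"
proof -
  obtain K where K: "compact K" "K \<subseteq> C" "\<And>v. v \<in> D \<Longrightarrow> \<exists>a\<in>\<Delta>. \<exists>A. lifts C a A \<and> A *v v \<in> K"
    using cocompact_cone by metis
  define \<xi> y where "\<xi> = top s0" and "y = s0 *\<^sub>R b1 + b3"
  define \<mu> where "\<mu> = lam s0"
  have lam: "\<mu> > 0" using lam_pos s0 by (simp add: \<mu>_def)
  have xi: "\<xi> \<in> bd" using top_bd s0 by (simp add: \<xi>_def)
  have yC: "y \<in> C" using axis_C[of s0 1] s0 by (simp add: y_def)
  have b2eq: "\<xi> - y = \<mu> *\<^sub>R b2" by (simp add: \<xi>_def y_def top_def \<mu>_def)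
  \<comment> \<open>Any null sequence strictly between 0 and 1 would do; the double successor keeps
    \<open>1 - \<epsilon> n\<close> nonzero.\<close>
  define \<epsilon> where "\<epsilon> n = 1 / real (Suc (Suc n))" for n
  have eps: "0 < \<epsilon> n" "\<epsilon> n < 1" for n by (simp_all add: \<epsilon>_def)
  have eps0: "\<epsilon> \<longlonglongrightarrow> 0" unfolding \<epsilon>_def[abs_def] by real_asymp
  \<comment> \<open>A path to \<open>top s0\<close> along the line through the pole. It stays in
    \<open>D\<close> because every wall is nonnegative at both ends: this is where it is used that
    \<open>s0\<close> lies in no gap.\<close>
  define x0 where "x0 n = \<epsilon> n *\<^sub>R y + (1 - \<epsilon> n) *\<^sub>R \<xi>" for n
  have x0D: "x0 n \<in> D" for n
  proof -
    have "x0 n \<in> C" unfolding x0_def using eps[of n] yC xi bdD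
      by (intro C_add_closure[OF scale_C closure_scale]) auto
    moreover have "wf M \<bullet> x0 n \<ge> 0" if M: "M \<in> BG" for M
    proof -
      have "wf M \<bullet> y \<ge> 0" using D_wall[OF axis_D[of s0 1] M] s0 by (simp add: y_def)
      moreover have "wf M \<bullet> \<xi> \<ge> 0"
      proof (cases "M = L")
        case True
        then show ?thesis using f_top(2)[of s0] lam by (simp add: \<xi>_def \<mu>_def flip: f2)
      qed (use nonneg M in \<open>simp add: \<xi>_def\<close>)
      ultimately show ?thesis using eps[of n] by (simp add: x0_def inner_add_right)
    qed
    ultimately show ?thesis using D_iff by blast
  qed
  then have "\<forall>n. \<exists>a A. a \<in> \<Delta> \<and> lifts C a A \<and> A *v x0 n \<in> K" using K(3) by blast
  then obtain g G where gG: "\<And>n. g n \<in> \<Delta>" "\<And>n. lifts C (g n) (G n)" "\<And>n. G n *v x0 n \<in> K" by metis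
  \<comment> \<open>The matrices \<open>G n\<close> may be unbounded, but these two summands lie in
    the closed cone and their sum stays in \<open>K\<close>. As \<open>height\<close> is additive
    and nonnegative, both remain bounded.\<close>
  define Y X where "Y n = \<epsilon> n *\<^sub>R (G n *v y)" and "X n = (1 - \<epsilon> n) *\<^sub>R (G n *v \<xi>)" for n
  have YX: "G n *v x0 n = Y n + X n" for n
    by (simp add: x0_def Y_def X_def matrix_vector_right_distrib matrix_vector_mult_scaleR)
  have Ycl: "Y n \<in> closure C" for n unfolding Y_def
    using eps[of n] yC C_sub_closure lift_closure[OF gG(2)] by (intro closure_scale) auto
  have Xcl: "X n \<in> closure C" for n unfolding X_def
    using eps[of n] xi bdD lift_closure[OF gG(2)] by (intro closure_scale) auto
  have Xn: "X n \<notin> C" for n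
  proof
    assume "X n \<in> C"
    then have "(1 / (1 - \<epsilon> n)) *\<^sub>R X n \<in> C" using eps[of n] by (intro scale_C) auto
    then have "G n *v \<xi> \<in> C" using eps[of n] by (simp add: X_def)
    then show False using lift_C[OF gG(2)] xi bdD by blast
  qed
  obtain \<kappa> where \<kappa>: "\<kappa> > 0" "\<And>v. v \<in> closure C \<Longrightarrow> norm v \<le> \<kappa> * (height \<bullet> v)" using height_bound by metis
  have "bounded ((\<lambda>v. height \<bullet> v) ` K)"
    using K(1) by (intro compact_imp_bounded compact_continuous_image continuous_intros)
  then obtain B where B: "\<And>v. v \<in> K \<Longrightarrow> height \<bullet> v \<le> B" by (auto simp: bounded_iff abs_le_iff)
  have hn: "height \<bullet> v \<ge> 0" if "v \<in> closure C" for v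
    using height_pos[OF that] by (cases "v = 0") auto
  have bd: "norm (Y n) \<le> \<kappa> * B" "norm (X n) \<le> \<kappa> * B" for n
  proof -
    have "height \<bullet> Y n + height \<bullet> X n \<le> B" using B[OF gG(3)[of n]] by (simp add: YX inner_add_right)
    then have "height \<bullet> Y n \<le> B" "height \<bullet> X n \<le> B" using hn[OF Ycl[of n]] hn[OF Xcl[of n]] by linarith+
    then show "norm (Y n) \<le> \<kappa> * B" "norm (X n) \<le> \<kappa> * B"
      using \<kappa>(2)[OF Ycl[of n]] \<kappa>(2)[OF Xcl[of n]] \<kappa>(1) by (meson mult_left_mono less_imp_le order_trans)+
  qed
  define t where "t f n = transpose (matrix_inv (G n)) *v f" for f n
  have tG: "t f n \<bullet> (G n *v v) = f \<bullet> v" for f n v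
    unfolding t_def transpose_inner by (simp add: matrix_inv_mult_vec[OF lift_invertible[OF gG(2)]])
  have tnz: "t f n \<noteq> 0" if "f \<noteq> 0" for f n using that lift_covector_nonzero[OF gG(2)] by (simp add: t_def)
  \<comment> \<open>Transported covectors may degenerate in size, so only their directions are
    followed. The lengths reappear as \<open>n1\<close> and \<open>n3\<close>, whose quotient scales
    all projected coordinates alike.\<close>
  define k where "k f n = t f n /\<^sub>R norm (t f n)" for f n
  have knorm: "norm (k f n) = 1" if "f \<noteq> 0" for f n using tnz[OF that] by (simp add: k_def)
  have kG: "f \<bullet> v = norm (t f n) * (k f n \<bullet> (G n *v v))" if "f \<noteq> 0" for f n v
    using tnz[OF that, of n] by (simp add: k_def tG)
  define B' where "B' = max 1 (\<kappa> * B)"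
  have "norm (Y n) \<le> B'" "norm (X n) \<le> B'" "norm (k f1 n) \<le> B'" "norm (k f3 n) \<le> B'" for n
    using bd[of n] knorm[OF f_nonzero(1), of n] knorm[OF f_nonzero(3), of n] by (auto simp: B'_def)
  then obtain r w x H1 H3 where r: "strict_mono (r :: nat \<Rightarrow> nat)" "(\<lambda>n. Y (r n)) \<longlonglongrightarrow> w"
    "(\<lambda>n. X (r n)) \<longlonglongrightarrow> x" "(\<lambda>n. k f1 (r n)) \<longlonglongrightarrow> H1" "(\<lambda>n. k f3 (r n)) \<longlonglongrightarrow> H3"
    using bounded_norm_sequences[of Y B' X "k f1" "k f3"] by metis
  have eps0': "(\<lambda>n. \<epsilon> (r n)) \<longlonglongrightarrow> 0" using LIMSEQ_subseq_LIMSEQ[OF eps0 r(1)] by (simp add: o_def)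
  have closedN: "z \<notin> C" if "\<And>n. u n \<notin> C" "u \<longlonglongrightarrow> z" for u :: "nat \<Rightarrow> real^3" and z
  proof -
    have "closed (- C)" using open_C by (simp add: closed_Compl)
    then show ?thesis using closed_sequentially[of "- C" u z] that by auto
  qed
  have "(\<lambda>n. Y (r n) + X (r n)) \<longlonglongrightarrow> w + x" using r by (intro tendsto_add)
  moreover have "Y (r n) + X (r n) \<in> K" for n using gG(3) by (simp flip: YX)
  ultimately have "w + x \<in> K" 
    using closed_sequentially[OF compact_imp_closed[OF K(1)], of "\<lambda>n. Y (r n) + X (r n)" "w + x"] by simp
  then have z: "w + x \<in> C" using K(2) by blast
  have wcl: "w \<in> closure C" using closed_sequentially[OF closed_closure _ r(2)] Ycl by blast
  have xcl: "x \<in> closure C" using closed_sequentially[OF closed_closure _ r(3)] Xcl by blast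
  have xC: "x \<notin> C" using closedN[OF _ r(3)] Xn by blast
  \<comment> \<open>The image of the pole at the scale of \<open>Y\<close>. The pole is a multiple
    of the difference of \<open>\<xi>\<close> and \<open>y\<close>, and at this scale the image of
    \<open>\<xi>\<close> disappears, so \<open>Q\<close> tends to a negative multiple of
    \<open>w\<close>.\<close>
  define Q where "Q n = \<epsilon> n *\<^sub>R (G n *v b2)" for n
  have Qeq: "Q n = (1/\<mu>) *\<^sub>R ((\<epsilon> n / (1 - \<epsilon> n)) *\<^sub>R X n - Y n)" for n
  proof -
    have "b2 = (1/\<mu>) *\<^sub>R (\<xi> - y)" using b2eq lam by simp
    then have "G n *v b2 = (1/\<mu>) *\<^sub>R (G n *v \<xi> - G n *v y)"
      by (simp add: matrix_vector_mult_scaleR matrix_vector_mult_diff_distrib)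
    then show ?thesis using eps[of n] by (simp add: Q_def X_def Y_def scaleR_diff_right)
  qed
  have "(\<lambda>n. (1/\<mu>) *\<^sub>R ((\<epsilon> (r n) / (1 - \<epsilon> (r n))) *\<^sub>R X (r n) - Y (r n))) \<longlonglongrightarrow> (1/\<mu>) *\<^sub>R ((0 / (1 - 0)) *\<^sub>R x - w)"
    by (intro tendsto_scaleR tendsto_diff tendsto_divide tendsto_const eps0' r) simp
  then have Qlim: "(\<lambda>n. Q (r n)) \<longlonglongrightarrow> - ((1/\<mu>) *\<^sub>R w)" by (simp add: Qeq)
  \<comment> \<open>Beyond \<open>y\<close> the line through the pole leaves the cone on the other
    side of \<open>L\<close>. The images of that exit point are not interior, yet they tend to a
    positive multiple of \<open>w\<close>.\<close>
  have wC: "w \<notin> C"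
  proof
    assume wC: "w \<in> C"
    have "y + t *\<^sub>R (- b2) \<noteq> 0" for t
    proof
      assume "y + t *\<^sub>R (- b2) = 0"
      then have "f3 \<bullet> (y + t *\<^sub>R (- b2)) = 0" by simp
      then show False by (simp add: y_def inner_add_right inner_diff_right dual)
    qed
    from exit[OF yC b2_notin(2) this] obtain q where q: "q > 0" "y + q *\<^sub>R (- b2) \<in> bd" by metis
    have "Y n - q *\<^sub>R Q n \<notin> C" for n
    proof
      assume "Y n - q *\<^sub>R Q n \<in> C"
      moreover have "Y n - q *\<^sub>R Q n = \<epsilon> n *\<^sub>R (G n *v (y + q *\<^sub>R (- b2)))"
        by (simp add: Y_def Q_def matrix_vector_mult_scaleR matrix_vector_mult_diff_distrib scaleR_diff_right mult.commute)
      ultimately have "\<epsilon> n *\<^sub>R (G n *v (y + q *\<^sub>R (- b2))) \<in> C" by simp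
      then have "G n *v (y + q *\<^sub>R (- b2)) \<in> C" using scale_C_iff[OF eps(1)] by blast
      then show False using lift_C[OF gG(2)] q bdD by blast
    qed
    moreover have "(\<lambda>n. Y (r n) - q *\<^sub>R Q (r n)) \<longlonglongrightarrow> w - q *\<^sub>R (- ((1/\<mu>) *\<^sub>R w))"
      by (intro tendsto_diff tendsto_scaleR tendsto_const r Qlim)
    ultimately have "w - q *\<^sub>R (- ((1/\<mu>) *\<^sub>R w)) \<notin> C" by (rule closedN)
    moreover have "w - q *\<^sub>R (- ((1/\<mu>) *\<^sub>R w)) = (1 + q / \<mu>) *\<^sub>R w" by (simp add: algebra_simps)
    ultimately show False using scale_C[OF wC, of "1 + q / \<mu>"] q lam by (simp add: add_pos_pos)
  qed
  \<comment> \<open>Neither limit is 0, since otherwise their interior sum would equal the other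
    one, which is not interior.\<close>
  have wbd: "w \<in> bd" using wcl wC z xC by (cases "w = 0") (auto simp: bd_def)
  have xbd: "x \<in> bd" using xcl xC z wC by (cases "x = 0") (auto simp: bd_def)
  have ptne: "pt x \<noteq> pt w"
  proof
    assume "pt x = pt w"
    then obtain c where "c > 0" "x = c *\<^sub>R w" using parallel_pos xbd wbd bdD by metis
    then have "w + x = (1 + c) *\<^sub>R w" by (simp add: algebra_simps)
    then show False using z bd_scale[OF wbd, of "1 + c"] \<open>c > 0\<close> bdD by auto
  qed
  \<comment> \<open>Nonnegativity on \<open>C\<close> passes to the limit, the norm stays 1, and
    \<open>H\<close> vanishes at \<open>w\<close> because \<open>f\<close> vanishes at the
    pole.\<close>
  have Hprop: "(\<forall>v\<in>C. H \<bullet> v \<ge> 0) \<and> norm H = 1 \<and> H \<bullet> w = 0"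
    if lim: "(\<lambda>n. k f (r n)) \<longlonglongrightarrow> H" and f: "f \<noteq> 0" "f \<bullet> b2 = 0" "\<And>v. v \<in> closure C \<Longrightarrow> f \<bullet> v \<ge> 0" for f H
  proof (intro conjI ballI)
    fix v assume v: "v \<in> C"
    have "k f n \<bullet> v \<ge> 0" for n
    proof -
      have "f \<bullet> (matrix_inv (G n) *v v) \<ge> 0" using f(3) v C_sub_closure lift_inv_C[OF gG(2)] by blast
      then have "norm (t f n) * (k f n \<bullet> v) \<ge> 0"
        using kG[OF f(1), of "matrix_inv (G n) *v v" n] by (simp add: matrix_inv_mult_vec[OF lift_invertible[OF gG(2)]])
      then show ?thesis using tnz[OF f(1), of n] by (simp add: zero_le_mult_iff)
    qed
    moreover have "(\<lambda>n. k f (r n) \<bullet> v) \<longlonglongrightarrow> H \<bullet> v" by (intro tendsto_inner lim tendsto_const)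
    ultimately show "H \<bullet> v \<ge> 0" using LIMSEQ_le_const by blast
  next
    have "(\<lambda>n. norm (k f (r n))) \<longlonglongrightarrow> norm H" by (intro tendsto_norm lim)
    then show "norm H = 1" using knorm[OF f(1)] LIMSEQ_const_iff[of "1::real" "norm H"] by simp
  next
    have "k f n \<bullet> Q n = 0" for n using f(2) tG[of f n b2] by (simp add: Q_def k_def)
    moreover have "(\<lambda>n. k f (r n) \<bullet> Q (r n)) \<longlonglongrightarrow> H \<bullet> (- ((1/\<mu>) *\<^sub>R w))" by (intro tendsto_inner lim Qlim)
    ultimately have "H \<bullet> (- ((1/\<mu>) *\<^sub>R w)) = 0" using LIMSEQ_const_iff[of "0::real"] by simp
    then show "H \<bullet> w = 0" using lam by simp
  qed
  note P1 = Hprop[OF r(4) f_nonzero(1) dual(2) f1_nonneg]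
  note P3 = Hprop[OF r(5) f_nonzero(3) dual(8) f3_nonneg]
  have Hnz: "H1 \<noteq> 0" "H3 \<noteq> 0" using P1 P3 by auto
  \<comment> \<open>Both limits support the cone at \<open>w\<close>, so they are proportional, and
    having norm 1 they coincide.\<close>
  obtain d where d: "d > 0" "H3 = d *\<^sub>R H1"
    using support_unique[OF C1 wbd, of H1 H3] P1 P3 Hnz by blast
  then have "d = 1" using P1 P3 by simp
  then have H: "H3 = H1" using d by simp
  show thesis
  proof (rule that[of "\<lambda>n. g (r n)" "\<lambda>n. G (r n)" x w "\<lambda>n. - (\<mu> *\<^sub>R Q (r n))" "\<lambda>n. - (\<mu> * \<epsilon> (r n))"
      "\<lambda>n. k f1 (r n)" H1 "\<lambda>n. k f3 (r n)" "\<lambda>n. norm (t f1 (r n))" "\<lambda>n. norm (t f3 (r n))"])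
    have "(\<lambda>n. (1 / (1 - \<epsilon> (r n))) *\<^sub>R X (r n)) \<longlonglongrightarrow> (1 / (1 - 0)) *\<^sub>R x"
      by (intro tendsto_scaleR tendsto_diff tendsto_divide tendsto_const eps0' r) simp
    moreover have "(1 / (1 - \<epsilon> n)) *\<^sub>R X n = G n *v top s0" for n using eps[of n] by (simp add: X_def \<xi>_def)
    ultimately show "(\<lambda>n. G (r n) *v top s0) \<longlonglongrightarrow> x" by simp
    have "(\<lambda>n. - (\<mu> *\<^sub>R Q (r n))) \<longlonglongrightarrow> - (\<mu> *\<^sub>R (- ((1/\<mu>) *\<^sub>R w)))"
      by (intro tendsto_minus tendsto_scaleR tendsto_const Qlim)
    then show "(\<lambda>n. - (\<mu> *\<^sub>R Q (r n))) \<longlonglongrightarrow> w" using lam by simp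
    show "- (\<mu> *\<^sub>R Q (r n)) = (- (\<mu> * \<epsilon> (r n))) *\<^sub>R (G (r n) *v b2)" for n by (simp add: Q_def)
    show "- (\<mu> * \<epsilon> (r n)) \<noteq> 0" for n using lam eps[of "r n"] by simp
    show "norm (t f1 (r n)) > 0" "norm (t f3 (r n)) > 0" for n using tnz f_nonzero by auto
    show "f1 \<bullet> v = norm (t f1 (r n)) * (k f1 (r n) \<bullet> (G (r n) *v v))"
      "f3 \<bullet> v = norm (t f3 (r n)) * (k f3 (r n) \<bullet> (G (r n) *v v))" for n v
      by (rule kG[OF f_nonzero(1)], rule kG[OF f_nonzero(3)])
    show "H1 \<bullet> v \<ge> 0" if "v \<in> C" for v using P1 that by blast
  qed (use gG xbd wbd ptne r H Hnz P1 in auto)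
qed

end

context framed
begin

text \<open>A boundary geodesic \<open>M\<close> neither of whose ends is \<open>w\<close> is pulled
  back by the zooming elements. The coordinates of its ends then tend to \<open>s0\<close>. The
  distance to \<open>s0\<close> and the size of the gap carry the same unknown scalars
  \<open>\<tau> n\<close> and \<open>\<mu> n\<close>, which cancel in the quotient; what is left
  converges because \<open>w\<close> and the two ends of \<open>M\<close> are not coplanar.\<close>

lemma porous:
  assumes s0: "s0 > 0" and nonneg: "\<And>M. M \<in> BG \<Longrightarrow> M \<noteq> L \<Longrightarrow> wf M \<bullet> top s0 \<ge> 0"
  shows "\<exists>\<rho>>0. \<forall>\<epsilon>>0. \<exists>d p q. 0 < d \<and> d < \<epsilon> \<and> s0 - d \<le> p \<and> p < q \<and> q \<le> s0 + d \<and> \<rho> * d \<le> q - p \<and> 0 < p \<and>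
    (\<exists>M\<in>BG. M \<noteq> L \<and> (\<forall>s. p < s \<and> s < q \<longrightarrow> wf M \<bullet> top s < 0))"
proof (rule zoom[OF s0 nonneg])
  fix g G w x c P h1 h3 n1 n3 H
  assume z: "\<And>n::nat. g n \<in> \<Delta>" "\<And>n. lifts C (g n) (G n)"
    "(\<lambda>n. G n *v top s0) \<longlonglongrightarrow> x" "x \<in> bd" "w \<in> bd" "pt x \<noteq> pt w"
    "P \<longlonglongrightarrow> w" "\<And>n. P n = c n *\<^sub>R (G n *v b2)" "\<And>n. c n \<noteq> (0::real)"
    "h1 \<longlonglongrightarrow> H" "h3 \<longlonglongrightarrow> H" "\<And>n. n1 n > (0::real)" "\<And>n. n3 n > (0::real)"
    "\<And>n v. f1 \<bullet> v = n1 n * (h1 n \<bullet> (G n *v v))" "\<And>n v. f3 \<bullet> v = n3 n * (h3 n \<bullet> (G n *v v))"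
    "\<And>v. v \<in> C \<Longrightarrow> H \<bullet> v \<ge> 0" "H \<noteq> 0" "H \<bullet> w = 0"
  have Hpos: "H \<bullet> v > 0" if "v \<in> bd" "pt v \<noteq> pt w" for v
    using functional_zero_unique[OF z(16,17) _ _ z(18)] that z(5) bdD by blast
  have hlim: "(\<lambda>n. h1 n \<bullet> v) \<longlonglongrightarrow> H \<bullet> v" "(\<lambda>n. h3 n \<bullet> v) \<longlonglongrightarrow> H \<bullet> v" for v
    by (intro tendsto_inner z tendsto_const)+
  have hev: "\<forall>\<^sub>F n in sequentially. h1 n \<bullet> v > 0 \<and> h3 n \<bullet> v > 0" if "v \<in> bd" "pt v \<noteq> pt w" for v
    using order_tendstoD(1)[OF hlim(1) Hpos[OF that]] order_tendstoD(1)[OF hlim(2) Hpos[OF that]]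
    by eventually_elim auto
  have fr: "framed C Ft \<Delta> L a A b1 b2 b3 f1 f2 f3 l1 l2 l3" by unfold_locales
  \<comment> \<open>\<open>H\<close> vanishes at \<open>w\<close>, so both ends must avoid it. If
    \<open>w\<close> happens to be an end of \<open>L\<close>, a translate of \<open>L\<close>
    different from \<open>L\<close> is taken instead; it shares no end with
    \<open>L\<close>.\<close>
  have "\<exists>M\<in>BG. \<exists>j1\<in>bd. \<exists>j2\<in>bd. pt j1 \<noteq> pt j2 \<and> wf M \<bullet> j1 = 0 \<and> wf M \<bullet> j2 = 0 \<and> pt j1 \<noteq> pt w \<and> pt j2 \<noteq> pt w"
  proof (cases "pt w \<noteq> pt b1 \<and> pt w \<noteq> pt b3")
    case True
    then show ?thesis using L b pt_b_distinct dual f2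
      by (intro bexI[of _ L] bexI[of _ b1] bexI[of _ b3]) auto
  next
    case False
    then obtain d where d: "d = b1 \<or> d = b3" "pt d \<noteq> pt w" using pt_b_distinct by metis
    then have "d \<in> bd" using b by auto
    then obtain n where n: "h1 n \<bullet> d > 0" "h3 n \<bullet> d > 0"
      using eventually_happens'[OF sequentially_bot hev[OF _ d(2)]] by blast
    note we = wall_image_ends[OF fr z(1)[of n] z(2)[of n]]
    \<comment> \<open>For this \<open>n\<close> both functionals are positive at the end
      \<open>d\<close> of \<open>L\<close> other than \<open>w\<close>, while at each end of the
      translate one of them vanishes. So \<open>d\<close> is not an end of the translate, and the
      translate is not \<open>L\<close>.\<close>
    have h0: "h1 n \<bullet> (G n *v b3) = 0" "h3 n \<bullet> (G n *v b1) = 0"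
      using z(14)[of b3 n] z(15)[of b1 n] z(12)[of n] z(13)[of n] dual by auto
    have ne: "g n ` L \<noteq> L"
    proof
      assume eq: "g n ` L = L"
      then have "f2 \<bullet> (G n *v b1) = 0" "f2 \<bullet> (G n *v b3) = 0" using we f2 by auto
      then have "pt (G n *v b1) = pt b1 \<or> pt (G n *v b1) = pt b3" "pt (G n *v b3) = pt b1 \<or> pt (G n *v b3) = pt b3"
        using chord_ends[OF b pt_b_distinct(2) we(3), of "f1 \<bullet> (G n *v b1)" "f3 \<bullet> (G n *v b1)"] expand[of "G n *v b1"]
          chord_ends[OF b pt_b_distinct(2) we(4), of "f1 \<bullet> (G n *v b3)" "f3 \<bullet> (G n *v b3)"] expand[of "G n *v b3"]
        by auto
      then have "pt (G n *v b1) = pt d \<or> pt (G n *v b3) = pt d" using we(5) d(1) by metis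
      then show False
      proof
        assume "pt (G n *v b1) = pt d"
        then obtain c where "c > 0" "d = c *\<^sub>R (G n *v b1)" using parallel_pos[of d "G n *v b1"] \<open>d \<in> bd\<close> we(3) bdD by metis
        then show False using n h0 by simp
      next
        assume "pt (G n *v b3) = pt d"
        then obtain c where "c > 0" "d = c *\<^sub>R (G n *v b3)" using parallel_pos[of d "G n *v b3"] \<open>d \<in> bd\<close> we(4) bdD by metis
        then show False using n h0 by simp
      qed
    qed
    have "pt j \<noteq> pt w" if j: "j \<in> bd" "wf (g n ` L) \<bullet> j = 0" for j
    proof
      assume "pt j = pt w"
      then obtain d where "d = b1 \<or> d = b3" "pt j = pt d" using False by metis
      moreover from this obtain c where "c > 0" "j = c *\<^sub>R d" using parallel_pos[of j d] j b bdD by metis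
      ultimately show False using j wall_ends_pos[OF we(6) ne] by auto
    qed
    then show ?thesis using we by blast
  qed
  then obtain M j1 j2 where M: "M \<in> BG" and j: "j1 \<in> bd" "j2 \<in> bd" "pt j1 \<noteq> pt j2" "wf M \<bullet> j1 = 0" "wf M \<bullet> j2 = 0"
    "pt j1 \<noteq> pt w" "pt j2 \<noteq> pt w" by blast
  define u where "u v n = matrix_inv (G n) *v v" for v n
  have Gu: "G n *v u v n = v" for n v by (simp add: u_def matrix_inv_mult_vec[OF lift_invertible[OF z(2)]])
  have ubd: "u v n \<in> bd \<longleftrightarrow> v \<in> bd" for v n unfolding u_def by (rule lift_inv_bd[OF z(2)])
  define \<Xi> where "\<Xi> n = G n *v top s0" for n
  have fXi: "n1 n * (h1 n \<bullet> \<Xi> n) = s0" "n3 n * (h3 n \<bullet> \<Xi> n) = 1" for n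
    using z(14)[of "top s0" n] z(15)[of "top s0" n] f_top[of s0] by (auto simp: \<Xi>_def)
  then have Xinz: "h1 n \<bullet> \<Xi> n > 0" "h3 n \<bullet> \<Xi> n > 0" for n
    using z(12)[of n] z(13)[of n] s0 by (metis zero_less_mult_pos zero_less_one)+
  define \<tau> where "\<tau> n = n1 n / n3 n" for n
  have taupos: "\<tau> n > 0" for n using z(12,13) by (simp add: \<tau>_def)
  have cu: "coord (u v n) = \<tau> n * ((h1 n \<bullet> v) / (h3 n \<bullet> v))" for v n
    using z(14)[of "u v n" n] z(15)[of "u v n" n] by (simp add: coord_def Gu \<tau>_def)
  have s0eq: "s0 = \<tau> n * ((h1 n \<bullet> \<Xi> n) / (h3 n \<bullet> \<Xi> n))" for n
  proof -
    have "\<tau> n * ((h1 n \<bullet> \<Xi> n) / (h3 n \<bullet> \<Xi> n)) = (n1 n * (h1 n \<bullet> \<Xi> n)) / (n3 n * (h3 n \<bullet> \<Xi> n))" by (simp add: \<tau>_def)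
    then show ?thesis by (simp add: fXi)
  qed
  have Xlim: "\<Xi> \<longlonglongrightarrow> x" using z(3) by (simp add: \<Xi>_def[abs_def])
  have hX: "(\<lambda>n. h1 n \<bullet> \<Xi> n) \<longlonglongrightarrow> H \<bullet> x" "(\<lambda>n. h3 n \<bullet> \<Xi> n) \<longlonglongrightarrow> H \<bullet> x"
    by (intro tendsto_inner z Xlim)+
  have Hx: "H \<bullet> x > 0" using Hpos z by blast
  have culim: "(\<lambda>n. coord (u v n)) \<longlonglongrightarrow> s0" if v: "v \<in> bd" "pt v \<noteq> pt w" for v
  proof -
    have "coord (u v n) = s0 * (((h1 n \<bullet> v) / (h3 n \<bullet> v)) * ((h3 n \<bullet> \<Xi> n) / (h1 n \<bullet> \<Xi> n)))" for n
      using Xinz[of n] by (subst s0eq[of n]) (simp add: cu)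
    moreover have "(\<lambda>n. s0 * (((h1 n \<bullet> v) / (h3 n \<bullet> v)) * ((h3 n \<bullet> \<Xi> n) / (h1 n \<bullet> \<Xi> n)))) \<longlonglongrightarrow>
        s0 * (((H \<bullet> v) / (H \<bullet> v)) * ((H \<bullet> x) / (H \<bullet> x)))"
      using Hpos[OF v] Hx by (intro tendsto_mult tendsto_divide tendsto_const hlim hX) auto
    ultimately show ?thesis using Hpos[OF v] Hx by simp
  qed
  define X where "X n v v' = (h1 n \<bullet> v) * (h3 n \<bullet> v') - (h1 n \<bullet> v') * (h3 n \<bullet> v)" for n v v'
  have diff: "\<tau> n * ((h1 n \<bullet> v) / (h3 n \<bullet> v)) - \<tau> n * ((h1 n \<bullet> v') / (h3 n \<bullet> v')) = \<tau> n * X n v v' / ((h3 n \<bullet> v) * (h3 n \<bullet> v'))"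
    if "h3 n \<bullet> v > 0" "h3 n \<bullet> v' > 0" for n v v'
    using that by (simp add: X_def field_simps)
  \<comment> \<open>Both functionals kill the image of the pole, so their cross product is a
    multiple of \<open>P n\<close>.\<close>
  have "\<exists>\<mu>. \<forall>v v'. X n v v' = \<mu> * (P n \<bullet> cross3 v v')" for n
  proof -
    have "h1 n \<bullet> P n = 0" "h3 n \<bullet> P n = 0" using z(14)[of b2 n] z(15)[of b2 n] z(12)[of n] z(13)[of n] dual by (auto simp: z(8))
    moreover have "P n \<noteq> 0" using z(9)[of n] lift_nonzero[OF z(2)] b_nonzero by (simp add: z(8))
    ultimately obtain \<mu> where "cross3 (h1 n) (h3 n) = \<mu> *\<^sub>R P n" using cross3_parallel by blast
    then have "X n v v' = \<mu> * (P n \<bullet> cross3 v v')" for v v'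
      using cross3_dot_cross3[of "h1 n" "h3 n" v v'] by (simp add: X_def)
    then show ?thesis by blast
  qed
  then obtain \<mu> where \<mu>: "\<And>n v v'. X n v v' = \<mu> n * (P n \<bullet> cross3 v v')" by metis
  \<comment> \<open>The quotient of the distance from an end of the pulled-back gap to
    \<open>s0\<close> by the size of the gap, with the common scalars removed; this is what
    \<open>ratio\<close> verifies.\<close>
  define R where "R v v' n = \<bar>P n \<bullet> cross3 (\<Xi> n) v\<bar> * (h3 n \<bullet> v') / (\<bar>P n \<bullet> cross3 j1 j2\<bar> * (h3 n \<bullet> \<Xi> n))" for v v' n
  have Plim: "(\<lambda>n. P n \<bullet> cross3 j1 j2) \<longlonglongrightarrow> w \<bullet> cross3 j1 j2" by (intro tendsto_inner z tendsto_const)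
  have wj: "w \<bullet> cross3 j1 j2 \<noteq> 0" using not_coplanar[OF j(1,2) z(5)] j by (simp add: inner_commute)
  have Rlim: "\<exists>B. \<forall>\<^sub>F n in sequentially. R v v' n < B" for v v'
  proof -
    have "(\<lambda>n. cross3 (\<Xi> n) v) \<longlonglongrightarrow> cross3 x v"
      using bounded_bilinear.tendsto[OF bilinear_conv_bounded_bilinear[THEN iffD1, OF bilinear_cross] Xlim tendsto_const] .
    then have "R v v' \<longlonglongrightarrow> \<bar>w \<bullet> cross3 x v\<bar> * (H \<bullet> v') / (\<bar>w \<bullet> cross3 j1 j2\<bar> * (H \<bullet> x))"
      unfolding R_def[abs_def] using wj Hx
      by (intro tendsto_divide tendsto_mult tendsto_rabs tendsto_inner Plim z hlim hX tendsto_const) auto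
    then have "\<forall>\<^sub>F n in sequentially. R v v' n < \<bar>w \<bullet> cross3 x v\<bar> * (H \<bullet> v') / (\<bar>w \<bullet> cross3 j1 j2\<bar> * (H \<bullet> x)) + 1"
      by (rule order_tendstoD) simp
    then show ?thesis by blast
  qed
  obtain B1 B2 where B12: "\<forall>\<^sub>F n in sequentially. R j1 j2 n < B1" "\<forall>\<^sub>F n in sequentially. R j2 j1 n < B2"
    using Rlim by metis
  \<comment> \<open>The lower bound 1 only ensures that \<open>1 / B\<close> is a positive
    constant.\<close>
  define B where "B = max 1 (max B1 B2)"
  have Pev: "\<forall>\<^sub>F n in sequentially. P n \<bullet> cross3 j1 j2 \<noteq> 0"
    using tendsto_imp_eventually_ne[OF Plim wj] .
  show ?thesis
  proof (rule exI[of _ "1 / B"], intro conjI allI impI)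
    show "1 / B > 0" by (simp add: B_def)
    fix \<epsilon> :: real assume eps: "\<epsilon> > 0"
    have near: "\<forall>\<^sub>F n in sequentially. \<bar>coord (u v n) - s0\<bar> < \<epsilon>" if "v \<in> bd" "pt v \<noteq> pt w" for v
      using tendstoD[OF culim[OF that] eps] by (simp add: dist_real_def)
    have "\<forall>\<^sub>F n in sequentially. (h1 n \<bullet> j1 > 0 \<and> h3 n \<bullet> j1 > 0) \<and> (h1 n \<bullet> j2 > 0 \<and> h3 n \<bullet> j2 > 0) \<and>
        \<bar>coord (u j1 n) - s0\<bar> < \<epsilon> \<and> \<bar>coord (u j2 n) - s0\<bar> < \<epsilon> \<and> P n \<bullet> cross3 j1 j2 \<noteq> 0 \<and> R j1 j2 n < B1 \<and> R j2 j1 n < B2"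
      by (intro eventually_conj hev near B12 Pev j)
    then obtain n where n: "h1 n \<bullet> j1 > 0" "h3 n \<bullet> j1 > 0" "h1 n \<bullet> j2 > 0" "h3 n \<bullet> j2 > 0"
        "\<bar>coord (u j1 n) - s0\<bar> < \<epsilon>" "\<bar>coord (u j2 n) - s0\<bar> < \<epsilon>" "P n \<bullet> cross3 j1 j2 \<noteq> 0" "R j1 j2 n < B1" "R j2 j1 n < B2"
      using eventually_happens'[OF sequentially_bot] by blast
    define u1 u2 where "u1 = u j1 n" and "u2 = u j2 n"
    have ub: "u1 \<in> bd" "u2 \<in> bd" using ubd j by (auto simp: u1_def u2_def)
    have fu: "f1 \<bullet> u1 > 0" "f3 \<bullet> u1 > 0" "f1 \<bullet> u2 > 0" "f3 \<bullet> u2 > 0"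
      using z(14)[of u1 n] z(15)[of u1 n] z(14)[of u2 n] z(15)[of u2 n] z(12)[of n] z(13)[of n] n
      by (auto simp: u1_def u2_def Gu)
    have upt: "pt u1 \<noteq> pt u2" using lift_pt_eq[OF z(2)[of n], of u1 u2] ub bdD j by (simp add: u1_def u2_def Gu)
    obtain g' where g': "g' \<in> \<Delta>" "g n \<circ> g' = id" using inv_in[OF z(1)] by blast
    \<comment> \<open>The pulled-back geodesic, whose ends are \<open>u1\<close> and
      \<open>u2\<close>.\<close>
    define N where "N = g' ` M"
    have N: "N \<in> BG" "g n ` N = M" using BG_image g' M by (simp_all only: N_def image_comp g'(2) image_id id_apply)
    obtain c where c: "c > 0" "\<And>v. wf M \<bullet> (G n *v v) = c * (wf N \<bullet> v)"
      using wall_image[OF N(1) z(1)[of n] z(2)[of n]] N(2) by auto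
    have wu: "wf N \<bullet> u1 = 0" "wf N \<bullet> u2 = 0" using c(2)[of u1] c(2)[of u2] c(1) j by (auto simp: u1_def u2_def Gu)
    have "N \<noteq> L"
    proof
      assume "N = L"
      then have "f2 \<bullet> u1 = 0" using wu f2 by simp
      then have "u1 = (f1 \<bullet> u1) *\<^sub>R b1 + (f3 \<bullet> u1) *\<^sub>R b3" using expand[of u1] by simp
      then show False using axis_C[OF fu(1,2)] ub bdD by auto
    qed
    note NL = N(1) this
    have cne: "coord u1 \<noteq> coord u2" using coord_ends_distinct[OF NL ub(1) wu(1) ub(2) wu(2) upt] .
    have ratio: "\<bar>coord (u v n) - s0\<bar> = \<bar>coord u1 - coord u2\<bar> * R v v' n"
      if v: "v = j1 \<and> v' = j2 \<or> v = j2 \<and> v' = j1" for v v'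
    proof -
      have h: "h3 n \<bullet> v > 0" "h3 n \<bullet> v' > 0" using v n by auto
      have "\<bar>s0 - coord (u v n)\<bar> = \<bar>\<tau> n * X n (\<Xi> n) v / ((h3 n \<bullet> \<Xi> n) * (h3 n \<bullet> v))\<bar>"
        unfolding cu by (subst s0eq[of n], subst diff) (use h Xinz in auto)
      also have "\<dots> = \<tau> n * \<bar>\<mu> n\<bar> * \<bar>P n \<bullet> cross3 (\<Xi> n) v\<bar> / ((h3 n \<bullet> \<Xi> n) * (h3 n \<bullet> v))"
        using h Xinz[of n] taupos[of n] by (simp add: \<mu> abs_mult)
      finally have 1: "\<bar>s0 - coord (u v n)\<bar> = \<tau> n * \<bar>\<mu> n\<bar> * \<bar>P n \<bullet> cross3 (\<Xi> n) v\<bar> / ((h3 n \<bullet> \<Xi> n) * (h3 n \<bullet> v))" .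
      have "\<bar>coord u1 - coord u2\<bar> = \<bar>\<tau> n * X n j1 j2 / ((h3 n \<bullet> j1) * (h3 n \<bullet> j2))\<bar>"
        unfolding u1_def u2_def cu using n by (subst diff) auto
      also have "\<dots> = \<tau> n * \<bar>\<mu> n\<bar> * \<bar>P n \<bullet> cross3 j1 j2\<bar> / ((h3 n \<bullet> j1) * (h3 n \<bullet> j2))"
        using n taupos[of n] by (simp add: \<mu> abs_mult)
      also have "(h3 n \<bullet> j1) * (h3 n \<bullet> j2) = (h3 n \<bullet> v) * (h3 n \<bullet> v')" using v by (auto simp: mult.commute)
      finally have 2: "\<bar>coord u1 - coord u2\<bar> = \<tau> n * \<bar>\<mu> n\<bar> * \<bar>P n \<bullet> cross3 j1 j2\<bar> / ((h3 n \<bullet> v) * (h3 n \<bullet> v'))" .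
      have "\<bar>coord u1 - coord u2\<bar> * R v v' n = \<tau> n * \<bar>\<mu> n\<bar> * \<bar>P n \<bullet> cross3 (\<Xi> n) v\<bar> / ((h3 n \<bullet> \<Xi> n) * (h3 n \<bullet> v))"
        unfolding 2 R_def using h n(7) Xinz[of n] by (simp add: mult.commute mult.left_commute)
      then show ?thesis using 1 by (simp add: abs_minus_commute)
    qed
    define d where "d = max \<bar>coord u1 - s0\<bar> \<bar>coord u2 - s0\<bar>"
    define p q where "p = min (coord u1) (coord u2)" and "q = max (coord u1) (coord u2)"
    have pq: "p < q" "q - p = \<bar>coord u1 - coord u2\<bar>" using cne by (auto simp: p_def q_def)
    have "\<bar>coord u1 - s0\<bar> \<le> (q - p) * B" "\<bar>coord u2 - s0\<bar> \<le> (q - p) * B"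
    proof -
      have "\<bar>coord u1 - s0\<bar> = (q - p) * R j1 j2 n" "\<bar>coord u2 - s0\<bar> = (q - p) * R j2 j1 n"
        using ratio[of j1 j2] ratio[of j2 j1] pq(2) by (auto simp: u1_def u2_def)
      moreover have "R j1 j2 n \<le> B" "R j2 j1 n \<le> B" using n(8,9) by (auto simp: B_def)
      ultimately show "\<bar>coord u1 - s0\<bar> \<le> (q - p) * B" "\<bar>coord u2 - s0\<bar> \<le> (q - p) * B"
        using pq(1) by (auto intro!: mult_left_mono)
    qed
    then have dB: "d \<le> (q - p) * B" by (simp add: d_def)
    show "\<exists>d p q. 0 < d \<and> d < \<epsilon> \<and> s0 - d \<le> p \<and> p < q \<and> q \<le> s0 + d \<and> 1 / B * d \<le> q - p \<and> 0 < p \<and>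
      (\<exists>M\<in>BG. M \<noteq> L \<and> (\<forall>s. p < s \<and> s < q \<longrightarrow> wf M \<bullet> top s < 0))"
    proof (rule exI[of _ d], rule exI[of _ p], rule exI[of _ q], intro conjI bexI[of _ N])
      show "0 < d" using cne by (auto simp: d_def)
      show "d < \<epsilon>" using n(5,6) by (simp add: d_def u1_def u2_def)
      show "s0 - d \<le> p" "q \<le> s0 + d" by (auto simp: d_def p_def q_def)
      show "1 / B * d \<le> q - p" using dB by (simp add: B_def pos_divide_le_eq)
      show p0: "0 < p" using fu by (simp add: p_def coord_def)
      show "\<forall>s. p < s \<and> s < q \<longrightarrow> wf N \<bullet> top s < 0"
      proof (intro allI impI)
        fix s assume s: "p < s \<and> s < q"
        then have "s > 0" using p0 by linarith
        show "wf N \<bullet> top s < 0"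
        proof (cases "coord u1 < coord u2")
          case True
          then show ?thesis using gap_iff[OF NL ub(1) wu(1) ub(2) wu(2) True \<open>s > 0\<close>] s by (simp add: p_def q_def)
        next
          case False
          then have lt: "coord u2 < coord u1" using cne by simp
          then show ?thesis using gap_iff[OF NL ub(2) wu(2) ub(1) wu(1) lt \<open>s > 0\<close>] s by (simp add: p_def q_def)
        qed
      qed
    qed (use pq NL in auto)
  qed
qed

end

section \<open>Porous subsets of the real line are null sets\<close>

definition porous_at :: "real set \<Rightarrow> real \<Rightarrow> real \<Rightarrow> bool" where
  "porous_at S \<rho> x \<longleftrightarrow> (\<forall>\<epsilon>>0. \<exists>d p q. 0 < d \<and> d < \<epsilon> \<and> x - d \<le> p \<and> p < q \<and> q \<le> x + d \<and> \<rho> * d \<le> q - p \<and>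
     {p<..<q} \<inter> S = {})"

text \<open>By Vitali's theorem disjoint balls inside \<open>U\<close> cover \<open>T\<close> up to
  a null set. Each has length \<open>2 r\<close> and contains a hole of length at least
  \<open>\<rho> r\<close> free of \<open>T\<close>, so deleting the holes removes at least the
  fraction \<open>\<rho> / 2\<close> of the covered measure.\<close>

lemma porous_shrink:
  fixes T :: "real set"
  assumes \<rho>: "0 < \<rho>" "\<rho> \<le> 1" and T: "\<And>x. x \<in> T \<Longrightarrow> porous_at T \<rho> x"
    and U: "open U" "T \<subseteq> U" "U \<in> lmeasurable"
  obtains V where "V \<in> lmeasurable" "T \<subseteq> V" "measure lebesgue V \<le> (1 - \<rho> / 2) * measure lebesgue U"
proof -
  define K where "K = {(x, d, p, q). x \<in> T \<and> 0 < d \<and> ball x d \<subseteq> U \<and> x - d \<le> p \<and> p < q \<and> q \<le> x + d \<and>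
     \<rho> * d \<le> q - p \<and> {p<..<q} \<inter> T = {}}"
  define a r p q where "a = (fst :: real \<times> real \<times> real \<times> real \<Rightarrow> real)"
    and "r = (\<lambda>i :: real \<times> real \<times> real \<times> real. fst (snd i))"
    and "p = (\<lambda>i :: real \<times> real \<times> real \<times> real. fst (snd (snd i)))"
    and "q = (\<lambda>i :: real \<times> real \<times> real \<times> real. snd (snd (snd i)))"
  have K: "a i \<in> T \<and> 0 < r i \<and> ball (a i) (r i) \<subseteq> U \<and> a i - r i \<le> p i \<and> p i < q i \<and> q i \<le> a i + r i \<and>
      \<rho> * r i \<le> q i - p i \<and> {p i<..<q i} \<inter> T = {}" if "i \<in> K" for i
    using that by (auto simp: K_def a_def r_def p_def q_def)
  have fine: "\<exists>i. i \<in> K \<and> x \<in> ball (a i) (r i) \<and> r i < \<delta>" if x: "x \<in> T" and d: "0 < \<delta>" for x \<delta>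
  proof -
    obtain e where e: "e > 0" "ball x e \<subseteq> U" using U x open_contains_ball by blast
    have "0 < min \<delta> e" using d e by simp
    then obtain d p' q' where dpq: "0 < d" "d < min \<delta> e" "x - d \<le> p'" "p' < q'" "q' \<le> x + d" "\<rho> * d \<le> q' - p'"
      "{p'<..<q'} \<inter> T = {}" using T[OF x] unfolding porous_at_def by meson
    have "ball x d \<subseteq> U" using e dpq by auto
    then have "(x, d, p', q') \<in> K" using dpq x by (simp add: K_def)
    then show ?thesis using dpq by (intro exI[of _ "(x, d, p', q')"]) (simp add: a_def r_def)
  qed
  obtain I where I: "countable I" "I \<subseteq> K" "pairwise (\<lambda>i j. disjnt (ball (a i) (r i)) (ball (a j) (r j))) I"
    "negligible (T - (\<Union>i \<in> I. ball (a i) (r i)))"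
    by (rule Vitali_covering_theorem_balls[of T K a r, OF fine]) blast+
  define W where "W = (\<Union>i\<in>I. ball (a i) (r i))"
  define Z where "Z = (\<Union>i\<in>I. {p i<..<q i})"
  have sub: "{p i<..<q i} \<subseteq> ball (a i) (r i)" if "i \<in> I" for i
  proof -
    have "i \<in> K" using that I(2) by blast
    from K[OF this] show ?thesis by (auto simp: dist_real_def)
  qed
  have ZW: "Z \<subseteq> W" "W \<subseteq> U" using sub K I unfolding Z_def W_def by blast+
  have sets: "W \<in> sets lebesgue" "Z \<in> sets lebesgue"
    unfolding W_def Z_def using I(1) by (auto intro!: sets.countable_UN'')
  have lm: "W \<in> lmeasurable" "Z \<in> lmeasurable"
    using fmeasurableI2[OF U(3) ZW(2) sets(1)] fmeasurableI2[OF U(3) subset_trans[OF ZW] sets(2)] by auto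
  have dW: "disjoint_family_on (\<lambda>i. ball (a i) (r i)) I"
    using I(3) by (auto simp: disjoint_family_on_def pairwise_def disjnt_def)
  have dZ: "disjoint_family_on (\<lambda>i. {p i<..<q i}) I"
    unfolding disjoint_family_on_def
  proof (intro ballI impI)
    fix i j assume ij: "i \<in> I" "j \<in> I" "i \<noteq> j"
    then have "ball (a i) (r i) \<inter> ball (a j) (r j) = {}" using dW by (auto simp: disjoint_family_on_def)
    then show "{p i<..<q i} \<inter> {p j<..<q j} = {}" using sub ij by blast
  qed
  have eW: "emeasure lebesgue W = (\<integral>\<^sup>+i. emeasure lebesgue (ball (a i) (r i)) \<partial>count_space I)"
    unfolding W_def by (rule emeasure_UN_countable) (use I(1) dW in auto)
  have eZ: "emeasure lebesgue Z = (\<integral>\<^sup>+i. emeasure lebesgue {p i<..<q i} \<partial>count_space I)"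
    unfolding Z_def by (rule emeasure_UN_countable) (use I(1) dZ in auto)
  have "ennreal (\<rho> / 2) * emeasure lebesgue W = (\<integral>\<^sup>+i. ennreal (\<rho> / 2) * emeasure lebesgue (ball (a i) (r i)) \<partial>count_space I)"
    unfolding eW by (rule nn_integral_cmult[symmetric]) simp
  also have "\<dots> \<le> emeasure lebesgue Z"
    unfolding eZ
  proof (rule nn_integral_mono)
    fix i assume "i \<in> space (count_space I)"
    then have i: "i \<in> K" using I by auto
    have "ball (a i) (r i) = {a i - r i<..<a i + r i}" by (rule ball_eq_greaterThanLessThan)
    then have "emeasure lebesgue (ball (a i) (r i)) = ennreal (2 * r i)" using K[OF i] by simp
    moreover have "emeasure lebesgue {p i<..<q i} = ennreal (q i - p i)" using K[OF i] by simp
    moreover have "ennreal (\<rho> / 2) * ennreal (2 * r i) = ennreal (\<rho> * r i)" using \<rho> by (simp flip: ennreal_mult')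
    ultimately show "ennreal (\<rho> / 2) * emeasure lebesgue (ball (a i) (r i)) \<le> emeasure lebesgue {p i<..<q i}"
      using K[OF i] by (simp add: ennreal_leI)
  qed
  finally have "ennreal (\<rho> / 2) * ennreal (measure lebesgue W) \<le> ennreal (measure lebesgue Z)"
    using lm by (simp add: emeasure_eq_measure2)
  then have "ennreal ((\<rho> / 2) * measure lebesgue W) \<le> ennreal (measure lebesgue Z)"
    using \<rho> by (simp flip: ennreal_mult')
  then have le: "(\<rho> / 2) * measure lebesgue W \<le> measure lebesgue Z" by (subst (asm) ennreal_le_iff) auto
  define N where "N = T - W"
  have N: "N \<in> lmeasurable" "measure lebesgue N = 0" using I(4)
    unfolding N_def W_def by (auto intro: negligible_imp_measurable negligible_imp_measure0)
  have "measure lebesgue (W - Z) = measure lebesgue W - measure lebesgue Z"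
    using lm ZW by (intro measurable_measure_Diff) auto
  moreover have WZ: "W - Z \<in> lmeasurable" using lm by blast
  moreover have "measure lebesgue ((W - Z) \<union> N) \<le> measure lebesgue (W - Z) + measure lebesgue N"
    using WZ N by (intro measure_Un_le) (auto dest: fmeasurableD)
  ultimately have fin: "measure lebesgue ((W - Z) \<union> N) \<le> (1 - \<rho> / 2) * measure lebesgue W" using le N by (simp add: algebra_simps)
  have "measure lebesgue W \<le> measure lebesgue U" using ZW U lm by (intro measure_mono_fmeasurable) auto
  then have "(1 - \<rho> / 2) * measure lebesgue W \<le> (1 - \<rho> / 2) * measure lebesgue U" using \<rho> by (intro mult_left_mono) auto
  moreover have "T \<subseteq> (W - Z) \<union> N" using K I unfolding N_def Z_def by blast
  ultimately show thesis
    using that[of "(W - Z) \<union> N"] fmeasurable.Un[OF WZ N(1)] fin by linarith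
qed

text \<open>If the infimum \<open>m\<close> over open supersets were positive, a superset of measure
  below \<open>m / (1 - \<rho> / 2)\<close> could be shrunk below \<open>m\<close> and slightly
  enlarged to an open set again. Boundedness supplies a superset of finite measure to start
  from.\<close>

lemma uniformly_porous_negligible:
  fixes T :: "real set"
  assumes \<rho>: "0 < \<rho>" "\<rho> \<le> 1" and T: "\<And>x. x \<in> T \<Longrightarrow> porous_at T \<rho> x" and bd: "bounded T"
  shows "negligible T"
proof -
  define \<M> where "\<M> = {measure lebesgue U |U. open U \<and> T \<subseteq> U \<and> U \<in> lmeasurable}"
  obtain B where B: "T \<subseteq> ball 0 B" using bd bounded_subset_ballD by blast
  then have "measure lebesgue (ball (0::real) B) \<in> \<M>"
    unfolding \<M>_def by (intro CollectI exI[of _ "ball 0 B"]) auto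
  then have ne: "\<M> \<noteq> {}" by blast
  have bdd: "bdd_below \<M>" unfolding \<M>_def by (intro bdd_belowI[of _ 0]) auto
  define m where "m = Inf \<M>"
  have m0: "m \<ge> 0" unfolding m_def using ne by (intro cInf_greatest) (auto simp: \<M>_def)
  have "m = 0"
  proof (rule ccontr)
    assume "m \<noteq> 0"
    then have mp: "m > 0" using m0 by simp
    have c: "1 - \<rho> / 2 > 0" "1 - \<rho> / 2 < 1" using \<rho> by auto
    then have "m < m / (1 - \<rho> / 2)" using mp by (simp add: less_divide_eq)
    then obtain z where "z \<in> \<M>" "z < m / (1 - \<rho> / 2)"
      using ne bdd by (auto simp: m_def cInf_less_iff)
    then obtain U where U: "open U" "T \<subseteq> U" "U \<in> lmeasurable" "measure lebesgue U < m / (1 - \<rho> / 2)"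
      by (auto simp: \<M>_def)
    obtain V where V: "V \<in> lmeasurable" "T \<subseteq> V" "measure lebesgue V \<le> (1 - \<rho> / 2) * measure lebesgue U"
      using porous_shrink[OF \<rho> T U(1,2,3)] by metis
    have "measure lebesgue V < m" using V(3) U(4) c by (simp add: pos_less_divide_eq mult.commute)
    define e where "e = m - measure lebesgue V"
    have "e > 0" using \<open>measure lebesgue V < m\<close> by (simp add: e_def)
    then obtain V' where V': "open V'" "V \<subseteq> V'" "V' - V \<in> lmeasurable" "emeasure lebesgue (V' - V) < ennreal e"
      using sets_lebesgue_outer_open[OF fmeasurableD[OF V(1)]] by metis
    have "measure lebesgue (V' - V) < e"
      using V'(3,4) \<open>e > 0\<close> by (simp add: emeasure_eq_measure2 ennreal_less_iff)
    moreover have eq: "V' = V \<union> (V' - V)" using V'(2) by blast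
    moreover have "measure lebesgue (V \<union> (V' - V)) \<le> measure lebesgue V + measure lebesgue (V' - V)"
      using V(1) V'(3) by (intro measure_Un_le) (auto dest: fmeasurableD)
    ultimately have "measure lebesgue V' < m" by (simp add: e_def)
    have "V \<union> (V' - V) \<in> lmeasurable" using V(1) V'(3) by (rule fmeasurable.Un)
    then have "V' \<in> lmeasurable" by (subst eq)
    then have "measure lebesgue V' \<in> \<M>" using V V' unfolding \<M>_def by (intro CollectI exI[of _ V']) auto
    then have "m \<le> measure lebesgue V'" unfolding m_def using bdd by (rule cInf_lower)
    then show False using \<open>measure lebesgue V' < m\<close> by simp
  qed
  show ?thesis unfolding negligible_outer
  proof (intro allI impI)
    fix e :: real assume "e > 0"
    then have "Inf \<M> < e" using \<open>m = 0\<close> by (simp add: m_def)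
    then obtain z where "z \<in> \<M>" "z < e" using ne bdd by (auto simp: cInf_less_iff)
    then show "\<exists>U. T \<subseteq> U \<and> U \<in> lmeasurable \<and> measure lebesgue U < e" by (auto simp: \<M>_def)
  qed
qed

lemma porous_at_mono: "porous_at S \<rho> x \<Longrightarrow> T \<subseteq> S \<Longrightarrow> \<rho>' \<le> \<rho> \<Longrightarrow> porous_at T \<rho>' x"
  unfolding porous_at_def
proof (intro allI impI)
  fix \<epsilon> :: real
  assume *: "\<forall>\<epsilon>>0. \<exists>d p q. 0 < d \<and> d < \<epsilon> \<and> x - d \<le> p \<and> p < q \<and> q \<le> x + d \<and> \<rho> * d \<le> q - p \<and> {p<..<q} \<inter> S = {}"
    and TS: "T \<subseteq> S" and r: "\<rho>' \<le> \<rho>" and "\<epsilon> > 0"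
  then obtain d p q where d: "0 < d" "d < \<epsilon>" "x - d \<le> p" "p < q" "q \<le> x + d" "\<rho> * d \<le> q - p" "{p<..<q} \<inter> S = {}"
    by meson
  have "\<rho>' * d \<le> \<rho> * d" using r d by (intro mult_right_mono) auto
  then have "\<rho>' * d \<le> q - p" using d(6) by linarith
  with d TS show "\<exists>d p q. 0 < d \<and> d < \<epsilon> \<and> x - d \<le> p \<and> p < q \<and> q \<le> x + d \<and> \<rho>' * d \<le> q - p \<and> {p<..<q} \<inter> T = {}"
    by blast
qed

text \<open>The constant may vary with the point, so the set is sorted by a lower bound
  \<open>1 / Suc k\<close> for the constant and by size. Subsets of porous sets keep their
  holes.\<close>

lemma porous_negligible:
  fixes S :: "real set"
  assumes "\<And>x. x \<in> S \<Longrightarrow> \<exists>\<rho>>0. porous_at S \<rho> x"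
  shows "negligible S"
proof -
  define T where "T k = {x\<in>S. porous_at S (1 / real (Suc k)) x \<and> \<bar>x\<bar> \<le> real k}" for k
  have "negligible (T k)" for k
  proof (rule uniformly_porous_negligible[of "1 / real (Suc k)"])
    fix x assume "x \<in> T k"
    then have "porous_at S (1 / real (Suc k)) x" by (simp add: T_def)
    moreover have "T k \<subseteq> S" by (auto simp: T_def)
    ultimately show "porous_at (T k) (1 / real (Suc k)) x" by (rule porous_at_mono) simp
  next
    show "bounded (T k)" unfolding bounded_iff by (intro exI[of _ "real k"]) (auto simp: T_def)
  qed auto
  then have "negligible (\<Union>k. T k)" by (rule negligible_Union_nat)
  moreover have "S \<subseteq> (\<Union>k. T k)"
  proof
    fix x assume x: "x \<in> S"
    then obtain \<rho> where \<rho>: "\<rho> > 0" "porous_at S \<rho> x" using assms by blast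
    obtain k1 where k1: "1 / \<rho> \<le> real k1" using real_arch_simple by blast
    obtain k2 where k2: "\<bar>x\<bar> \<le> real k2" using real_arch_simple by blast
    define k where "k = max k1 k2"
    have "1 / \<rho> \<le> real (Suc k)" "\<bar>x\<bar> \<le> real k" using k1 k2 by (auto simp: k_def)
    then have "1 / real (Suc k) \<le> \<rho>" using \<rho>(1) by (simp add: field_simps)
    then have "x \<in> T k" using porous_at_mono[OF \<rho>(2) subset_refl] x \<open>\<bar>x\<bar> \<le> real k\<close> by (simp add: T_def)
    then show "x \<in> (\<Union>k. T k)" by blast
  qed
  ultimately show ?thesis by (rule negligible_subset)
qed

text \<open>Disjoint nonempty open intervals form a countable family, so the measure of their union
  is the integral of the lengths against counting measure. Finiteness of that integral is absolute
  summability.\<close>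

lemma disjoint_intervals_has_sum:
  fixes lo hi :: "'i \<Rightarrow> real"
  assumes ab: "a \<le> b" and I: "\<And>i. i \<in> I \<Longrightarrow> lo i < hi i \<and> a \<le> lo i \<and> hi i \<le> b"
    and disj: "\<And>i j. i \<in> I \<Longrightarrow> j \<in> I \<Longrightarrow> i \<noteq> j \<Longrightarrow> {lo i<..<hi i} \<inter> {lo j<..<hi j} = {}"
    and null: "negligible ({a<..<b} - (\<Union>i\<in>I. {lo i<..<hi i}))"
  shows "((\<lambda>i. hi i - lo i) has_sum (b - a)) I"
proof -
  define J where "J i = {lo i<..<hi i}" for i
  have inj: "inj_on J I"
  proof (rule inj_onI, rule ccontr)
    fix i j assume ij: "i \<in> I" "j \<in> I" "J i = J j" "i \<noteq> j"
    then have "{lo i<..<hi i} = {}" using disj[of i j] by (auto simp: J_def)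
    then show False using I[OF ij(1)] by simp
  qed
  have "countable (J ` I)"
  proof (rule countable_disjoint_open_subsets)
    show "pairwise disjnt (J ` I)" using disj by (auto simp: pairwise_def disjnt_def J_def)
  qed (auto simp: J_def)
  then have cI: "countable I" using inj by (rule countable_image_inj_on)
  have dis: "disjoint_family_on J I" using disj by (auto simp: disjoint_family_on_def J_def)
  have em: "emeasure lebesgue (\<Union>i\<in>I. J i) = (\<integral>\<^sup>+i. emeasure lebesgue (J i) \<partial>count_space I)"
    by (rule emeasure_UN_countable[OF _ cI dis]) (simp add: J_def)
  have sub: "(\<Union>i\<in>I. J i) \<subseteq> {a<..<b}" using I by (fastforce simp: J_def)
  have Jset: "(\<Union>i\<in>I. J i) \<in> sets lebesgue" using cI by (auto intro!: sets.countable_UN'' simp: J_def)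
  have "emeasure lebesgue ({a<..<b} - (\<Union>i\<in>I. J i)) = 0"
    using null negligible_iff_emeasure0 by (auto simp: J_def negligible_iff_null_sets null_setsD1)
  then have "emeasure lebesgue {a<..<b} = emeasure lebesgue (\<Union>i\<in>I. J i)"
    using Jset sub by (intro emeasure_eq_AE AE_I[of _ _ "{a<..<b} - (\<Union>i\<in>I. J i)"]) auto
  moreover have "emeasure lebesgue {a<..<b} = ennreal (b - a)" using ab by simp
  ultimately have "(\<integral>\<^sup>+i. emeasure lebesgue (J i) \<partial>count_space I) = ennreal (b - a)" using em by simp
  moreover have "(\<integral>\<^sup>+i. emeasure lebesgue (J i) \<partial>count_space I) = (\<integral>\<^sup>+i. ennreal (hi i - lo i) \<partial>count_space I)"
    using I by (intro nn_integral_cong) (auto simp: J_def less_imp_le)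
  ultimately have nn: "(\<integral>\<^sup>+i. ennreal (hi i - lo i) \<partial>count_space I) = ennreal (b - a)" by simp
  have pos: "AE i in count_space I. 0 \<le> hi i - lo i" using I by (auto simp: AE_count_space less_imp_le)
  have "integrable (count_space I) (\<lambda>i. hi i - lo i)"
    using nn pos by (intro integrableI_nonneg) auto
  then have abs: "Infinite_Set_Sum.abs_summable_on (\<lambda>i. hi i - lo i) I" by (simp add: Infinite_Set_Sum.abs_summable_on_def)
  have "infsetsum (\<lambda>i. hi i - lo i) I = b - a"
    unfolding infsetsum_def using integral_eq_nn_integral[OF _ pos] nn ab by simp
  then have "infsum (\<lambda>i. hi i - lo i) I = b - a" using infsetsum_infsum[OF abs] by simp
  moreover have "(\<lambda>i. hi i - lo i) summable_on I"
    using abs abs_summable_equivalent abs_summable_summable by blast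
  ultimately show ?thesis using has_sum_infsum by fastforce
qed

section \<open>The stabilizer of a boundary geodesic\<close>

lemma PGL3_simps: "carrier PGL3 = {proj_map A |A. invertible A}" "x \<otimes>\<^bsub>PGL3\<^esub> y = x \<circ> y" "\<one>\<^bsub>PGL3\<^esub> = id"
  by (simp_all add: PGL3_def)

lemma funpow_inverse:
  fixes f g :: "'a \<Rightarrow> 'a"
  assumes "f \<circ> g = id"
  shows "f ^^ n \<circ> g ^^ n = id"
proof (induction n)
  case (Suc n)
  have "f ^^ Suc n \<circ> g ^^ Suc n = f ^^ n \<circ> (f \<circ> g) \<circ> g ^^ n"
    unfolding funpow_Suc_right[of n f] funpow.simps(2)[of n g] by (simp only: comp_assoc)
  then show ?case using Suc assms by (simp only: comp_id)
qed (simp only: funpow.simps comp_id)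

lemma inv_PGL3_eq:
  assumes "b \<in> carrier PGL3" "a \<circ> b = id" "b \<circ> a = id"
  shows "inv\<^bsub>PGL3\<^esub> a = b"
  unfolding m_inv_def PGL3_simps
proof (rule the_equality)
  show "b \<in> {proj_map A |A. invertible A} \<and> a \<circ> b = id \<and> b \<circ> a = id" using assms by (simp add: PGL3_simps)
  fix y assume y: "y \<in> {proj_map A |A. invertible A} \<and> a \<circ> y = id \<and> y \<circ> a = id"
  have "y = (b \<circ> a) \<circ> y" using assms by simp
  also have "\<dots> = b \<circ> (a \<circ> y)" by (simp add: comp_assoc)
  finally show "y = b" using y by simp
qed

context surface
begin

lemma carrier_PGL3: "a \<in> \<Delta> \<Longrightarrow> a \<in> carrier PGL3"
proof -
  assume "a \<in> \<Delta>"
  then obtain A where A: "lifts C a A" using ex_lift by blast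
  then show ?thesis using lift_invertible[OF A] by (auto simp: PGL3_simps lifts_def)
qed

text \<open>In the arc length \<open>ln s\<close> of the chord this is the translation by
  \<open>ln r\<close>.\<close>

definition translates :: "real^3 \<Rightarrow> real^3 \<Rightarrow> (rp2 \<Rightarrow> rp2) \<Rightarrow> real \<Rightarrow> bool" where
  "translates u v b r \<longleftrightarrow> b \<in> \<Delta> \<and> r > 0 \<and> (\<forall>s>0. b (pt (s *\<^sub>R u + v)) = pt ((r * s) *\<^sub>R u + v))"

lemma translates_comp: "translates u v b r \<Longrightarrow> translates u v b' r' \<Longrightarrow> translates u v (b \<circ> b') (r * r')"
  by (auto simp: translates_def comp_in mult.assoc)

lemma translates_funpow: "translates u v b r \<Longrightarrow> translates u v (b ^^ n) (r ^ n)"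
proof (induction n)
  case 0 then show ?case by (simp add: translates_def id_in[unfolded id_def])
next
  case (Suc n) then show ?case using translates_comp[of u v b r "b ^^ n" "r ^ n"] by (simp only: funpow.simps power_Suc)
qed

lemma translates_inverse:
  assumes "translates u v b r" "b' \<in> \<Delta>" "b' \<circ> b = id"
  shows "translates u v b' (1 / r)"
  unfolding translates_def
proof (intro conjI allI impI)
  have r: "r > 0" using assms by (simp add: translates_def)
  then show "1 / r > 0" by simp
  show "b' \<in> \<Delta>" by fact
  fix s :: real assume "s > 0"
  then have "b (pt ((s / r) *\<^sub>R u + v)) = pt (s *\<^sub>R u + v)" using assms(1) r by (simp add: translates_def)
  then have "b' (pt (s *\<^sub>R u + v)) = (b' \<circ> b) (pt ((s / r) *\<^sub>R u + v))" by simp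
  then show "b' (pt (s *\<^sub>R u + v)) = pt ((1 / r * s) *\<^sub>R u + v)" using assms(3) by simp
qed

lemma translates_1:
  assumes "translates u v b 1" "u + v \<in> C"
  shows "b = id"
proof -
  have "b (pt (1 *\<^sub>R u + v)) = pt ((1 * 1) *\<^sub>R u + v)" using assms(1) unfolding translates_def by (metis zero_less_one)
  then show ?thesis using assms free[of b "pt (u + v)"] by (simp add: translates_def)
qed

end

context framed
begin

lemma framed_self: "framed C Ft \<Delta> L a A b1 b2 b3 f1 f2 f3 l1 l2 l3" by unfold_locales

lemma eigen_translates:
  assumes "b \<in> \<Delta>" "lifts C b G" "G *v b1 = x *\<^sub>R b1" "G *v b3 = z *\<^sub>R b3" "x > 0" "z > 0"
  shows "translates b1 b3 b (x / z)"
  unfolding translates_def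
proof (intro conjI allI impI)
  show "b \<in> \<Delta>" "x / z > 0" using assms by auto
  fix s :: real assume "s > 0"
  then have C: "s *\<^sub>R b1 + b3 \<in> C" using axis_C[of s 1] by simp
  have "b (pt (s *\<^sub>R b1 + b3)) = pt ((s * x) *\<^sub>R b1 + z *\<^sub>R b3)"
    using lift_pt[OF assms(2) C_nonzero[OF C]] assms(3,4) by (simp add: matrix_vector_right_distrib matrix_vector_mult_scaleR)
  also have "\<dots> = pt ((s * x / z) *\<^sub>R b1 + b3)" using \<open>s > 0\<close> assms by (intro pencil_scale) auto
  finally show "b (pt (s *\<^sub>R b1 + b3)) = pt ((x / z * s) *\<^sub>R b1 + b3)" by (simp add: mult.commute)
qed

lemma a_translates: "translates b1 b3 a (l1 / l3)"
  by (rule eigen_translates[OF a(1) A eig(1,3) lpos(1,3)])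

text \<open>The element \<open>b\<close> has a frame of its own over the same \<open>L\<close>. Its
  two boundary eigenvectors lie in the plane of \<open>L\<close>, so they are \<open>b1\<close> and
  \<open>b3\<close> up to order and scaling: \<open>b\<close> fixes both ends.\<close>

lemma stabilizer_translates:
  assumes b: "b \<in> \<Delta>" "b ` L = L"
  shows "\<exists>r. translates b1 b3 b r"
proof (cases "b = id")
  case True
  then show ?thesis by (intro exI[of _ 1]) (simp add: translates_def id_in)
next
  case False
  then obtain G e1 e2 e3 h1 h2 h3 x y z where "framed C Ft \<Delta> L b G e1 e2 e3 h1 h2 h3 x y z"
    using ex_frame[OF L b(1) _ b(2)] by metis
  then interpret g: framed C Ft \<Delta> L b G e1 e2 e3 h1 h2 h3 x y z .
  have "f2 \<bullet> e1 = 0" "f2 \<bullet> e3 = 0" using g.dual g.f2 f2 by auto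
  then have "e1 = (f1 \<bullet> e1) *\<^sub>R b1 + (f3 \<bullet> e1) *\<^sub>R b3" "e3 = (f1 \<bullet> e3) *\<^sub>R b1 + (f3 \<bullet> e3) *\<^sub>R b3"
    using expand[of e1] expand[of e3] by auto
  then have pts: "pt e1 = pt b1 \<or> pt e1 = pt b3" "pt e3 = pt b1 \<or> pt e3 = pt b3"
    using chord_ends[OF framed.b[OF framed_self] pt_b_distinct(2)] g.b by blast+
  have e: "G *v (c *\<^sub>R e1) = x *\<^sub>R (c *\<^sub>R e1)" "G *v (c *\<^sub>R e3) = z *\<^sub>R (c *\<^sub>R e3)" for c
    using g.eig by (simp_all add: matrix_vector_mult_scaleR mult.commute)
  have par: "\<exists>c. p = c *\<^sub>R q" if "pt q = pt p" "p \<in> bd" "q \<in> bd" for p q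
    using that pt_eq_iff[of p q] bdD by metis
  show ?thesis
  proof (cases "pt e1 = pt b1")
    case True
    then have "pt e3 = pt b3" using pts g.pt_b_distinct by metis
    then obtain c c' where "b1 = c *\<^sub>R e1" "b3 = c' *\<^sub>R e3" using par True framed.b[OF framed_self] g.b by metis
    then have "G *v b1 = x *\<^sub>R b1" "G *v b3 = z *\<^sub>R b3" using e by auto
    then show ?thesis using eigen_translates[OF b(1) g.A] g.lpos by blast
  next
    case False
    then have "pt e1 = pt b3" "pt e3 = pt b1" using pts g.pt_b_distinct by metis+
    then obtain c c' where "b3 = c *\<^sub>R e1" "b1 = c' *\<^sub>R e3" using par framed.b[OF framed_self] g.b by metis
    then have "G *v b3 = x *\<^sub>R b3" "G *v b1 = z *\<^sub>R b1" using e by auto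
    then show ?thesis using eigen_translates[OF b(1) g.A] g.lpos by blast
  qed
qed

lemma pencil_C: "s > 0 \<Longrightarrow> s *\<^sub>R b1 + b3 \<in> C"
  using axis_C[of s 1] by simp

lemma translates_unique: "translates b1 b3 b r \<Longrightarrow> translates b1 b3 b r' \<Longrightarrow> r = r'"
proof -
  assume t: "translates b1 b3 b r" "translates b1 b3 b r'"
  then have r: "r > 0" "r' > 0" by (auto simp: translates_def)
  have "pt ((r * 1) *\<^sub>R b1 + b3) = pt ((r' * 1) *\<^sub>R b1 + b3)" using t unfolding translates_def by (metis zero_less_one)
  then show ?thesis using pt_pencil_eq_iff[OF b pt_b_distinct(2) r] by simp
qed

text \<open>All these elements move one point of a compact arc of \<open>L\<close> to another point
  of that arc, so proper discontinuity applies.\<close>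

lemma translations_finite:
  "finite {b. \<exists>r. translates b1 b3 b r \<and> 1 \<le> r \<and> r \<le> R}"
proof -
  define K where "K = pt ` (\<lambda>s. s *\<^sub>R b1 + b3) ` {1..R}"
  have sub: "(\<lambda>s. s *\<^sub>R b1 + b3) ` {1..R} \<subseteq> C" using pencil_C by force
  have "compact K" unfolding K_def
    using sub zero_notin_C
    by (intro compact_continuous_image continuous_on_pt continuous_intros) auto
  moreover have "K \<subseteq> \<Omega>" using sub by (auto simp: K_def)
  ultimately have fin: "finite {b \<in> \<Delta>. b ` K \<inter> K \<noteq> {}}" by (rule proper)
  have "{b. \<exists>r. translates b1 b3 b r \<and> 1 \<le> r \<and> r \<le> R} \<subseteq> {b \<in> \<Delta>. b ` K \<inter> K \<noteq> {}}"
  proof clarify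
    fix b r assume t: "translates b1 b3 b r" "1 \<le> r" "r \<le> R"
    then have "b (pt (1 *\<^sub>R b1 + b3)) = pt ((r * 1) *\<^sub>R b1 + b3)" unfolding translates_def by (metis zero_less_one)
    moreover have inK: "pt (s *\<^sub>R b1 + b3) \<in> K" if "s \<in> {1..R}" for s
      unfolding K_def image_image using that by (rule imageI)
    have "pt (1 *\<^sub>R b1 + b3) \<in> K" "pt ((r * 1) *\<^sub>R b1 + b3) \<in> K"
      by (rule inK, use t in simp)+
    ultimately have "b ` K \<inter> K \<noteq> {}" by (metis IntI empty_iff imageI)
    then show "b \<in> \<Delta> \<and> b ` K \<inter> K \<noteq> {}" using t by (simp add: translates_def)
  qed
  then show ?thesis using fin by (rule finite_subset)
qed

text \<open>The multipliers form a discrete group of positive reals, so the stabilizer is generated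
  by the element \<open>b0\<close> with the least multiplier above 1: dividing by the largest
  possible power of it leaves a multiplier in the interval from 1 to \<open>r0\<close>, hence 1, and
  the action is free. Primitivity identifies \<open>b0\<close> with \<open>a\<close>.\<close>

lemma stabilizer_generated:
  assumes prim: "primitive \<Delta> a" and b: "b \<in> \<Delta>" "b ` L = L"
  shows "b \<in> generate PGL3 {a}"
proof -
  define R where "R = l1 / l3"
  have R: "R > 1" using l by (simp add: R_def)
  define F where "F = {b. \<exists>r. translates b1 b3 b r \<and> 1 < r \<and> r \<le> R}"
  have "F \<subseteq> {b. \<exists>r. translates b1 b3 b r \<and> 1 \<le> r \<and> r \<le> R}" by (auto simp: F_def less_imp_le)
  then have finF: "finite F" using translations_finite by (rule finite_subset)
  have aF: "a \<in> F" using a_translates R by (auto simp: F_def R_def)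
  define tr where "tr b = (THE r. translates b1 b3 b r)" for b
  have tr: "tr b = r" if "translates b1 b3 b r" for b r
    unfolding tr_def using that translates_unique by (intro the_equality) auto
  obtain b0 where b0: "b0 \<in> F" "\<And>b. b \<in> F \<Longrightarrow> tr b0 \<le> tr b"
    using finF aF arg_min_if_finite[of F tr] by (metis empty_iff linorder_not_less)
  define r0 where "r0 = tr b0"
  have t0: "translates b1 b3 b0 r0" and r0: "1 < r0" "r0 \<le> R" using b0(1) tr by (auto simp: F_def r0_def)
  have b0D: "b0 \<in> \<Delta>" using t0 by (simp add: translates_def)
  obtain c0 where c0: "c0 \<in> \<Delta>" "b0 \<circ> c0 = id" "c0 \<circ> b0 = id" using inv_in[OF b0D] by blast
  have tc: "translates b1 b3 c0 (1 / r0)" by (rule translates_inverse[OF t0 c0(1,3)])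
  have pos: "\<exists>n. b = b0 ^^ n" if t: "translates b1 b3 b r" "r \<ge> 1" for b r
  proof -
    obtain n where n: "r0 ^ n \<le> r" "r < r0 ^ Suc n"
    proof -
      obtain k where "r < r0 ^ k" using real_arch_pow r0 by blast
      define k0 where "k0 = (LEAST k. r < r0 ^ k)"
      have k0: "r < r0 ^ k0" unfolding k0_def using \<open>r < r0 ^ k\<close> by (rule LeastI)
      then have "k0 \<noteq> 0" using t(2) by (intro notI) simp
      then obtain n where n: "k0 = Suc n" using not0_implies_Suc by blast
      then have "\<not> r < r0 ^ n" using not_less_Least[of n "\<lambda>k. r < r0 ^ k"] by (simp add: k0_def)
      then show thesis using that[of n] k0 n by simp
    qed
    define c where "c = b \<circ> c0 ^^ n"
    have tcn: "translates b1 b3 c (r / r0 ^ n)"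
      using translates_comp[OF t(1) translates_funpow[OF tc, of n]] by (simp add: c_def power_one_over)
    have r0n: "r0 ^ n > 0" using r0 by simp
    have one: "r / r0 ^ n = 1"
    proof (rule ccontr)
      assume "r / r0 ^ n \<noteq> 1"
      then have "1 < r / r0 ^ n" "r / r0 ^ n < r0" using n r0n by (auto simp: field_simps)
      then have "c \<in> F" "tr c < r0" using tcn r0 tr[OF tcn] by (auto simp: F_def)
      then show False using b0(2)[of c] by (simp add: r0_def)
    qed
    have "translates b1 b3 c 1" using tcn by (simp only: one)
    then have cid: "c = id" using pencil_C[of 1] by (intro translates_1[of b1 b3]) auto
    have inv: "c0 ^^ n \<circ> b0 ^^ n = id" for n using c0(3) by (rule funpow_inverse)
    have "b0 ^^ n = c \<circ> b0 ^^ n" using cid by simp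
    also have "\<dots> = b \<circ> (c0 ^^ n \<circ> b0 ^^ n)" by (simp add: c_def comp_assoc)
    finally show ?thesis using inv by auto
  qed
  obtain n where "a = b0 ^^ n" using pos[OF a_translates] R by (auto simp: R_def)
  then have "n = 1" using prim b0D by (auto simp: primitive_def)
  then have ab0: "a = b0" using \<open>a = b0 ^^ n\<close> by simp
  have gena: "a \<in> generate PGL3 {a}" by (rule generate.incl) simp
  have "inv\<^bsub>PGL3\<^esub> a = c0" unfolding ab0 using c0 carrier_PGL3 by (intro inv_PGL3_eq) auto
  then have genc: "c0 \<in> generate PGL3 {a}" using generate.inv[of a "{a}" PGL3] by simp
  have genpow: "x ^^ n \<in> generate PGL3 {a}" if "x \<in> generate PGL3 {a}" for x and n
  proof (induction n)
    case 0 show ?case using generate.one[of PGL3 "{a}"] by (simp only: PGL3_simps funpow.simps)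
  next
    case (Suc n) then show ?case using generate.eng[OF that Suc] by (simp only: PGL3_simps funpow.simps)
  qed
  obtain r where r: "translates b1 b3 b r" using stabilizer_translates[OF b] by blast
  show ?thesis
  proof (cases "r \<ge> 1")
    case True
    then show ?thesis using pos[OF r] genpow[OF gena] ab0 by auto
  next
    case False
    obtain b' where b': "b' \<in> \<Delta>" "b \<circ> b' = id" "b' \<circ> b = id" using inv_in[OF b(1)] by blast
    have "r > 0" using r by (simp add: translates_def)
    then have "1 / r \<ge> 1" using False by simp
    then obtain n where n: "b' = b0 ^^ n" using pos[OF translates_inverse[OF r b'(1,3)]] by blast
    have inv: "b0 ^^ n \<circ> c0 ^^ n = id" for n using c0(2) by (rule funpow_inverse)
    have "b = b \<circ> (b' \<circ> c0 ^^ n)" using inv[of n] n by simp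
    also have "\<dots> = (b \<circ> b') \<circ> c0 ^^ n" by (simp only: comp_assoc)
    also have "\<dots> = c0 ^^ n" using b' by simp
    finally show ?thesis using genpow[OF genc] by simp
  qed
qed

text \<open>Unlike \<open>translates\<close>, this also records the action on \<open>b2\<close>,
  which is needed to move the boundary curve over \<open>L\<close>.\<close>

lemma generated_diagonal:
  assumes "h \<in> generate PGL3 {a}"
  shows "h \<in> \<Delta> \<and> (\<exists>G x y z. lifts C h G \<and> G *v b1 = x *\<^sub>R b1 \<and> G *v b2 = y *\<^sub>R b2 \<and> G *v b3 = z *\<^sub>R b3 \<and>
    x > 0 \<and> y > 0 \<and> z > 0)"
  using assms
proof (induction rule: generate.induct)
  case one
  have "lifts C id (mat 1)"
    by (auto simp: lifts_def proj_map_def fun_eq_iff Rep_rp2_inverse)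
  then have "lifts C id (mat 1) \<and> mat 1 *v b1 = 1 *\<^sub>R b1 \<and> mat 1 *v b2 = 1 *\<^sub>R b2 \<and> mat 1 *v b3 = 1 *\<^sub>R b3 \<and>
      (1::real) > 0 \<and> (1::real) > 0 \<and> (1::real) > 0" by simp
  then show ?case using id_in unfolding PGL3_simps by blast
next
  case (incl h)
  then show ?case using a(1) A eig lpos by auto
next
  case (inv h)
  then have h: "h = a" by simp
  obtain c where c: "c \<in> \<Delta>" "a \<circ> c = id" "c \<circ> a = id" using inv_in[OF a(1)] by blast
  have ic: "inv\<^bsub>PGL3\<^esub> h = c" unfolding h using c carrier_PGL3 by (intro inv_PGL3_eq) auto
  let ?G = "matrix_inv A"
  have invA: "invertible A" by (rule lift_invertible[OF A])
  have AI: "A ** ?G = mat 1" by (simp add: matrix_eq matrix_inv_mult_vec[OF invA] flip: matrix_vector_mul_assoc)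
  have "det A * det ?G = 1" using arg_cong[OF AI, of det] by (simp add: det_mul)
  then have dG: "det ?G > 0" using A by (metis lifts_def zero_less_mult_pos zero_less_one)
  then have invG: "invertible ?G" by (simp add: invertible_det_nz)
  have "c = proj_map ?G"
  proof
    fix p obtain v where v: "v \<noteq> 0" "p = pt v" using pt_cases by blast
    have nz: "?G *v v \<noteq> 0" using invertible_mult_eq_0[OF invG] v by blast
    have "a (pt (?G *v v)) = pt v" using lift_pt[OF A nz] by (simp add: matrix_inv_mult_vec[OF invA])
    then have "c (pt v) = (c \<circ> a) (pt (?G *v v))" by simp
    then show "c p = proj_map ?G p" using c v proj_map_pt[OF invG v(1)] by simp
  qed
  moreover have "(*v) ?G ` C = C"
  proof (intro subset_antisym subsetI)
    fix v assume "v \<in> C"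
    then show "v \<in> (*v) ?G ` C" using lift_C[OF A] matrix_inv_mult_vec[OF invA] by (intro image_eqI[of _ _ "A *v v"]) auto
  qed (use lift_inv_C[OF A] in auto)
  ultimately have "lifts C c ?G" using dG by (simp add: lifts_def)
  moreover have "?G *v b1 = (1/l1) *\<^sub>R b1" "?G *v b2 = (1/l2) *\<^sub>R b2" "?G *v b3 = (1/l3) *\<^sub>R b3"
  proof -
    have *: "?G *v v = (1/k) *\<^sub>R v" if "A *v v = k *\<^sub>R v" "k > 0" for v k
    proof -
      have "v = ?G *v (k *\<^sub>R v)" using matrix_inv_mult_vec(2)[OF invA, of v] that by simp
      then have "v = k *\<^sub>R (?G *v v)" by (simp add: matrix_vector_mult_scaleR)
      then have "(1/k) *\<^sub>R v = (1/k) *\<^sub>R (k *\<^sub>R (?G *v v))" by simp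
      then show ?thesis using that by simp
    qed
    show "?G *v b1 = (1/l1) *\<^sub>R b1" "?G *v b2 = (1/l2) *\<^sub>R b2" "?G *v b3 = (1/l3) *\<^sub>R b3"
      using * eig lpos by auto
  qed
  ultimately have "lifts C c ?G \<and> ?G *v b1 = (1/l1) *\<^sub>R b1 \<and> ?G *v b2 = (1/l2) *\<^sub>R b2 \<and> ?G *v b3 = (1/l3) *\<^sub>R b3 \<and>
    1 / l1 > 0 \<and> 1 / l2 > 0 \<and> 1 / l3 > 0" using lpos by simp
  then show ?case unfolding ic using c(1) by blast
next
  case (eng h1 h2)
  from eng.IH obtain G x y z G' x' y' z' where
    G: "lifts C h1 G" "G *v b1 = x *\<^sub>R b1" "G *v b2 = y *\<^sub>R b2" "G *v b3 = z *\<^sub>R b3" "x > 0" "y > 0" "z > 0" and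
    G': "lifts C h2 G'" "G' *v b1 = x' *\<^sub>R b1" "G' *v b2 = y' *\<^sub>R b2" "G' *v b3 = z' *\<^sub>R b3" "x' > 0" "y' > 0" "z' > 0"
    and D: "h1 \<in> \<Delta>" "h2 \<in> \<Delta>" by blast
  have "lifts C (h1 \<circ> h2) (G ** G')"
  proof -
    have det: "det (G ** G') > 0" using G G' by (simp add: lifts_def det_mul)
    then have invGG: "invertible (G ** G')" by (simp add: invertible_det_nz)
    have "h1 \<circ> h2 = proj_map (G ** G')"
    proof
      fix p obtain v where v: "v \<noteq> 0" "p = pt v" using pt_cases by blast
      show "(h1 \<circ> h2) p = proj_map (G ** G') p"
        using v proj_map_pt[OF invGG v(1)] lift_pt[OF G'(1) v(1)] lift_pt[OF G(1), of "G' *v v"] lift_nonzero[OF G'(1)]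
        by (simp add: matrix_vector_mul_assoc)
    qed
    moreover have "(*v) (G ** G') ` C = (*v) G ` (*v) G' ` C"
      by (simp add: image_image matrix_vector_mul_assoc)
    ultimately show ?thesis using det G(1) G'(1) by (simp add: lifts_def)
  qed
  moreover have "(G ** G') *v b1 = (x * x') *\<^sub>R b1" "(G ** G') *v b2 = (y * y') *\<^sub>R b2" "(G ** G') *v b3 = (z * z') *\<^sub>R b3"
    using G G' by (simp_all add: matrix_vector_mult_scaleR mult.commute flip: matrix_vector_mul_assoc)
  ultimately have "lifts C (h1 \<circ> h2) (G ** G') \<and> (G ** G') *v b1 = (x * x') *\<^sub>R b1 \<and> (G ** G') *v b2 = (y * y') *\<^sub>R b2 \<and>
      (G ** G') *v b3 = (z * z') *\<^sub>R b3 \<and> x * x' > 0 \<and> y * y' > 0 \<and> z * z' > 0" using G G' by simp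
  then show ?case using comp_in[OF D] unfolding PGL3_simps by blast
qed

lemma generated_L: "h \<in> generate PGL3 {a} \<Longrightarrow> h ` L = L"
proof (induction rule: generate.induct)
  case (inv h)
  then have h: "h = a" by simp
  obtain c where c: "c \<in> \<Delta>" "a \<circ> c = id" "c \<circ> a = id" using inv_in[OF a(1)] by blast
  have ic: "inv\<^bsub>PGL3\<^esub> h = c" unfolding h using c carrier_PGL3 by (intro inv_PGL3_eq) auto
  have "c ` a ` L = L" using c(3) by (simp add: image_comp)
  then show ?case using a(3) ic by simp
next
  case (eng h1 h2) then show ?case by (simp only: PGL3_simps image_comp[symmetric])
qed (use a(3) in \<open>auto simp: PGL3_simps\<close>)

text \<open>The image is, after scaling, a boundary vector over the translated parameter on the side
  of the surface, and by \<open>below_C\<close> there is only one.\<close>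

lemma top_diagonal:
  assumes "lifts C h G" "G *v b1 = x *\<^sub>R b1" "G *v b2 = y *\<^sub>R b2" "G *v b3 = z *\<^sub>R b3" "x > 0" "y > 0" "z > 0" "s > 0"
  shows "\<exists>c>0. G *v top s = c *\<^sub>R top ((x / z) * s)"
proof -
  have Gt: "G *v top s = (s * x) *\<^sub>R b1 + (lam s * y) *\<^sub>R b2 + z *\<^sub>R b3"
    by (simp add: top_def matrix_vector_right_distrib matrix_vector_mult_scaleR assms)
  define s' where "s' = (x / z) * s"
  have s': "s' > 0" using assms by (simp add: s'_def)
  have "(1/z) *\<^sub>R (G *v top s) \<in> bd" using lift_bd[OF assms(1)] top_bd assms by (intro bd_scale) auto
  moreover have eq: "(1/z) *\<^sub>R (G *v top s) = s' *\<^sub>R b1 + (lam s * y / z) *\<^sub>R b2 + b3"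
    unfolding Gt using assms by (simp add: scaleR_add_right s'_def)
  ultimately have bd': "s' *\<^sub>R b1 + (lam s * y / z) *\<^sub>R b2 + b3 \<in> bd" by simp
  have "lam s * y / z > 0" using lam_pos assms by simp
  have "lam s * y / z = lam s'"
  proof (rule ccontr)
    assume "lam s * y / z \<noteq> lam s'"
    then consider "lam s * y / z < lam s'" | "lam s' < lam s * y / z" by linarith
    then show False
    proof cases
      case 1
      then have "s' *\<^sub>R b1 + (lam s * y / z) *\<^sub>R b2 + b3 \<in> C"
        using top_bd[OF s'] bdD \<open>lam s * y / z > 0\<close> by (intro below_C[OF s', of "lam s'"]) (auto simp: top_def)
      then show False using bd' bdD by blast
    next
      case 2
      then have "top s' \<in> C" unfolding top_def using bd' bdD lam_pos[OF s']
        by (intro below_C[OF s', of "lam s * y / z"]) auto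
      then show False using top_bd[OF s'] bdD by blast
    qed
  qed
  then have "(1/z) *\<^sub>R (G *v top s) = top s'" unfolding eq by (simp add: top_def)
  then have "z *\<^sub>R ((1/z) *\<^sub>R (G *v top s)) = z *\<^sub>R top s'" by simp
  then show ?thesis using assms s'_def by (intro exI[of _ z]) simp
qed

end

section \<open>Endpoints and the gap function\<close>

lemma cross3_lift:
  "(G *v u) \<bullet> cross3 (G *v y) (G *v v) = det G * (u \<bullet> cross3 y v)" for G :: "real^3^3"
proof -
  have "(G *v u) \<bullet> cross3 (G *v y) (G *v v) = u \<bullet> (transpose G *v cross3 (G *v y) (G *v v))"
    by (metis inner_commute transpose_inner transpose_transpose)
  then show ?thesis using cross_matrix_mult[of G y v] by simp
qed

context surface
begin

text \<open>\<open>M\<close> is directed from \<open>q\<close> to \<open>p\<close> with the surface on its left.\<close>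

definition ends :: "rp2 set \<Rightarrow> rp2 \<Rightarrow> rp2 \<Rightarrow> bool" where
  "ends M p q \<longleftrightarrow> (\<exists>u v. u \<in> bd \<and> v \<in> bd \<and> p = pt u \<and> q = pt v \<and> pt u \<noteq> pt v \<and> wf M \<bullet> u = 0 \<and> wf M \<bullet> v = 0 \<and>
     (\<forall>y. wf M \<bullet> y > 0 \<longrightarrow> u \<bullet> cross3 y v > 0))"

lemma ends_image:
  assumes M: "M \<in> BG" and e: "ends M p q" and g: "g \<in> \<Delta>"
  shows "ends (g ` M) (g p) (g q)"
proof -
  obtain u v where uv: "u \<in> bd" "v \<in> bd" "p = pt u" "q = pt v" "pt u \<noteq> pt v" "wf M \<bullet> u = 0" "wf M \<bullet> v = 0"
    "\<And>y. wf M \<bullet> y > 0 \<Longrightarrow> u \<bullet> cross3 y v > 0" using e by (auto simp: ends_def)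
  obtain G where G: "lifts C g G" using ex_lift g by blast
  obtain c where c: "c > 0" "\<And>x. wf (g ` M) \<bullet> (G *v x) = c * (wf M \<bullet> x)" using wall_image[OF M g G] by blast
  show ?thesis unfolding ends_def
  proof (intro exI conjI allI impI)
    show "G *v u \<in> bd" "G *v v \<in> bd" using uv(1,2) lift_bd[OF G] by simp_all
    show "g p = pt (G *v u)" "g q = pt (G *v v)"
      using lift_pt[OF G bdD(3)[OF uv(1)]] lift_pt[OF G bdD(3)[OF uv(2)]] uv(3,4) by simp_all
    show "pt (G *v u) \<noteq> pt (G *v v)" using lift_pt_eq[OF G bdD(3)[OF uv(1)] bdD(3)[OF uv(2)]] uv(5) by simp
    show "wf (g ` M) \<bullet> (G *v u) = 0" "wf (g ` M) \<bullet> (G *v v) = 0" using c(2)[of u] c(2)[of v] uv(6,7) by simp_all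
    fix y assume ypos: "wf (g ` M) \<bullet> y > 0"
    define x where "x = matrix_inv G *v y"
    have y: "y = G *v x" by (simp add: x_def matrix_inv_mult_vec[OF lift_invertible[OF G]])
    have "c * (wf M \<bullet> x) > 0" using ypos c(2)[of x] unfolding y by simp
    then have "wf M \<bullet> x > 0" using c(1) by (simp add: zero_less_mult_iff)
    then have "u \<bullet> cross3 x v > 0" by (rule uv)
    then show "(G *v u) \<bullet> cross3 y (G *v v) > 0" using G unfolding y cross3_lift by (simp add: lifts_def)
  qed
qed

end

context framed
begin

lemma L_point: "p \<in> L \<longleftrightarrow> (\<exists>s>0. p = pt (s *\<^sub>R b1 + b3))"
proof
  assume "p \<in> L"
  moreover have "L = cut f2" using wall_wf[OF L] f2 by (simp add: wall_def)
  ultimately obtain v where v: "v \<in> C" "f2 \<bullet> v = 0" "p = pt v" by (auto simp: cut_def)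
  then have "v = (f1 \<bullet> v) *\<^sub>R b1 + (f3 \<bullet> v) *\<^sub>R b3" using expand[of v] by simp
  then have "p = pt ((f1 \<bullet> v / (f3 \<bullet> v)) *\<^sub>R b1 + b3)" using pencil_scale f_pos_C[OF v(1)] v(3) by metis
  then show "\<exists>s>0. p = pt (s *\<^sub>R b1 + b3)" using f_pos_C[OF v(1)] by (intro exI[of _ "f1 \<bullet> v / (f3 \<bullet> v)"]) simp
next
  assume "\<exists>s>0. p = pt (s *\<^sub>R b1 + b3)"
  then obtain s where "s > 0" "p = pt (s *\<^sub>R b1 + b3)" by blast
  then show "p \<in> L" using mem_L_iff[OF pencil_C] dual by (simp add: inner_add_right)
qed

lemma axis_eq: "axis_of \<Omega> a = L"
  using stabilizer[OF L a] by simp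

lemma closed_length:
  assumes d: "\<And>x y. x \<in> \<Omega> \<Longrightarrow> y \<in> \<Omega> \<Longrightarrow> d x y = \<kappa> * hilbert_dist \<Omega> x y"
  shows "closed_geodesic_length \<Omega> d a = \<kappa> * ln (l1 / l3)"
proof -
  define x where "x = (SOME x. x \<in> axis_of \<Omega> a)"
  have "pt (1 *\<^sub>R b1 + b3) \<in> axis_of \<Omega> a" unfolding axis_eq L_point by (intro exI[of _ 1]) simp
  then have "x \<in> L" unfolding x_def axis_eq[symmetric] by (rule someI)
  then obtain s where s: "s > 0" "x = pt (s *\<^sub>R b1 + b3)" using L_point by blast
  define R where "R = l1 / l3"
  have R: "R > 1" using l by (simp add: R_def)
  have ax: "a x = pt ((R * s) *\<^sub>R b1 + b3)" using a_translates s by (simp add: translates_def R_def)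
  have O: "x \<in> \<Omega>" "a x \<in> \<Omega>" unfolding ax unfolding s(2) using pencil_C s R by auto
  have "x \<noteq> a x" using free[OF a(1) O(1)] a(2) by auto
  then have "closed_geodesic_length \<Omega> d a = d x (a x)"
    unfolding closed_geodesic_length_def Let_def x_def[symmetric]
    by (intro geodesic_length_eq[OF d O]) auto
  also have "\<dots> = \<kappa> * \<bar>ln s - ln (R * s)\<bar>"
  proof -
    have "hilbert_dist \<Omega> x (a x) = \<bar>ln s - ln (R * s)\<bar>"
      unfolding ax unfolding s(2) using hilbert_dist_pencil[OF b pt_b_distinct(2) s(1), of "R * s"] s R by simp
    then show ?thesis using d[OF O] by simp
  qed
  also have "\<bar>ln s - ln (R * s)\<bar> = ln R" using s R by (simp add: ln_mult)
  finally show ?thesis by (simp add: R_def)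
qed

text \<open>The orbit of a boundary vector under \<open>A\<close>, divided by powers of
  \<open>l1\<close>, tends to \<open>b1\<close>, and its \<open>b3\<close> part decays faster than
  its \<open>b2\<close> part. The secants thus tend to the line through \<open>b1\<close> and
  \<open>b2\<close>. Inverse iterates give the tangent at \<open>b3\<close>, so the pole is the
  class of \<open>b2\<close>.\<close>

lemma tangent_b1: "tangent_normal (frontier \<Omega>) (pt b1) = pt (cross3 b1 b2)"
proof -
  define q where "q k = b1 + ((l2 / l1) ^ k * lam 1) *\<^sub>R b2 + (l3 / l1) ^ k *\<^sub>R b3" for k
  have lam: "lam 1 > 0" by (rule lam_pos) simp
  have qb: "q k \<in> bd" for k
  proof (induction k)
    case 0 then show ?case using top_bd[of 1] by (simp add: q_def top_def)
  next
    case (Suc k)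
    then have "(1/l1) *\<^sub>R (A *v q k) \<in> bd" using lpos lift_bd[OF A] by (intro bd_scale) auto
    moreover have "(1/l1) *\<^sub>R (A *v q k) = q (Suc k)" using lpos
      by (simp add: q_def matrix_vector_right_distrib matrix_vector_mult_scaleR eig scaleR_add_right field_simps)
    ultimately show ?case by simp
  qed
  have lims: "(\<lambda>n. (l2 / l1) ^ n) \<longlonglongrightarrow> 0" "(\<lambda>n. (l3 / l1) ^ n) \<longlonglongrightarrow> 0" "(\<lambda>n. (l3 / l2) ^ n) \<longlonglongrightarrow> 0"
    using l lpos by (auto intro!: ratio_power_tendsto_0)
  have "f2 \<bullet> q k = (l2 / l1) ^ k * lam 1" for k by (simp add: q_def inner_add_right dual)
  then have f2q: "f2 \<bullet> q k \<noteq> 0" for k using lam lpos by simp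
  have ne: "pt (q k) \<noteq> pt b1" for k
  proof
    assume "pt (q k) = pt b1"
    then obtain c where "q k = c *\<^sub>R b1" using pt_eq_iff[OF bdD(3)[OF qb] b_nonzero(1)] by blast
    then show False using f2q[of k] dual by simp
  qed
  have "q \<longlonglongrightarrow> b1 + (0 * lam 1) *\<^sub>R b2 + 0 *\<^sub>R b3"
    unfolding q_def[abs_def] by (intro tendsto_add tendsto_scaleR tendsto_mult tendsto_const lims)
  then have "(\<lambda>k. pt (q k)) \<longlonglongrightarrow> pt b1" using b_nonzero by (intro tendsto_pt) auto
  moreover have "(\<lambda>k. pt (cross3 b1 (q k))) \<longlonglongrightarrow> pt (cross3 b1 b2)"
  proof -
    have "cross3 b1 (q k) = (l2 / l1) ^ k *\<^sub>R (lam 1 *\<^sub>R cross3 b1 b2 + (l3 / l2) ^ k *\<^sub>R cross3 b1 b3)" for k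
      using lpos by (simp add: q_def cross_add_right cross_mult_right scaleR_add_right power_divide)
    then have "pt (cross3 b1 (q k)) = pt (lam 1 *\<^sub>R cross3 b1 b2 + (l3 / l2) ^ k *\<^sub>R cross3 b1 b3)" for k
      using lpos by simp
    moreover have "(\<lambda>k. lam 1 *\<^sub>R cross3 b1 b2 + (l3 / l2) ^ k *\<^sub>R cross3 b1 b3) \<longlonglongrightarrow> lam 1 *\<^sub>R cross3 b1 b2 + 0 *\<^sub>R cross3 b1 b3"
      by (intro tendsto_add tendsto_scaleR tendsto_const lims)
    then have "(\<lambda>k. pt (lam 1 *\<^sub>R cross3 b1 b2 + (l3 / l2) ^ k *\<^sub>R cross3 b1 b3)) \<longlonglongrightarrow> pt (lam 1 *\<^sub>R cross3 b1 b2 + 0 *\<^sub>R cross3 b1 b3)"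
      using lam cross3_eq_0_iff[OF b_nonzero(1,2)] pt_b_distinct by (intro tendsto_pt) auto
    ultimately show ?thesis using lam by simp
  qed
  ultimately show ?thesis by (intro secant_limit[OF C1 b(1) qb ne])
qed

lemma tangent_b3: "tangent_normal (frontier \<Omega>) (pt b3) = pt (cross3 b3 b2)"
proof -
  define q where "q k = (l3 / l1) ^ k *\<^sub>R b1 + ((l3 / l2) ^ k * lam 1) *\<^sub>R b2 + b3" for k
  have lam: "lam 1 > 0" by (rule lam_pos) simp
  have qb: "q k \<in> bd" for k
  proof (induction k)
    case 0 then show ?case using top_bd[of 1] by (simp add: q_def top_def)
  next
    case (Suc k)
    then have "l3 *\<^sub>R q k \<in> bd" using lpos by (intro bd_scale) auto
    moreover have "l3 *\<^sub>R q k = A *v q (Suc k)" using lpos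
      by (simp add: q_def matrix_vector_right_distrib matrix_vector_mult_scaleR eig scaleR_add_right field_simps)
    ultimately show ?case using lift_bd[OF A] by simp
  qed
  have lims: "(\<lambda>n. (l2 / l1) ^ n) \<longlonglongrightarrow> 0" "(\<lambda>n. (l3 / l1) ^ n) \<longlonglongrightarrow> 0" "(\<lambda>n. (l3 / l2) ^ n) \<longlonglongrightarrow> 0"
    using l lpos by (auto intro!: ratio_power_tendsto_0)
  have "f2 \<bullet> q k = (l3 / l2) ^ k * lam 1" for k by (simp add: q_def inner_add_right dual)
  then have f2q: "f2 \<bullet> q k \<noteq> 0" for k using lam lpos by simp
  have ne: "pt (q k) \<noteq> pt b3" for k
  proof
    assume "pt (q k) = pt b3"
    then obtain c where "q k = c *\<^sub>R b3" using pt_eq_iff[OF bdD(3)[OF qb] b_nonzero(3)] by blast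
    then show False using f2q[of k] dual by simp
  qed
  have "q \<longlonglongrightarrow> 0 *\<^sub>R b1 + (0 * lam 1) *\<^sub>R b2 + b3"
    unfolding q_def[abs_def] by (intro tendsto_add tendsto_scaleR tendsto_mult tendsto_const lims)
  then have "(\<lambda>k. pt (q k)) \<longlonglongrightarrow> pt b3" using b_nonzero by (intro tendsto_pt) auto
  moreover have "(\<lambda>k. pt (cross3 b3 (q k))) \<longlonglongrightarrow> pt (cross3 b3 b2)"
  proof -
    have "cross3 b3 (q k) = (l3 / l2) ^ k *\<^sub>R (lam 1 *\<^sub>R cross3 b3 b2 + (l2 / l1) ^ k *\<^sub>R cross3 b3 b1)" for k
      using lpos by (simp add: q_def cross_add_right cross_mult_right scaleR_add_right power_divide)
    then have "pt (cross3 b3 (q k)) = pt (lam 1 *\<^sub>R cross3 b3 b2 + (l2 / l1) ^ k *\<^sub>R cross3 b3 b1)" for k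
      using lpos by simp
    moreover have "(\<lambda>k. lam 1 *\<^sub>R cross3 b3 b2 + (l2 / l1) ^ k *\<^sub>R cross3 b3 b1) \<longlonglongrightarrow> lam 1 *\<^sub>R cross3 b3 b2 + 0 *\<^sub>R cross3 b3 b1"
      by (intro tendsto_add tendsto_scaleR tendsto_const lims)
    then have "(\<lambda>k. pt (lam 1 *\<^sub>R cross3 b3 b2 + (l2 / l1) ^ k *\<^sub>R cross3 b3 b1)) \<longlonglongrightarrow> pt (lam 1 *\<^sub>R cross3 b3 b2 + 0 *\<^sub>R cross3 b3 b1)"
      using lam cross3_eq_0_iff[OF b_nonzero(3,2)] pt_b_distinct by (intro tendsto_pt) auto
    ultimately show ?thesis using lam by simp
  qed
  ultimately show ?thesis by (intro secant_limit[OF C1 b(2) qb ne])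
qed

lemma pole_eq: "pole_of \<Omega> a = pt b2"
  unfolding pole_of_def tangent_line_def ar tangent_b1 tangent_b3
proof (rule the_equality)
  have nz: "cross3 b1 b2 \<noteq> 0" "cross3 b3 b2 \<noteq> 0"
    using cross3_eq_0_iff[OF b_nonzero(1,2)] cross3_eq_0_iff[OF b_nonzero(3,2)] pt_b_distinct by auto
  show "pt b2 \<in> polar (pt (cross3 b1 b2)) \<inter> polar (pt (cross3 b3 b2))"
    using nz b_nonzero by (simp add: mem_polar dot_cross_self)
  fix p assume p: "p \<in> polar (pt (cross3 b1 b2)) \<inter> polar (pt (cross3 b3 b2))"
  obtain w where w: "w \<noteq> 0" "p = pt w" using pt_cases by blast
  then have "cross3 b1 b2 \<bullet> w = 0" "cross3 b3 b2 \<bullet> w = 0" using p nz by (auto simp: mem_polar inner_commute)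
  then obtain x y x' y' where w1: "w = x *\<^sub>R b1 + y *\<^sub>R b2" and w3: "w = x' *\<^sub>R b3 + y' *\<^sub>R b2"
    using cross3_kernel[OF b_nonzero(1,2) pt_b_distinct(1)] cross3_kernel[OF b_nonzero(3,2) pt_b_distinct(3)[symmetric]] by blast
  have "f1 \<bullet> w = 0" unfolding w3 using dual by (simp add: inner_add_right)
  moreover have "f3 \<bullet> w = 0" unfolding w1 using dual by (simp add: inner_add_right)
  ultimately have "w = (f2 \<bullet> w) *\<^sub>R b2" using expand[of w] by simp
  then show "p = pt b2" using w pt_eq_iff[OF w(1) b_nonzero(2)] by blast
qed

lemma orth_proj_eq:
  assumes u: "f1 \<bullet> u > 0" "f3 \<bullet> u > 0"
  shows "orth_proj \<Omega> a (pt u) = pt (coord u *\<^sub>R b1 + b3)"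
  unfolding orth_proj_def pole_eq axis_eq
proof (rule the_equality)
  have unz: "u \<noteq> 0" using u by auto
  have cu: "coord u > 0" using u by (simp add: coord_def)
  have eq: "pt (coord u *\<^sub>R b1 + b3) = pt ((f1 \<bullet> u) *\<^sub>R b1 + (f3 \<bullet> u) *\<^sub>R b3)"
    using pencil_scale[OF u, of b1 b3] by (simp add: coord_def)
  have nz: "(f1 \<bullet> u) *\<^sub>R b1 + (f3 \<bullet> u) *\<^sub>R b3 \<noteq> 0" using axis_C[OF u] C_nonzero by blast
  have "(f1 \<bullet> u) *\<^sub>R b1 + (f3 \<bullet> u) *\<^sub>R b3 = (- (f2 \<bullet> u)) *\<^sub>R b2 + 1 *\<^sub>R u" using expand[of u] by (simp add: algebra_simps)
  then have "pt (coord u *\<^sub>R b1 + b3) \<in> line_through (pt b2) (pt u)"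
    unfolding eq mem_line_through[OF b_nonzero(2) unz nz] by blast
  moreover have "pt (coord u *\<^sub>R b1 + b3) \<in> L" using cu L_point by blast
  ultimately show "pt (coord u *\<^sub>R b1 + b3) \<in> closure L \<inter> line_through (pt b2) (pt u)"
    using closure_subset by blast
  fix z assume z: "z \<in> closure L \<inter> line_through (pt b2) (pt u)"
  obtain w where w: "w \<noteq> 0" "z = pt w" using pt_cases by blast
  \<comment> \<open>Points added by the closure still satisfy the linear equation of
    \<open>L\<close>, which singles out one point on the line through the pole and
    \<open>u\<close>.\<close>
  have "f2 \<bullet> w = 0"
  proof -
    have "{w. w \<noteq> 0 \<and> pt w \<in> L} \<subseteq> {w. f2 \<bullet> w = 0}"
    proof clarify
      fix w assume w: "w \<noteq> 0" "pt w \<in> L"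
      then obtain s where s: "s > 0" "pt w = pt (s *\<^sub>R b1 + b3)" using L_point by blast
      then obtain c where "w = c *\<^sub>R (s *\<^sub>R b1 + b3)" using pt_eq_iff[OF w(1) C_nonzero[OF pencil_C[OF s(1)]]] by blast
      then show "f2 \<bullet> w = 0" using dual by (simp add: inner_add_right)
    qed
    then have "closure {w. w \<noteq> 0 \<and> pt w \<in> L} \<subseteq> {w. f2 \<bullet> w = 0}" by (intro closure_minimal) (auto simp: closed_hyperplane)
    then show ?thesis using z w pt_closure_iff[OF w(1), of L] by auto
  qed
  obtain x y where xy: "w = x *\<^sub>R b2 + y *\<^sub>R u" using z w mem_line_through[OF b_nonzero(2) unz w(1)] by auto
  have f: "f1 \<bullet> w = y * (f1 \<bullet> u)" "f3 \<bullet> w = y * (f3 \<bullet> u)" using dual by (simp_all add: xy inner_add_right)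
  have weq: "w = y *\<^sub>R ((f1 \<bullet> u) *\<^sub>R b1 + (f3 \<bullet> u) *\<^sub>R b3)"
    using expand[of w] \<open>f2 \<bullet> w = 0\<close> f by (simp add: scaleR_add_right)
  then have "y \<noteq> 0" using w by auto
  then show "z = pt (coord u *\<^sub>R b1 + b3)" unfolding eq w(2) weq by simp
qed

lemma gap_value:
  assumes "f1 \<bullet> u > 0" "f3 \<bullet> u > 0" "f1 \<bullet> v > 0" "f3 \<bullet> v > 0"
  shows "ln (cross_ratio (attracting a) (orth_proj \<Omega> a (pt u)) (repelling a) (orth_proj \<Omega> a (pt v))) =
    ln (coord v) - ln (coord u)"
proof -
  have "coord u > 0" "coord v > 0" using assms by (simp_all add: coord_def)
  then show ?thesis unfolding orth_proj_eq[OF assms(1,2)] orth_proj_eq[OF assms(3,4)] ar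
    using cross_ratio_pencil[OF b pt_b_distinct(2), of "coord v" "coord u"] by (simp add: ln_div)
qed

lemma triple_b: "b3 \<bullet> cross3 b1 b2 = b1 \<bullet> cross3 b2 b3" "b2 \<bullet> cross3 b3 b1 = b1 \<bullet> cross3 b2 b3"
  by (simp_all add: cross3_simps)

lemma triple_mixed:
  "u \<bullet> cross3 b1 v = ((f3 \<bullet> u) * (f2 \<bullet> v) - (f2 \<bullet> u) * (f3 \<bullet> v)) * (b1 \<bullet> cross3 b2 b3)"
  "u \<bullet> cross3 b3 v = ((f2 \<bullet> u) * (f1 \<bullet> v) - (f1 \<bullet> u) * (f2 \<bullet> v)) * (b1 \<bullet> cross3 b2 b3)"
proof -
  have c: "b2 \<bullet> cross3 b1 b3 = - (b1 \<bullet> cross3 b2 b3)" "b1 \<bullet> cross3 b3 b2 = - (b1 \<bullet> cross3 b2 b3)"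
    by (simp_all add: cross3_simps)
  define u1 u2 u3 v1 v2 v3 where d: "u1 = f1 \<bullet> u" "u2 = f2 \<bullet> u" "u3 = f3 \<bullet> u" "v1 = f1 \<bullet> v" "v2 = f2 \<bullet> v" "v3 = f3 \<bullet> v"
  have u: "u = u1 *\<^sub>R b1 + u2 *\<^sub>R b2 + u3 *\<^sub>R b3" and v: "v = v1 *\<^sub>R b1 + v2 *\<^sub>R b2 + v3 *\<^sub>R b3"
    unfolding d by (rule expand)+
  have "(u1 *\<^sub>R b1 + u2 *\<^sub>R b2 + u3 *\<^sub>R b3) \<bullet> cross3 b1 (v1 *\<^sub>R b1 + v2 *\<^sub>R b2 + v3 *\<^sub>R b3) = (u3 * v2 - u2 * v3) * (b1 \<bullet> cross3 b2 b3)"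
    by (simp add: cross_add_right cross_mult_right inner_add_left inner_add_right dot_cross_self triple_b c algebra_simps)
  then show "u \<bullet> cross3 b1 v = ((f3 \<bullet> u) * (f2 \<bullet> v) - (f2 \<bullet> u) * (f3 \<bullet> v)) * (b1 \<bullet> cross3 b2 b3)"
    by (simp flip: u v d)
  have "(u1 *\<^sub>R b1 + u2 *\<^sub>R b2 + u3 *\<^sub>R b3) \<bullet> cross3 b3 (v1 *\<^sub>R b1 + v2 *\<^sub>R b2 + v3 *\<^sub>R b3) = (u2 * v1 - u1 * v2) * (b1 \<bullet> cross3 b2 b3)"
    by (simp add: cross_add_right cross_mult_right inner_add_left inner_add_right dot_cross_self triple_b c algebra_simps)
  then show "u \<bullet> cross3 b3 v = ((f2 \<bullet> u) * (f1 \<bullet> v) - (f1 \<bullet> u) * (f2 \<bullet> v)) * (b1 \<bullet> cross3 b2 b3)"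
    by (simp flip: u v d)
qed

lemma triple_middle: "b3 \<bullet> cross3 b1 y = (f2 \<bullet> y) * (b1 \<bullet> cross3 b2 b3)" "b1 \<bullet> cross3 y b3 = (f2 \<bullet> y) * (b1 \<bullet> cross3 b2 b3)"
proof -
  show 1: "b3 \<bullet> cross3 b1 y = (f2 \<bullet> y) * (b1 \<bullet> cross3 b2 b3)" using triple_mixed(1)[of b3 y] dual by simp
  have "b1 \<bullet> cross3 y b3 = b3 \<bullet> cross3 b1 y" by (simp add: cross3_simps)
  then show "b1 \<bullet> cross3 y b3 = (f2 \<bullet> y) * (b1 \<bullet> cross3 b2 b3)" using 1 by simp
qed

text \<open>The representatives in \<open>left_of\<close> are taken in the closed half-cone, so they
  are positive multiples of \<open>b3\<close>, \<open>b1\<close> and \<open>p\<close>. The surface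
  being on the left then says that the determinant of the frame is positive.\<close>

lemma ends_L:
  assumes p: "p \<in> Di" and left: "left_of C (repelling a) (attracting a) (pt p)"
  shows "ends L (attracting a) (repelling a)"
proof -
  obtain u v w where uvw: "u \<in> Rep_rp2 (pt b3)" "u \<in> closure C" "v \<in> Rep_rp2 (pt b1)" "v \<in> closure C"
    "w \<in> Rep_rp2 (pt p)" "w \<in> C" "det (vector [u, v, w] :: real^3^3) > 0"
    using left unfolding left_of_def ar by blast
  have pC: "p \<in> C" using p Di_sub D_sub by blast
  obtain x y z where xyz: "u = x *\<^sub>R b3" "v = y *\<^sub>R b1" "w = z *\<^sub>R p"
    using uvw mem_Rep_pt b_nonzero C_nonzero[OF pC] by metis
  have det: "u \<bullet> cross3 v w > 0" using uvw by (simp add: dot_cross_det)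
  then have nz: "u \<noteq> 0" "v \<noteq> 0" "w \<noteq> 0" by auto
  have pos: "k > 0" if "k *\<^sub>R e \<in> closure C" "k *\<^sub>R e \<noteq> 0" "e \<in> closure C" for k e
    using height_pos[OF that(1,2)] height_pos[OF that(3)] that(2) by (auto simp: zero_less_mult_iff)
  have "x > 0" "y > 0" "z > 0"
    using pos[of x b3] pos[of y b1] pos[of z p] uvw nz b bdD C_sub_closure pC unfolding xyz by auto
  moreover have "u \<bullet> cross3 v w = (x * y * z) * ((f2 \<bullet> p) * (b1 \<bullet> cross3 b2 b3))"
    unfolding xyz using triple_middle(1)[of p] by (simp add: cross_mult_left cross_mult_right)
  ultimately have "(f2 \<bullet> p) * (b1 \<bullet> cross3 b2 b3) > 0"
    using det zero_less_mult_pos[of "x * y * z" "(f2 \<bullet> p) * (b1 \<bullet> cross3 b2 b3)"] by simp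
  then have "b1 \<bullet> cross3 b2 b3 > 0" using f2_pos[OF p] by (simp add: zero_less_mult_iff)
  then have "b1 \<bullet> cross3 y b3 > 0" if "f2 \<bullet> y > 0" for y using that triple_middle(2)[of y] by simp
  then have "\<forall>y. wf L \<bullet> y > 0 \<longrightarrow> b1 \<bullet> cross3 y b3 > 0" by (simp flip: f2)
  moreover have "wf L \<bullet> b1 = 0" "wf L \<bullet> b3 = 0" using dual f2 by auto
  ultimately show ?thesis unfolding ends_def ar using b pt_b_distinct by blast
qed

text \<open>The orientation of \<open>M\<close> is evaluated at \<open>b1\<close> and at
  \<open>b3\<close>, both of which are on its positive side. The two determinants compare
  \<open>f2/f3\<close> and \<open>f1/f2\<close> at the ends; multiplying the comparisons orders
  \<open>f1/f3\<close>. So the attracting end gives the lower end of the gap, which makes the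
  logarithm in \<open>gap\<close> positive.\<close>

lemma ends_gap:
  assumes LL: "ends L (attracting a) (repelling a)" and M: "M \<in> BG" "M \<noteq> L" and e: "ends M p q"
  obtains u v where "p = pt u" "q = pt v" "u \<in> bd" "v \<in> bd" "wf M \<bullet> u = 0" "wf M \<bullet> v = 0"
    "f1 \<bullet> u > 0" "f3 \<bullet> u > 0" "f1 \<bullet> v > 0" "f3 \<bullet> v > 0"
    "0 < coord u" "coord u < coord v" "\<And>s. s > 0 \<Longrightarrow> wf M \<bullet> top s < 0 \<longleftrightarrow> coord u < s \<and> s < coord v"
proof -
  obtain u0 v0 where 0: "u0 \<in> bd" "v0 \<in> bd" "pt b1 = pt u0" "pt b3 = pt v0"
    "\<And>y. wf L \<bullet> y > 0 \<Longrightarrow> u0 \<bullet> cross3 y v0 > 0" using LL unfolding ends_def ar by blast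
  obtain c d where cd: "c > 0" "u0 = c *\<^sub>R b1" "d > 0" "v0 = d *\<^sub>R b3"
    using 0 b bdD parallel_pos by metis
  have "u0 \<bullet> cross3 b2 v0 > 0" using 0(5)[of b2] dual f2 by simp
  then have \<delta>: "b1 \<bullet> cross3 b2 b3 > 0" using cd by (simp add: cross_mult_left cross_mult_right zero_less_mult_iff)
  obtain u v where uv: "u \<in> bd" "v \<in> bd" "p = pt u" "q = pt v" "pt u \<noteq> pt v" "wf M \<bullet> u = 0" "wf M \<bullet> v = 0"
    "\<And>y. wf M \<bullet> y > 0 \<Longrightarrow> u \<bullet> cross3 y v > 0" using e by (auto simp: ends_def)
  note pu = end_pos[OF M uv(1,6)] and pv = end_pos[OF M uv(2,7)]
  have "u \<bullet> cross3 b1 v > 0" "u \<bullet> cross3 b3 v > 0" using uv(8) wall_ends_pos[OF M] by auto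
  then have "(f3 \<bullet> u) * (f2 \<bullet> v) > (f2 \<bullet> u) * (f3 \<bullet> v)" "(f2 \<bullet> u) * (f1 \<bullet> v) > (f1 \<bullet> u) * (f2 \<bullet> v)"
    using \<delta> by (simp_all add: triple_mixed zero_less_mult_iff)
  then have "(f2 \<bullet> u) / (f3 \<bullet> u) < (f2 \<bullet> v) / (f3 \<bullet> v)" "(f1 \<bullet> u) / (f2 \<bullet> u) < (f1 \<bullet> v) / (f2 \<bullet> v)"
    using pu pv by (simp_all add: divide_simps mult.commute)
  then have "(f1 \<bullet> u) / (f2 \<bullet> u) * ((f2 \<bullet> u) / (f3 \<bullet> u)) < (f1 \<bullet> v) / (f2 \<bullet> v) * ((f2 \<bullet> v) / (f3 \<bullet> v))"
    using pu pv by (intro mult_strict_mono) auto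
  then have lt: "coord u < coord v" using pu pv by (simp add: coord_def)
  have "coord u > 0" using pu by (simp add: coord_def)
  then show thesis using that[OF uv(3,4,1,2,6,7) pu(1,3) pv(1,3) _ lt] gap_iff[OF M uv(1,6,2,7) lt] by blast
qed

end

section \<open>Summing over the orthoset\<close>

lemma double_coset_absorb:
  assumes G: "h \<in> generate PGL3 {a}" "k \<in> generate PGL3 {b}"
    and inv: "\<exists>h'\<in>generate PGL3 {a}. h' \<circ> h = id \<and> h \<circ> h' = id" "\<exists>k'\<in>generate PGL3 {b}. k' \<circ> k = id \<and> k \<circ> k' = id"
  shows "double_coset (generate PGL3 {a}) (h \<circ> g \<circ> k) (generate PGL3 {b}) = double_coset (generate PGL3 {a}) g (generate PGL3 {b})"
proof -
  have eng: "x \<circ> y \<in> generate PGL3 S" if "x \<in> generate PGL3 S" "y \<in> generate PGL3 S" for x y S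
    using generate.eng[OF that] by (simp add: PGL3_simps)
  obtain h' k' where h': "h' \<in> generate PGL3 {a}" "h' \<circ> h = id" and k': "k' \<in> generate PGL3 {b}" "k \<circ> k' = id"
    using inv by blast
  show ?thesis unfolding double_coset_def
  proof (intro subset_antisym subsetI)
    fix x assume "x \<in> {ha \<circ> (h \<circ> g \<circ> k) \<circ> ka |ha ka. ha \<in> generate PGL3 {a} \<and> ka \<in> generate PGL3 {b}}"
    then obtain y z where yz: "y \<in> generate PGL3 {a}" "z \<in> generate PGL3 {b}" "x = y \<circ> (h \<circ> g \<circ> k) \<circ> z" by blast
    then have "x = (y \<circ> h) \<circ> g \<circ> (k \<circ> z)" by (simp only: comp_assoc)
    then show "x \<in> {h \<circ> g \<circ> k |h k. h \<in> generate PGL3 {a} \<and> k \<in> generate PGL3 {b}}"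
      using eng[OF yz(1) G(1)] eng[OF G(2) yz(2)] by blast
  next
    fix x assume "x \<in> {h \<circ> g \<circ> k |h k. h \<in> generate PGL3 {a} \<and> k \<in> generate PGL3 {b}}"
    then obtain y z where yz: "y \<in> generate PGL3 {a}" "z \<in> generate PGL3 {b}" "x = y \<circ> g \<circ> z" by blast
    have "(y \<circ> h') \<circ> (h \<circ> g \<circ> k) \<circ> (k' \<circ> z) = y \<circ> (h' \<circ> h) \<circ> g \<circ> (k \<circ> k') \<circ> z" by (simp only: comp_assoc)
    also have "\<dots> = x" unfolding h'(2) k'(2) yz(3) by (simp only: comp_id id_comp)
    finally have "x = (y \<circ> h') \<circ> (h \<circ> g \<circ> k) \<circ> (k' \<circ> z)" by (rule sym)
    then show "x \<in> {ha \<circ> (h \<circ> g \<circ> k) \<circ> ka |ha ka. ha \<in> generate PGL3 {a} \<and> ka \<in> generate PGL3 {b}}"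
      using eng[OF yz(1) h'(1)] eng[OF k'(1) yz(2)] by blast
  qed
qed

locale marked = surface C Ft \<Delta> for C Ft \<Delta> +
  fixes m :: nat and \<alpha> :: "nat \<Rightarrow> rp2 \<Rightarrow> rp2"
  assumes marks: "\<And>i. i < m \<Longrightarrow> \<alpha> i \<in> \<Delta> \<and> \<alpha> i \<noteq> id \<and> axis_of (pt ` C) (\<alpha> i) \<in> BG \<and>
      \<alpha> i ` axis_of (pt ` C) (\<alpha> i) = axis_of (pt ` C) (\<alpha> i) \<and> primitive \<Delta> (\<alpha> i) \<and>
      ends (axis_of (pt ` C) (\<alpha> i)) (attracting (\<alpha> i)) (repelling (\<alpha> i))"
    and components: "\<And>L. L \<in> BG \<Longrightarrow> \<exists>!i. i < m \<and> (\<exists>g\<in>\<Delta>. L = g ` axis_of (pt ` C) (\<alpha> i))"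
begin

abbreviation Lx :: "nat \<Rightarrow> rp2 set" where "Lx i \<equiv> axis_of (pt ` C) (\<alpha> i)"
abbreviation H :: "nat \<Rightarrow> (rp2 \<Rightarrow> rp2) set" where "H i \<equiv> generate PGL3 {\<alpha> i}"

lemma mark_frame:
  assumes "i < m"
  shows "\<exists>A b1 b2 b3 f1 f2 f3 l1 l2 l3. framed C Ft \<Delta> (Lx i) (\<alpha> i) A b1 b2 b3 f1 f2 f3 l1 l2 l3"
proof -
  have "Lx i \<in> BG" "\<alpha> i \<in> \<Delta>" "\<alpha> i \<noteq> id" "\<alpha> i ` Lx i = Lx i" using marks[OF assms] by auto
  then show ?thesis by (rule ex_frame)
qed

text \<open>Since the cyclic group is the full stabilizer of the axis, double cosets become orbits
  of boundary geodesics under the stabilizer of \<open>Lx i\<close>.\<close>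

lemma H_stab: "i < m \<Longrightarrow> h \<in> H i \<longleftrightarrow> h \<in> \<Delta> \<and> h ` Lx i = Lx i"
proof -
  assume i: "i < m"
  obtain A b1 b2 b3 f1 f2 f3 l1 l2 l3 where "framed C Ft \<Delta> (Lx i) (\<alpha> i) A b1 b2 b3 f1 f2 f3 l1 l2 l3"
    using mark_frame[OF i] by blast
  then interpret f: framed C Ft \<Delta> "Lx i" "\<alpha> i" A b1 b2 b3 f1 f2 f3 l1 l2 l3 .
  have "primitive \<Delta> (\<alpha> i)" using marks[OF i] by blast
  from f.stabilizer_generated[OF this, of h] f.generated_diagonal[of h] f.generated_L[of h] show ?thesis by blast
qed

lemma inv_image: "g \<circ> g' = id \<Longrightarrow> g ` g' ` X = X"
  by (simp only: image_comp image_id id_apply)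

lemma H_inverse: "i < m \<Longrightarrow> h \<in> H i \<Longrightarrow> \<exists>h'\<in>H i. h' \<circ> h = id \<and> h \<circ> h' = id"
proof -
  assume i: "i < m" and h: "h \<in> H i"
  then obtain h' where h': "h' \<in> \<Delta>" "h \<circ> h' = id" "h' \<circ> h = id" using inv_in H_stab by blast
  have "h' ` Lx i = h' ` h ` Lx i" using H_stab[OF i] h by simp
  then have "h' ` Lx i = Lx i" using inv_image[OF h'(3)] by simp
  then show ?thesis using H_stab[OF i] h' by blast
qed

lemma H_sub: "i < m \<Longrightarrow> h \<in> H i \<Longrightarrow> h \<in> \<Delta>"
  using H_stab by blast

lemma id_H: "id \<in> H i"
  using generate.one[of PGL3 "{\<alpha> i}"] by (simp only: PGL3_simps)

lemma dc_absorb: "i < m \<Longrightarrow> j < m \<Longrightarrow> h \<in> H i \<Longrightarrow> k \<in> H j \<Longrightarrow>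
    double_coset (H i) (h \<circ> g \<circ> k) (H j) = double_coset (H i) g (H j)"
  by (rule double_coset_absorb) (auto intro: H_inverse)

lemma dc_self: "g \<in> double_coset (H i) g (H j)"
proof -
  have "g = id \<circ> g \<circ> id" by (simp only: comp_id id_comp)
  then show ?thesis unfolding double_coset_def using id_H by blast
qed

lemma mark_unique: "i < m \<Longrightarrow> j < m \<Longrightarrow> g \<in> \<Delta> \<Longrightarrow> g' \<in> \<Delta> \<Longrightarrow> g ` Lx i = g' ` Lx j \<Longrightarrow> i = j"
proof -
  assume ij: "i < m" "j < m" "g \<in> \<Delta>" "g' \<in> \<Delta>" "g ` Lx i = g' ` Lx j"
  have "g ` Lx i \<in> BG" using BG_image ij marks by blast
  then show ?thesis using components[of "g ` Lx i"] ij by blast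
qed

lemma same_image: "i < m \<Longrightarrow> g \<in> \<Delta> \<Longrightarrow> g' \<in> \<Delta> \<Longrightarrow> g ` Lx i = g' ` Lx i \<Longrightarrow> \<exists>k\<in>H i. g' = g \<circ> k"
proof -
  assume g: "i < m" "g \<in> \<Delta>" "g' \<in> \<Delta>" "g ` Lx i = g' ` Lx i"
  obtain c where c: "c \<in> \<Delta>" "g \<circ> c = id" "c \<circ> g = id" using inv_in g by blast
  have "(c \<circ> g') ` Lx i = c ` g ` Lx i" using g(4) by (simp only: image_comp)
  then have "(c \<circ> g') ` Lx i = Lx i" using inv_image[OF c(3)] by simp
  then have "c \<circ> g' \<in> H i" using H_stab g comp_in c by blast
  moreover have "g' = (g \<circ> c) \<circ> g'" using c(2) by (simp only: id_comp)
  then have "g' = g \<circ> (c \<circ> g')" by (simp only: comp_assoc)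
  ultimately show ?thesis by blast
qed

lemma orthoset_mem:
  "(i, j, K) \<in> orthoset \<Delta> m \<alpha> \<longleftrightarrow> i < m \<and> j < m \<and> (\<exists>g\<in>\<Delta>. K = double_coset (H i) g (H j) \<and> g ` Lx j \<noteq> Lx i)"
proof
  assume "(i, j, K) \<in> orthoset \<Delta> m \<alpha>"
  then obtain g where g: "i < m" "j < m" "g \<in> \<Delta>" "K = double_coset (H i) g (H j)"
    "\<not> (i = j \<and> K = double_coset (H i) id (H i))" by (auto simp: orthoset_def Let_def)
  have "g ` Lx j \<noteq> Lx i"
  proof
    assume eq: "g ` Lx j = Lx i"
    then have "i = j" using mark_unique[of j i g id] g id_in by simp
    then have "g \<in> H i" using H_stab eq g by blast
    then have "double_coset (H i) (g \<circ> id \<circ> id) (H i) = double_coset (H i) id (H i)"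
      using dc_absorb[OF g(1,1) _ id_H] by blast
    then show False using g \<open>i = j\<close> by (simp only: comp_id simp_thms)
  qed
  then show "i < m \<and> j < m \<and> (\<exists>g\<in>\<Delta>. K = double_coset (H i) g (H j) \<and> g ` Lx j \<noteq> Lx i)" using g by blast
next
  assume "i < m \<and> j < m \<and> (\<exists>g\<in>\<Delta>. K = double_coset (H i) g (H j) \<and> g ` Lx j \<noteq> Lx i)"
  then obtain g where g: "i < m" "j < m" "g \<in> \<Delta>" "K = double_coset (H i) g (H j)" "g ` Lx j \<noteq> Lx i" by blast
  have "\<not> (i = j \<and> K = double_coset (H i) id (H i))"
  proof
    assume a: "i = j \<and> K = double_coset (H i) id (H i)"
    then have "g \<in> double_coset (H i) id (H i)" using dc_self g(4) by metis
    then obtain h k where hk: "h \<in> H i" "k \<in> H i" "g = h \<circ> id \<circ> k" unfolding double_coset_def by blast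
    have "g ` Lx i = h ` k ` Lx i" unfolding hk(3) by (simp only: image_comp comp_id)
    then show False using g(1,5) a hk H_stab by auto
  qed
  then show "(i, j, K) \<in> orthoset \<Delta> m \<alpha>" using g by (auto simp: orthoset_def Let_def)
qed

lemma dc_cases:
  assumes "i < m" "j < m" "g' \<in> double_coset (H i) g (H j)"
  obtains h k where "h \<in> H i" "k \<in> H j" "g' = h \<circ> g \<circ> k" "g' ` Lx j = h ` g ` Lx j"
proof -
  obtain h k where hk: "h \<in> H i" "k \<in> H j" "g' = h \<circ> g \<circ> k" using assms(3) unfolding double_coset_def by blast
  have "g' ` Lx j = h ` g ` k ` Lx j" unfolding hk(3) by (simp only: image_comp comp_assoc)
  then have "g' ` Lx j = h ` g ` Lx j" using H_stab[OF assms(2)] hk(2) by simp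
  then show thesis using that hk by blast
qed

end

section \<open>The gaps along one marked axis\<close>

locale marked_frame = marked C Ft \<Delta> m \<alpha> + framed C Ft \<Delta> "axis_of (pt ` C) (\<alpha> i)" "\<alpha> i" A b1 b2 b3 f1 f2 f3 l1 l2 l3
  for C Ft \<Delta> m \<alpha> i A b1 b2 b3 f1 f2 f3 l1 l2 l3 +
  assumes i: "i < m"
begin

definition \<tau> :: real where "\<tau> = ln (l1 / l3)"

lemma \<tau>_pos: "\<tau> > 0" using l by (simp add: \<tau>_def)

text \<open>Defining the gap by the sign of the wall, rather than by endpoints, lets disjointness
  and equivariance be checked point by point.\<close>

definition gapset :: "rp2 set \<Rightarrow> real set" where
  "gapset M = {t. wf M \<bullet> top (exp t) < 0}"

definition lo where "lo M = Inf (gapset M)"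
definition hi where "hi M = Sup (gapset M)"

lemma ends_interval:
  assumes M: "M \<in> BG" "M \<noteq> Lx i" and e: "ends M p q"
  shows "\<exists>u v. p = pt u \<and> q = pt v \<and> u \<in> bd \<and> v \<in> bd \<and> wf M \<bullet> u = 0 \<and> wf M \<bullet> v = 0 \<and> f1 \<bullet> u > 0 \<and> f3 \<bullet> u > 0 \<and> f1 \<bullet> v > 0 \<and> f3 \<bullet> v > 0 \<and>
    0 < coord u \<and> coord u < coord v \<and> gapset M = {ln (coord u)<..<ln (coord v)} \<and> lo M = ln (coord u) \<and> hi M = ln (coord v) \<and> lo M < hi M"
proof -
  have LL: "ends (Lx i) (attracting (\<alpha> i)) (repelling (\<alpha> i))" using marks[OF i] by blast
  obtain u v where uv: "p = pt u" "q = pt v" "u \<in> bd" "v \<in> bd" "wf M \<bullet> u = 0" "wf M \<bullet> v = 0"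
    "f1 \<bullet> u > 0" "f3 \<bullet> u > 0" "f1 \<bullet> v > 0" "f3 \<bullet> v > 0"
    "0 < coord u" "coord u < coord v" "\<And>s. s > 0 \<Longrightarrow> wf M \<bullet> top s < 0 \<longleftrightarrow> coord u < s \<and> s < coord v"
    using ends_gap[OF LL M e] by metis
  have g: "gapset M = {ln (coord u)<..<ln (coord v)}"
  proof (rule Set.set_eqI)
    fix t :: real
    have "coord u < exp t \<longleftrightarrow> ln (coord u) < t" "exp t < coord v \<longleftrightarrow> t < ln (coord v)"
      using uv(11,12) by (metis exp_less_cancel_iff exp_ln, metis exp_less_cancel_iff exp_ln less_trans)
    then show "t \<in> gapset M \<longleftrightarrow> t \<in> {ln (coord u)<..<ln (coord v)}" using uv(13)[of "exp t"] by (simp add: gapset_def)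
  qed
  have "ln (coord u) < ln (coord v)" using uv by simp
  then have "lo M = ln (coord u)" "hi M = ln (coord v)" by (simp_all add: lo_def hi_def g)
  then show ?thesis using uv g \<open>ln (coord u) < ln (coord v)\<close> by auto
qed

lemma BG_ends: "M \<in> BG \<Longrightarrow> \<exists>p q. ends M p q"
  using components[of M] marks ends_image by metis

lemma gapset_interval:
  assumes "M \<in> BG" "M \<noteq> Lx i"
  shows "gapset M = {lo M<..<hi M}" "lo M < hi M"
  using BG_ends[OF assms(1)] ends_interval[OF assms] by metis+

lemma gap_eq:
  assumes j: "j < m" and g: "g \<in> \<Delta>" "g ` Lx j \<noteq> Lx i"
  shows "ln (cross_ratio (attracting (\<alpha> i)) (orth_proj (pt ` C) (\<alpha> i) (g (attracting (\<alpha> j))))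
     (repelling (\<alpha> i)) (orth_proj (pt ` C) (\<alpha> i) (g (repelling (\<alpha> j))))) = hi (g ` Lx j) - lo (g ` Lx j)"
proof -
  have "ends (g ` Lx j) (g (attracting (\<alpha> j))) (g (repelling (\<alpha> j)))" "g ` Lx j \<in> BG"
    using ends_image marks[OF j] g BG_image by blast+
  then obtain u v where "g (attracting (\<alpha> j)) = pt u" "g (repelling (\<alpha> j)) = pt v"
    "f1 \<bullet> u > 0" "f3 \<bullet> u > 0" "f1 \<bullet> v > 0" "f3 \<bullet> v > 0" "lo (g ` Lx j) = ln (coord u)" "hi (g ` Lx j) = ln (coord v)"
    using ends_interval[OF _ g(2)] by metis
  then show ?thesis using gap_value by simp
qed

lemma gapset_disjoint:
  assumes "M \<in> BG" "M' \<in> BG" "t \<in> gapset M" "t \<in> gapset M'"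
  shows "M = M'"
  using walls_disjoint_closure[OF assms(1,2), of "top (exp t)"] assms top_bd[of "exp t"] bdD by (simp add: gapset_def)

lemma translates_image:
  assumes h: "h \<in> H i" and M: "M \<in> BG" "M \<noteq> Lx i" and t: "translates b1 b3 h (exp r)"
  shows "h ` M \<in> BG" "h ` M \<noteq> Lx i" "lo (h ` M) = lo M + r" "hi (h ` M) = hi M + r"
proof -
  have hD: "h \<in> \<Delta>" using H_sub i h by blast
  show hM: "h ` M \<in> BG" using BG_image hD M by blast
  show hne: "h ` M \<noteq> Lx i"
  proof
    assume eq: "h ` M = Lx i"
    obtain h' where h': "h' \<in> H i" "h' \<circ> h = id" using H_inverse[OF i h] by blast
    have "M = h' ` h ` M" using inv_image[OF h'(2)] by simp
    then show False using eq M(2) H_stab[OF i] h'(1) by simp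
  qed
  obtain G x y z where G: "lifts C h G" "G *v b1 = x *\<^sub>R b1" "G *v b2 = y *\<^sub>R b2" "G *v b3 = z *\<^sub>R b3" "x > 0" "y > 0" "z > 0"
    using generated_diagonal[OF h] by blast
  have "translates b1 b3 h (x / z)" by (rule eigen_translates[OF hD G(1,2,4,5,7)])
  then have xz: "x / z = exp r" using translates_unique t by blast
  obtain c where c: "c > 0" "\<And>v. wf (h ` M) \<bullet> (G *v v) = c * (wf M \<bullet> v)" using wall_image[OF M(1) hD G(1)] by blast
  have "t + r \<in> gapset (h ` M) \<longleftrightarrow> t \<in> gapset M" for t
  proof -
    obtain d where d: "d > 0" "G *v top (exp t) = d *\<^sub>R top ((x / z) * exp t)"
      using top_diagonal[OF G, of "exp t"] by auto
    then have "d * (wf (h ` M) \<bullet> top (exp (t + r))) = c * (wf M \<bullet> top (exp t))"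
      using c(2)[of "top (exp t)"] by (simp add: xz exp_add mult.commute)
    then have "wf (h ` M) \<bullet> top (exp (t + r)) < 0 \<longleftrightarrow> wf M \<bullet> top (exp t) < 0"
      using c(1) d(1) by (metis mult_less_0_iff not_less_iff_gr_or_eq)
    then show ?thesis by (simp add: gapset_def)
  qed
  then have "gapset (h ` M) = {lo M + r<..<hi M + r}"
  proof (intro Set.set_eqI)
    fix t assume *: "\<And>t. t + r \<in> gapset (h ` M) \<longleftrightarrow> t \<in> gapset M"
    show "t \<in> gapset (h ` M) \<longleftrightarrow> t \<in> {lo M + r<..<hi M + r}"
      using *[of "t - r"] gapset_interval[OF M] by auto
  qed
  then have "{lo (h ` M)<..<hi (h ` M)} = {lo M + r<..<hi M + r}" using gapset_interval[OF hM hne] by simp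
  then show "lo (h ` M) = lo M + r" "hi (h ` M) = hi M + r"
    using gapset_interval(2)[OF hM hne] gapset_interval(2)[OF M] by (auto simp: greaterThanLessThan_eq_iff)
qed

lemma H_translations: "h \<in> H i \<Longrightarrow> \<exists>k::int. translates b1 b3 h (exp (of_int k * \<tau>))"
proof (induction rule: generate.induct)
  case one
  show ?case by (intro exI[of _ 0]) (simp add: translates_def PGL3_simps id_in[unfolded id_def])
next
  case (incl h)
  have "exp \<tau> = l1 / l3" using lpos by (simp add: \<tau>_def)
  then show ?case using incl a_translates by (intro exI[of _ 1]) simp
next
  case (inv h)
  then have h: "h = \<alpha> i" by simp
  obtain c where c: "c \<in> \<Delta>" "\<alpha> i \<circ> c = id" "c \<circ> \<alpha> i = id" using inv_in[OF a(1)] by blast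
  have ic: "inv\<^bsub>PGL3\<^esub> h = c" unfolding h using c carrier_PGL3 by (intro inv_PGL3_eq) auto
  have e: "1 / (l1 / l3) = exp (- \<tau>)" using lpos by (simp add: \<tau>_def exp_minus)
  show ?case unfolding ic using translates_inverse[OF a_translates c(1,3)] unfolding e by (intro exI[of _ "-1"]) simp
next
  case (eng h1 h2)
  then obtain k1 k2 :: int where "translates b1 b3 h1 (exp (of_int k1 * \<tau>))" "translates b1 b3 h2 (exp (of_int k2 * \<tau>))" by blast
  then have "translates b1 b3 (h1 \<circ> h2) (exp (of_int k1 * \<tau>) * exp (of_int k2 * \<tau>))" by (rule translates_comp)
  moreover have "exp (of_int k1 * \<tau>) * exp (of_int k2 * \<tau>) = exp (of_int (k1 + k2) * \<tau>)"
    by (simp add: exp_add[symmetric] algebra_simps)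
  ultimately show ?case unfolding PGL3_simps by metis
qed

lemma ex_translation: "\<exists>h\<in>H i. translates b1 b3 h (exp (of_int k * \<tau>))"
proof -
  have nat: "\<exists>h\<in>H i. translates b1 b3 h (exp (real n * \<tau>))" for n
  proof (induction n)
    case 0
    then show ?case using id_H by (intro bexI[of _ id]) (simp_all add: translates_def id_in id_in[unfolded id_def])
  next
    case (Suc n)
    then obtain h where h: "h \<in> H i" "translates b1 b3 h (exp (real n * \<tau>))" by blast
    have "\<alpha> i \<circ> h \<in> H i" using generate.eng[OF generate.incl h(1), of "\<alpha> i"] by (simp add: PGL3_simps)
    moreover have "translates b1 b3 (\<alpha> i \<circ> h) (l1 / l3 * exp (real n * \<tau>))" using translates_comp[OF a_translates h(2)] .
    moreover have "l1 / l3 * exp (real n * \<tau>) = exp (real (Suc n) * \<tau>)"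
      using lpos by (simp add: \<tau>_def exp_add algebra_simps)
    ultimately show ?case by metis
  qed
  show ?thesis
  proof (cases "k \<ge> 0")
    case True
    then show ?thesis using nat[of "nat k"] by simp
  next
    case False
    obtain h where h: "h \<in> H i" "translates b1 b3 h (exp (real (nat (- k)) * \<tau>))" using nat by blast
    obtain h' where h': "h' \<in> H i" "h' \<circ> h = id" using H_inverse[OF i h(1)] by blast
    have "1 / exp (real (nat (- k)) * \<tau>) = exp (of_int k * \<tau>)" using False by (simp add: exp_minus field_simps)
    then show ?thesis using translates_inverse[OF h(2) H_sub[OF i h'(1)] h'(2)] h'(1) by metis
  qed
qed

text \<open>Porosity was obtained in the multiplicative coordinate. The logarithm is differentiable
  on positive reals, so it carries null sets to null sets in arc length.\<close>

lemma gaps_conull: "negligible {t. \<forall>M\<in>BG. M \<noteq> Lx i \<longrightarrow> t \<notin> gapset M}"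
proof -
  define S where "S = {s. s > 0 \<and> (\<forall>M\<in>BG. M \<noteq> Lx i \<longrightarrow> wf M \<bullet> top s \<ge> 0)}"
  have "negligible S"
  proof (rule porous_negligible)
    fix s assume s: "s \<in> S"
    then have "\<And>M. M \<in> BG \<Longrightarrow> M \<noteq> Lx i \<Longrightarrow> wf M \<bullet> top s \<ge> 0" "s > 0" by (auto simp: S_def)
    from porous[OF this(2,1)] obtain \<rho> where \<rho>: "\<rho> > 0" "\<forall>\<epsilon>>0. \<exists>d p q. 0 < d \<and> d < \<epsilon> \<and> s - d \<le> p \<and> p < q \<and> q \<le> s + d \<and> \<rho> * d \<le> q - p \<and> 0 < p \<and>
        (\<exists>M\<in>BG. M \<noteq> Lx i \<and> (\<forall>s. p < s \<and> s < q \<longrightarrow> wf M \<bullet> top s < 0))" by blast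
    have "porous_at S \<rho> s" unfolding porous_at_def
    proof (intro allI impI)
      fix \<epsilon> :: real assume "\<epsilon> > 0"
      from \<rho>(2)[rule_format, OF this] obtain d p q M where d: "0 < d" "d < \<epsilon>" "s - d \<le> p" "p < q" "q \<le> s + d" "\<rho> * d \<le> q - p" "0 < p"
        "M \<in> BG" "M \<noteq> Lx i" "\<forall>s. p < s \<and> s < q \<longrightarrow> wf M \<bullet> top s < 0" by blast
      have "{p<..<q} \<inter> S = {}"
      proof (rule ccontr)
        assume "{p<..<q} \<inter> S \<noteq> {}"
        then obtain x where "p < x" "x < q" "x \<in> S" by auto
        then show False using d(8,9) d(10)[rule_format, of x] by (auto simp: S_def)
      qed
      then show "\<exists>d p q. 0 < d \<and> d < \<epsilon> \<and> s - d \<le> p \<and> p < q \<and> q \<le> s + d \<and> \<rho> * d \<le> q - p \<and> {p<..<q} \<inter> S = {}"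
        using d by blast
    qed
    then show "\<exists>\<rho>>0. porous_at S \<rho> s" using \<rho>(1) by blast
  qed
  moreover have "ln differentiable_on S"
    unfolding differentiable_on_def
  proof
    fix s assume "s \<in> S"
    then have "(ln has_real_derivative inverse s) (at s within S)" by (intro DERIV_subset[OF DERIV_ln]) (auto simp: S_def)
    then show "ln differentiable at s within S" by (auto simp: differentiable_def has_field_derivative_def)
  qed
  ultimately have "negligible (ln ` S)" by (intro negligible_differentiable_image_negligible) auto
  moreover have "{t. \<forall>M\<in>BG. M \<noteq> Lx i \<longrightarrow> t \<notin> gapset M} \<subseteq> ln ` S"
  proof
    fix t assume t: "t \<in> {t. \<forall>M\<in>BG. M \<noteq> Lx i \<longrightarrow> t \<notin> gapset M}"
    then have "exp t \<in> S" by (auto simp: S_def gapset_def not_less)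
    then show "t \<in> ln ` S" by (intro image_eqI[of _ _ "exp t"]) auto
  qed
  ultimately show ?thesis by (rule negligible_subset)
qed

text \<open>Recovers from a boundary geodesic the tagged double coset of the elements carrying a
  marked axis to it; by \<open>coset_of_image\<close> the chosen element does not matter.\<close>

definition coset_of :: "rp2 set \<Rightarrow> nat \<times> nat \<times> (rp2 \<Rightarrow> rp2) set" where
  "coset_of M = (let j = (THE j. j < m \<and> (\<exists>g\<in>\<Delta>. M = g ` Lx j)) in
     (i, j, double_coset (H i) (SOME g. g \<in> \<Delta> \<and> M = g ` Lx j) (H j)))"

lemma coset_of_image:
  assumes j: "j < m" and g: "g \<in> \<Delta>"
  shows "coset_of (g ` Lx j) = (i, j, double_coset (H i) g (H j))"
proof -
  have M: "g ` Lx j \<in> BG" using BG_image g marks[OF j] by blast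
  have jj: "(THE j'. j' < m \<and> (\<exists>g'\<in>\<Delta>. g ` Lx j = g' ` Lx j')) = j"
    using j g mark_unique by (intro the_equality) blast+
  define g' where "g' = (SOME g'. g' \<in> \<Delta> \<and> g ` Lx j = g' ` Lx j)"
  have "g' \<in> \<Delta> \<and> g ` Lx j = g' ` Lx j" unfolding g'_def by (rule someI[of _ g]) (use g in blast)
  then obtain k where k: "k \<in> H j" "g' = g \<circ> k" using same_image[OF j g] by blast
  have "g' = id \<circ> g \<circ> k" using k(2) by (simp only: id_comp)
  then have "double_coset (H i) g' (H j) = double_coset (H i) g (H j)" using dc_absorb[OF i j id_H k(1)] by metis
  then show ?thesis unfolding coset_of_def jj Let_def g'_def by simp
qed

text \<open>The line is cut into windows of length \<open>\<tau>\<close> at translates of a point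
  \<open>t0\<close> outside all gaps, so no gap straddles a cut. Every \<open>H i\<close>-orbit of
  geodesics other than \<open>Lx i\<close> has exactly one member with its gap in the first window,
  and these orbits are the double cosets.\<close>

lemma gap_has_sum: "(gap (pt ` C) \<alpha> has_sum \<tau>) {x \<in> orthoset \<Delta> m \<alpha>. fst x = i}"
proof -
  let ?B = "{M \<in> BG. M \<noteq> Lx i}"
  \<comment> \<open>An endpoint of a gap lies in no gap, as these are open and disjoint; if there
    are no other geodesics, any point serves.\<close>
  obtain t0 where t0: "\<And>M. M \<in> ?B \<Longrightarrow> t0 \<notin> gapset M"
  proof (cases "?B = {}")
    case False
    then obtain M0 where M0: "M0 \<in> BG" "M0 \<noteq> Lx i" by blast
    have "lo M0 \<notin> gapset M" if M: "M \<in> ?B" for M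
    proof
      assume "lo M0 \<in> gapset M"
      then have lt: "lo M < lo M0" "lo M0 < hi M" using gapset_interval M by auto
      define t where "t = (lo M0 + min (hi M) (hi M0)) / 2"
      have "t \<in> gapset M" "t \<in> gapset M0" using lt gapset_interval[OF M0] gapset_interval[of M] M
        by (auto simp: t_def min_def)
      then have "M = M0" using gapset_disjoint M M0 by blast
      then show False using lt by simp
    qed
    then show thesis using that by blast
  qed (use that in blast)
  have notin: "t0 + of_int k * \<tau> \<notin> gapset M" if M: "M \<in> BG" "M \<noteq> Lx i" for k :: int and M
  proof
    assume g: "t0 + of_int k * \<tau> \<in> gapset M"
    obtain h where h: "h \<in> H i" "translates b1 b3 h (exp (of_int (- k) * \<tau>))" using ex_translation by blast
    have "t0 \<in> gapset (h ` M)"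
      using g gapset_interval[OF M] translates_image[OF h(1) M h(2)] gapset_interval[OF translates_image(1,2)[OF h(1) M h(2)]] by auto
    then show False using t0 translates_image(1,2)[OF h(1) M h(2)] by blast
  qed
  define W where "W = {M \<in> BG. M \<noteq> Lx i \<and> t0 \<le> lo M \<and> hi M \<le> t0 + \<tau>}"
  have "((\<lambda>M. hi M - lo M) has_sum (t0 + \<tau> - t0)) W"
  proof (rule disjoint_intervals_has_sum)
    show "t0 \<le> t0 + \<tau>" using \<tau>_pos by simp
    show "lo M < hi M \<and> t0 \<le> lo M \<and> hi M \<le> t0 + \<tau>" if "M \<in> W" for M
      using that gapset_interval by (auto simp: W_def)
    show "{lo M<..<hi M} \<inter> {lo M'<..<hi M'} = {}" if "M \<in> W" "M' \<in> W" "M \<noteq> M'" for M M'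
    proof -
      have MM: "M \<in> BG" "M \<noteq> Lx i" "M' \<in> BG" "M' \<noteq> Lx i" using that by (simp_all add: W_def)
      have "gapset M \<inter> gapset M' = {}" using gapset_disjoint[OF MM(1,3)] that(3) by blast
      then show ?thesis using gapset_interval(1)[OF MM(1,2)] gapset_interval(1)[OF MM(3,4)] by simp
    qed
    have "{t0<..<t0 + \<tau>} - (\<Union>M\<in>W. {lo M<..<hi M}) \<subseteq> {t. \<forall>M\<in>BG. M \<noteq> Lx i \<longrightarrow> t \<notin> gapset M}"
    proof (intro subsetI CollectI ballI impI notI)
      fix t M assume t: "t \<in> {t0<..<t0 + \<tau>} - (\<Union>M\<in>W. {lo M<..<hi M})" and M: "M \<in> BG" "M \<noteq> Lx i" "t \<in> gapset M"
      have "t0 \<notin> gapset M" "t0 + \<tau> \<notin> gapset M" using notin[OF M(1,2), of 0] notin[OF M(1,2), of 1] by auto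
      then have "M \<in> W" using t M gapset_interval[OF M(1,2)] by (auto simp: W_def)
      then show False using t M gapset_interval[OF M(1,2)] by auto
    qed
    then show "negligible ({t0<..<t0 + \<tau>} - (\<Union>M\<in>W. {lo M<..<hi M}))" using gaps_conull negligible_subset by blast
  qed
  then have sumW: "((\<lambda>M. hi M - lo M) has_sum \<tau>) W" by simp
  have ex_window: "\<exists>h\<in>H i. h ` M \<in> W" if M: "M \<in> BG" "M \<noteq> Lx i" for M
  proof -
    \<comment> \<open>The index of the window in which the gap begins; since no cut lies in a gap,
      the gap also ends there.\<close>
    define k where "k = \<lfloor>(lo M - t0) / \<tau>\<rfloor>"
    have "of_int k \<le> (lo M - t0) / \<tau>" "(lo M - t0) / \<tau> < of_int k + 1" by (simp_all add: k_def)
    then have lo: "t0 + of_int k * \<tau> \<le> lo M" "lo M < t0 + of_int (k + 1) * \<tau>"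
      using \<tau>_pos by (simp_all add: field_simps)
    then have hi: "hi M \<le> t0 + of_int (k + 1) * \<tau>" using notin[OF M, of "k + 1"] gapset_interval[OF M] by auto
    obtain h where h: "h \<in> H i" "translates b1 b3 h (exp (of_int (- k) * \<tau>))" using ex_translation by blast
    have "h ` M \<in> W" using translates_image[OF h(1) M h(2)] lo hi by (simp add: W_def algebra_simps)
    then show ?thesis using h(1) by blast
  qed
  have bij: "bij_betw coset_of W {x \<in> orthoset \<Delta> m \<alpha>. fst x = i}"
  proof (rule bij_betw_imageI; (rule inj_onI subset_antisym; (rule subsetI)?))
    fix M M' assume MM: "M \<in> W" "M' \<in> W" "coset_of M = coset_of M'"
    obtain j g where j: "j < m" "g \<in> \<Delta>" "M = g ` Lx j" using components[of M] MM by (auto simp: W_def)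
    obtain j' g' where j': "j' < m" "g' \<in> \<Delta>" "M' = g' ` Lx j'" using components[of M'] MM by (auto simp: W_def)
    have eq: "j' = j" "double_coset (H i) g (H j) = double_coset (H i) g' (H j)"
      using MM(3) coset_of_image[OF j(1,2)] coset_of_image[OF j'(1,2)] j(3) j'(3) by auto
    then have "g' \<in> double_coset (H i) g (H j)" using dc_self by metis
    then obtain h where h: "h \<in> H i" "M' = h ` M" using dc_cases[OF i j(1)] j(3) j'(3) eq(1) by metis
    obtain k :: int where k: "translates b1 b3 h (exp (of_int k * \<tau>))" using H_translations[OF h(1)] by blast
    have M: "M \<in> BG" "M \<noteq> Lx i" using MM by (auto simp: W_def)
    have "lo M' = lo M + of_int k * \<tau>" "hi M' = hi M + of_int k * \<tau>" using translates_image[OF h(1) M k] h by auto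
    moreover have "t0 \<le> lo M" "hi M \<le> t0 + \<tau>" "t0 \<le> lo M'" "hi M' \<le> t0 + \<tau>" using MM(1,2) by (simp_all add: W_def)
    \<comment> \<open>Two gaps of the same positive length in one window of length
      \<open>\<tau>\<close> differ by a shift strictly smaller than \<open>\<tau>\<close>, and this
      shift is a multiple of \<open>\<tau>\<close>.\<close>
    ultimately have k1: "of_int k * \<tau> < \<tau>" "of_int k * \<tau> > - \<tau>" using gapset_interval(2)[OF M] by linarith+
    have "of_int k * \<tau> < 1 * \<tau>" "(-1) * \<tau> < of_int k * \<tau>" using k1 by simp_all
    then have "of_int k < (1::real)" "of_int k > (-1::real)" using \<tau>_pos by (simp_all only: mult_less_cancel_right_pos)
    then have "k = 0" by linarith
    then have "translates b1 b3 h 1" using k by simp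
    then have "h = id" using pencil_C[of 1] by (intro translates_1[of b1 b3]) auto
    then show "M = M'" using h by simp
  next
    fix x assume "x \<in> coset_of ` W"
    then obtain M where M: "M \<in> W" "x = coset_of M" by blast
    obtain j g where j: "j < m" "g \<in> \<Delta>" "M = g ` Lx j" using components[of M] M by (auto simp: W_def)
    then have "x = (i, j, double_coset (H i) g (H j))" using coset_of_image M by simp
    moreover have "g ` Lx j \<noteq> Lx i" using M j by (simp add: W_def)
    ultimately have "(i, j, double_coset (H i) g (H j)) \<in> orthoset \<Delta> m \<alpha>" "fst x = i"
      using i j unfolding orthoset_mem by auto
    then show "x \<in> {x \<in> orthoset \<Delta> m \<alpha>. fst x = i}" using \<open>x = (i, _, _)\<close> by simp
  next
    fix x assume "x \<in> {x \<in> orthoset \<Delta> m \<alpha>. fst x = i}"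
    then obtain j K where x: "x = (i, j, K)" "(i, j, K) \<in> orthoset \<Delta> m \<alpha>" by (cases x) auto
    then obtain g where g: "j < m" "g \<in> \<Delta>" "K = double_coset (H i) g (H j)" "g ` Lx j \<noteq> Lx i" using x(2) unfolding orthoset_mem by blast
    have "g ` Lx j \<in> BG" using BG_image[OF g(2)] marks[OF g(1)] by blast
    then obtain h where h: "h \<in> H i" "h ` g ` Lx j \<in> W" using ex_window g(4) by blast
    have "h \<circ> g \<in> \<Delta>" using comp_in H_sub i h g by blast
    then have "coset_of ((h \<circ> g) ` Lx j) = (i, j, double_coset (H i) (h \<circ> g) (H j))" using coset_of_image g(1) by blast
    moreover have "double_coset (H i) (h \<circ> g) (H j) = K" using dc_absorb[OF i g(1) h(1) id_H, of g] g(3) by (simp only: comp_id)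
    moreover have "(h \<circ> g) ` Lx j = h ` g ` Lx j" by (simp only: image_comp)
    ultimately show "x \<in> coset_of ` W" using h(2) x(1) by (metis imageI)
  qed
  \<comment> \<open>\<open>gap\<close> is evaluated at a chosen representative. It differs from
    \<open>g\<close> on the right by an element fixing \<open>Lx j\<close> and on the left by one
    that only shifts the gap.\<close>
  have "gap (pt ` C) \<alpha> (coset_of M) = hi M - lo M" if MW: "M \<in> W" for M
  proof -
    obtain j g where j: "j < m" "g \<in> \<Delta>" "M = g ` Lx j" using components[of M] MW by (auto simp: W_def)
    define K where "K = double_coset (H i) g (H j)"
    define g' where "g' = (SOME g. g \<in> K)"
    have "g' \<in> K" unfolding g'_def by (rule someI[of _ g]) (simp add: K_def dc_self)
    then obtain h k where h: "h \<in> H i" "k \<in> H j" "g' = h \<circ> g \<circ> k" "g' ` Lx j = h ` g ` Lx j"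
      unfolding K_def by (rule dc_cases[OF i j(1)])
    obtain n :: int where n: "translates b1 b3 h (exp (of_int n * \<tau>))" using H_translations[OF h(1)] by blast
    have M: "M \<in> BG" "M \<noteq> Lx i" using MW by (auto simp: W_def)
    note ti = translates_image[OF h(1) M n]
    have "g' \<in> \<Delta>" using h comp_in H_sub i j by metis
    then have "gap (pt ` C) \<alpha> (i, j, K) = hi (h ` M) - lo (h ` M)"
      using gap_eq[OF j(1), of g'] ti(2) h(4) j(3) by (simp add: gap_def Let_def flip: g'_def)
    then show ?thesis using ti coset_of_image[OF j(1,2)] j(3) by (simp add: K_def)
  qed
  then have "((\<lambda>M. gap (pt ` C) \<alpha> (coset_of M)) has_sum \<tau>) W" using sumW by (simp cong: has_sum_cong)
  then show ?thesis using has_sum_reindex_bij_betw[OF bij, of "gap (pt ` C) \<alpha>" \<tau>] by simp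
qed

end

context marked
begin

definition len :: "nat \<Rightarrow> real" where
  "len i = closed_geodesic_length (pt ` C) (hilbert_dist (pt ` C)) (\<alpha> i)"

lemma mark_gap_has_sum:
  assumes i: "i < m"
  shows "(gap (pt ` C) \<alpha> has_sum len i) {x \<in> orthoset \<Delta> m \<alpha>. fst x = i}"
proof -
  obtain A b1 b2 b3 f1 f2 f3 l1 l2 l3 where "framed C Ft \<Delta> (Lx i) (\<alpha> i) A b1 b2 b3 f1 f2 f3 l1 l2 l3"
    using mark_frame[OF i] by blast
  then interpret f: framed C Ft \<Delta> "Lx i" "\<alpha> i" A b1 b2 b3 f1 f2 f3 l1 l2 l3 .
  interpret mf: marked_frame C Ft \<Delta> m \<alpha> i A b1 b2 b3 f1 f2 f3 l1 l2 l3 by unfold_locales (rule i)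
  have "len i = mf.\<tau>" unfolding len_def mf.\<tau>_def using f.closed_length[of "hilbert_dist (pt ` C)" 1] by simp
  then show ?thesis using mf.gap_has_sum by simp
qed

theorem length_identity: "(gap (pt ` C) \<alpha> has_sum (\<Sum>i<m. len i)) (orthoset \<Delta> m \<alpha>)"
proof -
  have "(gap (pt ` C) \<alpha> has_sum (\<Sum>i<n. len i)) {x \<in> orthoset \<Delta> m \<alpha>. fst x < n}" if "n \<le> m" for n
    using that
  proof (induction n)
    case (Suc n)
    have "{x \<in> orthoset \<Delta> m \<alpha>. fst x < Suc n} = {x \<in> orthoset \<Delta> m \<alpha>. fst x < n} \<union> {x \<in> orthoset \<Delta> m \<alpha>. fst x = n}"
      by auto
    moreover have "(gap (pt ` C) \<alpha> has_sum ((\<Sum>i<n. len i) + len n))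
        ({x \<in> orthoset \<Delta> m \<alpha>. fst x < n} \<union> {x \<in> orthoset \<Delta> m \<alpha>. fst x = n})"
      using Suc mark_gap_has_sum[of n] by (intro has_sum_Un_disjoint) auto
    ultimately show ?case by simp
  qed simp
  moreover have "{x \<in> orthoset \<Delta> m \<alpha>. fst x < m} = orthoset \<Delta> m \<alpha>" using orthoset_mem by auto
  ultimately show ?thesis by fastforce
qed

end

section \<open>Hyperbolic geometry\<close>

lemma diag3_inner: "a \<bullet> (diag3 x y z *v b) = x * a $ 1 * b $ 1 + y * a $ 2 * b $ 2 + z * a $ 3 * b $ 3"
  by (simp add: diag3_def matrix_vector_mult_def inner_vec_def sum_3 algebra_simps)

text \<open>The argument is \<open>cosh\<close> of half the logarithm of \<open>s / t\<close>. This
  half is the factor 2 between the Hilbert and the hyperbolic metric.\<close>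

lemma arcosh_ratio:
  assumes "s > 0" "t > 0"
  shows "arcosh ((s + t) / (2 * sqrt (s * t))) = \<bar>ln s - ln t\<bar> / (2::real)"
proof -
  define x where "x = (ln s - ln t) / 2"
  have "exp x = sqrt (s / t)"
    using assms by (simp add: x_def powr_half_sqrt[symmetric] powr_def ln_div)
  then have e: "exp x = sqrt s / sqrt t" "exp (- x) = sqrt t / sqrt s"
    by (simp_all add: real_sqrt_divide exp_minus)
  have "cosh x = (s + t) / (2 * sqrt (s * t))"
    unfolding cosh_def e real_sqrt_mult using assms by (simp add: field_simps)
  then have "arcosh ((s + t) / (2 * sqrt (s * t))) = arcosh (cosh \<bar>x\<bar>)" by (simp add: cosh_real_abs)
  also have "\<dots> = \<bar>x\<bar>" by (rule arcosh_cosh_real) simp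
  finally show ?thesis by (simp add: x_def)
qed

lemma rep_pt:
  assumes "v \<noteq> 0"
  obtains c where "c \<noteq> 0" "rep (pt v) = c *\<^sub>R v"
proof -
  have "rep (pt v) \<in> Rep_rp2 (pt v) \<and> rep (pt v) \<noteq> 0"
    unfolding rep_def by (rule someI[of _ v]) (use assms mem_Rep_pt[of v v] scaleR_one in metis)
  then obtain c where "rep (pt v) = c *\<^sub>R v" "rep (pt v) \<noteq> 0" using mem_Rep_pt[OF assms] by blast
  then show thesis using that[of c] by auto
qed

locale conic = strict_cone C for C +
  fixes Q :: "real^3^3"
  assumes conic_form: "conic_form Q" and conic_interior: "pt ` C = conic_interior Q"
begin

definition qf :: "real^3 \<Rightarrow> real^3 \<Rightarrow> real" where "qf u v = u \<bullet> (Q *v v)"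

lemma qf_linear:
  "qf (u + v) w = qf u w + qf v w" "qf w (u + v) = qf w u + qf w v" "qf (c *\<^sub>R u) v = c * qf u v" "qf u (c *\<^sub>R v) = c * qf u v"
  by (simp_all add: qf_def inner_add_left inner_add_right matrix_vector_right_distrib matrix_vector_mult_scaleR)

lemma qf_basis:
  obtains e1 e2 e3 where "qf e1 e1 = 1" "qf e2 e2 = 1" "qf e3 e3 = -1"
    "qf e1 e2 = 0" "qf e1 e3 = 0" "qf e2 e3 = 0" "qf e2 e1 = 0" "qf e3 e1 = 0" "qf e3 e2 = 0"
    "\<forall>v. \<exists>a b c. v = a *\<^sub>R e1 + b *\<^sub>R e2 + c *\<^sub>R e3"
proof -
  obtain T where T: "invertible T" "Q = transpose T ** diag3 1 1 (-1) ** T" using conic_form by (auto simp: conic_form_def)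
  have q: "qf u v = (T *v u) $ 1 * (T *v v) $ 1 + (T *v u) $ 2 * (T *v v) $ 2 - (T *v u) $ 3 * (T *v v) $ 3" for u v
  proof -
    have "qf u v = u \<bullet> (transpose T *v (diag3 1 1 (-1) *v (T *v v)))"
      unfolding qf_def by (simp only: T(2) matrix_vector_mul_assoc[symmetric])
    also have "\<dots> = (diag3 1 1 (-1) *v (T *v v)) \<bullet> (T *v u)" using transpose_inner by (simp only: inner_commute[of u])
    also have "\<dots> = (T *v u) \<bullet> (diag3 1 1 (-1) *v (T *v v))" by (rule inner_commute)
    finally show ?thesis by (simp add: diag3_inner)
  qed
  define e where "e i = matrix_inv T *v axis i 1" for i :: 3
  have Te: "T *v e i = axis i 1" for i using matrix_inv_mult_vec[OF T(1)] by (simp add: e_def)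
  have ex: "\<exists>a b c. v = a *\<^sub>R e 1 + b *\<^sub>R e 2 + c *\<^sub>R e 3" for v
  proof -
    have "v = matrix_inv T *v (T *v v)" using matrix_inv_mult_vec[OF T(1)] by simp
    also have "\<dots> = matrix_inv T *v (((T *v v) $ 1) *\<^sub>R axis 1 1 + ((T *v v) $ 2) *\<^sub>R axis 2 1 + ((T *v v) $ 3) *\<^sub>R axis 3 1)"
      using vec3_expansion[of "T *v v"] by (rule arg_cong)
    finally show ?thesis by (simp add: e_def matrix_vector_right_distrib matrix_vector_mult_scaleR) blast
  qed
  show thesis by (rule that[of "e 1" "e 2" "e 3"]) (simp_all add: q Te axis_def ex)
qed

lemma qf_sym: "qf u v = qf v u"
proof -
  obtain e1 e2 e3 where e: "qf e1 e1 = 1" "qf e2 e2 = 1" "qf e3 e3 = -1"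
    "qf e1 e2 = 0" "qf e1 e3 = 0" "qf e2 e3 = 0" "qf e2 e1 = 0" "qf e3 e1 = 0" "qf e3 e2 = 0"
    "\<forall>v. \<exists>a b c. v = a *\<^sub>R e1 + b *\<^sub>R e2 + c *\<^sub>R e3" by (rule qf_basis)
  obtain a b c a' b' c' where "u = a *\<^sub>R e1 + b *\<^sub>R e2 + c *\<^sub>R e3" "v = a' *\<^sub>R e1 + b' *\<^sub>R e2 + c' *\<^sub>R e3"
    using e(10) by meson
  then show ?thesis by (simp add: qf_linear e(1-9))
qed

lemma pt_C_iff: "v \<noteq> 0 \<Longrightarrow> pt v \<in> pt ` C \<longleftrightarrow> qf v v < 0"
proof -
  assume v: "v \<noteq> 0"
  have "qf (c *\<^sub>R v) (c *\<^sub>R v) = c\<^sup>2 * qf v v" for c by (simp add: qf_linear power2_eq_square)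
  then have "(\<forall>w\<in>Rep_rp2 (pt v). w \<noteq> 0 \<longrightarrow> qf w w < 0) \<longleftrightarrow> qf v v < 0"
    unfolding Bex_def using v mem_Rep_pt[OF v] scaleR_one[of v]
    by (metis mult_pos_neg scale_eq_0_iff zero_less_power2)
  then show ?thesis unfolding conic_interior by (simp add: conic_interior_def qf_def)
qed

lemma qf_C: "v \<in> C \<Longrightarrow> qf v v < 0"
  using pt_C_iff[OF C_nonzero] by blast

lemma qf_bd: assumes u: "u \<in> bd" shows "qf u u = 0"
proof (rule antisym)
  have "continuous_on UNIV (\<lambda>v. qf v v)" unfolding qf_def
    by (intro continuous_intros linear_continuous_on bounded_linear.linear matrix_vector_mul_bounded_linear)
  then have "closed {v. qf v v \<le> 0}" by (simp add: closed_Collect_le)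
  moreover have "C \<subseteq> {v. qf v v \<le> 0}" using qf_C by force
  ultimately have "closure C \<subseteq> {v. qf v v \<le> 0}" by (rule closure_minimal[rotated])
  then show "qf u u \<le> 0" using u bdD by blast
  show "0 \<le> qf u u" using pt_in_image[of u] pt_C_iff[of u] bdD[OF u] by force
qed

text \<open>A null vector is a limit of negative vectors, so its class is in the closure of the
  domain; having value 0, it is not in the interior.\<close>

lemma null_bd:
  assumes w: "qf w w = 0" "w \<noteq> 0"
  shows "w \<in> bd \<or> - w \<in> bd"
proof -
  obtain e1 e2 e3 where e: "qf e1 e1 = 1" "qf e2 e2 = 1" "qf e3 e3 = -1"
    "qf e1 e2 = 0" "qf e1 e3 = 0" "qf e2 e3 = 0" "qf e2 e1 = 0" "qf e3 e1 = 0" "qf e3 e2 = 0"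
    "\<forall>v. \<exists>a b c. v = a *\<^sub>R e1 + b *\<^sub>R e2 + c *\<^sub>R e3" by (rule qf_basis)
  obtain a b c where wabc: "w = a *\<^sub>R e1 + b *\<^sub>R e2 + c *\<^sub>R e3" using e(10) by meson
  have abc: "a * a + b * b = c * c" using w(1) unfolding wabc by (simp add: qf_linear e(1-9))
  have c: "c \<noteq> 0"
  proof
    assume "c = 0"
    then have "a = 0 \<and> b = 0" using abc sum_squares_eq_zero_iff by simp
    then show False using w(2) \<open>c = 0\<close> wabc by simp
  qed
  \<comment> \<open>The added multiple of \<open>e3\<close> has the sign of the \<open>e3\<close>
    coordinate of \<open>w\<close>, so it only enlarges the negative square.\<close>
  define z where "z n = w + (c / real (Suc n)) *\<^sub>R e3" for n
  have z: "pt (z n) \<in> pt ` C" for n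
  proof -
    define \<delta> where "\<delta> = 1 / real (Suc n)"
    have \<delta>: "\<delta> > 0" "z n = w + (c * \<delta>) *\<^sub>R e3" by (simp_all add: \<delta>_def z_def)
    have "qf (z n) (z n) = a * a + b * b - c * c - (c * c) * (2 * \<delta> + \<delta> * \<delta>)"
      unfolding \<delta>(2) wabc by (simp add: qf_linear e(1-9) algebra_simps)
    also have "\<dots> < 0"
    proof -
      have "c * c > 0" using c by (simp add: zero_less_mult_iff) linarith
      then have "(c * c) * (2 * \<delta> + \<delta> * \<delta>) > 0" using \<delta>(1) by (intro mult_pos_pos[of "c * c"] add_pos_pos) auto
      then show ?thesis using abc by linarith
    qed
    finally have "qf (z n) (z n) < 0" .
    moreover from this have "z n \<noteq> 0" by (auto simp: qf_def)
    ultimately show ?thesis using pt_C_iff by blast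
  qed
  have "(\<lambda>n. z n) \<longlonglongrightarrow> w + 0 *\<^sub>R e3" unfolding z_def
    by (intro tendsto_add tendsto_const tendsto_scaleR) (rule LIMSEQ_Suc[OF lim_const_over_n])
  then have "(\<lambda>n. pt (z n)) \<longlonglongrightarrow> pt w" using w(2) by (intro tendsto_pt) auto
  then have "pt w \<in> closure (pt ` C)"
    by (rule Lim_in_closed_set[OF closed_closure, rotated 2]) (use z closure_subset[of "pt ` C"] in \<open>auto intro!: always_eventually\<close>)
  then obtain u where u: "u \<in> closure C" "u \<noteq> 0" "pt w = pt u" unfolding closure_pt_image by auto
  then obtain r where r: "r \<noteq> 0" "u = r *\<^sub>R w" using pt_eq_iff[of u w] w(2) by auto
  have uC: "u \<notin> C" using qf_C[of u] r w(1) by (auto simp: qf_linear)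
  then have ub: "u \<in> bd" using u by (simp add: bd_def)
  show ?thesis
  proof (cases "r > 0")
    case True
    then have "w = (1 / r) *\<^sub>R u" using r by simp
    then show ?thesis using bd_scale[OF ub, of "1 / r"] True by simp
  next
    case False
    then have "- w = (- 1 / r) *\<^sub>R u" using r by simp
    then show ?thesis using bd_scale[OF ub, of "- 1 / r"] False r by simp
  qed
qed

lemma qf_bd_neg: "u \<in> bd \<Longrightarrow> v \<in> bd \<Longrightarrow> pt u \<noteq> pt v \<Longrightarrow> qf u v < 0"
proof -
  assume uv: "u \<in> bd" "v \<in> bd" "pt u \<noteq> pt v"
  then have "1 *\<^sub>R u + 1 *\<^sub>R v \<in> C" using bdD by (intro C_pos_comb) auto
  then have "qf (u + v) (u + v) < 0" using qf_C by simp
  then show ?thesis using qf_bd[OF uv(1)] qf_bd[OF uv(2)] qf_sym[of u v] by (simp add: qf_linear)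
qed

text \<open>A lift preserves the boundary, so the transported form vanishes on all null vectors of
  \<open>qf\<close>, and a form vanishing on the light cone is a multiple of the original one. The
  factor is positive because both forms are negative on \<open>C\<close>.\<close>

lemma qf_lift:
  assumes A: "lifts C a A"
  obtains \<kappa> where "\<kappa> > 0" "\<forall>v w. qf (A *v v) (A *v w) = \<kappa> * qf v w"
proof -
  obtain e1 e2 e3 where e: "qf e1 e1 = 1" "qf e2 e2 = 1" "qf e3 e3 = -1"
    "qf e1 e2 = 0" "qf e1 e3 = 0" "qf e2 e3 = 0" "qf e2 e1 = 0" "qf e3 e1 = 0" "qf e3 e2 = 0"
    "\<forall>v. \<exists>a b c. v = a *\<^sub>R e1 + b *\<^sub>R e2 + c *\<^sub>R e3" by (rule qf_basis)
  define g where "g v w = qf (A *v v) (A *v w)" for v w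
  have gl: "g (u + v) w = g u w + g v w" "g w (u + v) = g w u + g w v" "g (c *\<^sub>R u) v = c * g u v" "g u (c *\<^sub>R v) = c * g u v" for u v w c
    by (simp_all add: g_def qf_linear matrix_vector_right_distrib matrix_vector_mult_scaleR)
  have gs: "g u v = g v u" for u v unfolding g_def by (rule qf_sym)
  have null: "g v v = 0" if "qf v v = 0" for v
  proof (cases "v = 0")
    case False
    from null_bd[OF that this] show ?thesis
    proof
      assume "v \<in> bd"
      then show ?thesis using lift_bd[OF A] qf_bd by (simp add: g_def)
    next
      assume "- v \<in> bd"
      then have "qf (A *v (- v)) (A *v (- v)) = 0" using lift_bd[OF A] qf_bd by blast
      moreover have "- v = (-1) *\<^sub>R v" by simp
      ultimately show ?thesis unfolding g_def by (metis matrix_vector_mult_scaleR mult_minus1 neg_equal_0_iff_equal qf_linear(3,4))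
    qed
  qed (simp add: g_def qf_def)
  note q = qf_linear e(1-9)
  \<comment> \<open>The first four null vectors kill the products with \<open>e3\<close> and equate
    the diagonal up to sign; the Pythagorean triple 3, 4, 5 then isolates the product of
    \<open>e1\<close> and \<open>e2\<close>.\<close>
  have 1: "g (e1 + e3) (e1 + e3) = 0" "g (e1 + (-1) *\<^sub>R e3) (e1 + (-1) *\<^sub>R e3) = 0"
    "g (e2 + e3) (e2 + e3) = 0" "g (e2 + (-1) *\<^sub>R e3) (e2 + (-1) *\<^sub>R e3) = 0"
    "g (3 *\<^sub>R e1 + 4 *\<^sub>R e2 + 5 *\<^sub>R e3) (3 *\<^sub>R e1 + 4 *\<^sub>R e2 + 5 *\<^sub>R e3) = 0"
    by (rule null; simp only: q; simp)+
  note s = gs[of e2 e1] gs[of e3 e1] gs[of e3 e2]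
  have "g e1 e1 + 2 * g e1 e3 + g e3 e3 = 0" "g e1 e1 - 2 * g e1 e3 + g e3 e3 = 0"
    using 1(1,2) by (simp_all only: gl s) (simp_all add: algebra_simps)
  then have 2: "g e1 e3 = 0" "g e1 e1 = - g e3 e3" by linarith+
  have "g e2 e2 + 2 * g e2 e3 + g e3 e3 = 0" "g e2 e2 - 2 * g e2 e3 + g e3 e3 = 0"
    using 1(3,4) by (simp_all only: gl s) (simp_all add: algebra_simps)
  then have 3: "g e2 e3 = 0" "g e2 e2 = - g e3 e3" by linarith+
  have 4: "g e1 e2 = 0" using 1(5) 2 3 unfolding gl s by simp
  define \<kappa> where "\<kappa> = - g e3 e3"
  have eq: "g v w = \<kappa> * qf v w" for v w
  proof -
    obtain a b c a' b' c' where "v = a *\<^sub>R e1 + b *\<^sub>R e2 + c *\<^sub>R e3" "w = a' *\<^sub>R e1 + b' *\<^sub>R e2 + c' *\<^sub>R e3"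
      using e(10) by meson
    then show ?thesis by (simp add: q gl s 2 3 4 \<kappa>_def algebra_simps)
  qed
  obtain v where v: "v \<in> C" using nonempty by blast
  then have "g v v < 0" "qf v v < 0" using qf_C lift_C[OF A] by (auto simp: g_def)
  then have "\<kappa> > 0" unfolding eq by (simp add: mult_less_0_iff)
  then show thesis using that eq by (simp add: g_def)
qed

lemma hyp_dist_pt:
  assumes "v \<noteq> 0" "w \<noteq> 0"
  shows "hyp_dist Q (pt v) (pt w) = arcosh (\<bar>qf v w\<bar> / sqrt (qf v v * qf w w))"
proof -
  obtain c d where c: "c \<noteq> 0" "rep (pt v) = c *\<^sub>R v" and d: "d \<noteq> 0" "rep (pt w) = d *\<^sub>R w"
    using rep_pt assms by metis
  have "\<bar>qf (c *\<^sub>R v) (d *\<^sub>R w)\<bar> = \<bar>c * d\<bar> * \<bar>qf v w\<bar>" by (simp add: qf_linear abs_mult)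
  moreover have "sqrt (qf (c *\<^sub>R v) (c *\<^sub>R v) * qf (d *\<^sub>R w) (d *\<^sub>R w)) = \<bar>c * d\<bar> * sqrt (qf v v * qf w w)"
  proof -
    have "qf (c *\<^sub>R v) (c *\<^sub>R v) * qf (d *\<^sub>R w) (d *\<^sub>R w) = (c * d)\<^sup>2 * (qf v v * qf w w)"
      by (simp add: qf_linear power2_eq_square algebra_simps)
    then show ?thesis by (simp only: real_sqrt_mult real_sqrt_abs)
  qed
  ultimately show ?thesis using c d by (simp add: hyp_dist_def Let_def qf_def)
qed

lemma hyp_perpendicular_pt:
  assumes x: "x \<in> C" and "y \<noteq> 0" "z \<noteq> 0"
  shows "hyp_perpendicular_at Q (pt x) (pt y) (pt z) \<longleftrightarrow> qf x x * qf y z = qf x y * qf x z"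
proof -
  obtain a b c where a: "a \<noteq> 0" "rep (pt x) = a *\<^sub>R x" and b: "b \<noteq> 0" "rep (pt y) = b *\<^sub>R y" and c: "c \<noteq> 0" "rep (pt z) = c *\<^sub>R z"
    using rep_pt assms C_nonzero by metis
  have xx: "qf x x \<noteq> 0" using qf_C[OF x] by simp
  have dir: "rep (pt y) - ((qf (rep (pt x)) (rep (pt y))) / (qf (rep (pt x)) (rep (pt x)))) *\<^sub>R rep (pt x) = b *\<^sub>R (y + (- (qf x y / qf x x)) *\<^sub>R x)"
    if "b \<noteq> 0" "rep (pt y) = b *\<^sub>R y" for b y using a that xx by (simp add: qf_linear algebra_simps)
  have "hyp_perpendicular_at Q (pt x) (pt y) (pt z) \<longleftrightarrow>
      qf (b *\<^sub>R (y + (- (qf x y / qf x x)) *\<^sub>R x)) (c *\<^sub>R (z + (- (qf x z / qf x x)) *\<^sub>R x)) = 0"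
    unfolding hyp_perpendicular_at_def Let_def using dir[OF b] dir[OF c] by (simp add: qf_def)
  also have "\<dots> \<longleftrightarrow> qf (y + (- (qf x y / qf x x)) *\<^sub>R x) (z + (- (qf x z / qf x x)) *\<^sub>R x) = 0" using b c by (simp add: qf_linear(3,4))
  also have "qf (y + (- (qf x y / qf x x)) *\<^sub>R x) (z + (- (qf x z / qf x x)) *\<^sub>R x) = qf y z - qf x y * qf x z / qf x x"
    using xx by (simp only: qf_linear qf_sym[of y x]) (simp add: field_simps)
  finally show ?thesis using xx by (simp add: field_simps)
qed

lemma hilbert_hyp:
  assumes "x \<in> pt ` C" "y \<in> pt ` C"
  shows "hilbert_dist (pt ` C) x y = 2 * hyp_dist Q x y"
proof (cases "x = y")
  case True
  obtain v where v: "v \<in> C" "x = pt v" using assms by blast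
  have "sqrt (qf v v * qf v v) = \<bar>qf v v\<bar>" by simp
  then have "hyp_dist Q x x = arcosh 1" using hyp_dist_pt[of v v] C_nonzero[OF v(1)] qf_C[OF v(1)] v(2) by simp
  then show ?thesis using True by (simp add: hilbert_dist_def)
next
  case False
  obtain x' y' where x': "x' \<in> C" "x = pt x'" and y': "y' \<in> C" "y = pt y'" using assms by blast
  then have "pt x' \<noteq> pt y'" using False by simp
  with x' y' obtain u v a b a' b' where uv: "u \<in> bd" "v \<in> bd" "pt u \<noteq> pt v" and
    ab: "a > 0" "b > 0" "a' > 0" "b' > 0" "x' = a *\<^sub>R u + b *\<^sub>R v" "y' = a' *\<^sub>R u + b' *\<^sub>R v"
    using chord by metis
  define s t where "s = a / b" and "t = a' / b'"
  have st: "s > 0" "t > 0" "x = pt (s *\<^sub>R u + v)" "y = pt (t *\<^sub>R u + v)"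
    using ab x' y' by (auto simp: s_def t_def pencil_scale)
  have PC: "r *\<^sub>R u + v \<in> C" if "r > 0" for r
    using C_pos_comb[of u v r 1] uv that bdD by auto
  define w where "w = - qf u v"
  have w: "w > 0" using qf_bd_neg[OF uv] by (simp add: w_def)
  have q: "qf (r *\<^sub>R u + v) (r' *\<^sub>R u + v) = - w * (r + r')" for r r'
    using qf_bd[OF uv(1)] qf_bd[OF uv(2)] qf_sym[of u v] by (simp add: w_def qf_linear algebra_simps)
  have "\<bar>qf (s *\<^sub>R u + v) (t *\<^sub>R u + v)\<bar> = w * (s + t)" using w st by (simp add: q abs_mult)
  moreover have "sqrt (qf (s *\<^sub>R u + v) (s *\<^sub>R u + v) * qf (t *\<^sub>R u + v) (t *\<^sub>R u + v)) = w * (2 * sqrt (s * t))"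
  proof -
    have "qf (s *\<^sub>R u + v) (s *\<^sub>R u + v) * qf (t *\<^sub>R u + v) (t *\<^sub>R u + v) = (w * 2)\<^sup>2 * (s * t)"
      unfolding q by (simp add: power2_eq_square)
    then show ?thesis using w by (simp add: real_sqrt_mult)
  qed
  ultimately have "hyp_dist Q x y = arcosh ((s + t) / (2 * sqrt (s * t)))"
    using hyp_dist_pt[of "s *\<^sub>R u + v" "t *\<^sub>R u + v"] PC[OF st(1)] PC[OF st(2)] C_nonzero st w by simp
  then show ?thesis using hilbert_dist_pencil[OF uv st(1,2)] st arcosh_ratio[OF st(1,2)] by simp
qed

lemma hyp_dist_eq: "x \<in> pt ` C \<Longrightarrow> y \<in> pt ` C \<Longrightarrow> hyp_dist Q x y = 1 / 2 * hilbert_dist (pt ` C) x y"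
  using hilbert_hyp by simp

lemma hyp_dist_lift:
  assumes A: "lifts C a A" and xy: "x \<in> pt ` C" "y \<in> pt ` C"
  shows "hyp_dist Q (a x) (a y) = hyp_dist Q x y"
proof -
  obtain v w where v: "v \<in> C" "x = pt v" and w: "w \<in> C" "y = pt w" using xy by blast
  obtain \<kappa> where k: "\<kappa> > 0" "\<forall>v w. qf (A *v v) (A *v w) = \<kappa> * qf v w" by (rule qf_lift[OF A])
  have n: "v \<noteq> 0" "w \<noteq> 0" "A *v v \<noteq> 0" "A *v w \<noteq> 0" using v w C_nonzero lift_nonzero[OF A] by auto
  have "sqrt (\<kappa> * qf v v * (\<kappa> * qf w w)) = \<kappa> * sqrt (qf v v * qf w w)"
  proof -
    have "\<kappa> * qf v v * (\<kappa> * qf w w) = \<kappa>\<^sup>2 * (qf v v * qf w w)" by (simp add: power2_eq_square algebra_simps)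
    then show ?thesis using k(1) by (simp only: real_sqrt_mult real_sqrt_abs abs_of_pos)
  qed
  then show ?thesis using n k(1) by (simp add: v w lift_pt[OF A] hyp_dist_pt k(2) abs_mult)
qed

lemma hyp_perpendicular_lift:
  assumes A: "lifts C a A" and xyz: "x \<in> pt ` C" "y \<in> pt ` C" "z \<in> pt ` C"
  shows "hyp_perpendicular_at Q (a x) (a y) (a z) \<longleftrightarrow> hyp_perpendicular_at Q x y z"
proof -
  obtain u v w where u: "u \<in> C" "x = pt u" and v: "v \<in> C" "y = pt v" and w: "w \<in> C" "z = pt w" using xyz by blast
  obtain \<kappa> where k: "\<kappa> > 0" "\<forall>v w. qf (A *v v) (A *v w) = \<kappa> * qf v w" by (rule qf_lift[OF A])
  have n: "u \<noteq> 0" "v \<noteq> 0" "w \<noteq> 0" "A *v u \<in> C" "A *v v \<noteq> 0" "A *v w \<noteq> 0" using u v w C_nonzero lift_nonzero[OF A] lift_C[OF A] by auto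
  show ?thesis using k(1) u(1) n
    by (simp add: u(2) v(2) w(2) lift_pt[OF A] hyp_perpendicular_pt k(2))
qed

text \<open>On a chord with null ends the form is a multiple of \<open>r s' + r' s\<close>, and the
  condition becomes linear in \<open>z\<close>; it holds for all \<open>z\<close> exactly if
  \<open>x\<close> pairs to zero with the tangent vector of the chord.\<close>

lemma perpendicular_pencil:
  assumes uv: "u \<in> bd" "v \<in> bd" "pt u \<noteq> pt v" and p: "\<nu> > 0" "\<mu> > 0" and x: "x \<noteq> 0"
  shows "(\<forall>z>0. hyp_perpendicular_at Q (pt (\<nu> *\<^sub>R u + \<mu> *\<^sub>R v)) (pt x) (pt (z *\<^sub>R u + v))) \<longleftrightarrow> \<nu> * qf u x = \<mu> * qf v x"
proof -
  have PC: "r *\<^sub>R u + s *\<^sub>R v \<in> C" if "r > 0" "s > 0" for r s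
    using C_pos_comb[of u v r s] uv that bdD by auto
  define g where "g = qf u v"
  have g: "g < 0" using qf_bd_neg[OF uv] by (simp add: g_def)
  have q: "qf (r *\<^sub>R u + s *\<^sub>R v) (r' *\<^sub>R u + s' *\<^sub>R v) = g * (r * s' + r' * s)" for r r' s s'
    using qf_bd[OF uv(1)] qf_bd[OF uv(2)] qf_sym[of u v] by (simp add: g_def qf_linear algebra_simps)
  have *: "hyp_perpendicular_at Q (pt (\<nu> *\<^sub>R u + \<mu> *\<^sub>R v)) (pt x) (pt (z *\<^sub>R u + v)) \<longleftrightarrow>
    2 * \<nu> * \<mu> * (z * qf u x + qf v x) = (\<nu> * qf u x + \<mu> * qf v x) * (\<nu> + z * \<mu>)" if "z > 0" for z
  proof -
    have zC: "z *\<^sub>R u + v \<noteq> 0" using PC[OF that zero_less_one] C_nonzero by auto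
    have e: "qf (\<nu> *\<^sub>R u + \<mu> *\<^sub>R v) (z *\<^sub>R u + v) = g * (\<nu> + z * \<mu>)" using q[of \<nu> \<mu> z 1] by simp
    have "qf x (z *\<^sub>R u + v) = z * qf u x + qf v x" "qf (\<nu> *\<^sub>R u + \<mu> *\<^sub>R v) x = \<nu> * qf u x + \<mu> * qf v x"
      by (simp_all add: qf_linear qf_sym[of x])
    then have "hyp_perpendicular_at Q (pt (\<nu> *\<^sub>R u + \<mu> *\<^sub>R v)) (pt x) (pt (z *\<^sub>R u + v)) \<longleftrightarrow>
        g * (\<nu> * \<mu> + \<nu> * \<mu>) * (z * qf u x + qf v x) = (\<nu> * qf u x + \<mu> * qf v x) * (g * (\<nu> + z * \<mu>))"
      unfolding hyp_perpendicular_pt[OF PC[OF p] x zC] q e by simp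
    also have "\<dots> \<longleftrightarrow> g * (2 * \<nu> * \<mu> * (z * qf u x + qf v x)) = g * ((\<nu> * qf u x + \<mu> * qf v x) * (\<nu> + z * \<mu>))"
      by (simp add: algebra_simps)
    finally show ?thesis using g by simp
  qed
  show ?thesis
  proof
    assume a: "\<forall>z>0. hyp_perpendicular_at Q (pt (\<nu> *\<^sub>R u + \<mu> *\<^sub>R v)) (pt x) (pt (z *\<^sub>R u + v))"
    \<comment> \<open>The condition is empty at the foot itself, where
      \<open>z = \<nu> / \<mu>\<close>; any other value determines it.\<close>
    define z where "z = 2 * \<nu> / \<mu>"
    have z: "z > 0" "z * \<mu> = 2 * \<nu>" using p by (simp_all add: z_def)
    have "2 * \<nu> * \<mu> * (z * qf u x + qf v x) = (\<nu> * qf u x + \<mu> * qf v x) * (\<nu> + z * \<mu>)" using a * z by blast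
    then have "2 * \<nu> * (z * \<mu>) * qf u x + 2 * \<nu> * \<mu> * qf v x = (\<nu> * qf u x + \<mu> * qf v x) * (\<nu> + z * \<mu>)" by (simp add: algebra_simps)
    then have "\<nu> * (\<nu> * qf u x) = \<nu> * (\<mu> * qf v x)" unfolding z(2) by (simp add: algebra_simps)
    then show "\<nu> * qf u x = \<mu> * qf v x" using p by simp
  next
    assume e: "\<nu> * qf u x = \<mu> * qf v x"
    show "\<forall>z>0. hyp_perpendicular_at Q (pt (\<nu> *\<^sub>R u + \<mu> *\<^sub>R v)) (pt x) (pt (z *\<^sub>R u + v))"
    proof (intro allI impI)
      fix z :: real assume z: "z > 0"
      have "2 * \<nu> * \<mu> * (z * qf u x + qf v x) = 2 * z * \<mu> * (\<nu> * qf u x) + 2 * \<nu> * (\<mu> * qf v x)" by (simp add: algebra_simps)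
      also have "\<dots> = (\<nu> * qf u x + \<mu> * qf v x) * (\<nu> + z * \<mu>)" unfolding e by (simp add: algebra_simps)
      finally show "hyp_perpendicular_at Q (pt (\<nu> *\<^sub>R u + \<mu> *\<^sub>R v)) (pt x) (pt (z *\<^sub>R u + v))" using *[OF z] by blast
    qed
  qed
qed

end

section \<open>Common perpendiculars\<close>

definition common_perpendicular :: "real^3^3 \<Rightarrow> rp2 set \<Rightarrow> rp2 set \<Rightarrow> rp2 \<Rightarrow> rp2 \<Rightarrow> bool" where
  "common_perpendicular Q L M x y \<longleftrightarrow>
     (\<forall>z\<in>L. hyp_perpendicular_at Q x y z) \<and> (\<forall>z\<in>M. hyp_perpendicular_at Q y x z)"

text \<open>Half-argument formulas: the squares of \<open>cosh (d / 2)\<close> and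
  \<open>sinh (d / 2)\<close> are \<open>q / (q - p)\<close> and \<open>p / (q - p)\<close>, so the
  square of \<open>coth (d / 2)\<close> is \<open>q / p\<close>.\<close>

lemma ln_coth_half:
  assumes "0 < p" "p < (q::real)"
  shows "4 * ln (coth (arcosh ((p + q) / (q - p)) / 2)) = 2 * (ln q - ln p)"
proof -
  define d where "d = arcosh ((p + q) / (q - p))"
  have R: "(p + q) / (q - p) > 1" using assms by (simp add: field_simps)
  have "d > 0" unfolding d_def using arcosh_real_gt_1_iff[of "(p + q) / (q - p)"] R by argo
  moreover have "cosh d = (p + q) / (q - p)" using R by (simp add: d_def)
  ultimately have d: "cosh d = (p + q) / (q - p)" "d > 0" by blast+
  have "(p + q) / (q - p) + 1 = 2 * (q / (q - p))" "(p + q) / (q - p) - 1 = 2 * (p / (q - p))"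
    using assms by (simp_all add: field_simps)
  then have c: "(cosh (d / 2))\<^sup>2 = q / (q - p)" and s: "(sinh (d / 2))\<^sup>2 = p / (q - p)"
    using d(1) cosh_double_cosh[of "d / 2"] cosh_square_eq[of "d / 2"] by simp_all
  have pos: "cosh (d / 2) > 0" "sinh (d / 2) > 0" using d(2) by simp_all
  then have "coth (d / 2) > 0" by (simp add: coth_def)
  moreover have "(coth (d / 2))\<^sup>2 = q / p" unfolding coth_def power_divide c s using assms by simp
  ultimately have "2 * ln (coth (d / 2)) = ln (q / p)" using ln_realpow[of "coth (d / 2)" 2] by simp
  then show ?thesis using assms by (simp add: ln_div d_def)
qed

context surface
begin

lemma wall_pencil:
  assumes M: "M \<in> BG" and uv: "u \<in> bd" "v \<in> bd" "pt u \<noteq> pt v" "wf M \<bullet> u = 0" "wf M \<bullet> v = 0"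
  shows "p \<in> M \<longleftrightarrow> (\<exists>s>0. p = pt (s *\<^sub>R u + v))"
proof -
  have mem: "pt (s *\<^sub>R u + v) \<in> M" if "s > 0" for s
    using C_pos_comb[of u v s 1] uv that bdD mem_L[OF _ M, of "s *\<^sub>R u + v"] by (auto simp: inner_add_right)
  have "M \<in> geodesics (pt ` C)" using M by (simp add: boundary_geodesics_def)
  have "\<exists>s>0. p = pt (s *\<^sub>R u + v)" if p: "p \<in> M"
  proof -
    have ne: "(1::real) \<noteq> 1 + 1" by simp
    obtain s where "s > 0" "p = pt (s *\<^sub>R u + v)"
      using geodesic_pencil[OF uv(1-3) zero_less_one zero_less_two ne \<open>M \<in> geodesics _\<close> mem[OF zero_less_one] mem[OF zero_less_two] p, of thesis] by blast
    then show ?thesis by blast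
  qed
  then show ?thesis using mem by blast
qed

end

locale framed_conic = framed C Ft \<Delta> L a A b1 b2 b3 f1 f2 f3 l1 l2 l3 + conic C Q
  for C Ft \<Delta> L a A b1 b2 b3 f1 f2 f3 l1 l2 l3 Q
begin

text \<open>The lift scales the form by some factor. The nonzero pairing of \<open>b1\<close> and
  \<open>b3\<close> shows that it is \<open>l1 * l3\<close>; since the eigenvalues are distinct,
  \<open>b2\<close> must be orthogonal to both. The pole is thus polar to \<open>L\<close> for the
  conic, which makes the projection the hyperbolic one.\<close>

lemma qf_b: "qf b1 b1 = 0" "qf b3 b3 = 0" "qf b1 b2 = 0" "qf b2 b3 = 0" "qf b1 b3 < 0"
proof -
  show "qf b1 b1 = 0" "qf b3 b3 = 0" "qf b1 b3 < 0" using qf_bd qf_bd_neg b pt_b_distinct by auto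
  obtain \<kappa> where k: "\<kappa> > 0" "\<forall>v w. qf (A *v v) (A *v w) = \<kappa> * qf v w" by (rule qf_lift[OF A])
  have "l1 * l3 * qf b1 b3 = \<kappa> * qf b1 b3" using k(2)[rule_format, of b1 b3] by (simp only: eig qf_linear ac_simps)
  then have K: "\<kappa> = l1 * l3" using \<open>qf b1 b3 < 0\<close> by (metis less_irrefl mult_right_cancel)
  have "l1 * l2 * qf b1 b2 = l1 * l3 * qf b1 b2" using k(2)[rule_format, of b1 b2] by (simp only: eig qf_linear K ac_simps)
  then show "qf b1 b2 = 0" using l lpos by simp
  have "l2 * l3 * qf b2 b3 = l1 * l3 * qf b2 b3" using k(2)[rule_format, of b2 b3] by (simp only: eig qf_linear K ac_simps)
  then show "qf b2 b3 = 0" using l lpos by simp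
qed

definition \<omega> :: real where "\<omega> = - qf b1 b3"
definition \<beta> :: real where "\<beta> = qf b2 b2"

lemma \<omega>: "\<omega> > 0" using qf_b by (simp add: \<omega>_def)

lemma qf_frame: "qf v w = - \<omega> * ((f1 \<bullet> v) * (f3 \<bullet> w) + (f3 \<bullet> v) * (f1 \<bullet> w)) + \<beta> * (f2 \<bullet> v) * (f2 \<bullet> w)"
proof -
  have "qf v w = qf ((f1 \<bullet> v) *\<^sub>R b1 + (f2 \<bullet> v) *\<^sub>R b2 + (f3 \<bullet> v) *\<^sub>R b3) ((f1 \<bullet> w) *\<^sub>R b1 + (f2 \<bullet> w) *\<^sub>R b2 + (f3 \<bullet> w) *\<^sub>R b3)"
    using expand[of v] expand[of w] by simp
  also have "\<dots> = - \<omega> * ((f1 \<bullet> v) * (f3 \<bullet> w) + (f3 \<bullet> v) * (f1 \<bullet> w)) + \<beta> * (f2 \<bullet> v) * (f2 \<bullet> w)"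
    unfolding qf_linear by (simp add: qf_b qf_sym[of b2 b1] qf_sym[of b3 b1] qf_sym[of b3 b2] \<omega>_def \<beta>_def algebra_simps)
  finally show ?thesis .
qed

text \<open>With suitable coordinates on both geodesics, the hyperbolic cosine of the distance minus
  \<open>(p + q) / (q - p)\<close> is a sum of two squares over a positive denominator. The squares
  vanish together at exactly one pair of points, and the two perpendicularity conditions have the
  same solution.\<close>

lemma common_perpendicular_unique:
  assumes M: "M \<in> BG" "M \<noteq> L" and uv: "u \<in> bd" "wf M \<bullet> u = 0" "v \<in> bd" "wf M \<bullet> v = 0" and lt: "coord u < coord v"
  shows "\<exists>X\<in>L. \<exists>Y\<in>M. (\<forall>x\<in>L. \<forall>y\<in>M. hyp_dist Q X Y \<le> hyp_dist Q x y) \<and>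
    (\<forall>x\<in>L. \<forall>y\<in>M. hyp_dist Q x y \<le> hyp_dist Q X Y \<longrightarrow> x = X \<and> y = Y) \<and>
    (\<forall>x\<in>L. \<forall>y\<in>M. common_perpendicular Q L M x y \<longleftrightarrow> x = X \<and> y = Y) \<and>
    ln (coord v) - ln (coord u) = 4 * ln (coth (hyp_dist Q X Y / 2))"
proof -
  note pu = end_pos[OF M uv(1,2)] and pv = end_pos[OF M uv(3,4)]
  \<comment> \<open>Square roots make the pairing of the two ends rational in \<open>p\<close> and
    \<open>q\<close>, as their \<open>f2\<close> coordinates are proportional to \<open>p\<close>
    and \<open>q\<close>.\<close>
  define p q where "p = sqrt (coord u)" and "q = sqrt (coord v)"
  have "coord u > 0" using pu by (simp add: coord_def)
  then have p: "p > 0" "p * p = coord u" and q: "q > p" "q * q = coord v" using lt by (simp_all add: p_def q_def)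
  then have q0: "q > 0" by linarith
  define u' v' where "u' = (1 / (f3 \<bullet> u)) *\<^sub>R u" and "v' = (1 / (f3 \<bullet> v)) *\<^sub>R v"
  have bd': "u' \<in> bd" "v' \<in> bd" using bd_scale uv pu pv by (simp_all add: u'_def v'_def)
  have w': "wf M \<bullet> u' = 0" "wf M \<bullet> v' = 0" using uv by (simp_all add: u'_def v'_def)
  have fu: "f1 \<bullet> u' = p * p" "f3 \<bullet> u' = 1" "f2 \<bullet> u' > 0" and fv: "f1 \<bullet> v' = q * q" "f3 \<bullet> v' = 1" "f2 \<bullet> v' > 0"
    using p q pu pv by (simp_all add: u'_def v'_def coord_def)
  have ne: "pt u' \<noteq> pt v'"
  proof
    assume "pt u' = pt v'"
    then obtain c where "u' = c *\<^sub>R v'" using pt_eq_iff bdD bd' by metis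
    then have "p * p = c * (q * q)" "1 = c * 1" using fu fv by (metis inner_scaleR_right)+
    then show False using p q lt by simp
  qed
  define m n where "m = f2 \<bullet> u'" and "n = f2 \<bullet> v'"
  have mm: "\<beta> * m * m = 2 * \<omega> * (p * p)" "\<beta> * n * n = 2 * \<omega> * (q * q)"
    using qf_bd[OF bd'(1)] qf_bd[OF bd'(2)] unfolding qf_frame fu(1,2) fv(1,2) by (simp_all add: m_def n_def algebra_simps)
  have mn: "m > 0" "n > 0" using fu fv by (simp_all add: m_def n_def)
  have "\<beta> * (m * m) > 0" using mm(1)[unfolded mult.assoc] \<omega> p(1) by simp
  then have \<beta>: "\<beta> > 0" using mn by (simp add: zero_less_mult_iff)
  \<comment> \<open>The product of the two null equations is the square of the mixed term, whose
    sign is known.\<close>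
  have "(\<beta> * m * n)\<^sup>2 = (\<beta> * m * m) * (\<beta> * n * n)" by (simp add: power2_eq_square algebra_simps)
  also have "\<dots> = (2 * \<omega> * p * q)\<^sup>2" unfolding mm by (simp add: power2_eq_square algebra_simps)
  finally have cross: "\<beta> * m * n = 2 * \<omega> * p * q"
    by (rule power2_eq_imp_eq) (use \<beta> mn \<omega> p q0 in simp_all)
  define X where "X x = x *\<^sub>R b1 + b3" for x
  define Y where "Y s = s *\<^sub>R u' + v'" for s
  have XC: "X x \<in> C" if "x > 0" for x using axis_C[OF that zero_less_one] by (simp add: X_def)
  have YC: "Y s \<in> C" if "s > 0" for s using C_pos_comb[of u' v' s 1] bd' ne that bdD by (auto simp: Y_def)
  have fX: "f1 \<bullet> X x = x" "f2 \<bullet> X x = 0" "f3 \<bullet> X x = 1" for x by (simp_all add: X_def inner_add_right dual)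
  have fY: "f1 \<bullet> Y s = s * (p * p) + q * q" "f3 \<bullet> Y s = s + 1" "f2 \<bullet> Y s = s * m + n" for s
    by (simp_all add: Y_def inner_add_right fu fv m_def n_def)
  have qXX: "qf (X x) (X x) = - 2 * \<omega> * x" for x by (simp add: qf_frame fX)
  have qXY: "qf (X x) (Y s) = - \<omega> * (s * (x + p * p) + (x + q * q))" for x s by (simp add: qf_frame fX fY algebra_simps)
  have quv: "qf u' v' = - \<omega> * (q - p)\<^sup>2"
    unfolding qf_frame fu(1,2) fv(1,2) m_def[symmetric] n_def[symmetric] cross by (simp add: power2_eq_square algebra_simps)
  have qYY: "qf (Y s) (Y s) = - 2 * \<omega> * s * (q - p)\<^sup>2" for s
    unfolding Y_def using qf_bd[OF bd'(1)] qf_bd[OF bd'(2)] qf_sym[of v' u'] quv by (simp add: qf_linear)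
  have Lm: "z \<in> L \<longleftrightarrow> (\<exists>x>0. z = pt (X x))" for z unfolding X_def by (rule L_point)
  have Mm: "z \<in> M \<longleftrightarrow> (\<exists>s>0. z = pt (Y s))" for z unfolding Y_def by (rule wall_pencil[OF M(1) bd' ne w'])
  define R where "R x s = (s * (x + p * p) + (x + q * q)) / (2 * sqrt (x * s) * (q - p))" for x s
  have dist: "hyp_dist Q (pt (X x)) (pt (Y s)) = arcosh (R x s)" if "x > 0" "s > 0" for x s
  proof -
    have pos: "s * (x + p * p) + (x + q * q) > 0" using that p q0 by (intro add_pos_pos mult_pos_pos) auto
    have "qf (X x) (X x) * qf (Y s) (Y s) = (2 * \<omega> * (q - p))\<^sup>2 * (x * s)"
      unfolding qXX qYY by (simp add: power2_eq_square algebra_simps)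
    then have "sqrt (qf (X x) (X x) * qf (Y s) (Y s)) = 2 * \<omega> * (q - p) * sqrt (x * s)"
      using \<omega> q(1) by (simp add: real_sqrt_mult)
    moreover have "\<bar>qf (X x) (Y s)\<bar> = \<omega> * (s * (x + p * p) + (x + q * q))"
      unfolding qXY abs_mult using \<omega> pos by simp
    ultimately show ?thesis
      unfolding hyp_dist_pt[OF C_nonzero[OF XC[OF that(1)]] C_nonzero[OF YC[OF that(2)]]] R_def using \<omega> by (simp add: ac_simps)
  qed
  define R0 where "R0 = (p + q) / (q - p)"
  have R0: "R0 > 1" using p q by (simp add: R0_def field_simps)
  have diff: "R x s - R0 = ((sqrt s * sqrt x - q)\<^sup>2 + (sqrt s * p - sqrt x)\<^sup>2) / (2 * sqrt (x * s) * (q - p))"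
    if "x > 0" "s > 0" for x s
  proof -
    have "R0 = (2 * sqrt (x * s) * (p + q)) / (2 * sqrt (x * s) * (q - p))" using that by (simp add: R0_def)
    then have "R x s - R0 = (s * (x + p * p) + (x + q * q) - 2 * sqrt (x * s) * (p + q)) / (2 * sqrt (x * s) * (q - p))"
      by (simp only: R_def diff_divide_distrib)
    moreover have "s * (x + p * p) + (x + q * q) - 2 * sqrt (x * s) * (p + q) = (sqrt s * sqrt x - q)\<^sup>2 + (sqrt s * p - sqrt x)\<^sup>2"
    proof -
      define r t where "r = sqrt s" and "t = sqrt x"
      have "(r * r) * (t * t + p * p) + (t * t + q * q) - 2 * (t * r) * (p + q) = (r * t - q)\<^sup>2 + (r * p - t)\<^sup>2"
        by (simp add: power2_eq_square algebra_simps)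
      moreover have "r * r = s" "t * t = x" "t * r = sqrt (x * s)" using that by (simp_all add: r_def t_def real_sqrt_mult)
      ultimately show ?thesis by (simp add: r_def t_def)
    qed
    ultimately show ?thesis by simp
  qed
  have den: "2 * sqrt (x * s) * (q - p) > 0" if "x > 0" "s > 0" for x s using that q by simp
  have ge: "R x s \<ge> R0" if "x > 0" "s > 0" for x s
  proof -
    have "R x s - R0 \<ge> 0" unfolding diff[OF that] using den[OF that] by (intro divide_nonneg_pos) auto
    then show ?thesis by simp
  qed
  have eq: "x = p * q \<and> s = q / p" if xs: "x > 0" "s > 0" and le: "R x s \<le> R0" for x s
  proof -
    have "((sqrt s * sqrt x - q)\<^sup>2 + (sqrt s * p - sqrt x)\<^sup>2) / (2 * sqrt (x * s) * (q - p)) \<le> 0"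
      using diff[OF xs] le by simp
    then have "(sqrt s * sqrt x - q)\<^sup>2 + (sqrt s * p - sqrt x)\<^sup>2 \<le> 0" using den[OF xs] by (simp add: divide_le_0_iff)
    then have 1: "sqrt s * sqrt x = q" "sqrt x = sqrt s * p" by (simp_all add: sum_power2_le_zero_iff)
    have "(sqrt s * sqrt s) * p = q" using 1 by (simp only: mult.assoc)
    then have "s * p = q" using xs by simp
    then have s: "s = q / p" using p(1) by (simp add: field_simps)
    have "x = sqrt x * sqrt x" using xs by simp
    also have "\<dots> = p * (sqrt s * sqrt x)" using 1(2) by simp
    finally show ?thesis using 1(1) s by simp
  qed
  define x0 s0 where "x0 = p * q" and "s0 = q / p"
  have 0: "x0 > 0" "s0 > 0" using p q0 by (simp_all add: x0_def s0_def)
  have "x0 * s0 = q * q" using p by (simp add: x0_def s0_def)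
  then have "R x0 s0 = (s0 * (x0 + p * p) + (x0 + q * q)) / (2 * q * (q - p))" using q0 by (simp add: R_def)
  also have "s0 * (x0 + p * p) + (x0 + q * q) = (2 * q) * (p + q)" using p by (simp add: x0_def s0_def field_simps)
  finally have RR: "R x0 s0 = R0" using q0 by (simp add: R0_def)
  have d0: "hyp_dist Q (pt (X x0)) (pt (Y s0)) = arcosh R0" using dist[OF 0] RR by simp
  have arc: "arcosh x \<le> arcosh y \<longleftrightarrow> x \<le> y" if "x \<ge> 1" "y \<ge> 1" for x y :: real
    using cosh_real_nonneg_le_iff[of "arcosh x" "arcosh y"] that by simp
  have perp: "common_perpendicular Q L M (pt (X x)) (pt (Y s)) \<longleftrightarrow> x * qf b1 (Y s) = qf b3 (Y s) \<and> s * qf u' (X x) = qf v' (X x)"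
    if "x > 0" "s > 0" for x s
  proof -
    have "(\<forall>z\<in>L. hyp_perpendicular_at Q (pt (X x)) (pt (Y s)) z) \<longleftrightarrow> x * qf b1 (Y s) = qf b3 (Y s)"
      using perpendicular_pencil[OF b pt_b_distinct(2) that(1) zero_less_one C_nonzero[OF YC[OF that(2)]]]
      unfolding Ball_def Lm by (auto simp: X_def)
    moreover have "(\<forall>z\<in>M. hyp_perpendicular_at Q (pt (Y s)) (pt (X x)) z) \<longleftrightarrow> s * qf u' (X x) = qf v' (X x)"
      using perpendicular_pencil[OF bd' ne that(2) zero_less_one C_nonzero[OF XC[OF that(1)]]]
      unfolding Ball_def Mm by (auto simp: Y_def)
    ultimately show ?thesis by (simp add: common_perpendicular_def)
  qed
  have perp': "x * qf b1 (Y s) = qf b3 (Y s) \<and> s * qf u' (X x) = qf v' (X x) \<longleftrightarrow> x = x0 \<and> s = s0" if "x > 0" "s > 0" for x s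
  proof -
    have "qf b1 (Y s) = - \<omega> * (s + 1)" "qf b3 (Y s) = - \<omega> * (s * (p * p) + q * q)"
      "qf u' (X x) = - \<omega> * (x + p * p)" "qf v' (X x) = - \<omega> * (x + q * q)"
      unfolding qf_frame fX fY fu(1,2) fv(1,2) by (simp_all add: dual)
    then have "x * qf b1 (Y s) = qf b3 (Y s) \<and> s * qf u' (X x) = qf v' (X x) \<longleftrightarrow>
      - \<omega> * (x * (s + 1)) = - \<omega> * (s * (p * p) + q * q) \<and> - \<omega> * (s * (x + p * p)) = - \<omega> * (x + q * q)"
      by (simp only: mult.left_commute)
    also have "\<dots> \<longleftrightarrow> x * (s + 1) = s * (p * p) + q * q \<and> s * (x + p * p) = x + q * q" using \<omega> by simp
    \<comment> \<open>Adding and subtracting the two equations separates the product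
      \<open>s * x\<close> from the quotient of \<open>x\<close> by \<open>s\<close>.\<close>
    also have "\<dots> \<longleftrightarrow> s * x = q * q \<and> x = s * (p * p)" by (auto simp: algebra_simps)
    also have "\<dots> \<longleftrightarrow> x = x0 \<and> s = s0"
    proof
      assume a: "s * x = q * q \<and> x = s * (p * p)"
      then have "s * (s * (p * p)) = q * q" by metis
      then have "(s * p)\<^sup>2 = q\<^sup>2" by (simp add: power2_eq_square ac_simps)
      then have "s * p = q" by (rule power2_eq_imp_eq) (use that p q0 in simp_all)
      then show "x = x0 \<and> s = s0" using a p by (auto simp: x0_def s0_def field_simps)
    next
      assume "x = x0 \<and> s = s0"
      then show "s * x = q * q \<and> x = s * (p * p)" using p(1) by (simp add: x0_def s0_def)
    qed
    finally show ?thesis .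
  qed
  have gap: "ln (coord v) - ln (coord u) = 4 * ln (coth (hyp_dist Q (pt (X x0)) (pt (Y s0)) / 2))"
    unfolding d0 R0_def ln_coth_half[OF p(1) q(1)] p(2)[symmetric] q(2)[symmetric] using p(1) q0 by (simp add: ln_mult)
  have inj: "pt (X x) = pt (X x') \<longleftrightarrow> x = x'" if "x > 0" "x' > 0" for x x'
    unfolding X_def using pt_pencil_eq_iff[OF b pt_b_distinct(2) that] .
  have inj': "pt (Y x) = pt (Y x') \<longleftrightarrow> x = x'" if "x > 0" "x' > 0" for x x'
    unfolding Y_def using pt_pencil_eq_iff[OF bd' ne that] .
  show ?thesis
  proof (rule bexI[of _ "pt (X x0)"], rule bexI[of _ "pt (Y s0)"], intro conjI ballI impI gap)
    fix x y assume "x \<in> L" "y \<in> M"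
    then obtain r s where r: "r > 0" "x = pt (X r)" and s: "s > 0" "y = pt (Y s)" using Lm Mm by blast
    have R1: "R r s \<ge> 1" "R0 \<ge> 1" using ge[OF r(1) s(1)] R0 by linarith+
    show "hyp_dist Q (pt (X x0)) (pt (Y s0)) \<le> hyp_dist Q x y"
      unfolding d0 r s dist[OF r(1) s(1)] arc[OF R1(2,1)] by (rule ge[OF r(1) s(1)])
    show "x = pt (X x0)" "y = pt (Y s0)" if "hyp_dist Q x y \<le> hyp_dist Q (pt (X x0)) (pt (Y s0))"
      using that eq[OF r(1) s(1)] unfolding d0 r s dist[OF r(1) s(1)] arc[OF R1] by (auto simp: x0_def s0_def)
    show "common_perpendicular Q L M x y \<longleftrightarrow> x = pt (X x0) \<and> y = pt (Y s0)"
      unfolding r s perp[OF r(1) s(1)] perp'[OF r(1) s(1)] using inj[OF r(1) 0(1)] inj'[OF s(1) 0(2)] by simp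
  qed (use Lm Mm 0 in blast)+
qed

end

lemma (in strict_cone) segment_arc:
  assumes xy: "x \<in> C" "y \<in> C" "pt x \<noteq> pt y"
  obtains c where "geodesic_arc (pt ` C) c (pt x) (pt y)" "\<And>t. 0 < t \<Longrightarrow> t < 1 \<Longrightarrow> c t = pt ((1 - t) *\<^sub>R x + t *\<^sub>R y)"
proof -
  define m where "m = cross3 x y"
  have m: "m \<noteq> 0" using xy C_nonzero by (auto simp: m_def cross3_eq_0_iff)
  define z where "z t = (1 - t) *\<^sub>R x + t *\<^sub>R y" for t
  have zC: "z t \<in> C" if "t \<in> {0..1}" for t
    using convexD_alt[OF convex_C xy(1,2), of t] that by (simp add: z_def)
  have mz: "m \<bullet> z t = 0" for t by (simp add: z_def m_def inner_add_right dot_cross_self)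
  have "continuous_on {0..1} (\<lambda>t. pt (z t))"
  proof (rule continuous_on_compose2[OF continuous_on_pt[OF zero_notin_C]])
    show "continuous_on {0..1} z" unfolding z_def by (intro continuous_intros)
    show "z ` {0..1} \<subseteq> C" using zC by blast
  qed
  moreover have "inj_on (\<lambda>t. pt (z t)) {0..1}"
  proof (rule inj_onI)
    fix t t' assume t: "t \<in> {0..1}" "t' \<in> {0..1}" "pt (z t) = pt (z t')"
    then obtain c where "z t = c *\<^sub>R z t'" using pt_eq_iff[of "z t" "z t'"] zC C_nonzero by blast
    then have "cross3 (z t) (z t') = 0" by (simp add: cross_mult_left)
    moreover have "cross3 (a *\<^sub>R x + b *\<^sub>R y) (a' *\<^sub>R x + b' *\<^sub>R y) = (a * b' - a' * b) *\<^sub>R m" for a b a' b'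
      using cross_skew[of y x] by (simp add: m_def cross_add_left cross_add_right cross_mult_left cross_mult_right algebra_simps)
    then have "cross3 (z t) (z t') = ((1 - t) * t' - (1 - t') * t) *\<^sub>R m" unfolding z_def .
    then have "cross3 (z t) (z t') = (t' - t) *\<^sub>R m" by (simp add: algebra_simps)
    ultimately show "t = t'" using m by simp
  qed
  moreover have "cut m \<in> geodesics (pt ` C)" "(\<lambda>t. pt (z t)) ` {0..1} \<subseteq> cut m"
  proof -
    show "(\<lambda>t. pt (z t)) ` {0..1} \<subseteq> cut m" using zC mz by (auto simp: pt_in_cut)
    moreover have "pt (z 0) \<in> (\<lambda>t. pt (z t)) ` {0..1}" by force
    ultimately have "cut m \<noteq> {}" by blast
    then show "cut m \<in> geodesics (pt ` C)" unfolding geodesics_cut using m by blast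
  qed
  moreover have "pt (z 0) = pt x" "pt (z 1) = pt y" by (simp_all add: z_def)
  ultimately have "geodesic_arc (pt ` C) (\<lambda>t. pt (z t)) (pt x) (pt y)" unfolding geodesic_arc_def by blast
  then show thesis using that[of "\<lambda>t. pt (z t)"] by (simp add: z_def)
qed

section \<open>Orthogeodesics and double cosets\<close>

locale hyperbolic = marked C Ft \<Delta> m \<alpha> + conic C Q for C Ft \<Delta> m \<alpha> Q
begin

lemma BG_sub: "M \<in> BG \<Longrightarrow> x \<in> M \<Longrightarrow> x \<in> pt ` C"
  by (auto simp: boundary_geodesics_def geodesics_def)

lemma move_in: "g \<in> \<Delta> \<Longrightarrow> x \<in> pt ` C \<Longrightarrow> g x \<in> pt ` C"
proof -
  assume g: "g \<in> \<Delta>" and x: "x \<in> pt ` C"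
  obtain A where A: "lifts C g A" using ex_lift g by blast
  obtain v where "v \<in> C" "x = pt v" using x by blast
  then show ?thesis using lift_pt[OF A] lift_C[OF A] C_nonzero by (metis imageI)
qed

lemma common_perpendicular_move:
  assumes g: "g \<in> \<Delta>" and LM: "L \<in> BG" "M \<in> BG" and xy: "x \<in> pt ` C" "y \<in> pt ` C"
  shows "common_perpendicular Q (g ` L) (g ` M) (g x) (g y) \<longleftrightarrow> common_perpendicular Q L M x y"
proof -
  obtain A where A: "lifts C g A" using ex_lift g by blast
  have "hyp_perpendicular_at Q (g x) (g y) (g z) \<longleftrightarrow> hyp_perpendicular_at Q x y z" if "z \<in> L" for z
    using hyp_perpendicular_lift[OF A xy BG_sub[OF LM(1) that]] .
  moreover have "hyp_perpendicular_at Q (g y) (g x) (g z) \<longleftrightarrow> hyp_perpendicular_at Q y x z" if "z \<in> M" for z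
    using hyp_perpendicular_lift[OF A xy(2,1) BG_sub[OF LM(2) that]] .
  ultimately show ?thesis unfolding common_perpendicular_def by simp
qed

lemma shortest_perpendicular:
  assumes i: "i < m" and j: "j < m" and g: "g \<in> \<Delta>" "g ` Lx j \<noteq> Lx i"
  obtains X Y where "X \<in> Lx i" "Y \<in> g ` Lx j" "shortest_arc Q (Lx i) (g ` Lx j) = (X, Y)"
    "\<forall>x\<in>Lx i. \<forall>y\<in>g ` Lx j. common_perpendicular Q (Lx i) (g ` Lx j) x y \<longleftrightarrow> x = X \<and> y = Y"
    "ln (cross_ratio (attracting (\<alpha> i)) (orth_proj (pt ` C) (\<alpha> i) (g (attracting (\<alpha> j))))
     (repelling (\<alpha> i)) (orth_proj (pt ` C) (\<alpha> i) (g (repelling (\<alpha> j))))) = 4 * ln (coth (hyp_dist Q X Y / 2))"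
proof -
  define M where "M = g ` Lx j"
  have M: "M \<in> BG" "M \<noteq> Lx i" using g BG_image marks[OF j] by (auto simp: M_def)
  obtain A b1 b2 b3 f1 f2 f3 l1 l2 l3 where "framed C Ft \<Delta> (Lx i) (\<alpha> i) A b1 b2 b3 f1 f2 f3 l1 l2 l3"
    using mark_frame[OF i] by blast
  then interpret f: framed C Ft \<Delta> "Lx i" "\<alpha> i" A b1 b2 b3 f1 f2 f3 l1 l2 l3 .
  interpret mf: marked_frame C Ft \<Delta> m \<alpha> i A b1 b2 b3 f1 f2 f3 l1 l2 l3 by unfold_locales (rule i)
  interpret fc: framed_conic C Ft \<Delta> "Lx i" "\<alpha> i" A b1 b2 b3 f1 f2 f3 l1 l2 l3 Q by unfold_locales
  have "ends M (g (attracting (\<alpha> j))) (g (repelling (\<alpha> j)))" unfolding M_def using ends_image marks[OF j] g(1) by blast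
  from mf.ends_interval[OF M this] obtain u v where uv: "u \<in> bd" "v \<in> bd" "wf M \<bullet> u = 0" "wf M \<bullet> v = 0"
    "f.coord u < f.coord v" "mf.lo M = ln (f.coord u)" "mf.hi M = ln (f.coord v)" by blast
  obtain X Y where XY: "X \<in> Lx i" "Y \<in> M" "\<forall>x\<in>Lx i. \<forall>y\<in>M. hyp_dist Q X Y \<le> hyp_dist Q x y"
    "\<forall>x\<in>Lx i. \<forall>y\<in>M. hyp_dist Q x y \<le> hyp_dist Q X Y \<longrightarrow> x = X \<and> y = Y"
    "\<forall>x\<in>Lx i. \<forall>y\<in>M. common_perpendicular Q (Lx i) M x y \<longleftrightarrow> x = X \<and> y = Y"
    "ln (f.coord v) - ln (f.coord u) = 4 * ln (coth (hyp_dist Q X Y / 2))"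
    using fc.common_perpendicular_unique[OF M uv(1,3,2,4,5)] by blast
  have "shortest_arc Q (Lx i) M = (X, Y)" unfolding shortest_arc_def
  proof (rule the_equality)
    fix e assume "e \<in> Lx i \<times> M \<and> (\<forall>x\<in>Lx i. \<forall>y\<in>M. hyp_dist Q (fst e) (snd e) \<le> hyp_dist Q x y)"
    then have "fst e \<in> Lx i" "snd e \<in> M" "hyp_dist Q (fst e) (snd e) \<le> hyp_dist Q X Y" using XY(1,2) by auto
    then show "e = (X, Y)" using XY(4) by (metis prod.collapse)
  qed (use XY in simp)
  then show thesis using that XY(1,2,5,6) mf.gap_eq[OF j g] uv(6,7) unfolding M_def by simp
qed

lemma arc_orbit_move: "d \<in> \<Delta> \<Longrightarrow> arc_orbit \<Delta> (d x, d y) = arc_orbit \<Delta> (x, y)"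
proof -
  assume d: "d \<in> \<Delta>"
  obtain c where c: "c \<in> \<Delta>" "c \<circ> d = id" using inv_in d by blast
  have cd: "c (d z) = z" for z using c(2) by (metis comp_apply id_apply)
  show ?thesis unfolding arc_orbit_def prod.case
  proof (intro subset_antisym subsetI)
    fix e assume "e \<in> {(g (d x), g (d y)) |g. g \<in> \<Delta>}"
    then obtain g where "g \<in> \<Delta>" "e = ((g \<circ> d) x, (g \<circ> d) y)" by auto
    then show "e \<in> {(g x, g y) |g. g \<in> \<Delta>}" using comp_in[OF _ d] by blast
  next
    fix e assume "e \<in> {(g x, g y) |g. g \<in> \<Delta>}"
    then obtain g where "g \<in> \<Delta>" "e = ((g \<circ> c) (d x), (g \<circ> c) (d y))" using cd by auto
    then show "e \<in> {(g (d x), g (d y)) |g. g \<in> \<Delta>}" using comp_in[OF _ c(1)] by blast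
  qed
qed

lemma arc_orbit_self: "e \<in> arc_orbit \<Delta> e"
proof -
  obtain x y where e: "e = (x, y)" by (cases e)
  have "(id x, id y) \<in> arc_orbit \<Delta> (x, y)" unfolding arc_orbit_def prod.case using id_in by blast
  then show ?thesis by (simp add: e)
qed

text \<open>An arc from \<open>x\<close> to \<open>y\<close> in the same geodesic has the direction
  of that geodesic, so it cannot be perpendicular to it. Conversely, the open segment between
  distinct boundary geodesics is automatically interior, so only the common perpendicular condition
  remains.\<close>

lemma orthogeodesic_lift_iff:
  "orthogeodesic_lift (pt ` C) Ft Q (x, y) \<longleftrightarrow>
    (\<exists>L\<in>BG. \<exists>M\<in>BG. L \<noteq> M \<and> x \<in> L \<and> y \<in> M \<and> common_perpendicular Q L M x y)"
proof
  assume "orthogeodesic_lift (pt ` C) Ft Q (x, y)"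
  then obtain L M c where LM: "L \<in> BG" "M \<in> BG" "x \<in> L" "y \<in> M" "geodesic_arc (pt ` C) c x y" "common_perpendicular Q L M x y"
    unfolding orthogeodesic_lift_def common_perpendicular_def by auto
  have xy: "x \<noteq> y"
  proof
    assume "x = y"
    then have "inj_on c {0..1}" "c 0 = c 1" using LM(5) by (auto simp: geodesic_arc_def)
    then show False using inj_onD[of c "{0..1}" 0 1] by simp
  qed
  \<comment> \<open>Perpendicularity tested at \<open>z = y\<close> gives equality in the reversed
    Cauchy-Schwarz inequality; on a chord the defect is the square of the coordinate determinant, so
    \<open>x = y\<close>.\<close>
  have "L \<noteq> M"
  proof
    assume "L = M"
    then have "hyp_perpendicular_at Q x y y" using LM by (simp add: common_perpendicular_def)
    obtain x' y' where x': "x' \<in> C" "x = pt x'" and y': "y' \<in> C" "y = pt y'" using LM BG_sub by blast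
    then have "pt x' \<noteq> pt y'" using xy by simp
    with x' y' obtain u v a b a' b' where uv: "u \<in> bd" "v \<in> bd" "pt u \<noteq> pt v" and
      ab: "a > 0" "b > 0" "a' > 0" "b' > 0" "x' = a *\<^sub>R u + b *\<^sub>R v" "y' = a' *\<^sub>R u + b' *\<^sub>R v"
      using chord by metis
    define w where "w = qf u v"
    have w: "w < 0" using qf_bd_neg[OF uv] by (simp add: w_def)
    have q: "qf (r *\<^sub>R u + s *\<^sub>R v) (r' *\<^sub>R u + s' *\<^sub>R v) = w * (r * s' + r' * s)" for r s r' s'
      using qf_bd[OF uv(1)] qf_bd[OF uv(2)] qf_sym[of v u] by (simp add: w_def qf_linear algebra_simps)
    have "qf x' x' * qf y' y' = qf x' y' * qf x' y'"
      using \<open>hyp_perpendicular_at Q x y y\<close> hyp_perpendicular_pt[OF x'(1)] C_nonzero[OF y'(1)] x'(2) y'(2) by blast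
    then have "w\<^sup>2 * (a * b' - a' * b)\<^sup>2 = 0" unfolding ab q by (simp add: power2_eq_square algebra_simps)
    then have "a * b' = a' * b" using w by simp
    then have "y' = (a' / a) *\<^sub>R x'" using ab by (simp add: scaleR_add_right field_simps)
    then show False using xy x' y' ab by simp
  qed
  then show "\<exists>L\<in>BG. \<exists>M\<in>BG. L \<noteq> M \<and> x \<in> L \<and> y \<in> M \<and> common_perpendicular Q L M x y" using LM by blast
next
  assume "\<exists>L\<in>BG. \<exists>M\<in>BG. L \<noteq> M \<and> x \<in> L \<and> y \<in> M \<and> common_perpendicular Q L M x y"
  then obtain L M where LM: "L \<in> BG" "M \<in> BG" "L \<noteq> M" "x \<in> L" "y \<in> M" "common_perpendicular Q L M x y" by blast
  obtain x' y' where x': "x' \<in> C" "x = pt x'" and y': "y' \<in> C" "y = pt y'" using LM BG_sub by blast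
  have wx: "wf L \<bullet> x' = 0" and wy: "wf M \<bullet> y' = 0" using LM x' y' mem_L by auto
  have xy: "pt x' \<noteq> pt y'"
  proof
    assume "pt x' = pt y'"
    then have "pt x' \<in> M" using LM y' by simp
    then show False using BG_disjoint[OF LM(1,2) x'(1) wx] mem_L[OF x'(1) LM(2)] LM(3) by blast
  qed
  obtain c where c: "geodesic_arc (pt ` C) c (pt x') (pt y')" "\<And>t. 0 < t \<Longrightarrow> t < 1 \<Longrightarrow> c t = pt ((1 - t) *\<^sub>R x' + t *\<^sub>R y')"
    using segment_arc[OF x'(1) y'(1) xy] by blast
  have "c t \<in> interior Ft" if t: "0 < t" "t < 1" for t
  proof -
    let ?z = "(1 - t) *\<^sub>R x' + t *\<^sub>R y'"
    have D: "x' \<in> D" "y' \<in> D" using L_sub_D LM x' y' wx wy by blast+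
    then have zD: "?z \<in> D" using D_add D_scale t by simp
    \<comment> \<open>If the point lay on a boundary geodesic \<open>N\<close>, the wall of
      \<open>N\<close>, nonnegative at both ends, would vanish at both, and disjointness would give
      \<open>L = N = M\<close>.\<close>
    have "?z \<in> Di"
    proof (rule ccontr)
      assume "?z \<notin> Di"
      then obtain N where N: "N \<in> BG" "pt ?z \<in> N" using boundary_point[OF zD] by blast
      then have "(1 - t) * (wf N \<bullet> x') + t * (wf N \<bullet> y') = 0"
        using mem_L[OF D_sub[OF zD] N(1)] by (simp add: inner_add_right)
      moreover have "(1 - t) * (wf N \<bullet> x') \<ge> 0" "t * (wf N \<bullet> y') \<ge> 0" using D_wall[OF D(1) N(1)] D_wall[OF D(2) N(1)] t by simp_all
      ultimately have "(1 - t) * (wf N \<bullet> x') = 0" "t * (wf N \<bullet> y') = 0" by linarith+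
      then have "wf N \<bullet> x' = 0" "wf N \<bullet> y' = 0" using t by simp_all
      then have "L = N" "M = N" using BG_disjoint[OF LM(1) N(1) x'(1) wx] BG_disjoint[OF LM(2) N(1) y'(1) wy] by simp_all
      then show False using LM(3) by simp
    qed
    then show ?thesis using c(2)[OF t] by (simp add: Di_def)
  qed
  then have "c ` {0<..<1} \<subseteq> interior Ft" by auto
  then show "orthogeodesic_lift (pt ` C) Ft Q (x, y)"
    using LM c(1) x'(2) y'(2) unfolding orthogeodesic_lift_def common_perpendicular_def prod.case by blast
qed

text \<open>\<open>gap\<close> and \<open>corresponding_orthogeodesic\<close> choose the same
  representative of \<open>K\<close>, so both values are read off from one \<open>g\<close>, which
  need not be the element that witnesses membership in the orthoset.\<close>

lemma corresponding_eq:
  assumes "(i, j, K) \<in> orthoset \<Delta> m \<alpha>"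
  obtains g X Y where "i < m" "j < m" "g \<in> \<Delta>" "K = double_coset (H i) g (H j)" "g ` Lx j \<noteq> Lx i"
    "X \<in> Lx i" "Y \<in> g ` Lx j" "common_perpendicular Q (Lx i) (g ` Lx j) X Y"
    "corresponding_orthogeodesic (pt ` C) \<Delta> Q \<alpha> (i, j, K) = arc_orbit \<Delta> (X, Y)"
    "gap (pt ` C) \<alpha> (i, j, K) = 4 * ln (coth (hyp_dist Q X Y / 2))"
proof -
  obtain g0 where g0: "i < m" "j < m" "g0 \<in> \<Delta>" "K = double_coset (H i) g0 (H j)" "g0 ` Lx j \<noteq> Lx i"
    using assms unfolding orthoset_mem by blast
  define g where "g = (SOME g. g \<in> K)"
  have gK: "g \<in> K" unfolding g_def by (rule someI[of _ g0]) (simp add: g0(4) dc_self)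
  obtain h k where hk: "h \<in> H i" "k \<in> H j" "g = h \<circ> g0 \<circ> k" "g ` Lx j = h ` g0 ` Lx j"
    by (rule dc_cases[OF g0(1,2) gK[unfolded g0(4)]])
  have gD: "g \<in> \<Delta>" unfolding hk(3) by (rule comp_in[OF comp_in[OF H_sub[OF g0(1) hk(1)] g0(3)] H_sub[OF g0(2) hk(2)]])
  have K: "K = double_coset (H i) g (H j)" unfolding hk(3) dc_absorb[OF g0(1,2) hk(1,2)] by (rule g0(4))
  have ne: "g ` Lx j \<noteq> Lx i"
  proof
    assume eq: "g ` Lx j = Lx i"
    obtain h' where h': "h' \<in> H i" "h' \<circ> h = id" using H_inverse[OF g0(1) hk(1)] by blast
    have "g0 ` Lx j = h' ` g ` Lx j" unfolding hk(4) inv_image[OF h'(2)] by simp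
    also have "\<dots> = Lx i" unfolding eq using H_stab[OF g0(1)] h'(1) by blast
    finally show False using g0(5) by simp
  qed
  obtain X Y where XY: "X \<in> Lx i" "Y \<in> g ` Lx j" "shortest_arc Q (Lx i) (g ` Lx j) = (X, Y)"
    "\<forall>x\<in>Lx i. \<forall>y\<in>g ` Lx j. common_perpendicular Q (Lx i) (g ` Lx j) x y \<longleftrightarrow> x = X \<and> y = Y"
    "ln (cross_ratio (attracting (\<alpha> i)) (orth_proj (pt ` C) (\<alpha> i) (g (attracting (\<alpha> j))))
     (repelling (\<alpha> i)) (orth_proj (pt ` C) (\<alpha> i) (g (repelling (\<alpha> j))))) = 4 * ln (coth (hyp_dist Q X Y / 2))"
    by (rule shortest_perpendicular[OF g0(1,2) gD ne])
  show thesis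
  proof (rule that[OF g0(1,2) gD K ne XY(1,2)])
    show "common_perpendicular Q (Lx i) (g ` Lx j) X Y" using XY by blast
    show "corresponding_orthogeodesic (pt ` C) \<Delta> Q \<alpha> (i, j, K) = arc_orbit \<Delta> (X, Y)"
      by (simp add: corresponding_orthogeodesic_def Let_def XY(3) flip: g_def)
    show "gap (pt ` C) \<alpha> (i, j, K) = 4 * ln (coth (hyp_dist Q X Y / 2))"
      by (simp add: gap_def Let_def XY(5) flip: g_def)
  qed
qed

lemma BG_common: "L \<in> BG \<Longrightarrow> M \<in> BG \<Longrightarrow> x \<in> L \<Longrightarrow> x \<in> M \<Longrightarrow> L = M"
proof -
  assume LM: "L \<in> BG" "M \<in> BG" "x \<in> L" "x \<in> M"
  then obtain v where v: "v \<in> C" "x = pt v" using BG_sub by blast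
  then show ?thesis using BG_disjoint[OF LM(1,2) v(1)] mem_L[OF v(1)] LM by blast
qed

lemma Lx_BG: "i < m \<Longrightarrow> g \<in> \<Delta> \<Longrightarrow> g ` Lx i \<in> BG" "i < m \<Longrightarrow> Lx i \<in> BG"
  using BG_image marks by blast+

lemma corresponding_bij:
  "bij_betw (corresponding_orthogeodesic (pt ` C) \<Delta> Q \<alpha>) (orthoset \<Delta> m \<alpha>) (orthogeodesics (pt ` C) Ft \<Delta> Q)"
proof (rule bij_betw_imageI; (rule inj_onI subset_antisym; (rule subsetI)?))
  fix e e' assume e: "e \<in> orthoset \<Delta> m \<alpha>" "e' \<in> orthoset \<Delta> m \<alpha>"
    "corresponding_orthogeodesic (pt ` C) \<Delta> Q \<alpha> e = corresponding_orthogeodesic (pt ` C) \<Delta> Q \<alpha> e'"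
  obtain i j K i' j' K' where ijK: "e = (i, j, K)" "e' = (i', j', K')" by (metis prod.exhaust)
  from corresponding_eq[OF e(1)[unfolded ijK(1)]] obtain g X Y where g: "i < m" "j < m" "g \<in> \<Delta>" "K = double_coset (H i) g (H j)"
    "X \<in> Lx i" "Y \<in> g ` Lx j" "corresponding_orthogeodesic (pt ` C) \<Delta> Q \<alpha> (i, j, K) = arc_orbit \<Delta> (X, Y)" by metis
  from corresponding_eq[OF e(2)[unfolded ijK(2)]] obtain g' X' Y' where g': "i' < m" "j' < m" "g' \<in> \<Delta>" "K' = double_coset (H i') g' (H j')"
    "X' \<in> Lx i'" "Y' \<in> g' ` Lx j'" "corresponding_orthogeodesic (pt ` C) \<Delta> Q \<alpha> (i', j', K') = arc_orbit \<Delta> (X', Y')" by metis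
  have "(X', Y') \<in> arc_orbit \<Delta> (X, Y)" using e(3) g(7) g'(7) arc_orbit_self[of "(X', Y')"] ijK by simp
  then obtain d where d: "d \<in> \<Delta>" "X' = d X" "Y' = d Y" by (auto simp: arc_orbit_def)
  have dg: "d \<circ> g \<in> \<Delta>" using comp_in d g by blast
  have "d ` Lx i = Lx i'" using BG_common[OF Lx_BG(1)[OF g(1) d(1)] Lx_BG(2)[OF g'(1)], of X'] g(5) g'(5) d(2) by blast
  then have i: "i = i'" using mark_unique[OF g(1) g'(1) d(1) id_in] by simp
  then have dH: "d \<in> H i" using H_stab[OF g(1)] d(1) \<open>d ` Lx i = Lx i'\<close> by simp
  have "Y' \<in> (d \<circ> g) ` Lx j" using g(6) d(3) by auto
  then have eq: "(d \<circ> g) ` Lx j = g' ` Lx j'" using BG_common[OF Lx_BG(1)[OF g(2) dg] Lx_BG(1)[OF g'(2,3)]] g'(6) by blast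
  then have j: "j = j'" using mark_unique[OF g(2) g'(2) dg g'(3)] by simp
  obtain k where k: "k \<in> H j" "g' = d \<circ> g \<circ> k" using same_image[OF g(2) dg g'(3)] eq j by blast
  have "K' = K" unfolding g'(4) k(2) g(4) i[symmetric] j[symmetric] by (rule dc_absorb[OF g(1,2) dH k(1)])
  then show "e = e'" using ijK i j by simp
next
  fix E assume "E \<in> corresponding_orthogeodesic (pt ` C) \<Delta> Q \<alpha> ` orthoset \<Delta> m \<alpha>"
  then obtain i j K where E: "(i, j, K) \<in> orthoset \<Delta> m \<alpha>" "E = corresponding_orthogeodesic (pt ` C) \<Delta> Q \<alpha> (i, j, K)" by auto
  from corresponding_eq[OF E(1)] obtain g X Y where g: "i < m" "j < m" "g \<in> \<Delta>" "g ` Lx j \<noteq> Lx i"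
    "X \<in> Lx i" "Y \<in> g ` Lx j" "common_perpendicular Q (Lx i) (g ` Lx j) X Y"
    "corresponding_orthogeodesic (pt ` C) \<Delta> Q \<alpha> (i, j, K) = arc_orbit \<Delta> (X, Y)" by metis
  have "orthogeodesic_lift (pt ` C) Ft Q (X, Y)"
    unfolding orthogeodesic_lift_iff using g(4-7) Lx_BG(1)[OF g(2,3)] Lx_BG(2)[OF g(1)] by metis
  then show "E \<in> orthogeodesics (pt ` C) Ft \<Delta> Q" using E(2) g(8) by (auto simp: orthogeodesics_def)
next
  fix E assume "E \<in> orthogeodesics (pt ` C) Ft \<Delta> Q"
  then obtain x y where xy: "orthogeodesic_lift (pt ` C) Ft Q (x, y)" "E = arc_orbit \<Delta> (x, y)" by (auto simp: orthogeodesics_def)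
  then obtain L M where LM: "L \<in> BG" "M \<in> BG" "L \<noteq> M" "x \<in> L" "y \<in> M" "common_perpendicular Q L M x y"
    unfolding orthogeodesic_lift_iff by blast
  obtain i g1 where i: "i < m" "g1 \<in> \<Delta>" "L = g1 ` Lx i" using components[OF LM(1)] by blast
  obtain j g2 where j: "j < m" "g2 \<in> \<Delta>" "M = g2 ` Lx j" using components[OF LM(2)] by blast
  obtain c where c: "c \<in> \<Delta>" "c \<circ> g1 = id" "g1 \<circ> c = id" using inv_in[OF i(2)] by blast
  define g where "g = c \<circ> g2"
  have gD: "g \<in> \<Delta>" using comp_in c j by (simp add: g_def)
  have cL: "c ` L = Lx i" unfolding i(3) by (rule inv_image[OF c(2)])
  have cM: "c ` M = g ` Lx j" unfolding j(3) g_def by (simp only: image_comp)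
  have ne: "g ` Lx j \<noteq> Lx i"
  proof
    assume "g ` Lx j = Lx i"
    then have "g1 ` c ` M = g1 ` c ` L" using cL cM by simp
    then show False using inv_image[OF c(3)] LM(3) by simp
  qed
  define K where "K = double_coset (H i) g (H j)"
  have mem: "(i, j, K) \<in> orthoset \<Delta> m \<alpha>" unfolding orthoset_mem K_def using i(1) j(1) gD ne by blast
  from corresponding_eq[OF mem] obtain g' X Y where g': "g' \<in> \<Delta>" "K = double_coset (H i) g' (H j)" "g' ` Lx j \<noteq> Lx i"
    "X \<in> Lx i" "Y \<in> g' ` Lx j" "common_perpendicular Q (Lx i) (g' ` Lx j) X Y"
    "corresponding_orthogeodesic (pt ` C) \<Delta> Q \<alpha> (i, j, K) = arc_orbit \<Delta> (X, Y)" by metis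
  have "g' \<in> double_coset (H i) g (H j)" using g'(2) dc_self K_def by metis
  \<comment> \<open>The representative used by \<open>corresponding_eq\<close> may differ from
    \<open>g\<close>; an element of \<open>H i\<close> moves the given arc to the geodesics of that
    representative.\<close>
  then obtain h where h: "h \<in> H i" "g' ` Lx j = h ` g ` Lx j" using dc_cases[OF i(1) j(1)] by metis
  have hD: "h \<in> \<Delta>" using H_sub[OF i(1) h(1)] .
  have hL: "h ` Lx i = Lx i" using H_stab[OF i(1)] h(1) by blast
  have gBG: "g ` Lx j \<in> BG" "Lx i \<in> BG" using Lx_BG i j gD by blast+
  have xyC: "x \<in> pt ` C" "y \<in> pt ` C" using BG_sub LM by blast+
  then have cxyC: "c x \<in> pt ` C" "c y \<in> pt ` C" using move_in c(1) by blast+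
  have "common_perpendicular Q (c ` L) (c ` M) (c x) (c y)" using common_perpendicular_move[OF c(1) LM(1,2) xyC] LM(6) by blast
  then have "common_perpendicular Q (Lx i) (g ` Lx j) (c x) (c y)" unfolding cL cM .
  then have "common_perpendicular Q (h ` Lx i) (h ` g ` Lx j) (h (c x)) (h (c y))"
    using common_perpendicular_move[OF hD gBG(2,1) cxyC] by blast
  then have cp: "common_perpendicular Q (Lx i) (g' ` Lx j) (h (c x)) (h (c y))" unfolding hL h(2)[symmetric] .
  have "h (c x) \<in> h ` c ` L" "h (c y) \<in> h ` c ` M" using LM(4,5) by blast+
  then have mem': "h (c x) \<in> Lx i" "h (c y) \<in> g' ` Lx j" unfolding cL cM hL h(2) by blast+
  obtain X0 Y0 where un: "\<forall>x\<in>Lx i. \<forall>y\<in>g' ` Lx j. common_perpendicular Q (Lx i) (g' ` Lx j) x y \<longleftrightarrow> x = X0 \<and> y = Y0"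
    by (rule shortest_perpendicular[OF i(1) j(1) g'(1,3)])
  then have "h (c x) = X" "h (c y) = Y" using un[rule_format, OF mem'] cp un[rule_format, OF g'(4,5)] g'(6) by simp_all
  then have "arc_orbit \<Delta> (X, Y) = E" using arc_orbit_move[OF hD, of "c x" "c y"] arc_orbit_move[OF c(1), of x y] xy(2) by simp
  then show "E \<in> corresponding_orthogeodesic (pt ` C) \<Delta> Q \<alpha> ` orthoset \<Delta> m \<alpha>" using mem g'(7) by (metis imageI)
qed

lemma orthogeodesic_length_eq:
  assumes xy: "x \<in> pt ` C" "y \<in> pt ` C" "x \<noteq> y"
  shows "orthogeodesic_length (pt ` C) Q (arc_orbit \<Delta> (x, y)) = hyp_dist Q x y"
proof -
  define e where "e = (SOME e. e \<in> arc_orbit \<Delta> (x, y))"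
  have "e \<in> arc_orbit \<Delta> (x, y)" unfolding e_def by (rule someI[of "\<lambda>e. e \<in> arc_orbit \<Delta> (x, y)", OF arc_orbit_self])
  then obtain g where g: "g \<in> \<Delta>" "e = (g x, g y)" by (auto simp: arc_orbit_def)
  obtain A where A: "lifts C g A" using ex_lift g by blast
  have ne: "g x \<noteq> g y" using lift_inj_map[OF A xy(1,2)] xy(3) by blast
  have "geodesic_length (pt ` C) (hyp_dist Q) (g x) (g y) = hyp_dist Q (g x) (g y)"
    using hyp_dist_eq by (rule geodesic_length_eq[OF _ move_in[OF g(1) xy(1)] move_in[OF g(1) xy(2)] ne])
  then show ?thesis unfolding orthogeodesic_length_def e_def[symmetric] g(2) using hyp_dist_lift[OF A xy(1,2)] by simp
qed

lemma gap_orthogeodesic: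
  assumes e: "e \<in> orthoset \<Delta> m \<alpha>"
  shows "gap (pt ` C) \<alpha> e = 4 * ln (coth (orthogeodesic_length (pt ` C) Q (corresponding_orthogeodesic (pt ` C) \<Delta> Q \<alpha> e) / 2))"
proof -
  obtain i j K where ijK: "e = (i, j, K)" by (metis prod.exhaust)
  from corresponding_eq[OF e[unfolded ijK]] obtain g X Y where g: "i < m" "j < m" "g \<in> \<Delta>" "g ` Lx j \<noteq> Lx i"
    "X \<in> Lx i" "Y \<in> g ` Lx j" "corresponding_orthogeodesic (pt ` C) \<Delta> Q \<alpha> (i, j, K) = arc_orbit \<Delta> (X, Y)"
    "gap (pt ` C) \<alpha> (i, j, K) = 4 * ln (coth (hyp_dist Q X Y / 2))" by metis
  note B = Lx_BG(1)[OF g(2,3)] Lx_BG(2)[OF g(1)]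
  have "X \<noteq> Y" using BG_common[OF B] g(4-6) by blast
  moreover have "X \<in> pt ` C" "Y \<in> pt ` C" using BG_sub B g(5,6) by blast+
  ultimately show ?thesis unfolding ijK g(7,8) using orthogeodesic_length_eq by simp
qed

lemma hyperbolic_length: "i < m \<Longrightarrow> closed_geodesic_length (pt ` C) (hyp_dist Q) (\<alpha> i) = len i / 2"
proof -
  assume i: "i < m"
  obtain A b1 b2 b3 f1 f2 f3 l1 l2 l3 where "framed C Ft \<Delta> (Lx i) (\<alpha> i) A b1 b2 b3 f1 f2 f3 l1 l2 l3"
    using mark_frame[OF i] by blast
  then interpret f: framed C Ft \<Delta> "Lx i" "\<alpha> i" A b1 b2 b3 f1 f2 f3 l1 l2 l3 .
  have "len i = ln (l1 / l3)" unfolding len_def using f.closed_length[of "hilbert_dist (pt ` C)" 1] by simp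
  then show ?thesis using f.closed_length[OF hyp_dist_eq] by simp
qed

theorem basmajian:
  "((\<lambda>E. 2 * ln (coth (orthogeodesic_length (pt ` C) Q E / 2))) has_sum
    (\<Sum>i<m. closed_geodesic_length (pt ` C) (hyp_dist Q) (\<alpha> i))) (orthogeodesics (pt ` C) Ft \<Delta> Q)"
proof -
  let ?l = "\<lambda>E. 2 * ln (coth (orthogeodesic_length (pt ` C) Q E / 2))"
  have "((\<lambda>e. gap (pt ` C) \<alpha> e * (1 / 2)) has_sum (\<Sum>i<m. len i) * (1 / 2)) (orthoset \<Delta> m \<alpha>)"
    using length_identity by (rule has_sum_cmult_left)
  also have "?this \<longleftrightarrow> ((\<lambda>e. ?l (corresponding_orthogeodesic (pt ` C) \<Delta> Q \<alpha> e)) has_sum (\<Sum>i<m. len i) * (1 / 2)) (orthoset \<Delta> m \<alpha>)"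
    by (rule has_sum_cong) (simp add: gap_orthogeodesic)
  also have "\<dots> \<longleftrightarrow> (?l has_sum (\<Sum>i<m. len i) * (1 / 2)) (orthogeodesics (pt ` C) Ft \<Delta> Q)"
    by (rule has_sum_reindex_bij_betw[OF corresponding_bij])
  also have "(\<Sum>i<m. len i) * (1 / 2) = (\<Sum>i<m. closed_geodesic_length (pt ` C) (hyp_dist Q) (\<alpha> i))"
    unfolding sum_distrib_right by (rule sum.cong) (simp_all add: hyperbolic_length)
  finally show ?thesis .
qed

end

section \<open>The length identity\<close>

lemma invertible_matrix_inv: "invertible A \<Longrightarrow> invertible (matrix_inv A)" for A :: "real^3^3"
  using someI_ex[of "\<lambda>A'. A ** A' = mat 1 \<and> A' ** A = mat 1"]
  by (auto simp: matrix_inv_def invertible_def)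

lemma proj_map_inverse:
  assumes "invertible A"
  shows "proj_map A \<circ> proj_map (matrix_inv A) = id" "proj_map (matrix_inv A) \<circ> proj_map A = id"
proof -
  have i: "invertible (matrix_inv A)" using assms by (rule invertible_matrix_inv)
  note m = matrix_inv_mult_vec[OF assms]
  have "(proj_map A \<circ> proj_map (matrix_inv A)) p = id p \<and> (proj_map (matrix_inv A) \<circ> proj_map A) p = id p" for p
  proof -
    obtain v where v: "v \<noteq> 0" "p = pt v" by (rule pt_cases)
    have "A *v v \<noteq> 0" "matrix_inv A *v v \<noteq> 0" using v invertible_mult_eq_0 assms i by auto
    then show ?thesis using v by (simp add: proj_map_pt[OF assms] proj_map_pt[OF i] m)
  qed
  then show "proj_map A \<circ> proj_map (matrix_inv A) = id" "proj_map (matrix_inv A) \<circ> proj_map A = id" by blast+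
qed

lemma subgroup_PGL3:
  assumes \<Gamma>: "subgroup \<Gamma> PGL3"
  shows "id \<in> \<Gamma>" "a \<in> \<Gamma> \<Longrightarrow> b \<in> \<Gamma> \<Longrightarrow> a \<circ> b \<in> \<Gamma>" "a \<in> \<Gamma> \<Longrightarrow> \<exists>b\<in>\<Gamma>. a \<circ> b = id \<and> b \<circ> a = id"
proof -
  show "id \<in> \<Gamma>" using subgroup.one_closed[OF \<Gamma>] by (simp only: PGL3_simps)
  show "a \<circ> b \<in> \<Gamma>" if "a \<in> \<Gamma>" "b \<in> \<Gamma>" using subgroup.m_closed[OF \<Gamma> that] by (simp only: PGL3_simps)
  show "\<exists>b\<in>\<Gamma>. a \<circ> b = id \<and> b \<circ> a = id" if a: "a \<in> \<Gamma>"
  proof -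
    have aP: "a \<in> carrier PGL3" using subgroup.subset[OF \<Gamma>] a by blast
    then obtain A where A: "invertible A" "a = proj_map A" by (auto simp: PGL3_simps)
    have bP: "proj_map (matrix_inv A) \<in> carrier PGL3" using invertible_matrix_inv[OF A(1)] by (auto simp: PGL3_simps)
    have "inv\<^bsub>PGL3\<^esub> a = proj_map (matrix_inv A)"
      using aP bP proj_map_inverse[OF A(1)] by (intro inv_PGL3_eq) (simp_all only: A(2))
    then have "proj_map (matrix_inv A) \<in> \<Gamma>" using subgroup.m_inv_closed[OF \<Gamma> a] by simp
    then show ?thesis using proj_map_inverse[OF A(1)] A(2) by blast
  qed
qed

lemma surface_of_subsurface:
  assumes C: "strict_cone C" and C1: "C1_boundary (pt ` C)" and cs: "convex_surface (pt ` C) \<Gamma>"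
    and sub: "geodesic_subsurface (pt ` C) \<Gamma> Ft \<Delta>" and cpt: "compact_space (quotient_space Ft \<Delta>)"
    and or: "\<forall>g\<in>\<Delta>. preserves_orientation C g"
  shows "surface C Ft \<Delta>"
proof -
  interpret strict_cone C by fact
  have \<Gamma>: "subgroup \<Gamma> PGL3" and act: "acts_freely_and_properly \<Gamma> (pt ` C)" using cs by (simp_all add: convex_surface_def)
  have \<Delta>: "\<Delta> = {g \<in> \<Gamma>. g ` Ft = Ft}" using sub by (simp add: geodesic_subsurface_def)
  note sub' = sub[unfolded geodesic_subsurface_def, THEN conjunct1]
    sub[unfolded geodesic_subsurface_def, THEN conjunct2, THEN conjunct1]
    sub[unfolded geodesic_subsurface_def, THEN conjunct2, THEN conjunct2, THEN conjunct1]
    sub[unfolded geodesic_subsurface_def, THEN conjunct2, THEN conjunct2, THEN conjunct2, THEN conjunct1]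
    sub[unfolded geodesic_subsurface_def, THEN conjunct2, THEN conjunct2, THEN conjunct2, THEN conjunct2, THEN conjunct1]
  note grp = subgroup_PGL3[OF \<Gamma>]
  show ?thesis
  proof unfold_locales
    show "C1_boundary (pt ` C)" "compact_space (quotient_space Ft \<Delta>)" by fact+
    show "Ft \<subseteq> pt ` C" "closedin (top_of_set (pt ` C)) Ft" "interior Ft \<noteq> {}"
      "\<exists>n. pt ` C \<subseteq> patch n \<and> convex (aff n ` Ft)" "pt ` C \<inter> frontier Ft = \<Union> (boundary_geodesics (pt ` C) Ft)"
      by (rule sub')+
    show "(\<exists>B. diagonalizes B a) \<and> L = axis_of (pt ` C) a"
      if "L \<in> boundary_geodesics (pt ` C) Ft" "a \<in> \<Delta>" "a \<noteq> id" "a ` L = L" for L a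
    proof -
      have "\<forall>L\<in>boundary_geodesics (pt ` C) Ft. \<forall>a\<in>\<Delta>. a \<noteq> id \<and> a ` L = L \<longrightarrow>
          (\<exists>B. diagonalizes B a) \<and> L = axis_of (pt ` C) a"
        using sub unfolding geodesic_subsurface_def by (elim conjE)
      from this[rule_format, OF that(1,2)] that(3,4) show ?thesis by blast
    qed
    show "id \<in> \<Delta>" using grp(1) by (simp add: \<Delta>)
    show "a \<circ> b \<in> \<Delta>" if "a \<in> \<Delta>" "b \<in> \<Delta>" for a b
    proof -
      have "(a \<circ> b) ` Ft = a ` b ` Ft" by (simp only: image_comp)
      then show ?thesis using that grp(2)[of a b] by (simp add: \<Delta>)
    qed
    show "\<exists>b\<in>\<Delta>. a \<circ> b = id \<and> b \<circ> a = id" if a: "a \<in> \<Delta>" for a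
    proof -
      obtain b where b: "b \<in> \<Gamma>" "a \<circ> b = id" "b \<circ> a = id" using grp(3)[of a] a by (auto simp: \<Delta>)
      have "b ` Ft = b ` a ` Ft" using a by (simp add: \<Delta>)
      also have "\<dots> = Ft" using b(3) by (simp only: image_comp image_id id_apply)
      finally show ?thesis using b by (auto simp: \<Delta>)
    qed
    show "\<exists>A. lifts C a A" if "a \<in> \<Delta>" for a using or that by (auto simp: preserves_orientation_def lifts_def)
    show "a = id" if "a \<in> \<Delta>" "p \<in> pt ` C" "a p = p" for a p
      using act that unfolding acts_freely_and_properly_def \<Delta> by blast
    show "finite {a \<in> \<Delta>. a ` K \<inter> K \<noteq> {}}" if "compact K" "K \<subseteq> pt ` C" for K
    proof (rule finite_subset)
      show "finite {g \<in> \<Gamma>. g ` K \<inter> K \<noteq> {}}" using act that unfolding acts_freely_and_properly_def by blast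
      show "{a \<in> \<Delta>. a ` K \<inter> K \<noteq> {}} \<subseteq> {g \<in> \<Gamma>. g ` K \<inter> K \<noteq> {}}" by (auto simp: \<Delta>)
    qed
    show "a ` Ft = Ft" if "a \<in> \<Delta>" for a using that by (simp add: \<Delta>)
  qed
qed

lemma (in surface) marked_of_marking:
  assumes mk: "positive_peripheral_marking (pt ` C) Ft \<Delta> C m \<alpha>"
  shows "marked C Ft \<Delta> m \<alpha>"
proof unfold_locales
  show "\<exists>!i. i < m \<and> (\<exists>g\<in>\<Delta>. L = g ` axis_of (pt ` C) (\<alpha> i))" if "L \<in> BG" for L
    by (rule bspec[OF conjunct2[OF mk[unfolded positive_peripheral_marking_def]] that])
  fix i assume i: "i < m"
  have per: "peripheral (pt ` C) Ft \<Delta> (\<alpha> i)" "primitive \<Delta> (\<alpha> i)"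
    and left: "\<forall>x\<in>interior Ft. left_of C (repelling (\<alpha> i)) (attracting (\<alpha> i)) x"
    using conjunct1[OF mk[unfolded positive_peripheral_marking_def], rule_format, OF i] by auto
  obtain L where L: "L \<in> BG" "\<alpha> i ` L = L" and a: "\<alpha> i \<in> \<Delta>" "\<alpha> i \<noteq> id"
    using per(1) unfolding peripheral_def by blast
  have ax: "L = axis_of (pt ` C) (\<alpha> i)" using stabilizer[OF L(1) a L(2)] by blast
  obtain A b1 b2 b3 f1 f2 f3 l1 l2 l3 where "framed C Ft \<Delta> L (\<alpha> i) A b1 b2 b3 f1 f2 f3 l1 l2 l3"
    using ex_frame[OF L(1) a L(2)] by blast
  then interpret f: framed C Ft \<Delta> L "\<alpha> i" A b1 b2 b3 f1 f2 f3 l1 l2 l3 .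
  obtain p where p: "p \<in> Di" using Di_nonempty by blast
  then have "left_of C (repelling (\<alpha> i)) (attracting (\<alpha> i)) (pt p)" using left by (auto simp: Di_def)
  then have "ends L (attracting (\<alpha> i)) (repelling (\<alpha> i))" by (rule f.ends_L[OF p])
  then show "\<alpha> i \<in> \<Delta> \<and> \<alpha> i \<noteq> id \<and> axis_of (pt ` C) (\<alpha> i) \<in> BG \<and>
      \<alpha> i ` axis_of (pt ` C) (\<alpha> i) = axis_of (pt ` C) (\<alpha> i) \<and> primitive \<Delta> (\<alpha> i) \<and>
      ends (axis_of (pt ` C) (\<alpha> i)) (attracting (\<alpha> i)) (repelling (\<alpha> i))"
    using a L per(2) unfolding ax by blast
qed

theorem proposition5p3:
  fixes \<Omega> Ft :: "rp2 set"
    and \<Gamma> \<Delta> :: "(rp2 \<Rightarrow> rp2) set"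
    and C :: "(real^3) set"
    and k m :: nat
    and \<alpha> :: "nat \<Rightarrow> rp2 \<Rightarrow> rp2"
  assumes closed_surface: "convex_surface \<Omega> \<Gamma>" "compact_space (quotient_space \<Omega> \<Gamma>)"
    and genus: "has_genus (quotient_space \<Omega> \<Gamma>) k" "k \<ge> 2"
    and domain: "strictly_convex \<Omega>" "C1_boundary \<Omega>"
    and surface: "geodesic_subsurface \<Omega> \<Gamma> Ft \<Delta>" "compact_space (quotient_space Ft \<Delta>)"
    and boundary: "boundary_geodesics \<Omega> Ft \<noteq> {}"
    and double: "is_double \<Omega> \<Gamma> Ft \<Delta>"
    and oriented: "orientation_cone \<Omega> C" "\<forall>g\<in>\<Delta>. preserves_orientation C g"
    and marking: "positive_peripheral_marking \<Omega> Ft \<Delta> C m \<alpha>"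
  shows "(gap \<Omega> \<alpha> has_sum (\<Sum>i<m. closed_geodesic_length \<Omega> (hilbert_dist \<Omega>) (\<alpha> i)))
           (orthoset \<Delta> m \<alpha>) \<and>
         (\<forall>Q. conic_form Q \<and> \<Omega> = conic_interior Q \<longrightarrow>
            (\<forall>x\<in>\<Omega>. \<forall>y\<in>\<Omega>. hilbert_dist \<Omega> x y = 2 * hyp_dist Q x y) \<and>
            bij_betw (corresponding_orthogeodesic \<Omega> \<Delta> Q \<alpha>)
              (orthoset \<Delta> m \<alpha>) (orthogeodesics \<Omega> Ft \<Delta> Q) \<and>
            (\<forall>e\<in>orthoset \<Delta> m \<alpha>.
               gap \<Omega> \<alpha> e = 4 * ln (coth (orthogeodesic_length \<Omega> Q
                                            (corresponding_orthogeodesic \<Omega> \<Delta> Q \<alpha> e) / 2))) \<and>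
            ((\<lambda>E. 2 * ln (coth (orthogeodesic_length \<Omega> Q E / 2))) has_sum
               (\<Sum>i<m. closed_geodesic_length \<Omega> (hyp_dist Q) (\<alpha> i)))
              (orthogeodesics \<Omega> Ft \<Delta> Q))"
proof (rule conjI, goal_cases)
  have C: "strict_cone C" and \<Omega>: "\<Omega> = pt ` C"
    using orientation_cone_strict[OF _ domain(1) oriented(1)] closed_surface(1) by (auto simp: convex_surface_def)
  interpret surface C Ft \<Delta>
    using surface_of_subsurface[OF C] closed_surface(1) domain(2) surface oriented(2) unfolding \<Omega> by blast
  interpret marked C Ft \<Delta> m \<alpha>
    using marked_of_marking marking unfolding \<Omega> by blast
  {
    case 1
    show ?case using length_identity unfolding len_def \<Omega> .
  next
    case 2
    show ?case
    proof (intro allI impI)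
      fix Q assume Q: "conic_form Q \<and> \<Omega> = conic_interior Q"
      interpret hyperbolic C Ft \<Delta> m \<alpha> Q by unfold_locales (use Q \<Omega> in auto)
      show "(\<forall>x\<in>\<Omega>. \<forall>y\<in>\<Omega>. hilbert_dist \<Omega> x y = 2 * hyp_dist Q x y) \<and>
            bij_betw (corresponding_orthogeodesic \<Omega> \<Delta> Q \<alpha>)
              (orthoset \<Delta> m \<alpha>) (orthogeodesics \<Omega> Ft \<Delta> Q) \<and>
            (\<forall>e\<in>orthoset \<Delta> m \<alpha>.
               gap \<Omega> \<alpha> e = 4 * ln (coth (orthogeodesic_length \<Omega> Q
                                            (corresponding_orthogeodesic \<Omega> \<Delta> Q \<alpha> e) / 2))) \<and>
            ((\<lambda>E. 2 * ln (coth (orthogeodesic_length \<Omega> Q E / 2))) has_sum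
               (\<Sum>i<m. closed_geodesic_length \<Omega> (hyp_dist Q) (\<alpha> i)))
              (orthogeodesics \<Omega> Ft \<Delta> Q)"
        unfolding \<Omega> using hilbert_hyp corresponding_bij gap_orthogeodesic basmajian by blast
    qed
  }
qed

end
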